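(* Let $E$ be a real-analytic soliton flow on a Riemannian manifold $(M,g)$ given by the Beltrami fields construction from a real-analytic $(N,h)$ and a one-form $A$. Suppose that $E$ admits a complexification on a set containing $U\times\gamma$, where $U$ is a nonempty open subset of $N$ and $\gamma$ is a circle in $\mathbb{C}$ centred at $0$. Then the following assertions are equivalent: (i) $(M,g)$ is Einstein; (ii) $\int_{\gamma}\rho\,(\mathcal{L}_E h)^{\mathbb{C}}\,d\rho=0$ on $U^{\mathbb{C}}$. Furthermore, a sufficient condition for (i) and (ii) to hold is that there exists an integer $j\geq1$ such that the trace-free part of $\int_{\gamma}\rho^{2j+1}(\mathcal{L}_E h)^{\mathbb{C}}\,d\rho$ is zero on $U^{\mathbb{C}}$.
   Context: A vector field $E$ on a Riemannian manifold $(M,g)$ is a soliton flow if there is a constant $a\in\mathbb{R}$ with $\mathrm{Ric}_M+a\,g+\tfrac12\mathcal{L}_E g=0$. Beltrami fields construction: $(N,h)$ is a connected oriented $3$-dimensional Riemannian manifold, $A$ is a one-form on $N$ satisfying the Beltrami fields equation $dA+2*A=0$, $M=N\times(0,\infty)$ with coordinate $\rho$ on $(0,\infty)$, $\phi:M\to N$ is the projection, and $g=\rho^2h+\rho^{-2}(\rho\,d\rho+A)^2$. Standing assumption: $dA$ (equivalently $A$) is nowhere zero. When $(N,h)$ is real-analytic, so are $A$ and $g$, and the complexification of $g$ is defined on $N^{\mathbb{C}}\times(\mathbb{C}\setminus\{0\})$, where $N^{\mathbb{C}}$ is a (local) complexification of $N$. That $E$ admits a complexification on a set containing $U\times\gamma$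 means that $E$ extends to a holomorphic vector field on an open set of $N^{\mathbb{C}}\times(\mathbb{C}\setminus\{0\})$ containing $U\times\gamma$. $U^{\mathbb{C}}$ denotes a sufficiently small neighbourhood of $U$ in $N^{\mathbb{C}}$. In the integrals, $h$ denotes $\phi^*h$, and $\mathcal{L}_Eh$ is regarded as a family, depending on $\rho$, of symmetric bilinear forms on $U$ by evaluating on vectors tangent to the slices $U\times\{\rho\}$ (equivalently, it is $\mathcal{L}_{E_\rho}h$, where $E_\rho=d\phi(E)|_{U\times\{\rho\}}$ is viewed as a vector field on $U$ depending on $\rho$); $(\mathcal{L}_Eh)^{\mathbb{C}}$ is its complexification, and the contour integrals over $\gamma$ are taken pointwise on $U^{\mathbb{C}}$. Trace-free parts are with respect to (the complexification of) $h$. *)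

theory Defs
  imports "HOL-Complex_Analysis.Complex_Analysis"
begin

section \<open>Smooth, real-analytic and holomorphic maps of several variables\<close>

primrec Ck_on :: "nat \<Rightarrow> ('v::real_normed_vector \<Rightarrow> 'w::real_normed_vector) \<Rightarrow> 'v set \<Rightarrow> bool" where
  "Ck_on 0 f S \<longleftrightarrow> continuous_on S f"
| "Ck_on (Suc n) f S \<longleftrightarrow> (\<forall>x\<in>S. f differentiable at x) \<and>
     (\<forall>v. Ck_on n (\<lambda>x. frechet_derivative f (at x) v) S)"

definition smooth_on :: "('v::real_normed_vector \<Rightarrow> 'w::real_normed_vector) \<Rightarrow> 'v set \<Rightarrow> bool" where
  "smooth_on f S \<longleftrightarrow> (\<forall>n. Ck_on n f S)"

text \<open>Locally the sum of a convergent power series; the summation index \<open>\<alpha>\<close> runs over all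
  multi-indices, i.e. over all functions from the standard basis to the natural numbers.\<close>

definition real_analytic_on ::
    "('v::euclidean_space \<Rightarrow> 'w::real_normed_vector) \<Rightarrow> 'v set \<Rightarrow> bool" where
  "real_analytic_on f S \<longleftrightarrow>
     (\<forall>x\<in>S. \<exists>r>0. \<exists>a :: ('v \<Rightarrow> nat) \<Rightarrow> 'w. \<forall>y\<in>ball x r.
        ((\<lambda>\<alpha>. (\<Prod>b\<in>Basis. ((y - x) \<bullet> b) ^ \<alpha> b) *\<^sub>R a \<alpha>) has_sum f y) (Basis \<rightarrow>\<^sub>E UNIV))"

class complex_space = real_normed_vector +
  fixes scaleC :: "complex \<Rightarrow> 'a \<Rightarrow> 'a"  (infixr \<open>*\<^sub>C\<close> 75)
  assumes scaleC_add_right: "c *\<^sub>C (x + y) = c *\<^sub>C x + c *\<^sub>C y"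
    and scaleC_add_left: "(c + d) *\<^sub>C x = c *\<^sub>C x + d *\<^sub>C x"
    and scaleC_scaleC: "c *\<^sub>C d *\<^sub>C x = (c * d) *\<^sub>C x"
    and scaleC_of_real: "complex_of_real s *\<^sub>C x = s *\<^sub>R x"

instantiation complex :: complex_space
begin
definition scaleC_complex :: "complex \<Rightarrow> complex \<Rightarrow> complex" where
  "scaleC_complex c x = c * x"
instance
  by standard (simp_all add: scaleC_complex_def algebra_simps scaleR_conv_of_real)
end

instantiation prod :: (complex_space, complex_space) complex_space
begin
definition scaleC_prod :: "complex \<Rightarrow> 'a \<times> 'b \<Rightarrow> 'a \<times> 'b" where
  "scaleC_prod c x = (c *\<^sub>C fst x, c *\<^sub>C snd x)"
instance
  by standard
    (simp_all add: scaleC_prod_def scaleC_add_right scaleC_add_left scaleC_scaleC scaleC_of_real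
      scaleR_prod_def)
end

instantiation vec :: (complex_space, finite) complex_space
begin
definition scaleC_vec :: "complex \<Rightarrow> ('a, 'b) vec \<Rightarrow> ('a, 'b) vec" where
  "scaleC_vec c x = (\<chi> i. c *\<^sub>C (x $ i))"
instance
  by standard
    (simp_all add: scaleC_vec_def vec_eq_iff scaleC_add_right scaleC_add_left scaleC_scaleC
      scaleC_of_real)
end

definition complex_linear :: "('v::complex_space \<Rightarrow> 'w::complex_space) \<Rightarrow> bool" where
  "complex_linear D \<longleftrightarrow> linear D \<and> (\<forall>c v. D (c *\<^sub>C v) = c *\<^sub>C D v)"

definition holomorphic_map_on ::
    "('v::complex_space \<Rightarrow> 'w::complex_space) \<Rightarrow> 'v set \<Rightarrow> bool" where
  "holomorphic_map_on f S \<longleftrightarrow> (\<forall>x\<in>S. \<exists>D. (f has_derivative D) (at x) \<and> complex_linear D)"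


section \<open>Charts and atlases\<close>

datatype ('a, 'v) chart = Chart (chart_dom: "'a set") (chart_map: "'a \<Rightarrow> 'v")

definition chart_image :: "('a, 'v) chart \<Rightarrow> 'v set" where
  "chart_image c = chart_map c ` chart_dom c"

definition chart_inv :: "('a, 'v) chart \<Rightarrow> 'v \<Rightarrow> 'a" where
  "chart_inv c = inv_into (chart_dom c) (chart_map c)"

definition is_chart :: "('a::topological_space, 'v::topological_space) chart \<Rightarrow> bool" where
  "is_chart c \<longleftrightarrow> open (chart_dom c) \<and> open (chart_image c) \<and>
     homeomorphism (chart_dom c) (chart_image c) (chart_map c) (chart_inv c)"

definition local_rep :: "('a \<Rightarrow> 'b) \<Rightarrow> ('a, 'v) chart \<Rightarrow> ('b, 'w) chart \<Rightarrow> 'v \<Rightarrow> 'w" where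
  "local_rep J c d = chart_map d \<circ> J \<circ> chart_inv c"

definition overlap :: "('a, 'v) chart \<Rightarrow> ('a, 'w) chart \<Rightarrow> 'v set" where
  "overlap c d = chart_map c ` (chart_dom c \<inter> chart_dom d)"

definition analytically_compatible ::
    "('a, 'v::euclidean_space) chart \<Rightarrow> ('a, 'v) chart \<Rightarrow> bool" where
  "analytically_compatible c d \<longleftrightarrow>
     real_analytic_on (local_rep id c d) (overlap c d) \<and>
     real_analytic_on (local_rep id d c) (overlap d c)"

definition holomorphically_compatible ::
    "('a, 'v::complex_space) chart \<Rightarrow> ('a, 'v) chart \<Rightarrow> bool" where
  "holomorphically_compatible c d \<longleftrightarrow>
     holomorphic_map_on (local_rep id c d) (overlap c d) \<and>
     holomorphic_map_on (local_rep id d c) (overlap d c)"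

text \<open>An atlas is a family of charts over an arbitrary index type. Tensor fields are given below,
  classically, by the family of their local representations, one for each chart of the atlas,
  subject to the transformation rule on overlaps. A local representation is a function of the
  coordinates of a point; only its values on the image of the chart matter.\<close>

definition real_analytic_atlas ::
    "'a::topological_space set \<Rightarrow> ('i \<Rightarrow> ('a, 'v::euclidean_space) chart) \<Rightarrow> bool" where
  "real_analytic_atlas C \<A> \<longleftrightarrow> (\<forall>i. is_chart (\<A> i)) \<and> (\<Union>i. chart_dom (\<A> i)) = C \<and>
     (\<forall>i j. analytically_compatible (\<A> i) (\<A> j))"

definition holomorphic_atlas ::
    "'a::topological_space set \<Rightarrow> ('i \<Rightarrow> ('a, 'v::complex_space) chart) \<Rightarrow> bool" where
  "holomorphic_atlas C \<A> \<longleftrightarrow> (\<forall>i. is_chart (\<A> i)) \<and> (\<Union>i. chart_dom (\<A> i)) = C \<and>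
     (\<forall>i j. holomorphically_compatible (\<A> i) (\<A> j))"

text \<open>All charts of an oriented atlas are positively oriented.\<close>

definition oriented_atlas :: "('i \<Rightarrow> ('a, real ^ 'm) chart) \<Rightarrow> bool" where
  "oriented_atlas \<A> \<longleftrightarrow> (\<forall>i j. \<forall>x\<in>overlap (\<A> i) (\<A> j).
     det (matrix (frechet_derivative (local_rep id (\<A> i) (\<A> j)) (at x))) > 0)"

definition product_atlas ::
    "'s set \<Rightarrow> ('i \<Rightarrow> ('a, 'v) chart) \<Rightarrow> 'i \<Rightarrow> ('a \<times> 's, 'v \<times> 's) chart" where
  "product_atlas S \<A> i =
     Chart (chart_dom (\<A> i) \<times> S) (\<lambda>(p, s). (chart_map (\<A> i) p, s))"


section \<open>Tensor fields\<close>

text \<open>\<open>E\<close> and \<open>F\<close> are \<open>J\<close>-related along the set \<open>S\<close>: \<open>dJ (E p) = F (J p)\<close> for \<open>p \<in> S\<close>.\<close>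

definition related_vector_fields ::
    "('i \<Rightarrow> ('a, 'v::real_normed_vector) chart) \<Rightarrow> ('k \<Rightarrow> ('b, 'w::real_normed_vector) chart) \<Rightarrow>
     ('a \<Rightarrow> 'b) \<Rightarrow> 'a set \<Rightarrow> ('i \<Rightarrow> 'v \<Rightarrow> 'v) \<Rightarrow> ('k \<Rightarrow> 'w \<Rightarrow> 'w) \<Rightarrow> bool" where
  "related_vector_fields \<A> \<B> J S E F \<longleftrightarrow>
     (\<forall>i k. \<forall>p\<in>S \<inter> chart_dom (\<A> i). J p \<in> chart_dom (\<B> k) \<longrightarrow>
        (let x = chart_map (\<A> i) p; f = local_rep J (\<A> i) (\<B> k)
         in F k (f x) = frechet_derivative f (at x) (E i x)))"

text \<open>\<open>B = J\<^sup>* C\<close> along the set \<open>S\<close>, for bilinear forms.\<close>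

definition pullback_bilinear_forms ::
    "('i \<Rightarrow> ('a, 'v::real_normed_vector) chart) \<Rightarrow> ('k \<Rightarrow> ('b, 'w::real_normed_vector) chart) \<Rightarrow>
     ('a \<Rightarrow> 'b) \<Rightarrow> 'a set \<Rightarrow> ('i \<Rightarrow> 'v \<Rightarrow> 'v \<Rightarrow> 'v \<Rightarrow> 'f) \<Rightarrow> ('k \<Rightarrow> 'w \<Rightarrow> 'w \<Rightarrow> 'w \<Rightarrow> 'f) \<Rightarrow> bool" where
  "pullback_bilinear_forms \<A> \<B> J S B C \<longleftrightarrow>
     (\<forall>i k. \<forall>p\<in>S \<inter> chart_dom (\<A> i). J p \<in> chart_dom (\<B> k) \<longrightarrow>
        (let x = chart_map (\<A> i) p; f = local_rep J (\<A> i) (\<B> k); D = frechet_derivative f (at x)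
         in \<forall>u v. B i x u v = C k (f x) (D u) (D v)))"

definition real_analytic_vector_field ::
    "('i \<Rightarrow> ('a, 'v::euclidean_space) chart) \<Rightarrow> ('i \<Rightarrow> 'v \<Rightarrow> 'v) \<Rightarrow> bool" where
  "real_analytic_vector_field \<A> E \<longleftrightarrow>
     related_vector_fields \<A> \<A> id UNIV E E \<and>
     (\<forall>i. real_analytic_on (E i) (chart_image (\<A> i)))"

definition holomorphic_vector_field ::
    "('k \<Rightarrow> ('b, 'w::complex_space) chart) \<Rightarrow> 'b set \<Rightarrow> ('k \<Rightarrow> 'w \<Rightarrow> 'w) \<Rightarrow> bool" where
  "holomorphic_vector_field \<B> W E \<longleftrightarrow>
     related_vector_fields \<B> \<B> id W E E \<and>
     (\<forall>k. holomorphic_map_on (E k) (chart_map (\<B> k) ` (W \<inter> chart_dom (\<B> k))))"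

definition smooth_one_form ::
    "('i \<Rightarrow> ('a, 'v::euclidean_space) chart) \<Rightarrow> ('i \<Rightarrow> 'v \<Rightarrow> 'v \<Rightarrow> real) \<Rightarrow> bool" where
  "smooth_one_form \<A> A \<longleftrightarrow>
     (\<forall>i. \<forall>x\<in>chart_image (\<A> i). linear (A i x)) \<and>
     (\<forall>i j. \<forall>x\<in>overlap (\<A> i) (\<A> j). \<forall>v.
        A i x v = A j (local_rep id (\<A> i) (\<A> j) x)
                      (frechet_derivative (local_rep id (\<A> i) (\<A> j)) (at x) v)) \<and>
     (\<forall>i v. smooth_on (\<lambda>x. A i x v) (chart_image (\<A> i)))"

definition real_analytic_metric ::
    "('i \<Rightarrow> ('a, 'v::euclidean_space) chart) \<Rightarrow> ('i \<Rightarrow> 'v \<Rightarrow> 'v \<Rightarrow> 'v \<Rightarrow> real) \<Rightarrow> bool" where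
  "real_analytic_metric \<A> h \<longleftrightarrow>
     (\<forall>i. \<forall>x\<in>chart_image (\<A> i). bilinear (h i x) \<and> (\<forall>u v. h i x u v = h i x v u) \<and>
        (\<forall>v. v \<noteq> 0 \<longrightarrow> h i x v v > 0)) \<and>
     pullback_bilinear_forms \<A> \<A> id UNIV h h \<and>
     (\<forall>i u v. real_analytic_on (\<lambda>x. h i x u v) (chart_image (\<A> i)))"

text \<open>A family of complex bilinear forms \<open>L \<zeta>\<close> on the slices \<open>{p. (p, \<zeta>) \<in> W}\<close>,
  depending holomorphically on \<open>p\<close> and the parameter \<open>\<zeta>\<close> jointly.\<close>

definition holomorphic_form_family ::
    "('k \<Rightarrow> ('b, 'w::complex_space) chart) \<Rightarrow> ('b \<times> complex) set \<Rightarrow>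
     (complex \<Rightarrow> 'k \<Rightarrow> 'w \<Rightarrow> 'w \<Rightarrow> 'w \<Rightarrow> complex) \<Rightarrow> bool" where
  "holomorphic_form_family \<B> W L \<longleftrightarrow>
     (\<forall>k. \<forall>(p, \<zeta>)\<in>W. p \<in> chart_dom (\<B> k) \<longrightarrow>
        (let B = L \<zeta> k (chart_map (\<B> k) p) in
           (\<forall>u v. B u v = B v u) \<and> (\<forall>u. complex_linear (B u)) \<and>
           (\<forall>v. complex_linear (\<lambda>u. B u v)))) \<and>
     (\<forall>\<zeta>. pullback_bilinear_forms \<B> \<B> id {p. (p, \<zeta>) \<in> W} (L \<zeta>) (L \<zeta>)) \<and>
     (\<forall>k u v. holomorphic_map_on (\<lambda>(z, \<zeta>). L \<zeta> k z u v)
        (chart_map (product_atlas UNIV \<B> k) ` (W \<inter> chart_dom (product_atlas UNIV \<B> k))))"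


section \<open>Local tensor calculus\<close>

text \<open>In this section \<open>G\<close>, \<open>H\<close> and \<open>B\<close> are bilinear forms, \<open>\<alpha>\<close> a one-form and \<open>V\<close> a vector field
  in a coordinate domain, and the vector arguments \<open>u, v, w\<close> are constant in the coordinates
  (so that their brackets vanish).\<close>

definition dir_deriv :: "('v::real_normed_vector \<Rightarrow> 'w::real_normed_vector) \<Rightarrow> 'v \<Rightarrow> 'v \<Rightarrow> 'w" where
  "dir_deriv f x u = frechet_derivative f (at x) u"

text \<open>The Levi-Civita connection is \<open>\<nabla>\<^sub>u V = dir_deriv V x u + christoffel G x u V\<close>.\<close>

definition christoffel ::
    "('v \<Rightarrow> 'v \<Rightarrow> 'v \<Rightarrow> real) \<Rightarrow> 'v::euclidean_space \<Rightarrow> 'v \<Rightarrow> 'v \<Rightarrow> 'v" where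
  "christoffel G x u v = (THE w. \<forall>z. G x w z =
     (dir_deriv (\<lambda>y. G y v z) x u + dir_deriv (\<lambda>y. G y u z) x v
      - dir_deriv (\<lambda>y. G y u v) x z) / 2)"

text \<open>\<open>R(u,v)w = \<nabla>\<^sub>u \<nabla>\<^sub>v w - \<nabla>\<^sub>v \<nabla>\<^sub>u w\<close>, and \<open>Ric(v,w)\<close> is the trace of \<open>u \<mapsto> R(u,v)w\<close>.\<close>

definition curvature ::
    "('v \<Rightarrow> 'v \<Rightarrow> 'v \<Rightarrow> real) \<Rightarrow> 'v::euclidean_space \<Rightarrow> 'v \<Rightarrow> 'v \<Rightarrow> 'v \<Rightarrow> 'v" where
  "curvature G x u v w =
     dir_deriv (\<lambda>y. christoffel G y v w) x u - dir_deriv (\<lambda>y. christoffel G y u w) x v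
     + christoffel G x u (christoffel G x v w) - christoffel G x v (christoffel G x u w)"

definition ricci :: "('v \<Rightarrow> 'v \<Rightarrow> 'v \<Rightarrow> real) \<Rightarrow> 'v::euclidean_space \<Rightarrow> 'v \<Rightarrow> 'v \<Rightarrow> real" where
  "ricci G x v w = (\<Sum>b\<in>Basis. curvature G x b v w \<bullet> b)"

definition lie_derivative ::
    "('v \<Rightarrow> 'v) \<Rightarrow> ('v \<Rightarrow> 'v \<Rightarrow> 'v \<Rightarrow> real) \<Rightarrow> 'v::real_normed_vector \<Rightarrow> 'v \<Rightarrow> 'v \<Rightarrow> real" where
  "lie_derivative V B x u v =
     dir_deriv (\<lambda>y. B y u v) x (V x) + B x (dir_deriv V x u) v + B x u (dir_deriv V x v)"

definition exterior_deriv ::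
    "('v \<Rightarrow> 'v \<Rightarrow> real) \<Rightarrow> 'v::real_normed_vector \<Rightarrow> 'v \<Rightarrow> 'v \<Rightarrow> real" where
  "exterior_deriv \<alpha> x u v = dir_deriv (\<lambda>y. \<alpha> y v) x u - dir_deriv (\<lambda>y. \<alpha> y u) x v"

definition gram :: "('f::zero_neq_one ^ 'm \<Rightarrow> 'f ^ 'm \<Rightarrow> 'f) \<Rightarrow> 'f ^ 'm ^ 'm" where
  "gram B = (\<chi> i j. B (axis i 1) (axis j 1))"

definition sharp ::
    "('v \<Rightarrow> 'v \<Rightarrow> 'v \<Rightarrow> real) \<Rightarrow> ('v \<Rightarrow> 'v \<Rightarrow> real) \<Rightarrow> 'v::real_vector \<Rightarrow> 'v" where
  "sharp H \<alpha> x = (THE w. \<forall>v. H x w v = \<alpha> x v)"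

definition volume_form ::
    "(real ^ 3 \<Rightarrow> real ^ 3 \<Rightarrow> real ^ 3 \<Rightarrow> real) \<Rightarrow> real ^ 3 \<Rightarrow> real ^ 3 \<Rightarrow> real ^ 3 \<Rightarrow> real ^ 3 \<Rightarrow> real" where
  "volume_form H x u v w = sqrt (det (gram (H x))) * det (vector [u, v, w] :: real ^ 3 ^ 3)"

text \<open>The Hodge star of a one-form in dimension three, in coordinates
  \<open>(*\<alpha>)\<^sub>j\<^sub>k = \<surd>(det H) \<epsilon>\<^sub>i\<^sub>j\<^sub>k \<alpha>\<^sup>i\<close>; thus \<open>*e\<^sup>1 = e\<^sup>2 \<and> e\<^sup>3\<close> for oriented orthonormal coframes.\<close>

definition hodge_star ::
    "(real ^ 3 \<Rightarrow> real ^ 3 \<Rightarrow> real ^ 3 \<Rightarrow> real) \<Rightarrow> (real ^ 3 \<Rightarrow> real ^ 3 \<Rightarrow> real) \<Rightarrow>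
     real ^ 3 \<Rightarrow> real ^ 3 \<Rightarrow> real ^ 3 \<Rightarrow> real" where
  "hodge_star H \<alpha> x u v = volume_form H x (sharp H \<alpha> x) u v"

text \<open>The trace with respect to \<open>H\<close> is \<open>H\<^sup>i\<^sup>j B\<^sub>i\<^sub>j\<close>.\<close>

definition trace_wrt ::
    "('f::field ^ 'm \<Rightarrow> 'f ^ 'm \<Rightarrow> 'f) \<Rightarrow> ('f ^ 'm \<Rightarrow> 'f ^ 'm \<Rightarrow> 'f) \<Rightarrow> 'f" where
  "trace_wrt H B = trace (matrix_inv (gram H) ** gram B)"

definition trace_free_part ::
    "('f::field ^ 'm \<Rightarrow> 'f ^ 'm \<Rightarrow> 'f) \<Rightarrow> ('f ^ 'm \<Rightarrow> 'f ^ 'm \<Rightarrow> 'f) \<Rightarrow> 'f ^ 'm \<Rightarrow> 'f ^ 'm \<Rightarrow> 'f" where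
  "trace_free_part H B u v = B u v - trace_wrt H B / of_nat CARD('m) * H u v"


section \<open>Einstein metrics and soliton flows\<close>

definition einstein ::
    "('i \<Rightarrow> ('a, 'v::euclidean_space) chart) \<Rightarrow> ('i \<Rightarrow> 'v \<Rightarrow> 'v \<Rightarrow> 'v \<Rightarrow> real) \<Rightarrow> bool" where
  "einstein \<A> g \<longleftrightarrow> (\<exists>a::real. \<forall>i. \<forall>x\<in>chart_image (\<A> i). \<forall>u v.
     ricci (g i) x u v = a * g i x u v)"

definition soliton_flow ::
    "('i \<Rightarrow> ('a, 'v::euclidean_space) chart) \<Rightarrow> ('i \<Rightarrow> 'v \<Rightarrow> 'v \<Rightarrow> 'v \<Rightarrow> real) \<Rightarrow>
     ('i \<Rightarrow> 'v \<Rightarrow> 'v) \<Rightarrow> bool" where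
  "soliton_flow \<A> g E \<longleftrightarrow> (\<exists>a::real. \<forall>i. \<forall>x\<in>chart_image (\<A> i). \<forall>u v.
     ricci (g i) x u v + a * g i x u v + 1/2 * lie_derivative (E i) (g i) x u v = 0)"


section \<open>The Beltrami fields construction\<close>

definition beltrami_equation ::
    "('i \<Rightarrow> ('n, real ^ 3) chart) \<Rightarrow> ('i \<Rightarrow> real ^ 3 \<Rightarrow> real ^ 3 \<Rightarrow> real ^ 3 \<Rightarrow> real) \<Rightarrow>
     ('i \<Rightarrow> real ^ 3 \<Rightarrow> real ^ 3 \<Rightarrow> real) \<Rightarrow> bool" where
  "beltrami_equation \<N> h A \<longleftrightarrow> (\<forall>i. \<forall>x\<in>chart_image (\<N> i). \<forall>u v.
     exterior_deriv (A i) x u v + 2 * hodge_star (h i) (A i) x u v = 0)"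

definition exterior_deriv_nowhere_zero ::
    "('i \<Rightarrow> ('n, 'v::real_normed_vector) chart) \<Rightarrow> ('i \<Rightarrow> 'v \<Rightarrow> 'v \<Rightarrow> real) \<Rightarrow> bool" where
  "exterior_deriv_nowhere_zero \<N> A \<longleftrightarrow> (\<forall>i. \<forall>x\<in>chart_image (\<N> i). \<exists>u v.
     exterior_deriv (A i) x u v \<noteq> 0)"

definition beltrami_manifold ::
    "('i \<Rightarrow> ('n, real ^ 3) chart) \<Rightarrow> 'i \<Rightarrow> ('n \<times> real, (real ^ 3) \<times> real) chart" where
  "beltrami_manifold \<N> = product_atlas {0<..} \<N>"

definition beltrami_metric ::
    "('i \<Rightarrow> real ^ 3 \<Rightarrow> real ^ 3 \<Rightarrow> real ^ 3 \<Rightarrow> real) \<Rightarrow> ('i \<Rightarrow> real ^ 3 \<Rightarrow> real ^ 3 \<Rightarrow> real) \<Rightarrow>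
     'i \<Rightarrow> (real ^ 3) \<times> real \<Rightarrow> (real ^ 3) \<times> real \<Rightarrow> (real ^ 3) \<times> real \<Rightarrow> real" where
  "beltrami_metric h A i = (\<lambda>(x, \<rho>) (u, s) (v, t).
     \<rho>\<^sup>2 * h i x u v + inverse (\<rho>\<^sup>2) * ((\<rho> * s + A i x u) * (\<rho> * t + A i x v)))"

text \<open>\<open>\<phi>\<^sup>*h\<close> for the projection \<open>\<phi> : N \<times> (0,\<infinity>) \<rightarrow> N\<close>, and the restriction of its Lie derivative
  to vectors tangent to the slices \<open>N \<times> {\<rho>}\<close>.\<close>

definition pullback_projection ::
    "('i \<Rightarrow> 'v \<Rightarrow> 'v \<Rightarrow> 'v \<Rightarrow> real) \<Rightarrow> 'i \<Rightarrow> 'v \<times> real \<Rightarrow> 'v \<times> real \<Rightarrow> 'v \<times> real \<Rightarrow> real" where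
  "pullback_projection h i = (\<lambda>(x, \<rho>) (u, s) (v, t). h i x u v)"

definition slice_lie_derivative ::
    "('i \<Rightarrow> 'v \<times> real \<Rightarrow> 'v \<times> real) \<Rightarrow> ('i \<Rightarrow> 'v \<Rightarrow> 'v \<Rightarrow> 'v \<Rightarrow> real) \<Rightarrow>
     real \<Rightarrow> 'i \<Rightarrow> 'v::real_normed_vector \<Rightarrow> 'v \<Rightarrow> 'v \<Rightarrow> real" where
  "slice_lie_derivative E h \<rho> i x u v =
     lie_derivative (E i) (pullback_projection h i) (x, \<rho>) (u, 0) (v, 0)"


section \<open>Complexification\<close>

definition complexify_vec :: "real ^ 'm \<Rightarrow> complex ^ 'm" where
  "complexify_vec x = (\<chi> i. complex_of_real (x $ i))"

text \<open>The complex manifold \<open>\<X>\<close> (with underlying space the whole type) is a complexification of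
  the real-analytic manifold \<open>\<N>\<close>, embedded by \<open>\<iota>\<close>: near each point of \<open>\<N>\<close> there are
  coordinates in which \<open>\<iota>\<close> becomes the inclusion of the real points of an open subset of complex
  coordinate space.\<close>

definition complexification ::
    "('i \<Rightarrow> ('n::topological_space, real ^ 'm) chart) \<Rightarrow>
     ('k \<Rightarrow> ('x::topological_space, complex ^ 'm) chart) \<Rightarrow> ('n \<Rightarrow> 'x) \<Rightarrow> bool" where
  "complexification \<N> \<X> \<iota> \<longleftrightarrow> holomorphic_atlas UNIV \<X> \<and> inj \<iota> \<and>
     (\<forall>p. \<exists>c d. is_chart c \<and> (\<forall>i. analytically_compatible c (\<N> i)) \<and>
        is_chart d \<and> (\<forall>k. holomorphically_compatible d (\<X> k)) \<and>
        p \<in> chart_dom c \<and> \<iota> ` chart_dom c = chart_dom d \<inter> range \<iota> \<and>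
        (\<forall>q\<in>chart_dom c. chart_map d (\<iota> q) = complexify_vec (chart_map c q)) \<and>
        complexify_vec -` chart_image d = chart_image c)"

definition complexification_vector_field ::
    "('i \<Rightarrow> ('n, real ^ 'm) chart) \<Rightarrow> ('k \<Rightarrow> ('x, complex ^ 'm) chart) \<Rightarrow> ('n \<Rightarrow> 'x) \<Rightarrow>
     ('x \<times> complex) set \<Rightarrow> ('i \<Rightarrow> (real ^ 'm) \<times> real \<Rightarrow> (real ^ 'm) \<times> real) \<Rightarrow>
     ('k \<Rightarrow> (complex ^ 'm) \<times> complex \<Rightarrow> (complex ^ 'm) \<times> complex) \<Rightarrow> bool" where
  "complexification_vector_field \<N> \<X> \<iota> W E EC \<longleftrightarrow>
     holomorphic_vector_field (product_atlas (- {0}) \<X>) W EC \<and>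
     related_vector_fields (product_atlas {0<..} \<N>) (product_atlas (- {0}) \<X>)
       (\<lambda>(p, \<rho>). (\<iota> p, complex_of_real \<rho>)) {(p, \<rho>). (\<iota> p, complex_of_real \<rho>) \<in> W} E EC"

definition admits_complexification_on ::
    "('i \<Rightarrow> ('n, real ^ 'm) chart) \<Rightarrow> ('k \<Rightarrow> ('x::topological_space, complex ^ 'm) chart) \<Rightarrow>
     ('n \<Rightarrow> 'x) \<Rightarrow> ('i \<Rightarrow> (real ^ 'm) \<times> real \<Rightarrow> (real ^ 'm) \<times> real) \<Rightarrow> ('x \<times> complex) set \<Rightarrow> bool" where
  "admits_complexification_on \<N> \<X> \<iota> E K \<longleftrightarrow>
     (\<exists>W EC. open W \<and> W \<subseteq> UNIV \<times> (- {0}) \<and> K \<subseteq> W \<and>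
        complexification_vector_field \<N> \<X> \<iota> W E EC)"

text \<open>\<open>LC\<close> is a holomorphic extension to \<open>W\<close> of the family \<open>L \<rho>\<close>, \<open>\<rho> > 0\<close>, of bilinear forms.\<close>

definition complexification_form_family ::
    "('i \<Rightarrow> ('n, real ^ 'm) chart) \<Rightarrow> ('k \<Rightarrow> ('x, complex ^ 'm) chart) \<Rightarrow> ('n \<Rightarrow> 'x) \<Rightarrow>
     ('x \<times> complex) set \<Rightarrow>
     (real \<Rightarrow> 'i \<Rightarrow> real ^ 'm \<Rightarrow> real ^ 'm \<Rightarrow> real ^ 'm \<Rightarrow> real) \<Rightarrow>
     (complex \<Rightarrow> 'k \<Rightarrow> complex ^ 'm \<Rightarrow> complex ^ 'm \<Rightarrow> complex ^ 'm \<Rightarrow> complex) \<Rightarrow> bool" where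
  "complexification_form_family \<N> \<X> \<iota> W L LC \<longleftrightarrow>
     holomorphic_form_family \<X> W LC \<and>
     (\<forall>\<rho>>0. pullback_bilinear_forms \<N> \<X> \<iota> {p. (\<iota> p, complex_of_real \<rho>) \<in> W}
        (\<lambda>i x u v. complex_of_real (L \<rho> i x u v)) (LC (complex_of_real \<rho>)))"

text \<open>A single form is a family independent of the parameter.\<close>

definition complexification_form ::
    "('i \<Rightarrow> ('n, real ^ 'm) chart) \<Rightarrow> ('k \<Rightarrow> ('x, complex ^ 'm) chart) \<Rightarrow> ('n \<Rightarrow> 'x) \<Rightarrow> 'x set \<Rightarrow>
     ('i \<Rightarrow> real ^ 'm \<Rightarrow> real ^ 'm \<Rightarrow> real ^ 'm \<Rightarrow> real) \<Rightarrow>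
     ('k \<Rightarrow> complex ^ 'm \<Rightarrow> complex ^ 'm \<Rightarrow> complex ^ 'm \<Rightarrow> complex) \<Rightarrow> bool" where
  "complexification_form \<N> \<X> \<iota> V h HC \<longleftrightarrow>
     complexification_form_family \<N> \<X> \<iota> (V \<times> UNIV) (\<lambda>_. h) (\<lambda>_. HC)"

text \<open>\<open>\<integral>\<^sub>\<gamma> \<rho>\<^sup>m L\<^sub>\<rho> d\<rho>\<close>, pointwise, over the circle \<open>\<gamma>\<close> of radius \<open>r\<close> centred at the origin.\<close>

definition moment_form ::
    "real \<Rightarrow> nat \<Rightarrow> (complex \<Rightarrow> 'k \<Rightarrow> 'w \<Rightarrow> 'w \<Rightarrow> 'w \<Rightarrow> complex) \<Rightarrow> 'k \<Rightarrow> 'w \<Rightarrow> 'w \<Rightarrow> 'w \<Rightarrow> complex" where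
  "moment_form r m LC k z u v =
     contour_integral (circlepath 0 r) (\<lambda>\<zeta>. \<zeta> ^ m * LC \<zeta> k z u v)"

definition form_vanishes_on ::
    "('k \<Rightarrow> ('x, 'w) chart) \<Rightarrow> 'x set \<Rightarrow> ('k \<Rightarrow> 'w \<Rightarrow> 'w \<Rightarrow> 'w \<Rightarrow> complex) \<Rightarrow> bool" where
  "form_vanishes_on \<X> V B \<longleftrightarrow>
     (\<forall>k. \<forall>p\<in>V \<inter> chart_dom (\<X> k). \<forall>u v. B k (chart_map (\<X> k) p) u v = 0)"

text \<open>Vanishing of \<open>\<integral>\<^sub>\<gamma> \<rho>\<^sup>m L\<^sub>\<rho> d\<rho>\<close>, respectively of its trace-free part, on a sufficiently small
  complex neighbourhood \<open>V\<close> of \<open>U\<close>. As the forms are holomorphic, this does not depend on the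
  choice of \<open>V\<close> once all its components meet \<open>U\<close>.\<close>

definition moment_vanishes ::
    "('k \<Rightarrow> ('x::topological_space, complex ^ 'm) chart) \<Rightarrow> ('n \<Rightarrow> 'x) \<Rightarrow> 'n set \<Rightarrow> real \<Rightarrow>
     ('x \<times> complex) set \<Rightarrow>
     (complex \<Rightarrow> 'k \<Rightarrow> complex ^ 'm \<Rightarrow> complex ^ 'm \<Rightarrow> complex ^ 'm \<Rightarrow> complex) \<Rightarrow> nat \<Rightarrow> bool" where
  "moment_vanishes \<X> \<iota> U r W LC m \<longleftrightarrow>
     (\<exists>V. open V \<and> \<iota> ` U \<subseteq> V \<and> V \<times> sphere 0 r \<subseteq> W \<and>
        form_vanishes_on \<X> V (moment_form r m LC))"

definition trace_free_moment_vanishes ::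
    "('k \<Rightarrow> ('x::topological_space, complex ^ 'm) chart) \<Rightarrow> ('n \<Rightarrow> 'x) \<Rightarrow> 'n set \<Rightarrow> real \<Rightarrow>
     'x set \<Rightarrow> ('k \<Rightarrow> complex ^ 'm \<Rightarrow> complex ^ 'm \<Rightarrow> complex ^ 'm \<Rightarrow> complex) \<Rightarrow>
     ('x \<times> complex) set \<Rightarrow>
     (complex \<Rightarrow> 'k \<Rightarrow> complex ^ 'm \<Rightarrow> complex ^ 'm \<Rightarrow> complex ^ 'm \<Rightarrow> complex) \<Rightarrow> nat \<Rightarrow> bool" where
  "trace_free_moment_vanishes \<X> \<iota> U r D HC W LC m \<longleftrightarrow>
     (\<exists>V. open V \<and> \<iota> ` U \<subseteq> V \<and> V \<times> sphere 0 r \<subseteq> W \<and> V \<subseteq> D \<and>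
        form_vanishes_on \<X> V (\<lambda>k z. trace_free_part (HC k z) (moment_form r m LC k z)))"

end

theory Submission
  imports Defs
begin

text \<open>Write \<open>E = X + f \<partial>\<^sub>\<rho>\<close>. The Beltrami equation makes all contributions of \<open>A\<close> to the Ricci tensor
  cancel, so that \<open>Ric = \<phi>\<^sup>*Q\<close> with \<open>Q = Ric\<^sub>h - 2h\<close>; as \<open>g\<close> is not a pullback from \<open>N\<close>, it is Einstein
  iff \<open>Q = 0\<close>. The soliton equation becomes
  \<open>\<rho> f' + A(X') + a \<rho> = 0\<close> and
  \<open>Q + a \<rho>\<^sup>2 h + 1/2 \<rho>\<^sup>2 L\<^sub>X h + \<rho> f h - 1/2 \<rho> (A \<otimes> h(X') + h(X') \<otimes> A) = 0\<close>, primes denoting \<open>\<rho>\<close>-derivatives.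
  At a fixed point of \<open>U\<close> these extend from real \<open>\<rho>\<close> to an annulus around \<open>\<gamma>\<close>. Integrating the second,
  and using the first to see that \<open>f\<close> has vanishing integral, gives
  \<open>\<integral> \<rho> L\<^sub>X h d\<rho> = - 4 \<pi> \<i> Q\<close>. Hence (ii) says that \<open>Q\<close> vanishes on \<open>U\<close>, and by analyticity on \<open>N\<close>.

  For \<open>n \<ge> 1\<close> the same integration shows that \<open>\<integral> \<rho>\<^bsup>2n+1\<^esup> L\<^sub>X h d\<rho>\<close> is a multiple of \<open>h\<close> plus the
  symmetric product of \<open>A\<close> with the one-form dual to \<open>Y = \<integral> \<rho>\<^bsup>2n-1\<^esup> X d\<rho>\<close>, up to a constant. If its
  trace-free part is zero on \<open>U\<close>, then \<open>Y = 0\<close> on \<open>U\<close> because \<open>A\<close> has a kernel, whence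
  \<open>\<integral> \<rho>\<^bsup>2n-1\<^esup> L\<^sub>X h d\<rho> = L\<^sub>Y h = 0\<close>, and one descends to the first moment.\<close>

section \<open>Holomorphic functions of several variables\<close>

text \<open>Why \<open>A\<close> drops out: dA = -2*A says that the dual vector field has curl -2a,
  and applying d once more that it has divergence zero. Together with the antisymmetric part of the
  covariant derivative of \<open>A\<close> these two facts remove every term in \<open>A\<close>
  from the Ricci tensor. That Q is a tensor on N is read off from the soliton equation, whose other
  terms visibly transform correctly, and not from a naturality theorem for curvature. Unique
  continuation acts on Q, which is built from h alone. The constant -4 \<pi> i comes from the pole
  of 2Q/\<rho> after division of the doubled equation by \<rho>. The integral of f vanishes because
  integration by parts turns it into minus the integral of \<rho> f', and \<rho> f' = -A(X') - a
  \<rho> has a primitive. The complex side is controlled from real points: there the derivative of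
  the embedding carries a real basis to a complex basis, so a complex form is known from its values
  on real vectors, and holomorphy propagates its vanishing to a neighbourhood. The given extension
  of the Lie derivative is tied to that of E only through these real values, so
  \<open>lie_formula\<close> has to identify the two before derivatives can be taken out of the
  integral.\<close>

lemma continuous_on_contour_integral_circlepath:
  fixes f :: "'p::topological_space \<Rightarrow> complex \<Rightarrow> complex"
  assumes cont: "continuous_on (P \<times> sphere w R) (\<lambda>(p, \<zeta>). f p \<zeta>)" and R: "R \<ge> 0"
  shows "continuous_on P (\<lambda>p. contour_integral (circlepath w R) (f p))"
proof -
  have "continuous_on P (\<lambda>p. integral (cbox 0 1)
      (\<lambda>t. f p (circlepath w R t) * vector_derivative (circlepath w R) (at t)))"
  proof (rule integral_continuous_on_param)
    have circ: "circlepath w R t \<in> sphere w R" for t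
      using R by (auto simp: circlepath dist_norm norm_mult)
    have "continuous_on (P \<times> cbox 0 1) (\<lambda>x. (\<lambda>(p, \<zeta>). f p \<zeta>) (fst x, circlepath w R (snd x)))"
      by (rule continuous_on_compose2[OF cont])
        (use circ in \<open>auto simp: circlepath intro!: continuous_intros\<close>)
    then have 1: "continuous_on (P \<times> cbox 0 1) (\<lambda>x. f (fst x) (circlepath w R (snd x)))"
      by simp
    show "continuous_on (P \<times> cbox 0 1)
        (\<lambda>(p, t). f p (circlepath w R t) * vector_derivative (circlepath w R) (at t))"
      unfolding vector_derivative_circlepath split_beta
      by (intro continuous_intros 1)
  qed
  then show ?thesis by (simp add: contour_integral_integral)
qed

lemma contour_integrable_on_circlepath:
  assumes "continuous_on (sphere w R) f" "R \<ge> 0"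
  shows "f contour_integrable_on circlepath w R"
  using assms by (intro contour_integrable_continuous_circlepath) auto

text \<open>Differentiation under the integral needs a derivative that is continuous in parameter
  and integration variable jointly. Only continuity of \<open>f\<close> itself is given jointly, so
  the derivative is rewritten by Cauchy's formula as an integral of \<open>f\<close> over a small
  circle around \<open>\<eta>0\<close>.\<close>

lemma has_field_derivative_contour_integral_circlepath:
  fixes f :: "complex \<Rightarrow> complex \<Rightarrow> complex"
  assumes "open O1" and cont: "continuous_on (O1 \<times> sphere w R) (\<lambda>(\<eta>, \<zeta>). f \<eta> \<zeta>)"
    and hol: "\<And>\<zeta>. \<zeta> \<in> sphere w R \<Longrightarrow> (\<lambda>\<eta>. f \<eta> \<zeta>) holomorphic_on O1"
    and \<eta>0: "\<eta>0 \<in> O1" and R: "R \<ge> 0"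
  shows "((\<lambda>\<eta>. contour_integral (circlepath w R) (f \<eta>)) has_field_derivative
     contour_integral (circlepath w R) (\<lambda>\<zeta>. deriv (\<lambda>\<eta>. f \<eta> \<zeta>) \<eta>0)) (at \<eta>0)"
proof -
  obtain \<rho> where \<rho>: "\<rho> > 0" "cball \<eta>0 \<rho> \<subseteq> O1"
    using \<open>open O1\<close> \<eta>0 open_contains_cball by blast
  let ?g = "circlepath w R"
  have circ: "?g t \<in> sphere w R" for t
    using R by (auto simp: circlepath dist_norm norm_mult)
  define c where "c = 1 / (2 * of_real pi * \<i>)"
  have derf: "((\<lambda>\<eta>. f \<eta> \<zeta>) has_field_derivative
      c * contour_integral (circlepath \<eta>0 \<rho>) (\<lambda>u. f u \<zeta> / (u - \<eta>)\<^sup>2)) (at \<eta>)"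
    if "\<zeta> \<in> sphere w R" "\<eta> \<in> ball \<eta>0 \<rho>" for \<eta> \<zeta>
    unfolding c_def
  proof (rule Cauchy_derivative_integral_circlepath(2))
    have "(\<lambda>\<eta>. f \<eta> \<zeta>) holomorphic_on cball \<eta>0 \<rho>"
      using hol[OF that(1)] \<rho> holomorphic_on_subset by blast
    then show "continuous_on (cball \<eta>0 \<rho>) (\<lambda>\<eta>. f \<eta> \<zeta>)" "(\<lambda>\<eta>. f \<eta> \<zeta>) holomorphic_on ball \<eta>0 \<rho>"
      using holomorphic_on_imp_continuous_on holomorphic_on_subset ball_subset_cball by blast+
  qed (use that in auto)
  define fx where "fx \<eta> t = c * contour_integral (circlepath \<eta>0 \<rho>) (\<lambda>u. f u (?g t) / (u - \<eta>)\<^sup>2)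
      * vector_derivative ?g (at t)" for \<eta> t
  have "((\<lambda>\<eta>. integral (cbox 0 1) (\<lambda>t. f \<eta> (?g t) * vector_derivative ?g (at t)))
     has_field_derivative integral (cbox 0 1) (fx \<eta>0)) (at \<eta>0 within ball \<eta>0 \<rho>)"
  proof (rule leibniz_rule_field_derivative)
    fix \<eta> t assume "\<eta> \<in> ball \<eta>0 \<rho>" "t \<in> cbox 0 (1::real)"
    show "((\<lambda>\<eta>. f \<eta> (?g t) * vector_derivative ?g (at t)) has_field_derivative fx \<eta> t)
        (at \<eta> within ball \<eta>0 \<rho>)"
      unfolding fx_def
      by (intro DERIV_cmult_right has_field_derivative_at_within[OF derf] circ) fact
  next
    fix \<eta> assume \<eta>: "\<eta> \<in> ball \<eta>0 \<rho>"
    then have "\<eta> \<in> O1" using \<rho> by auto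
    have "continuous_on (sphere w R) (\<lambda>\<zeta>. (\<lambda>(\<eta>, \<zeta>). f \<eta> \<zeta>) (\<eta>, \<zeta>))"
      by (rule continuous_on_compose2[OF cont]) (use \<open>\<eta> \<in> O1\<close> in \<open>auto intro!: continuous_intros\<close>)
    then have "f \<eta> contour_integrable_on ?g"
      by (intro contour_integrable_on_circlepath) (use R in auto)
    then show "(\<lambda>t. f \<eta> (?g t) * vector_derivative ?g (at t)) integrable_on cbox 0 1"
      by (simp add: contour_integrable_on)
  next
    have 1: "continuous_on (ball \<eta>0 \<rho> \<times> cbox 0 (1::real))
       (\<lambda>p. contour_integral (circlepath \<eta>0 \<rho>) (\<lambda>u. f u (?g (snd p)) / (u - fst p)\<^sup>2))"
    proof (rule continuous_on_contour_integral_circlepath)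
      have "continuous_on ((ball \<eta>0 \<rho> \<times> cbox 0 1) \<times> sphere \<eta>0 \<rho>)
         (\<lambda>x. (\<lambda>(\<eta>, \<zeta>). f \<eta> \<zeta>) (snd x, ?g (snd (fst x))))"
        by (rule continuous_on_compose2[OF cont])
          (use circ \<rho> in \<open>auto simp: circlepath intro!: continuous_intros\<close>)
      then show "continuous_on ((ball \<eta>0 \<rho> \<times> cbox 0 1) \<times> sphere \<eta>0 \<rho>)
         (\<lambda>(p, u). f u (?g (snd p)) / (u - fst p)\<^sup>2)"
        unfolding split_beta by (intro continuous_intros) auto
    qed (use \<rho> in auto)
    show "continuous_on (ball \<eta>0 \<rho> \<times> cbox 0 1) (\<lambda>(\<eta>, t). fx \<eta> t)"
      unfolding fx_def split_beta vector_derivative_circlepath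
      by (intro continuous_intros 1)
  qed (use \<rho> in auto)
  moreover have "fx \<eta>0 t = deriv (\<lambda>\<eta>. f \<eta> (?g t)) \<eta>0 * vector_derivative ?g (at t)" for t
    unfolding fx_def using DERIV_imp_deriv[OF derf[OF circ, of \<eta>0 t]] \<rho> by simp
  then have "fx \<eta>0 = (\<lambda>t. deriv (\<lambda>\<eta>. f \<eta> (?g t)) \<eta>0 * vector_derivative ?g (at t))" ..
  ultimately show ?thesis
    using \<rho> by (simp add: contour_integral_integral at_within_open[of \<eta>0 "ball \<eta>0 \<rho>"])
qed

text \<open>Abstracting the scalar multiplication lets the same results serve the spaces of
  class \<open>complex_space\<close> and the complexification \<open>'v \<times> 'v\<close> of a real space \<open>'v\<close>.\<close>

locale complex_scaling =
  fixes sc :: "complex \<Rightarrow> 'z::euclidean_space \<Rightarrow> 'z"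
  assumes sc_add_right: "sc c (x + y) = sc c x + sc c y"
    and sc_add_left: "sc (c + d) x = sc c x + sc d x"
    and sc_sc: "sc c (sc d x) = sc (c * d) x"
    and sc_of_real: "sc (complex_of_real s) x = s *\<^sub>R x"
begin

text \<open>Continuity together with holomorphy on complex affine lines. On open sets this agrees
  with complex Frechet differentiability (\<open>ghol_has_derivative\<close>,
  \<open>ghol_if_has_derivative\<close>), but in this form products, uniform limits and parameter
  integrals reduce at once to one complex variable.\<close>

definition ghol :: "('z \<Rightarrow> complex) \<Rightarrow> 'z set \<Rightarrow> bool" where
  "ghol F S \<longleftrightarrow> continuous_on S F \<and> (\<forall>z v. (\<lambda>\<zeta>. F (z + sc \<zeta> v)) holomorphic_on {\<zeta>. z + sc \<zeta> v \<in> S})"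

definition cderiv :: "'z \<Rightarrow> ('z \<Rightarrow> complex) \<Rightarrow> 'z \<Rightarrow> complex" where
  "cderiv v F z = deriv (\<lambda>\<zeta>. F (z + sc \<zeta> v)) 0"

lemma sc_expand: "sc \<zeta> v = Re \<zeta> *\<^sub>R v + Im \<zeta> *\<^sub>R sc \<i> v"
proof -
  have "sc \<zeta> v = sc (of_real (Re \<zeta>) + of_real (Im \<zeta>) * \<i>) v"
    by (subst complex_eq) (simp add: mult.commute)
  then show ?thesis by (simp only: sc_add_left sc_of_real flip: sc_sc)
qed

lemma sc_0 [simp]: "sc 0 v = 0" and sc_1 [simp]: "sc 1 v = v"
  using sc_of_real[of 0 v] sc_of_real[of 1 v] by auto

lemma sc_scaleR: "sc c (s *\<^sub>R x) = s *\<^sub>R sc c x"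
  by (simp only: sc_sc mult.commute flip: sc_of_real)

lemma linear_sc: "linear (sc c)"
  by (rule linearI) (simp_all add: sc_add_right sc_scaleR)

lemma sc_bound: obtains K where "K > 0" "\<And>\<zeta> v. norm (sc \<zeta> v) \<le> K * cmod \<zeta> * norm v"
proof -
  obtain B where B: "B > 0" "\<And>v. norm (sc \<i> v) \<le> B * norm v"
    using linear_bounded_pos[OF linear_sc] by blast
  have "norm (sc \<zeta> v) \<le> (1 + B) * cmod \<zeta> * norm v" for \<zeta> v
  proof -
    have "norm (sc \<zeta> v) \<le> \<bar>Re \<zeta>\<bar> * norm v + \<bar>Im \<zeta>\<bar> * norm (sc \<i> v)"
      by (subst sc_expand) (rule order.trans[OF norm_triangle_ineq], simp)
    also have "\<dots> \<le> cmod \<zeta> * norm v + cmod \<zeta> * (B * norm v)"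
      by (intro add_mono mult_mono abs_Re_le_cmod abs_Im_le_cmod B) auto
    finally show ?thesis by (simp add: algebra_simps)
  qed
  with B(1) show ?thesis by (intro that[of "1 + B"]) auto
qed

lemma continuous_on_sc [continuous_intros]:
  "continuous_on X f \<Longrightarrow> continuous_on X (\<lambda>x. sc (f x) v)"
  by (subst sc_expand) (intro continuous_intros)

lemma open_line: "open S \<Longrightarrow> open {\<zeta>. z + sc \<zeta> v \<in> S}"
  by (rule open_vimage[of S "\<lambda>\<zeta>. z + sc \<zeta> v", unfolded vimage_def])
    (auto intro!: continuous_intros)

lemma ghol_subset: "ghol F S \<Longrightarrow> T \<subseteq> S \<Longrightarrow> ghol F T"
  unfolding ghol_def
proof (intro conjI allI; elim conjE)
  fix z v assume "T \<subseteq> S" "\<forall>z v. (\<lambda>\<zeta>. F (z + sc \<zeta> v)) holomorphic_on {\<zeta>. z + sc \<zeta> v \<in> S}"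
  then show "(\<lambda>\<zeta>. F (z + sc \<zeta> v)) holomorphic_on {\<zeta>. z + sc \<zeta> v \<in> T}"
    by (blast intro: holomorphic_on_subset)
qed (rule continuous_on_subset)

lemma ghol_cong: "ghol F S \<Longrightarrow> (\<And>z. z \<in> S \<Longrightarrow> F z = G z) \<Longrightarrow> ghol G S"
  unfolding ghol_def
  using continuous_on_cong[of S S F G]
  by (metis (mono_tags, lifting) holomorphic_transform mem_Collect_eq)

lemma ghol_const: "ghol (\<lambda>_. c) S"
  by (auto simp: ghol_def)

lemma ghol_add: "ghol F S \<Longrightarrow> ghol G S \<Longrightarrow> ghol (\<lambda>z. F z + G z) S"
  by (auto simp: ghol_def intro!: continuous_intros holomorphic_intros)

lemma ghol_mult: "ghol F S \<Longrightarrow> ghol G S \<Longrightarrow> ghol (\<lambda>z. F z * G z) S"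
  by (auto simp: ghol_def intro!: continuous_intros holomorphic_intros)

lemma ghol_sum: "(\<And>i. i \<in> I \<Longrightarrow> ghol (F i) S) \<Longrightarrow> ghol (\<lambda>z. \<Sum>i\<in>I. F i z) S"
  by (induction I rule: infinite_finite_induct) (auto intro: ghol_const ghol_add)

lemma ghol_prod: "(\<And>i. i \<in> I \<Longrightarrow> ghol (F i) S) \<Longrightarrow> ghol (\<lambda>z. \<Prod>i\<in>I. F i z) S"
  by (induction I rule: infinite_finite_induct) (auto intro: ghol_const ghol_mult)

lemma ghol_power: "ghol F S \<Longrightarrow> ghol (\<lambda>z. F z ^ n) S"
  by (induction n) (auto intro: ghol_const ghol_mult)

lemma ghol_inverse: "ghol F S \<Longrightarrow> (\<And>z. z \<in> S \<Longrightarrow> F z \<noteq> 0) \<Longrightarrow> ghol (\<lambda>z. inverse (F z)) S"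
  by (auto simp: ghol_def intro!: continuous_intros holomorphic_intros)

lemma line_in_ball:
  assumes "open S" "z0 \<in> S"
  obtains \<delta> and R :: real where "\<delta> > 0" "R > 0" "\<And>z \<zeta>. z \<in> ball z0 \<delta> \<Longrightarrow> \<zeta> \<in> cball 0 R \<Longrightarrow> z + sc \<zeta> v \<in> S"
proof -
  obtain K where K: "K > 0" "\<And>\<zeta> v. norm (sc \<zeta> v) \<le> K * cmod \<zeta> * norm v" using sc_bound by blast
  obtain e where e: "e > 0" "ball z0 e \<subseteq> S" using assms open_contains_ball by blast
  show ?thesis
  proof (rule that[of "e/2" "e / (2 * K * (norm v + 1))"])
    fix z and \<zeta> :: complex assume z: "z \<in> ball z0 (e/2)" and \<zeta>: "\<zeta> \<in> cball 0 (e / (2 * K * (norm v + 1)))"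
    have "norm (sc \<zeta> v) \<le> K * cmod \<zeta> * norm v" by (rule K)
    also have "\<dots> \<le> K * (e / (2 * K * (norm v + 1))) * norm v"
      using K \<zeta> by (intro mult_right_mono mult_left_mono) auto
    also have "\<dots> = (e/2) * (norm v / (norm v + 1))"
    proof -
      have "norm v + 1 \<noteq> 0" using norm_ge_zero[of v] by linarith
      then show ?thesis using K(1) by (simp add: divide_simps)
    qed
    also have "\<dots> < e/2"
    proof -
      have "norm v / (norm v + 1) < 1" using norm_ge_zero[of v] by (simp add: divide_less_eq_1 add_nonneg_pos)
      then show ?thesis using mult_strict_left_mono[of "norm v / (norm v + 1)" 1 "e/2"] e(1) by simp
    qed
    finally have "dist z0 (z + sc \<zeta> v) < e"
      using z norm_triangle_ineq[of "z0 - z" "- sc \<zeta> v"]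
      by (simp add: dist_norm algebra_simps)
    then show "z + sc \<zeta> v \<in> S" using e by auto
  qed (use e K in \<open>auto intro!: divide_pos_pos mult_pos_pos add_nonneg_pos\<close>)
qed

lemma ghol_line:
  assumes "ghol F S"
  shows "(\<lambda>\<zeta>. F (z + sc \<zeta> v)) holomorphic_on {\<zeta>. z + sc \<zeta> v \<in> S}"
  using assms by (auto simp: ghol_def)

lemma cderiv_line:
  assumes "open S" "ghol F S" "z + sc \<eta> v \<in> S"
  shows "((\<lambda>\<zeta>. F (z + sc \<zeta> v)) has_field_derivative cderiv v F (z + sc \<eta> v)) (at \<eta>)"
proof -
  have 1: "((\<lambda>\<zeta>. F (z + sc \<eta> v + sc \<zeta> v)) has_field_derivative cderiv v F (z + sc \<eta> v)) (at 0)"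
    unfolding cderiv_def
    by (rule holomorphic_derivI[OF ghol_line[OF assms(2)] open_line[OF assms(1)]]) (use assms in auto)
  have "((\<lambda>\<zeta>. F (z + sc \<eta> v + sc \<zeta> v)) has_field_derivative cderiv v F (z + sc \<eta> v)) (at (\<eta> - \<eta>))"
    using 1 by simp
  then have "((\<lambda>\<zeta>. F (z + sc \<eta> v + sc (\<zeta> - \<eta>) v)) has_field_derivative cderiv v F (z + sc \<eta> v) * 1) (at \<eta>)"
    by (rule DERIV_chain2) (auto intro!: derivative_eq_intros)
  moreover have "z + sc \<eta> v + sc (\<zeta> - \<eta>) v = z + sc \<zeta> v" for \<zeta>
    by (simp add: add.assoc flip: sc_add_left)
  ultimately show ?thesis by simp
qed

lemma cderiv_contour_integral:
  assumes "ghol F S" "R > 0" "\<And>\<zeta>. \<zeta> \<in> cball 0 R \<Longrightarrow> z + sc \<zeta> v \<in> S"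
  shows "cderiv v F z = contour_integral (circlepath 0 R) (\<lambda>\<zeta>. F (z + sc \<zeta> v) / \<zeta>\<^sup>2) / (2 * pi * \<i>)"
proof -
  have "(\<lambda>\<zeta>. F (z + sc \<zeta> v)) holomorphic_on cball 0 R"
    by (rule holomorphic_on_subset[OF ghol_line[OF assms(1)]]) (use assms(3) in auto)
  then show ?thesis
    using Cauchy_contour_integral_circlepath_2[of 0 R "\<lambda>\<zeta>. F (z + sc \<zeta> v)" 0] assms(2)
    by (auto simp: cderiv_def holomorphic_on_imp_continuous_on holomorphic_on_subset[of _ "cball 0 R"])
qed

lemma ghol_contour_integral:
  fixes f :: "'z \<Rightarrow> complex \<Rightarrow> complex"
  assumes S: "open S" and cont: "continuous_on (S \<times> sphere w R) (\<lambda>(z, \<zeta>). f z \<zeta>)"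
    and hol: "\<And>\<zeta>. \<zeta> \<in> sphere w R \<Longrightarrow> ghol (\<lambda>z. f z \<zeta>) S" and R: "R \<ge> 0"
  shows "ghol (\<lambda>z. contour_integral (circlepath w R) (f z)) S"
    and "\<And>z v. z \<in> S \<Longrightarrow> cderiv v (\<lambda>z. contour_integral (circlepath w R) (f z)) z
      = contour_integral (circlepath w R) (\<lambda>\<zeta>. cderiv v (\<lambda>z. f z \<zeta>) z)"
proof -
  have der: "((\<lambda>\<eta>. contour_integral (circlepath w R) (f (z + sc \<eta> v))) has_field_derivative
     contour_integral (circlepath w R) (\<lambda>\<zeta>. deriv (\<lambda>\<eta>. f (z + sc \<eta> v) \<zeta>) \<eta>)) (at \<eta>)"
    if "z + sc \<eta> v \<in> S" for z v \<eta>
  proof (rule has_field_derivative_contour_integral_circlepath[of "{\<eta>. z + sc \<eta> v \<in> S}"])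
    have "continuous_on ({\<eta>. z + sc \<eta> v \<in> S} \<times> sphere w R)
        (\<lambda>x. (\<lambda>(z, \<zeta>). f z \<zeta>) (z + sc (fst x) v, snd x))"
      by (rule continuous_on_compose2[OF cont]) (auto intro!: continuous_intros)
    then show "continuous_on ({\<eta>. z + sc \<eta> v \<in> S} \<times> sphere w R) (\<lambda>(\<eta>, \<zeta>). f (z + sc \<eta> v) \<zeta>)"
      by (simp add: split_beta)
    show "(\<lambda>\<eta>. f (z + sc \<eta> v) \<zeta>) holomorphic_on {\<eta>. z + sc \<eta> v \<in> S}" if "\<zeta> \<in> sphere w R" for \<zeta>
      using hol[OF that] by (rule ghol_line)
  qed (use that R open_line[OF S] in auto)
  show "ghol (\<lambda>z. contour_integral (circlepath w R) (f z)) S"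
    unfolding ghol_def
  proof (intro conjI allI)
    show "continuous_on S (\<lambda>z. contour_integral (circlepath w R) (f z))"
      by (rule continuous_on_contour_integral_circlepath[OF cont R])
    show "(\<lambda>\<eta>. contour_integral (circlepath w R) (f (z + sc \<eta> v))) holomorphic_on {\<eta>. z + sc \<eta> v \<in> S}" for z v
      using der by (auto simp: holomorphic_on_open open_line[OF S])
  qed
  show "cderiv v (\<lambda>z. contour_integral (circlepath w R) (f z)) z
      = contour_integral (circlepath w R) (\<lambda>\<zeta>. cderiv v (\<lambda>z. f z \<zeta>) z)" if "z \<in> S" for z v
    unfolding cderiv_def by (rule DERIV_imp_deriv[OF der[of z 0 v, simplified, OF that]])
qed

text \<open>Near a given point one radius serves all base points, so there the derivative is a
  contour integral of translates of \<open>F\<close> over a fixed circle, and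
  \<open>ghol_contour_integral\<close> applies. Continuity and holomorphy on lines are local, hence
  the local statement suffices.\<close>

lemma ghol_cderiv:
  assumes S: "open S" and F: "ghol F S"
  shows "ghol (cderiv v F) S"
proof -
  have contF: "continuous_on S F" using F by (auto simp: ghol_def)
  have loc: "\<exists>\<delta>>0. ball z0 \<delta> \<subseteq> S \<and> ghol (cderiv v F) (ball z0 \<delta>)" if z0: "z0 \<in> S" for z0
  proof -
    obtain \<delta> R where \<delta>: "\<delta> > 0" "R > 0"
      and in_S: "\<And>z \<zeta>. z \<in> ball z0 \<delta> \<Longrightarrow> \<zeta> \<in> cball 0 R \<Longrightarrow> z + sc \<zeta> v \<in> S"
      using line_in_ball[OF S z0] by metis
    have "ghol (\<lambda>z. contour_integral (circlepath 0 R) (\<lambda>\<zeta>. F (z + sc \<zeta> v) / \<zeta>\<^sup>2)) (ball z0 \<delta>)"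
    proof (rule ghol_contour_integral)
      have "continuous_on (ball z0 \<delta> \<times> sphere 0 R) (\<lambda>x. F (fst x + sc (snd x) v))"
        by (rule continuous_on_compose2[OF contF]) (use in_S in \<open>auto intro!: continuous_intros\<close>)
      then show "continuous_on (ball z0 \<delta> \<times> sphere 0 R) (\<lambda>(z, \<zeta>). F (z + sc \<zeta> v) / \<zeta>\<^sup>2)"
        unfolding split_beta by (intro continuous_intros) (use \<delta> in auto)
      show "ghol (\<lambda>z. F (z + sc \<zeta> v) / \<zeta>\<^sup>2) (ball z0 \<delta>)" if \<zeta>: "\<zeta> \<in> sphere 0 R" for \<zeta>
        unfolding ghol_def
      proof (intro conjI allI)
        have "continuous_on (ball z0 \<delta>) (\<lambda>z. F (z + sc \<zeta> v))"
          by (rule continuous_on_compose2[OF contF]) (use in_S \<zeta> in \<open>auto intro!: continuous_intros\<close>)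
        then show "continuous_on (ball z0 \<delta>) (\<lambda>z. F (z + sc \<zeta> v) / \<zeta>\<^sup>2)"
          by (intro continuous_intros) (use \<delta> \<zeta> in auto)
        have "(\<lambda>\<eta>. F (z + sc \<zeta> v + sc \<eta> u)) holomorphic_on {\<eta>. z + sc \<eta> u \<in> ball z0 \<delta>}" for z u
        proof (rule holomorphic_on_subset[OF ghol_line[OF F]], safe)
          fix \<eta> assume "z + sc \<eta> u \<in> ball z0 \<delta>"
          from in_S[OF this, of \<zeta>] \<zeta> show "z + sc \<zeta> v + sc \<eta> u \<in> S" by (simp add: algebra_simps)
        qed
        then show "(\<lambda>\<eta>. F (z + sc \<eta> u + sc \<zeta> v) / \<zeta>\<^sup>2) holomorphic_on {\<eta>. z + sc \<eta> u \<in> ball z0 \<delta>}" for z u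
          by (intro holomorphic_intros) (use \<delta> \<zeta> in \<open>auto simp: algebra_simps\<close>)
      qed
    qed (use \<delta> in auto)
    then have "ghol (\<lambda>z. contour_integral (circlepath 0 R) (\<lambda>\<zeta>. F (z + sc \<zeta> v) / \<zeta>\<^sup>2) * (1 / (2 * pi * \<i>))) (ball z0 \<delta>)"
      by (intro ghol_mult ghol_const)
    then have "ghol (cderiv v F) (ball z0 \<delta>)"
      by (rule ghol_cong) (use cderiv_contour_integral[OF F \<delta>(2) in_S] in auto)
    moreover have "ball z0 \<delta> \<subseteq> S" using in_S[of _ 0] \<delta> by auto
    ultimately show ?thesis using \<delta> by blast
  qed
  show ?thesis
    unfolding ghol_def
  proof (intro conjI allI)
    show "continuous_on S (cderiv v F)"
      unfolding continuous_on_eq_continuous_at[OF S]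
    proof
      fix z0 assume "z0 \<in> S"
      from loc[OF this] show "isCont (cderiv v F) z0"
        by (auto simp: ghol_def continuous_on_eq_continuous_at[OF open_ball])
    qed
    show "(\<lambda>\<zeta>. cderiv v F (z + sc \<zeta> u)) holomorphic_on {\<zeta>. z + sc \<zeta> u \<in> S}" for z u
      unfolding holomorphic_on_open[OF open_line[OF S]]
    proof safe
      fix \<eta> assume "z + sc \<eta> u \<in> S"
      from loc[OF this] obtain \<delta> where \<delta>: "\<delta> > 0" "ghol (cderiv v F) (ball (z + sc \<eta> u) \<delta>)" by blast
      then have "\<eta> \<in> {\<zeta>. z + sc \<zeta> u \<in> ball (z + sc \<eta> u) \<delta>}" by simp
      with ghol_line[OF \<delta>(2), of z u]
      show "\<exists>f'. ((\<lambda>\<zeta>. cderiv v F (z + sc \<zeta> u)) has_field_derivative f') (at \<eta>)"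
        unfolding holomorphic_on_open[OF open_line[OF open_ball]] by blast
    qed
  qed
qed

lemma cderiv_scale:
  assumes "open S" "ghol F S" "z \<in> S"
  shows "cderiv (sc c v) F z = c * cderiv v F z"
proof -
  have "((\<lambda>\<zeta>. F (z + sc \<zeta> v)) has_field_derivative cderiv v F z) (at (0 * c))"
    using cderiv_line[OF assms(1,2), of z 0 v] assms(3) by simp
  then have "((\<lambda>\<zeta>. F (z + sc (\<zeta> * c) v)) has_field_derivative cderiv v F z * c) (at 0)"
    by (rule DERIV_chain2) (auto intro!: derivative_eq_intros)
  then show ?thesis
    unfolding cderiv_def[of "sc c v"] by (simp add: sc_sc DERIV_imp_deriv mult.commute)
qed

text \<open>A second-order Taylor estimate uniform in base point and direction. The slice through
  \<open>z\<close> in direction \<open>w\<close> is holomorphic and bounded on a disc whose radius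
  \<open>R\<close> is inversely proportional to the length of \<open>w\<close>; Cauchy's inequality
  then makes its second derivative on the unit disc quadratic in that length.\<close>

lemma remainder_bound:
  assumes "open S" "ghol F S" "z0 \<in> S"
  obtains \<delta> C where "\<delta> > 0" "C \<ge> 0"
    "\<And>z w. z \<in> ball z0 \<delta> \<Longrightarrow> norm w < \<delta> \<Longrightarrow> z + w \<in> S \<and>
       cmod (F (z + w) - F z - cderiv w F z) \<le> C * (norm w)\<^sup>2"
proof -
  obtain K where K: "K > 0" "\<And>\<zeta> v. norm (sc \<zeta> v) \<le> K * cmod \<zeta> * norm v" using sc_bound by blast
  obtain e where e: "e > 0" "cball z0 e \<subseteq> S" using assms open_contains_cball by blast
  have "compact (F ` cball z0 e)"
    using assms e by (intro compact_continuous_image) (auto simp: ghol_def intro: continuous_on_subset)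
  then obtain M where M: "M > 0" "\<And>z. z \<in> cball z0 e \<Longrightarrow> cmod (F z) \<le> M"
    by (auto dest!: compact_imp_bounded simp: bounded_pos)
  \<comment> \<open>The bound e/2 leaves room e/2 for the line; the bound e/(4K) forces R \<ge> 2,
    so that discs of radius R - 1 \<ge> R/2 about points of the unit disc still lie in the disc of
    radius R.\<close>
  define \<delta> where "\<delta> = min (e/2) (e / (4 * K))"
  have \<delta>: "\<delta> > 0" using e K by (auto simp: \<delta>_def)
  have *: "z + w \<in> S \<and> cmod (F (z + w) - F z - cderiv w F z) \<le> (32 * M * K\<^sup>2 / e\<^sup>2) * (norm w)\<^sup>2"
    if z: "z \<in> ball z0 \<delta>" and w: "norm w < \<delta>" for z w
  proof (cases "w = 0")
    case True
    have "cderiv 0 F z = 0"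
      using linear_0[OF linear_sc] by (simp add: cderiv_def)
    then show ?thesis using True z e M by (auto simp: \<delta>_def subset_iff)
  next
    case False
    define R where "R = e / (2 * K * norm w)"
    have R: "R \<ge> 2"
    proof -
      have "norm w * (4 * K) \<le> e" using w K by (simp add: \<delta>_def field_simps)
      then show ?thesis using False K by (simp add: R_def field_simps)
    qed
    have in_e: "z + sc \<zeta> w \<in> cball z0 e" if "\<zeta> \<in> cball 0 R" for \<zeta>
    proof -
      have "norm (sc \<zeta> w) \<le> K * R * norm w"
        using K(2)[of \<zeta> w] that K(1) by (smt (verit) mem_cball_0 mult_left_mono mult_right_mono norm_ge_zero)
      also have "\<dots> = e/2" using False K by (simp add: R_def)
      finally have "norm (sc \<zeta> w) \<le> e/2" .
      moreover have "norm (z0 - z) < e/2" using z by (auto simp: \<delta>_def dist_norm)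
      ultimately show ?thesis
        using norm_triangle_ineq4[of "z0 - z" "sc \<zeta> w"] by (simp add: dist_norm algebra_simps)
    qed
    define \<phi> where "\<phi> = (\<lambda>\<zeta>. F (z + sc \<zeta> w))"
    have hol: "\<phi> holomorphic_on cball 0 R"
      unfolding \<phi>_def by (rule holomorphic_on_subset[OF ghol_line[OF assms(2)]]) (use in_e e in auto)
    have hol': "(deriv ^^ i) \<phi> holomorphic_on ball 0 R" for i
      by (rule holomorphic_higher_deriv[OF holomorphic_on_subset[OF hol]]) auto
    have "cmod ((deriv ^^ 0) \<phi> 1 - (\<Sum>i\<le>1. (deriv ^^ i) \<phi> 0 * (1 - 0) ^ i / fact i))
        \<le> (8 * M / R\<^sup>2) * cmod (1 - 0) ^ Suc 1 / fact 1"
    proof (rule complex_Taylor[where S="cball 0 1"])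
      fix i x assume x: "x \<in> cball (0::complex) 1"
      then have "((deriv ^^ i) \<phi> has_field_derivative deriv ((deriv ^^ i) \<phi>) x) (at x)"
        using R by (intro holomorphic_derivI[OF hol']) auto
      then show "((deriv ^^ i) \<phi> has_field_derivative (deriv ^^ Suc i) \<phi> x) (at x within cball 0 1)"
        by (simp add: has_field_derivative_at_within)
    next
      fix x assume x: "x \<in> cball (0::complex) 1"
      have sub: "cball x (R - 1) \<subseteq> cball 0 R"
      proof
        fix y assume "y \<in> cball x (R - 1)"
        then show "y \<in> cball 0 R"
          using x norm_triangle_ineq4[of x "x - y"] by (simp add: dist_norm)
      qed
      have "cmod ((deriv ^^ 2) \<phi> x) \<le> fact 2 * M / (R - 1)\<^sup>2"
      proof (rule Cauchy_inequality)
        show "\<phi> holomorphic_on ball x (R - 1)"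
          using hol by (rule holomorphic_on_subset) (use sub ball_subset_cball in blast)
        show "continuous_on (cball x (R - 1)) \<phi>"
          using holomorphic_on_imp_continuous_on[OF hol] sub by (rule continuous_on_subset)
        fix y assume "cmod (x - y) = R - 1"
        then have "y \<in> cball x (R - 1)" by (simp add: dist_norm)
        then have "y \<in> cball 0 R" using sub by blast
        then show "cmod (\<phi> y) \<le> M" unfolding \<phi>_def by (intro M in_e)
      qed (use R in auto)
      also have "\<dots> \<le> fact 2 * M / (R / 2)\<^sup>2"
        using R M by (intro divide_left_mono power_mono mult_pos_pos) auto
      finally show "cmod ((deriv ^^ Suc 1) \<phi> x) \<le> 8 * M / R\<^sup>2"
        by (simp add: power2_eq_square field_simps numeral_2_eq_2)
    qed auto
    also have "8 * M / R\<^sup>2 * cmod (1 - 0) ^ Suc 1 / fact 1 = (32 * M * K\<^sup>2 / e\<^sup>2) * (norm w)\<^sup>2"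
      using e by (simp add: R_def field_simps power2_eq_square)
    finally have "cmod (F (z + w) - F z - cderiv w F z) \<le> (32 * M * K\<^sup>2 / e\<^sup>2) * (norm w)\<^sup>2"
      by (simp add: \<phi>_def cderiv_def diff_diff_eq)
    moreover have "z + w \<in> S" using in_e[of 1] R e by auto
    ultimately show ?thesis by simp
  qed
  show ?thesis by (rule that[OF \<delta> _ *]) (use M in auto)
qed

text \<open>Going from \<open>z0\<close> to \<open>z0 + t(u + v)\<close> directly or through
  \<open>z0 + tu\<close> gives the same increment of \<open>F\<close>. By
  \<open>remainder_bound\<close> the three first-order terms therefore agree up to order t squared;
  division by \<open>t\<close> and continuity of \<open>cderiv v F\<close> give additivity in the
  limit.\<close>

lemma cderiv_add:
  assumes S: "open S" and F: "ghol F S" and z0: "z0 \<in> S"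
  shows "cderiv (u + v) F z0 = cderiv u F z0 + cderiv v F z0"
proof -
  obtain \<delta> C where \<delta>: "\<delta> > 0" "C \<ge> 0"
    and rem: "\<And>z w. z \<in> ball z0 \<delta> \<Longrightarrow> norm w < \<delta> \<Longrightarrow> z + w \<in> S \<and>
       cmod (F (z + w) - F z - cderiv w F z) \<le> C * (norm w)\<^sup>2"
    using remainder_bound[OF assms] by metis
  define D where "D = (C * (norm (u + v))\<^sup>2 + C * (norm u)\<^sup>2 + C * (norm v)\<^sup>2)"
  define N where "N = norm u + norm v + 1"
  have N: "N > 0" by (auto simp: N_def add_nonneg_pos)
  have main: "cmod (cderiv (u + v) F z0 - cderiv u F z0 - cderiv v F (z0 + t *\<^sub>R u)) \<le> t * D"
    if t: "0 < t" "t < \<delta> / N" for t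
  proof -
    have small: "norm (t *\<^sub>R w) < \<delta>" if "norm w \<le> norm u + norm v" for w
    proof -
      have "t * norm w \<le> t * (norm u + norm v)" using that t by (intro mult_left_mono) auto
      also have "\<dots> < t * N" using t by (simp add: N_def)
      also have "\<dots> < \<delta>" using t N by (simp add: field_simps)
      finally show ?thesis using t by simp
    qed
    have ud: "norm (t *\<^sub>R u) < \<delta>" by (rule small) simp
    have z1: "z0 + t *\<^sub>R u \<in> ball z0 \<delta>" using ud by (simp add: dist_norm)
    have z1S: "z0 + t *\<^sub>R u \<in> S" using rem[of z0 "t *\<^sub>R u"] \<delta> ud by simp
    have scale: "cderiv (t *\<^sub>R w) F z = of_real t * cderiv w F z" if "z \<in> S" for w z
      using cderiv_scale[OF S F that, of "of_real t" w] by (simp add: sc_of_real)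
    have 1: "cmod (F (z0 + t *\<^sub>R (u + v)) - F z0 - of_real t * cderiv (u + v) F z0) \<le> C * (t\<^sup>2 * (norm (u + v))\<^sup>2)"
      using rem[of z0 "t *\<^sub>R (u + v)"] small[of "u + v"] \<delta> scale[OF z0] norm_triangle_ineq[of u v]
      by (simp add: power_mult_distrib del: scaleR_add_right)
    have 2: "cmod (F (z0 + t *\<^sub>R u) - F z0 - of_real t * cderiv u F z0) \<le> C * (t\<^sup>2 * (norm u)\<^sup>2)"
      using rem[of z0 "t *\<^sub>R u"] ud \<delta> scale[OF z0] by (simp add: power_mult_distrib)
    have 3: "cmod (F (z0 + t *\<^sub>R (u + v)) - F (z0 + t *\<^sub>R u) - of_real t * cderiv v F (z0 + t *\<^sub>R u))
        \<le> C * (t\<^sup>2 * (norm v)\<^sup>2)"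
      using rem[OF z1, of "t *\<^sub>R v"] small[of v] scale[OF z1S]
      by (simp add: power_mult_distrib scaleR_add_right add.assoc)
    have "t * cmod (cderiv (u + v) F z0 - cderiv u F z0 - cderiv v F (z0 + t *\<^sub>R u)) =
       cmod (of_real t * (cderiv (u + v) F z0 - cderiv u F z0 - cderiv v F (z0 + t *\<^sub>R u)))"
      using t by (simp add: norm_mult)
    also have "\<dots> = cmod (
       (F (z0 + t *\<^sub>R u) - F z0 - of_real t * cderiv u F z0)
       + (F (z0 + t *\<^sub>R (u + v)) - F (z0 + t *\<^sub>R u) - of_real t * cderiv v F (z0 + t *\<^sub>R u))
       - (F (z0 + t *\<^sub>R (u + v)) - F z0 - of_real t * cderiv (u + v) F z0))"
      by (simp add: algebra_simps)
    also have "\<dots> \<le> C * (t\<^sup>2 * (norm u)\<^sup>2) + C * (t\<^sup>2 * (norm v)\<^sup>2) + C * (t\<^sup>2 * (norm (u + v))\<^sup>2)"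
      by (intro order.trans[OF norm_triangle_ineq4] add_mono order.trans[OF norm_triangle_ineq] 1 2 3)
    also have "\<dots> = t * (t * D)" by (simp add: D_def algebra_simps power2_eq_square)
    finally show ?thesis using t by simp
  qed
  have "((\<lambda>t. cmod (cderiv (u + v) F z0 - cderiv u F z0 - cderiv v F (z0 + t *\<^sub>R u)))
      \<longlongrightarrow> cmod (cderiv (u + v) F z0 - cderiv u F z0 - cderiv v F (z0 + 0 *\<^sub>R u))) (at_right 0)"
  proof -
    have "isCont (cderiv v F) z0"
      using ghol_cderiv[OF S F] z0 by (auto simp: ghol_def continuous_on_eq_continuous_at[OF S])
    then have "isCont (cderiv v F) (z0 + 0 *\<^sub>R u)" by simp
    then have "isCont (\<lambda>t. cderiv v F (z0 + t *\<^sub>R u)) 0"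
      by (rule isCont_o2[rotated]) (auto intro!: continuous_intros)
    then have "((\<lambda>t. cderiv v F (z0 + t *\<^sub>R u)) \<longlongrightarrow> cderiv v F (z0 + 0 *\<^sub>R u)) (at_right 0)"
      unfolding isCont_def by (rule filterlim_mono[OF _ order_refl]) (simp add: at_le)
    then show ?thesis by (intro tendsto_intros)
  qed
  moreover have "((\<lambda>t. t * D) \<longlongrightarrow> 0 * D) (at_right 0)" by (intro tendsto_intros)
  moreover have "\<forall>\<^sub>F t in at_right 0. cmod (cderiv (u + v) F z0 - cderiv u F z0 - cderiv v F (z0 + t *\<^sub>R u)) \<le> t * D"
    unfolding eventually_at_right_field using main \<delta> N by (intro exI[of _ "\<delta> / N"]) auto
  ultimately have "cmod (cderiv (u + v) F z0 - cderiv u F z0 - cderiv v F (z0 + 0 *\<^sub>R u)) \<le> 0 * D"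
    by (intro tendsto_le[OF _ _ _ , rotated -1]) auto
  then show ?thesis by (simp add: algebra_simps)
qed

lemma ghol_has_derivative:
  assumes S: "open S" and F: "ghol F S" and z: "z \<in> S"
  shows "(F has_derivative (\<lambda>v. cderiv v F z)) (at z)"
proof -
  obtain \<delta> C where \<delta>: "\<delta> > 0" "C \<ge> 0"
    and rem: "\<And>y w. y \<in> ball z \<delta> \<Longrightarrow> norm w < \<delta> \<Longrightarrow> y + w \<in> S \<and>
       cmod (F (y + w) - F y - cderiv w F y) \<le> C * (norm w)\<^sup>2"
    using remainder_bound[OF assms] by metis
  have "linear (\<lambda>v. cderiv v F z)"
    using cderiv_scale[OF assms, of "of_real s" for s]
    by (intro linearI) (simp_all add: cderiv_add[OF assms] sc_of_real scaleR_conv_of_real)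
  then have bl: "bounded_linear (\<lambda>v. cderiv v F z)" by (simp add: linear_conv_bounded_linear)
  show ?thesis
    unfolding has_derivative_at_within
  proof (intro conjI bl)
    have "((\<lambda>y. C * norm (y - z)) \<longlongrightarrow> C * norm (z - z)) (at z)" by (intro tendsto_intros)
    then have lim: "((\<lambda>y. C * norm (y - z)) \<longlongrightarrow> 0) (at z)" by simp
    have *: "norm ((F y - F z - cderiv (y - z) F z) /\<^sub>R norm (y - z)) \<le> C * norm (y - z)"
      if y: "y \<noteq> z \<and> dist y z < \<delta>" for y
    proof -
      have "cmod (F (z + (y - z)) - F z - cderiv (y - z) F z) \<le> C * (norm (y - z))\<^sup>2"
        using rem[of z "y - z"] y \<delta> by (simp add: dist_norm)
      then show "norm ((F y - F z - cderiv (y - z) F z) /\<^sub>R norm (y - z)) \<le> C * norm (y - z)"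
        using y unfolding norm_scaleR by (simp add: divide_simps power2_eq_square)
    qed
    have "\<forall>\<^sub>F y in at z. norm ((F y - F z - cderiv (y - z) F z) /\<^sub>R norm (y - z)) \<le> C * norm (y - z)"
      unfolding eventually_at using * \<delta>(1) by blast
    then show "((\<lambda>y. (F y - F z - cderiv (y - z) F z) /\<^sub>R norm (y - z)) \<longlongrightarrow> 0) (at z)"
      by (rule Lim_null_comparison[OF _ lim])
  qed
qed

lemma ghol_if_has_derivative:
  assumes S: "open S"
    and der: "\<And>z. z \<in> S \<Longrightarrow> \<exists>D. (F has_derivative D) (at z) \<and> (\<forall>c v. D (sc c v) = c * D v)"
  shows "ghol F S"
  unfolding ghol_def
proof (intro conjI allI)
  show "continuous_on S F"
    using der by (metis continuous_at_imp_continuous_on has_derivative_continuous)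
  fix z v
  show "(\<lambda>\<zeta>. F (z + sc \<zeta> v)) holomorphic_on {\<zeta>. z + sc \<zeta> v \<in> S}"
    unfolding holomorphic_on_open[OF open_line[OF S]]
  proof safe
    fix \<eta> assume "z + sc \<eta> v \<in> S"
    then obtain D where D: "(F has_derivative D) (at (z + sc \<eta> v))" "\<And>c v. D (sc c v) = c * D v"
      using der by blast
    have "bounded_linear (\<lambda>\<zeta>. sc \<zeta> v)"
      by (subst sc_expand) (intro bounded_linear_add bounded_linear_compose[OF bounded_linear_scaleR_left]
          bounded_linear_Re bounded_linear_Im)
    then have "((\<lambda>\<zeta>. z + sc \<zeta> v) has_derivative (\<lambda>\<zeta>. sc \<zeta> v)) (at \<eta>)"
      by (auto intro!: derivative_eq_intros bounded_linear_imp_has_derivative)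
    from has_derivative_compose[OF this D(1)]
    have "((\<lambda>\<zeta>. F (z + sc \<zeta> v)) has_derivative (\<lambda>\<zeta>. D v * \<zeta>)) (at \<eta>)"
      by (simp add: D(2) mult.commute)
    then show "\<exists>f'. ((\<lambda>\<zeta>. F (z + sc \<zeta> v)) has_field_derivative f') (at \<eta>)"
      by (auto simp: has_field_derivative_def)
  qed
qed

end

section \<open>Mean values and the symmetry of second derivatives\<close>

lemmas has_frechet_derivative = frechet_derivative_works[THEN iffD1]

lemma mvt_line:
  fixes f :: "'v::real_normed_vector \<Rightarrow> real"
  assumes "h > 0" and "\<And>s. 0 \<le> s \<Longrightarrow> s \<le> h \<Longrightarrow> f differentiable at (x + s *\<^sub>R u)"
  shows "\<exists>\<xi>. 0 < \<xi> \<and> \<xi> < h \<and> f (x + h *\<^sub>R u) - f x = h * frechet_derivative f (at (x + \<xi> *\<^sub>R u)) u"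
proof -
  have der: "((\<lambda>s. f (x + s *\<^sub>R u)) has_derivative (\<lambda>t. frechet_derivative f (at (x + s *\<^sub>R u)) (t *\<^sub>R u))) (at s)"
    if "0 \<le> s" "s \<le> h" for s
    by (rule has_derivative_compose[where f="\<lambda>s. x + s *\<^sub>R u" and g=f])
      (auto intro!: derivative_eq_intros has_frechet_derivative assms(2) that)
  then have "continuous_on {0..h} (\<lambda>s. f (x + s *\<^sub>R u))"
    by (intro has_derivative_continuous_on[OF has_derivative_at_withinI]) auto
  from mvt[OF \<open>h > 0\<close> this, of "\<lambda>s t. frechet_derivative f (at (x + s *\<^sub>R u)) (t *\<^sub>R u)"] der
  obtain \<xi> where \<xi>: "0 < \<xi>" "\<xi> < h"
    "f (x + h *\<^sub>R u) - f (x + 0 *\<^sub>R u) = frechet_derivative f (at (x + \<xi> *\<^sub>R u)) ((h - 0) *\<^sub>R u)"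
    by auto
  have "linear (frechet_derivative f (at (x + \<xi> *\<^sub>R u)))"
    using \<xi> assms(2)[of \<xi>] by (intro linear_frechet_derivative) auto
  then show ?thesis using \<xi> by (intro exI[of _ \<xi>]) (auto simp: linear_cmul)
qed

text \<open>The mean value theorem twice: along \<open>u\<close> for the increment of
  \<open>f\<close> in direction \<open>v\<close>, then along \<open>v\<close> for the derivative of
  \<open>f\<close> in direction \<open>u\<close>.\<close>

lemma second_dir_deriv_quotient:
  fixes f :: "'v::real_normed_vector \<Rightarrow> real"
  assumes h: "h > 0" and f: "\<And>s t. 0 \<le> s \<Longrightarrow> s \<le> h \<Longrightarrow> 0 \<le> t \<Longrightarrow> t \<le> h \<Longrightarrow> f differentiable at (x + s *\<^sub>R u + t *\<^sub>R v)"
    and fu: "\<And>s t. 0 \<le> s \<Longrightarrow> s \<le> h \<Longrightarrow> 0 \<le> t \<Longrightarrow> t \<le> h \<Longrightarrow> dir_deriv_u differentiable at (x + s *\<^sub>R u + t *\<^sub>R v)"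
    and dir_deriv_u: "dir_deriv_u = (\<lambda>y. frechet_derivative f (at y) u)"
  shows "\<exists>\<xi> \<eta>. 0 < \<xi> \<and> \<xi> < h \<and> 0 < \<eta> \<and> \<eta> < h \<and>
    f (x + h *\<^sub>R u + h *\<^sub>R v) - f (x + h *\<^sub>R u) - f (x + h *\<^sub>R v) + f x
      = h * h * frechet_derivative dir_deriv_u (at (x + \<xi> *\<^sub>R u + \<eta> *\<^sub>R v)) v"
proof -
  define g where "g y = f (y + h *\<^sub>R v) - f y" for y
  have shift: "((\<lambda>y. f (y + h *\<^sub>R v)) has_derivative frechet_derivative f (at (y + h *\<^sub>R v))) (at y)"
    if "f differentiable at (y + h *\<^sub>R v)" for y
    by (rule has_derivative_compose[where f="\<lambda>y. y + h *\<^sub>R v" and g=f and f'="\<lambda>w. w"])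
      (auto intro!: derivative_eq_intros has_frechet_derivative that)
  have g: "(g has_derivative (\<lambda>w. frechet_derivative f (at (y + h *\<^sub>R v)) w - frechet_derivative f (at y) w)) (at y)"
    if "f differentiable at (y + h *\<^sub>R v)" "f differentiable at y" for y
    unfolding g_def by (intro has_derivative_diff shift has_frechet_derivative that)
  have gd: "(g has_derivative (\<lambda>w. frechet_derivative f (at (x + s *\<^sub>R u + h *\<^sub>R v)) w - frechet_derivative f (at (x + s *\<^sub>R u)) w)) (at (x + s *\<^sub>R u))"
    if "0 \<le> s" "s \<le> h" for s
    using g[of "x + s *\<^sub>R u"] f[of s h] f[of s 0] that h by simp
  have "\<exists>\<xi>. 0 < \<xi> \<and> \<xi> < h \<and> g (x + h *\<^sub>R u) - g x = h * frechet_derivative g (at (x + \<xi> *\<^sub>R u)) u"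
    by (rule mvt_line[OF h]) (rule differentiableI, rule gd)
  then obtain \<xi> where \<xi>: "0 < \<xi>" "\<xi> < h"
    "g (x + h *\<^sub>R u) - g x = h * frechet_derivative g (at (x + \<xi> *\<^sub>R u)) u" by blast
  have "frechet_derivative g (at (x + \<xi> *\<^sub>R u)) u = dir_deriv_u (x + \<xi> *\<^sub>R u + h *\<^sub>R v) - dir_deriv_u (x + \<xi> *\<^sub>R u)"
    using frechet_derivative_at[OF gd[of \<xi>], symmetric] \<xi> by (simp add: dir_deriv_u)
  moreover obtain \<eta> where "0 < \<eta>" "\<eta> < h"
    "dir_deriv_u (x + \<xi> *\<^sub>R u + h *\<^sub>R v) - dir_deriv_u (x + \<xi> *\<^sub>R u)
      = h * frechet_derivative dir_deriv_u (at (x + \<xi> *\<^sub>R u + \<eta> *\<^sub>R v)) v"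
    using mvt_line[OF h, of dir_deriv_u "x + \<xi> *\<^sub>R u" v] fu[of \<xi>] \<xi> by auto
  ultimately show ?thesis
    using \<xi> by (intro exI[of _ \<xi>] exI[of _ \<eta>]) (auto simp: g_def algebra_simps)
qed

text \<open>The second difference is symmetric in \<open>u\<close> and \<open>v\<close> and equals
  both mixed derivatives at points arbitrarily close to \<open>x\<close>; continuity identifies them
  at \<open>x\<close>. This serves twice: as ddA = 0, and to exchange the second derivatives of
  coordinate changes.\<close>

lemma second_dir_deriv_symmetric:
  fixes f :: "'v::real_normed_vector \<Rightarrow> real"
  assumes S: "open S" "x \<in> S"
    and f: "\<And>y. y \<in> S \<Longrightarrow> f differentiable at y"
    and fu: "\<And>y w. y \<in> S \<Longrightarrow> (\<lambda>y. frechet_derivative f (at y) w) differentiable at y"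
    and cont: "\<And>w w'. continuous_on S (\<lambda>y. frechet_derivative (\<lambda>y. frechet_derivative f (at y) w) (at y) w')"
  shows "frechet_derivative (\<lambda>y. frechet_derivative f (at y) u) (at x) v
    = frechet_derivative (\<lambda>y. frechet_derivative f (at y) v) (at x) u"
proof -
  let ?D = "\<lambda>w w' y. frechet_derivative (\<lambda>y. frechet_derivative f (at y) w) (at y) w'"
  obtain r where r: "r > 0" "ball x r \<subseteq> S" using S open_contains_ball by blast
  have close: "\<exists>d>0. \<forall>y\<in>S. dist y x < d \<longrightarrow> dist (?D w w' y) (?D w w' x) < e" if "e > 0" for e w w'
    using cont[of w w'] S that unfolding continuous_on_iff by blast
  have main: "\<bar>?D u v x - ?D v u x\<bar> \<le> 2 * e" if e: "e > 0" for e
  proof -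
    obtain d1 where d1: "d1 > 0" "\<And>y. y \<in> S \<Longrightarrow> dist y x < d1 \<Longrightarrow> dist (?D u v y) (?D u v x) < e"
      using close[OF e, of u v] by blast
    obtain d2 where d2: "d2 > 0" "\<And>y. y \<in> S \<Longrightarrow> dist y x < d2 \<Longrightarrow> dist (?D v u y) (?D v u x) < e"
      using close[OF e, of v u] by blast
    define d where "d = min r (min d1 d2)"
    define h where "h = d / (2 * (norm u + norm v + 1))"
    have N: "norm u + norm v + 1 > 0" by (auto intro: add_nonneg_pos)
    have d: "d > 0" and h: "h > 0" using r d1 d2 N by (auto simp: d_def h_def)
    have near: "dist (x + s *\<^sub>R u + t *\<^sub>R v) x < d" if "0 \<le> s" "s \<le> h" "0 \<le> t" "t \<le> h" for s t
    proof -
      have "dist (x + s *\<^sub>R u + t *\<^sub>R v) x \<le> s * norm u + t * norm v"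
        using that norm_triangle_ineq[of "s *\<^sub>R u" "t *\<^sub>R v"] by (simp add: dist_norm)
      also have "\<dots> \<le> h * norm u + h * norm v" using that by (intro add_mono mult_right_mono) auto
      also have "\<dots> \<le> h * (norm u + norm v + 1)" using h by (simp add: algebra_simps)
      also have "\<dots> = d / 2" using N by (simp add: h_def field_simps)
      finally show ?thesis using d by simp
    qed
    then have near': "dist (x + t *\<^sub>R v + s *\<^sub>R u) x < d" if "0 \<le> s" "s \<le> h" "0 \<le> t" "t \<le> h" for s t
      using that by (simp add: algebra_simps)
    then have near'': "dist (x + s *\<^sub>R v + t *\<^sub>R u) x < d" if "0 \<le> s" "s \<le> h" "0 \<le> t" "t \<le> h" for s t
      using that by blast
    have inS: "y \<in> S" if "dist y x < d" for y using that r by (auto simp: d_def dist_commute)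
    have q: "\<exists>\<xi> \<eta>. 0 < \<xi> \<and> \<xi> < h \<and> 0 < \<eta> \<and> \<eta> < h \<and>
        f (x + h *\<^sub>R u + h *\<^sub>R v) - f (x + h *\<^sub>R u) - f (x + h *\<^sub>R v) + f x
        = h * h * ?D u v (x + \<xi> *\<^sub>R u + \<eta> *\<^sub>R v)"
      by (rule second_dir_deriv_quotient[OF h _ _ refl]; rule f fu, rule inS, rule near; assumption)
    obtain \<xi> \<eta> where 1: "0 < \<xi>" "\<xi> < h" "0 < \<eta>" "\<eta> < h"
      "f (x + h *\<^sub>R u + h *\<^sub>R v) - f (x + h *\<^sub>R u) - f (x + h *\<^sub>R v) + f x
        = h * h * ?D u v (x + \<xi> *\<^sub>R u + \<eta> *\<^sub>R v)"
      using q by blast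
    have q: "\<exists>\<xi> \<eta>. 0 < \<xi> \<and> \<xi> < h \<and> 0 < \<eta> \<and> \<eta> < h \<and>
        f (x + h *\<^sub>R v + h *\<^sub>R u) - f (x + h *\<^sub>R v) - f (x + h *\<^sub>R u) + f x
        = h * h * ?D v u (x + \<xi> *\<^sub>R v + \<eta> *\<^sub>R u)"
      by (rule second_dir_deriv_quotient[OF h _ _ refl]; rule f fu, rule inS, rule near''; assumption)
    obtain \<xi>' \<eta>' where 2: "0 < \<xi>'" "\<xi>' < h" "0 < \<eta>'" "\<eta>' < h"
      "f (x + h *\<^sub>R v + h *\<^sub>R u) - f (x + h *\<^sub>R v) - f (x + h *\<^sub>R u) + f x
        = h * h * ?D v u (x + \<xi>' *\<^sub>R v + \<eta>' *\<^sub>R u)"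
      using q by blast
    have "h * h * ?D u v (x + \<xi> *\<^sub>R u + \<eta> *\<^sub>R v) = h * h * ?D v u (x + \<xi>' *\<^sub>R v + \<eta>' *\<^sub>R u)"
      unfolding 1(5)[symmetric] 2(5)[symmetric] by (simp add: algebra_simps)
    then have eq: "?D u v (x + \<xi> *\<^sub>R u + \<eta> *\<^sub>R v) = ?D v u (x + \<xi>' *\<^sub>R v + \<eta>' *\<^sub>R u)"
      using h by simp
    have "dist (x + \<xi> *\<^sub>R u + \<eta> *\<^sub>R v) x < d" "dist (x + \<xi>' *\<^sub>R v + \<eta>' *\<^sub>R u) x < d"
      using near[of \<xi> \<eta>] near'[of \<eta>' \<xi>'] 1 2 by auto
    then have "dist (?D u v (x + \<xi> *\<^sub>R u + \<eta> *\<^sub>R v)) (?D u v x) < e"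
      "dist (?D v u (x + \<xi>' *\<^sub>R v + \<eta>' *\<^sub>R u)) (?D v u x) < e"
      using inS by (auto intro!: d1 d2 simp: d_def)
    then show ?thesis unfolding eq dist_real_def by linarith
  qed
  have "\<bar>?D u v x - ?D v u x\<bar> \<le> 0 + e" if "e > 0" for e
    using main[of "e/2"] that by simp
  then have "\<bar>?D u v x - ?D v u x\<bar> \<le> 0" by (rule field_le_epsilon)
  then show ?thesis by simp
qed

lemma (in complex_scaling) ghol_uniform_limit:
  assumes S: "open S" and f: "\<forall>\<^sub>F n in F. ghol (f n) S" and lim: "uniform_limit S f g F" and F: "F \<noteq> bot"
  shows "ghol g S"
  unfolding ghol_def
proof (intro conjI allI)
  show "continuous_on S g"
    by (rule uniform_limit_theorem[OF _ lim F]) (use f in \<open>auto simp: ghol_def elim: eventually_mono\<close>)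
  show "(\<lambda>\<zeta>. g (z + sc \<zeta> v)) holomorphic_on {\<zeta>. z + sc \<zeta> v \<in> S}" for z v
    unfolding holomorphic_on_open[OF open_line[OF S]]
  proof
    fix \<eta> assume "\<eta> \<in> {\<zeta>. z + sc \<zeta> v \<in> S}"
    then obtain \<rho> where \<rho>: "\<rho> > 0" "cball \<eta> \<rho> \<subseteq> {\<zeta>. z + sc \<zeta> v \<in> S}"
      using open_line[OF S, of z v] open_contains_cball by blast
    have "(\<lambda>\<zeta>. g (z + sc \<zeta> v)) holomorphic_on ball \<eta> \<rho>"
    proof (rule holomorphic_uniform_limit[OF _ _ F])
      show "\<forall>\<^sub>F n in F. continuous_on (cball \<eta> \<rho>) (\<lambda>\<zeta>. f n (z + sc \<zeta> v)) \<and> (\<lambda>\<zeta>. f n (z + sc \<zeta> v)) holomorphic_on ball \<eta> \<rho>"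
        using f
      proof eventually_elim
        case (elim n)
        from ghol_line[OF this, of z v] \<rho>
        have "(\<lambda>\<zeta>. f n (z + sc \<zeta> v)) holomorphic_on cball \<eta> \<rho>" using holomorphic_on_subset by blast
        then show ?case
          by (meson ball_subset_cball holomorphic_on_imp_continuous_on holomorphic_on_subset)
      qed
      show "uniform_limit (cball \<eta> \<rho>) (\<lambda>n \<zeta>. f n (z + sc \<zeta> v)) (\<lambda>\<zeta>. g (z + sc \<zeta> v)) F"
        unfolding uniform_limit_iff
      proof (intro allI impI)
        fix e :: real assume "e > 0"
        with lim have "\<forall>\<^sub>F n in F. \<forall>y\<in>S. dist (f n y) (g y) < e" by (auto simp: uniform_limit_iff)
        then show "\<forall>\<^sub>F n in F. \<forall>\<zeta>\<in>cball \<eta> \<rho>. dist (f n (z + sc \<zeta> v)) (g (z + sc \<zeta> v)) < e"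
          by (rule eventually_mono) (use \<rho> in blast)
      qed
    qed
    then show "\<exists>f'. ((\<lambda>\<zeta>. g (z + sc \<zeta> v)) has_field_derivative f') (at \<eta>)"
      using \<rho> by (auto simp: holomorphic_on_open)
  qed
qed

interpretation cspace: complex_scaling "scaleC :: complex \<Rightarrow> 'z::{complex_space, euclidean_space} \<Rightarrow> 'z"
  by unfold_locales (rule scaleC_add_right scaleC_add_left scaleC_scaleC scaleC_of_real)+

lemma holomorphic_map_on_iff_ghol:
  fixes F :: "'z::{complex_space, euclidean_space} \<Rightarrow> complex"
  assumes "open S"
  shows "holomorphic_map_on F S \<longleftrightarrow> cspace.ghol F S"
proof
  show "holomorphic_map_on F S \<Longrightarrow> cspace.ghol F S"
    by (intro cspace.ghol_if_has_derivative assms)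
      (auto simp: holomorphic_map_on_def complex_linear_def scaleC_complex_def)
  assume F: "cspace.ghol F S"
  show "holomorphic_map_on F S"
    unfolding holomorphic_map_on_def
  proof
    fix z assume z: "z \<in> S"
    have "(F has_derivative (\<lambda>v. cspace.cderiv v F z)) (at z)"
      by (rule cspace.ghol_has_derivative[OF assms F z])
    moreover from has_derivative_linear[OF this]
    have "complex_linear (\<lambda>v. cspace.cderiv v F z)"
      by (simp add: complex_linear_def scaleC_complex_def cspace.cderiv_scale[OF assms F z])
    ultimately show "\<exists>D. (F has_derivative D) (at z) \<and> complex_linear D" by blast
  qed
qed

text \<open>The complexification of the real space \<open>'v\<close>, with \<open>(x, y)\<close> in the role of \<open>x + \<i> y\<close>.\<close>

definition pair_scale :: "complex \<Rightarrow> 'v::real_vector \<times> 'v \<Rightarrow> 'v \<times> 'v" where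
  "pair_scale c p = (Re c *\<^sub>R fst p - Im c *\<^sub>R snd p, Re c *\<^sub>R snd p + Im c *\<^sub>R fst p)"

interpretation cpair: complex_scaling "pair_scale :: complex \<Rightarrow> 'v::euclidean_space \<times> 'v \<Rightarrow> 'v \<times> 'v"
  by unfold_locales (auto simp: pair_scale_def algebra_simps prod_eq_iff)

subsection \<open>Real-analytic functions as restrictions of holomorphic ones\<close>

definition ext_hol :: "('v::euclidean_space \<Rightarrow> complex) \<Rightarrow> 'v set \<Rightarrow> bool" where
  "ext_hol f S \<longleftrightarrow> (\<forall>x\<in>S. \<exists>r>0. \<exists>F. cpair.ghol F (ball (x, 0) r) \<and> (\<forall>y\<in>ball x r. F (y, 0) = f y))"

lemma ext_holI:
  assumes "\<And>x. x \<in> S \<Longrightarrow> \<exists>r>0. \<exists>F. cpair.ghol F (ball (x, 0) r) \<and> (\<forall>y\<in>ball x r. F (y, 0) = f y)"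
  shows "ext_hol f S"
  using assms by (auto simp: ext_hol_def)

lemma ext_holE:
  assumes "ext_hol f S" "x \<in> S" "open S"
  obtains r F where "r > 0" "cpair.ghol F (ball (x, 0) r)" "\<And>y. y \<in> ball x r \<Longrightarrow> F (y, 0) = f y" "ball x r \<subseteq> S"
proof -
  obtain r F where r: "r > 0" "cpair.ghol F (ball (x, 0) r)" "\<And>y. y \<in> ball x r \<Longrightarrow> F (y, 0) = f y"
    using assms unfolding ext_hol_def by blast
  obtain e where e: "e > 0" "ball x e \<subseteq> S" using assms open_contains_ball by blast
  show ?thesis
  proof (rule that[of "min r e" F])
    show "cpair.ghol F (ball (x, 0) (min r e))"
      by (rule cpair.ghol_subset[OF r(2)]) auto
  qed (use r e in auto)
qed

lemma ext_hol_subset: "ext_hol f S \<Longrightarrow> T \<subseteq> S \<Longrightarrow> ext_hol f T"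
  by (auto simp: ext_hol_def)

lemma ext_hol_cong: "ext_hol f S \<Longrightarrow> open S \<Longrightarrow> (\<And>x. x \<in> S \<Longrightarrow> f x = g x) \<Longrightarrow> ext_hol g S"
  by (rule ext_holI, erule (2) ext_holE) (metis subsetD)

lemma ext_hol_const: "ext_hol (\<lambda>_. c) S"
  by (rule ext_holI) (use cpair.ghol_const zero_less_one in blast)

lemma ext_hol_combine:
  fixes f g :: "'v::euclidean_space \<Rightarrow> complex"
  assumes S: "open S" and f: "ext_hol f S" "ext_hol g S"
    and op: "\<And>F G (T :: ('v \<times> 'v) set). cpair.ghol F T \<Longrightarrow> cpair.ghol G T \<Longrightarrow> cpair.ghol (\<lambda>z. op (F z) (G z)) T"
  shows "ext_hol (\<lambda>x. op (f x) (g x)) S"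
proof (rule ext_holI)
  fix x assume x: "x \<in> S"
  obtain r F where r: "r > 0" "cpair.ghol F (ball (x, 0) r)" "\<And>y. y \<in> ball x r \<Longrightarrow> F (y, 0) = f y"
    using ext_holE[OF f(1) x S] by metis
  obtain s G where s: "s > 0" "cpair.ghol G (ball (x, 0) s)" "\<And>y. y \<in> ball x s \<Longrightarrow> G (y, 0) = g y"
    using ext_holE[OF f(2) x S] by metis
  have "cpair.ghol (\<lambda>z. op (F z) (G z)) (ball (x, 0) (min r s))"
    by (intro op cpair.ghol_subset[OF r(2)] cpair.ghol_subset[OF s(2)]) auto
  then show "\<exists>r>0. \<exists>H. cpair.ghol H (ball (x, 0) r) \<and> (\<forall>y\<in>ball x r. H (y, 0) = op (f y) (g y))"
    using r s by (intro exI[of _ "min r s"] exI[of _ "\<lambda>z. op (F z) (G z)"]) auto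
qed

lemma ext_hol_add: "open S \<Longrightarrow> ext_hol f S \<Longrightarrow> ext_hol g S \<Longrightarrow> ext_hol (\<lambda>x. f x + g x) S"
  by (rule ext_hol_combine[where op="(+)"]) (auto intro: cpair.ghol_add)

lemma ext_hol_mult: "open S \<Longrightarrow> ext_hol f S \<Longrightarrow> ext_hol g S \<Longrightarrow> ext_hol (\<lambda>x. f x * g x) S"
  by (rule ext_hol_combine[where op="(*)"]) (auto intro: cpair.ghol_mult)

lemma ext_hol_minus: "open S \<Longrightarrow> ext_hol f S \<Longrightarrow> ext_hol (\<lambda>x. - f x) S"
  using ext_hol_mult[OF _ ext_hol_const[of "-1"]] by simp

lemma ext_hol_diff: "open S \<Longrightarrow> ext_hol f S \<Longrightarrow> ext_hol g S \<Longrightarrow> ext_hol (\<lambda>x. f x - g x) S"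
  using ext_hol_add[of S f "\<lambda>x. - g x"] ext_hol_minus by auto

lemma ext_hol_sum: "open S \<Longrightarrow> (\<And>i. i \<in> I \<Longrightarrow> ext_hol (f i) S) \<Longrightarrow> ext_hol (\<lambda>x. \<Sum>i\<in>I. f i x) S"
  by (induction I rule: infinite_finite_induct) (auto intro: ext_hol_const ext_hol_add)

lemma ext_hol_inverse:
  assumes S: "open S" and f: "ext_hol f S" and nz: "\<And>x. x \<in> S \<Longrightarrow> f x \<noteq> 0"
  shows "ext_hol (\<lambda>x. inverse (f x)) S"
proof (rule ext_holI)
  fix x assume x: "x \<in> S"
  obtain r F where r: "r > 0" "cpair.ghol F (ball (x, 0) r)" "\<And>y. y \<in> ball x r \<Longrightarrow> F (y, 0) = f y" "ball x r \<subseteq> S"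
    using ext_holE[OF f x S] by metis
  have "continuous_on (ball (x, 0) r) F" using r(2) by (auto simp: cpair.ghol_def)
  moreover have "F (x, 0) \<noteq> 0" using nz[OF x] r by simp
  ultimately have "\<exists>d>0. \<forall>y\<in>ball (x, 0) r. dist (x, 0) y < d \<longrightarrow> F y \<noteq> 0"
    using continuous_on_avoid[of "ball (x, 0) r" F "(x, 0)" 0] r(1) by simp
  then obtain d where d: "d > 0" "\<And>y. y \<in> ball (x, 0) r \<Longrightarrow> dist (x, 0) y < d \<Longrightarrow> F y \<noteq> 0" by blast
  have "cpair.ghol (\<lambda>z. inverse (F z)) (ball (x, 0) (min r d))"
    by (intro cpair.ghol_inverse cpair.ghol_subset[OF r(2)]) (use d in auto)
  then show "\<exists>r>0. \<exists>H. cpair.ghol H (ball (x, 0) r) \<and> (\<forall>y\<in>ball x r. H (y, 0) = inverse (f y))"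
    using r d by (intro exI[of _ "min r d"] exI[of _ "\<lambda>z. inverse (F z)"]) auto
qed

lemma ghol_has_derivative_real:
  assumes F: "cpair.ghol F (ball (x, 0) r)" and eq: "\<And>y. y \<in> ball x r \<Longrightarrow> F (y, 0) = f y" and y: "y \<in> ball x r"
  shows "(f has_derivative (\<lambda>v. cpair.cderiv (v, 0) F (y, 0))) (at y)"
proof -
  have "(y, 0) \<in> ball (x, 0) r" using y by (simp add: dist_Pair_Pair)
  then have "(F has_derivative (\<lambda>v. cpair.cderiv v F (y, 0))) (at (y, 0))"
    by (intro cpair.ghol_has_derivative[OF _ F]) auto
  then have "((\<lambda>y. F (y, 0)) has_derivative (\<lambda>v. cpair.cderiv (v, 0) F (y, 0))) (at y)"
    by (rule has_derivative_compose[rotated]) (auto intro!: derivative_eq_intros)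
  then show ?thesis
    by (rule has_derivative_transform_within_open[of _ _ _ _ "ball x r"]) (use y eq in auto)
qed

lemma ext_hol_differentiable:
  assumes "open S" "ext_hol f S" "x \<in> S"
  shows "f differentiable at x"
proof -
  obtain r F where r: "r > 0" "cpair.ghol F (ball (x, 0) r)" "\<And>y. y \<in> ball x r \<Longrightarrow> F (y, 0) = f y"
    using ext_holE[OF assms(2,3,1)] by metis
  from ghol_has_derivative_real[OF r(2,3), of x] r(1) show ?thesis
    by (auto intro: differentiableI)
qed

text \<open>The complex derivative of the extension in the real direction \<open>(v, 0)\<close>
  extends the real derivative, and it is again holomorphic.\<close>

lemma ext_hol_frechet_derivative:
  assumes "open S" "ext_hol f S"
  shows "ext_hol (\<lambda>x. frechet_derivative f (at x) v) S"
proof (rule ext_holI)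
  fix x assume x: "x \<in> S"
  obtain r F where r: "r > 0" "cpair.ghol F (ball (x, 0) r)" "\<And>y. y \<in> ball x r \<Longrightarrow> F (y, 0) = f y"
    using ext_holE[OF assms(2) x assms(1)] by metis
  have "cpair.cderiv (v, 0) F (y, 0) = frechet_derivative f (at y) v" if "y \<in> ball x r" for y
    using frechet_derivative_at[OF ghol_has_derivative_real[OF r(2,3) that]] by metis
  then show "\<exists>r>0. \<exists>H. cpair.ghol H (ball (x, 0) r) \<and> (\<forall>y\<in>ball x r. H (y, 0) = frechet_derivative f (at y) v)"
    using cpair.ghol_cderiv[OF open_ball r(2)] r(1) by blast
qed

text \<open>The complex line through \<open>y0\<close> and \<open>y\<close> meets the ball in a
  convex, hence connected set. On it the extension vanishes along a real segment around the
  parameter 0, so it vanishes at the parameter 1, which is \<open>y\<close>.\<close>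

lemma ext_hol_identity:
  assumes f: "cpair.ghol F (ball (x, 0) r)" "\<And>y. y \<in> ball x r \<Longrightarrow> F (y, 0) = f y"
    and T: "open T" "y0 \<in> T" "y0 \<in> ball x r" "\<And>y. y \<in> T \<Longrightarrow> f y = 0"
    and y: "y \<in> ball x r"
  shows "f y = 0"
proof -
  let ?B = "ball (x, 0) r"
  let ?l = "\<lambda>\<zeta>. (y0, 0) + pair_scale \<zeta> (y - y0, 0)"
  have l_real: "?l (of_real t) = (y0 + t *\<^sub>R (y - y0), 0)" for t
    by (simp add: pair_scale_def)
  have "convex {\<zeta>. ?l \<zeta> \<in> ?B}"
  proof (rule convexI)
    fix a b and u v :: real
    assume ab: "a \<in> {\<zeta>. ?l \<zeta> \<in> ?B}" "b \<in> {\<zeta>. ?l \<zeta> \<in> ?B}" and uv: "0 \<le> u" "0 \<le> v" "u + v = 1"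
    have "?l (u *\<^sub>R a + v *\<^sub>R b) = u *\<^sub>R ?l a + v *\<^sub>R ?l b"
      using uv(3) by (simp add: pair_scale_def algebra_simps flip: scaleR_add_left)
    then show "u *\<^sub>R a + v *\<^sub>R b \<in> {\<zeta>. ?l \<zeta> \<in> ?B}"
      using convexD[OF convex_ball, of "?l a" "(x,0)" r "?l b"] ab uv by auto
  qed
  then have conn: "connected {\<zeta>. ?l \<zeta> \<in> ?B}" by (rule convex_connected)
  have "\<exists>e>0. \<forall>t. \<bar>t\<bar> < e \<longrightarrow> y0 + t *\<^sub>R (y - y0) \<in> T"
  proof -
    have "open ((\<lambda>t. y0 + t *\<^sub>R (y - y0)) -` T)"
      by (rule open_vimage[OF T(1)]) (intro continuous_intros)
    moreover have "0 \<in> (\<lambda>t. y0 + t *\<^sub>R (y - y0)) -` T" using T by simp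
    ultimately obtain e where "e > 0" "ball 0 e \<subseteq> (\<lambda>t. y0 + t *\<^sub>R (y - y0)) -` T"
      using open_contains_ball by blast
    then show ?thesis by (intro exI[of _ e]) (auto simp: subset_iff)
  qed
  then obtain e where e: "e > 0" "\<And>t. \<bar>t\<bar> < e \<Longrightarrow> y0 + t *\<^sub>R (y - y0) \<in> T" by blast
  obtain e' where e': "e' > 0" "\<And>t. \<bar>t\<bar> < e' \<Longrightarrow> ?l (of_real t) \<in> ?B"
  proof -
    have "0 \<in> {\<zeta>. ?l \<zeta> \<in> ?B}" using T by (simp add: pair_scale_def dist_Pair_Pair)
    then obtain e where "e > 0" "ball 0 e \<subseteq> {\<zeta>. ?l \<zeta> \<in> ?B}"
      using cpair.open_line[OF open_ball] open_contains_ball by blast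
    then show ?thesis by (intro that[of e]) (auto simp: subset_iff)
  qed
  define d where "d = min e e'"
  have "F (?l 1) = 0"
  proof (rule analytic_continuation[where f="\<lambda>\<zeta>. F (?l \<zeta>)" and w=1 and S="{\<zeta>. ?l \<zeta> \<in> ?B}" and U="complex_of_real ` {-d<..<d}" and \<xi>=0])
    show "(\<lambda>\<zeta>. F (?l \<zeta>)) holomorphic_on {\<zeta>. ?l \<zeta> \<in> ?B}" by (rule cpair.ghol_line[OF f(1)])
    show "open {\<zeta>. ?l \<zeta> \<in> ?B}" by (rule cpair.open_line) simp
    show "complex_of_real ` {-d<..<d} \<subseteq> {\<zeta>. ?l \<zeta> \<in> ?B}" using e'(2) by (auto simp: d_def)
    show "0 \<in> {\<zeta>. ?l \<zeta> \<in> ?B}" using T by (simp add: pair_scale_def dist_Pair_Pair)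
    show "1 \<in> {\<zeta>. ?l \<zeta> \<in> ?B}" using y by (simp add: pair_scale_def dist_Pair_Pair)
    show "(0::complex) islimpt complex_of_real ` {-d<..<d}"
      unfolding islimpt_approachable
    proof (intro allI impI)
      fix \<epsilon> :: real assume \<epsilon>: "\<epsilon> > 0"
      define t where "t = min \<epsilon> d / 2"
      have "t > 0" "t < \<epsilon>" "t < d" using \<epsilon> e e' by (auto simp: t_def d_def)
      then show "\<exists>x'\<in>complex_of_real ` {-d<..<d}. x' \<noteq> 0 \<and> dist x' 0 < \<epsilon>"
        by (intro bexI[of _ "of_real t"]) auto
    qed
    fix \<zeta> :: complex assume "\<zeta> \<in> complex_of_real ` {-d<..<d}"
    then obtain t where t: "\<zeta> = of_real t" "\<bar>t\<bar> < d" by auto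
    have "y0 + t *\<^sub>R (y - y0) \<in> ball x r" using e'(2)[of t] t unfolding l_real by (simp add: d_def dist_Pair_Pair)
    moreover have "y0 + t *\<^sub>R (y - y0) \<in> T" using e(2)[of t] t by (simp add: d_def)
    ultimately show "F (?l \<zeta>) = 0" unfolding t l_real using f(2) T(4) by simp
  qed (rule conn)
  then show ?thesis using f(2)[OF y] by (simp add: pair_scale_def)
qed

text \<open>The same power series is summed at complex coordinates. Absolute convergence at one real
  point all of whose coordinates equal \<open>s\<close> dominates the terms wherever the complex
  coordinates are at most \<open>s\<close> in modulus, and a uniform limit of polynomials is
  holomorphic.\<close>

lemma ext_hol_real_analytic:
  fixes f :: "'v::euclidean_space \<Rightarrow> real"
  assumes "real_analytic_on f S"
  shows "ext_hol (\<lambda>x. complex_of_real (f x)) S"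
proof (rule ext_holI)
  fix x assume "x \<in> S"
  then obtain r a where r: "r > 0"
    and a: "\<And>y. y \<in> ball x r \<Longrightarrow> ((\<lambda>\<alpha>. (\<Prod>b\<in>Basis. ((y - x) \<bullet> b) ^ \<alpha> b) *\<^sub>R a \<alpha>) has_sum f y) (Basis \<rightarrow>\<^sub>E UNIV)"
    using assms unfolding real_analytic_on_def by blast
  \<comment> \<open>With this value the comparison point, \<open>s\<close> times the sum of the
    basis vectors away from \<open>x\<close>, has distance at most r/2 from
    \<open>x\<close>.\<close>
  define s where "s = r / (2 * DIM('v))"
  have s: "s > 0" using r by (simp add: s_def)
  define M where "M \<alpha> = (\<Prod>b\<in>(Basis::'v set). s ^ \<alpha> b) * \<bar>a \<alpha>\<bar>" for \<alpha>
  let ?I = "(Basis::'v set) \<rightarrow>\<^sub>E (UNIV :: nat set)"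
  have M: "M summable_on ?I"
  proof -
    define y where "y = x + (\<Sum>b\<in>Basis. s *\<^sub>R b)"
    have yb: "(y - x) \<bullet> b = s" if "b \<in> Basis" for b
      using that by (simp add: y_def inner_sum_left inner_Basis if_distrib cong: if_cong)
    have "norm (y - x) \<le> (\<Sum>b\<in>(Basis::'v set). norm (s *\<^sub>R b))" unfolding y_def add_diff_cancel_left' by (rule norm_sum)
    also have "\<dots> = r / 2" using r by (simp add: s_def)
    finally have "y \<in> ball x r" using r by (simp add: dist_norm norm_minus_commute)
    from a[OF this] have "(\<lambda>\<alpha>. (\<Prod>b\<in>(Basis::'v set). s ^ \<alpha> b) * a \<alpha>) summable_on ?I"
      by (auto simp: has_sum_imp_summable yb cong: prod.cong)
    then have "(\<lambda>\<alpha>. norm ((\<Prod>b\<in>(Basis::'v set). s ^ \<alpha> b) * a \<alpha>)) summable_on ?I"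
      by (rule summable_on_iff_abs_summable_on_real[THEN iffD1])
    moreover have "norm ((\<Prod>b\<in>(Basis::'v set). s ^ \<alpha> b) * a \<alpha>) = M \<alpha>" for \<alpha>
      using s by (simp add: M_def abs_mult abs_prod)
    ultimately show ?thesis by simp
  qed
  define co where "co b z = Complex ((fst z - x) \<bullet> b) (snd z \<bullet> b)" for b :: 'v and z :: "'v \<times> 'v"
  define m where "m \<alpha> z = (\<Prod>b\<in>Basis. co b z ^ \<alpha> b) * of_real (a \<alpha>)" for \<alpha> z
  define F where "F z = (\<Sum>\<^sub>\<infinity>\<alpha>\<in>?I. m \<alpha> z)" for z
  let ?B = "ball (x, 0::'v) (min r s)"
  have co: "cmod (co b z) \<le> s" if "z \<in> ?B" "b \<in> Basis" for b z
  proof -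
    have "co b z = Complex ((fst z - x) \<bullet> b) ((snd z - 0) \<bullet> b)" by (simp add: co_def)
    also have "cmod \<dots> = sqrt (((fst z - x) \<bullet> b)\<^sup>2 + ((snd z - 0) \<bullet> b)\<^sup>2)" by (simp add: cmod_def)
    also have "\<dots> \<le> sqrt ((norm (fst z - x))\<^sup>2 + (norm (snd z - 0))\<^sup>2)"
      using Basis_le_norm[OF that(2), of "fst z - x"] Basis_le_norm[OF that(2), of "snd z - 0"]
      by (intro real_sqrt_le_mono add_mono abs_le_square_iff[THEN iffD1]) auto
    also have "\<dots> = norm (z - (x, 0))" by (simp add: norm_Pair prod_eq_iff norm_prod_def)
    also have "\<dots> \<le> s" using that(1) by (simp add: dist_norm norm_minus_commute)
    finally show ?thesis .
  qed
  have lim: "uniform_limit ?B (\<lambda>X z. \<Sum>\<alpha>\<in>X. m \<alpha> z) F (finite_subsets_at_top ?I)"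
    unfolding F_def
  proof (rule Weierstrass_m_test_general[OF _ M])
    fix \<alpha> z assume "z \<in> ?B"
    have "cmod (m \<alpha> z) = (\<Prod>b\<in>Basis. cmod (co b z) ^ \<alpha> b) * \<bar>a \<alpha>\<bar>"
      by (simp add: m_def norm_mult norm_power flip: prod_norm)
    also have "\<dots> \<le> M \<alpha>" unfolding M_def
      by (intro mult_right_mono prod_mono conjI power_mono co \<open>z \<in> ?B\<close>) auto
    finally show "cmod (m \<alpha> z) \<le> M \<alpha>" .
  qed
  have gm: "cpair.ghol (m \<alpha>) ?B" for \<alpha>
  proof -
    have "cpair.ghol (co b) ?B" for b
    proof -
      have "co b ((p, q) + pair_scale \<zeta> (u, v)) = co b (p, q) + \<zeta> * Complex (u \<bullet> b) (v \<bullet> b)" for p q u v \<zeta>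
        by (simp add: co_def pair_scale_def complex_eq_iff algebra_simps inner_simps)
      moreover have "continuous_on ?B (co b)"
        unfolding co_def Complex_eq by (intro continuous_intros)
      ultimately show ?thesis
        by (auto simp: cpair.ghol_def intro!: holomorphic_intros)
    qed
    then show ?thesis unfolding m_def
      by (intro cpair.ghol_mult cpair.ghol_prod cpair.ghol_power cpair.ghol_const)
  qed
  have "cpair.ghol F ?B"
    by (rule cpair.ghol_uniform_limit[OF _ _ lim]) (auto intro!: always_eventually cpair.ghol_sum gm)
  moreover have "F (y, 0) = of_real (f y)" if "y \<in> ball x (min r s)" for y
  proof -
    have "((\<lambda>\<alpha>. complex_of_real ((\<Prod>b\<in>Basis. ((y - x) \<bullet> b) ^ \<alpha> b) *\<^sub>R a \<alpha>)) has_sum of_real (f y)) ?I"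
      using a[of y] that by (intro has_sum_of_real) auto
    moreover have "complex_of_real ((\<Prod>b\<in>Basis. ((y - x) \<bullet> b) ^ \<alpha> b) *\<^sub>R a \<alpha>) = m \<alpha> (y, 0)" for \<alpha>
      by (simp add: m_def co_def complex_of_real_def[symmetric])
    ultimately show ?thesis unfolding F_def by (simp add: infsumI)
  qed
  ultimately show "\<exists>r>0. \<exists>F. cpair.ghol F (ball (x, 0) r) \<and> (\<forall>y\<in>ball x r. F (y, 0) = of_real (f y))"
    using r s by (intro exI[of _ "min r s"] exI[of _ F]) auto
qed

section \<open>Linear algebra of a three-dimensional inner product\<close>

definition lin_trace :: "('v::euclidean_space \<Rightarrow> 'v) \<Rightarrow> real" where
  "lin_trace L = (\<Sum>b\<in>Basis. L b \<bullet> b)"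

lemma lin_trace_add: "lin_trace (\<lambda>b. L b + M b) = lin_trace L + lin_trace M"
  and lin_trace_diff: "lin_trace (\<lambda>b. L b - M b) = lin_trace L - lin_trace M"
  and lin_trace_scaleR: "lin_trace (\<lambda>b. c *\<^sub>R L b) = c * lin_trace L"
  by (simp_all add: lin_trace_def inner_simps sum.distrib sum_subtractf sum_negf sum_distrib_left)

lemma lin_trace_id: "lin_trace (\<lambda>b::'v::euclidean_space. b) = DIM('v)"
  by (simp add: lin_trace_def)

lemma linear_eq_sum_Basis:
  assumes "linear f"
  shows "f w = (\<Sum>b\<in>Basis. (w \<bullet> b) *\<^sub>R f b)"
  by (subst euclidean_representation[symmetric, of w])
    (simp only: linear_sum[OF assms] linear_cmul[OF assms])

lemma lin_trace_rank_one:
  assumes "linear f"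
  shows "lin_trace (\<lambda>b. f b *\<^sub>R w) = f w"
  by (subst (2) linear_eq_sum_Basis[OF assms]) (simp add: lin_trace_def mult.commute)

lemma lin_trace_commute:
  fixes L M :: "'v::euclidean_space \<Rightarrow> 'v"
  assumes L: "linear L" and M: "linear M"
  shows "lin_trace (\<lambda>b. L (M b)) = lin_trace (\<lambda>b. M (L b))"
proof -
  have *: "lin_trace (\<lambda>b. L (M b)) = (\<Sum>b\<in>Basis. \<Sum>c\<in>Basis. (M b \<bullet> c) * (L c \<bullet> b))"
    if "linear L" for L M :: "'v \<Rightarrow> 'v"
    unfolding lin_trace_def
    by (intro sum.cong refl, subst linear_eq_sum_Basis[OF that]) (simp add: inner_sum_left)
  show ?thesis
    unfolding *[OF L] *[OF M] by (subst sum.swap) (simp add: mult.commute)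
qed

locale inner3 =
  fixes h :: "real ^ 3 \<Rightarrow> real ^ 3 \<Rightarrow> real"
  assumes bilinear: "bilinear h" and sym: "h u v = h v u" and posdef: "v \<noteq> 0 \<Longrightarrow> h v v > 0"
begin

lemma add_left: "h (u + v) w = h u w + h v w" and add_right: "h u (v + w) = h u v + h u w"
  and diff_left: "h (u - v) w = h u w - h v w" and diff_right: "h u (v - w) = h u v - h u w"
  and minus_left: "h (- u) w = - h u w" and minus_right: "h u (- w) = - h u w"
  and scaleR_left: "h (c *\<^sub>R u) w = c * h u w" and scaleR_right: "h u (c *\<^sub>R w) = c * h u w"
  and zero_left: "h 0 w = 0" and zero_right: "h u 0 = 0"
  using bilinear_ladd[OF bilinear] bilinear_radd[OF bilinear] bilinear_lsub[OF bilinear]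
    bilinear_rsub[OF bilinear] bilinear_lneg[OF bilinear] bilinear_rneg[OF bilinear]
    bilinear_lmul[OF bilinear] bilinear_rmul[OF bilinear] bilinear_lzero[OF bilinear]
    bilinear_rzero[OF bilinear] by simp_all

lemma sum_left: "h (\<Sum>i\<in>I. f i) w = (\<Sum>i\<in>I. h (f i) w)"
  and sum_right: "h u (\<Sum>i\<in>I. f i) = (\<Sum>i\<in>I. h u (f i))"
  using bilinear linear_sum[of "\<lambda>u. h u w" f I] linear_sum[of "h u" f I]
  by (simp_all add: bilinear_def)

lemmas bilinear_simps = add_left add_right diff_left diff_right minus_left minus_right
  scaleR_left scaleR_right zero_left zero_right sum_left sum_right

lemma eqI: "(\<And>z. h u z = h v z) \<Longrightarrow> u = v"
  using posdef[of "u - v"] by (force simp: diff_left)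

definition vol :: "real ^ 3 \<Rightarrow> real ^ 3 \<Rightarrow> real ^ 3 \<Rightarrow> real" where
  "vol u v w = sqrt (det (gram h)) * det (vector [u, v, w] :: real ^ 3 ^ 3)"

text \<open>\<open>\<phi>\<close> pairs with \<open>p\<close> and \<open>q\<close> and always has
  third coordinate 0. Being not surjective on a space of finite dimension it is not injective, and a
  kernel vector can be normalised.\<close>

lemma orthogonal_unit_vector:
  obtains e where "h e e = 1" "h p e = 0" "h q e = 0"
proof -
  define \<phi> :: "real ^ 3 \<Rightarrow> real ^ 3" where
    "\<phi> v = (\<chi> i. if i = 1 then h p v else if i = 2 then h q v else 0)" for v
  have lin: "linear \<phi>"
    by (rule linearI) (simp_all add: \<phi>_def vec_eq_iff add_right scaleR_right)
  have "\<not> surj \<phi>"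
  proof
    assume "surj \<phi>"
    then obtain v where "axis 3 1 = \<phi> v" by (rule surjE)
    then have "axis 3 1 $ (3::3) = \<phi> v $ 3" by simp
    then show False by (simp add: \<phi>_def)
  qed
  then have "\<not> inj \<phi>" using linear_injective_imp_surjective[OF lin] by blast
  then obtain v where v: "v \<noteq> 0" "\<phi> v = 0"
    using linear_injective_0[OF lin] by blast
  have "\<phi> v $ 1 = 0" "\<phi> v $ 2 = 0" unfolding v(2) by simp_all
  then have "h p v = 0" "h q v = 0" by (simp_all add: \<phi>_def)
  then show ?thesis
    using posdef[OF v(1)] by (intro that[of "(1 / sqrt (h v v)) *\<^sub>R v"]) (auto simp: bilinear_simps)
qed

text \<open>The Gram matrix of the frame is E G E^T, where the rows of E are the frame
  vectors.\<close>

lemma det_gram_frame: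
  fixes e :: "3 \<Rightarrow> real ^ 3"
  shows "det (gram h) * (det (\<chi> i. e i))\<^sup>2 = det (\<chi> i j. h (e i) (e j))"
proof -
  let ?E = "\<chi> i. e i"
  have expand: "u = (\<Sum>k\<in>UNIV. u $ k *\<^sub>R axis k 1)" for u :: "real ^ 3"
    using basis_expansion[of u] by (simp add: scalar_mult_eq_scaleR)
  have hexp: "h u v = (\<Sum>l\<in>UNIV. (\<Sum>k\<in>UNIV. u $ k * h (axis k 1) (axis l 1)) * v $ l)" for u v
  proof -
    have "h u v = h (\<Sum>k\<in>UNIV. u $ k *\<^sub>R axis k 1) (\<Sum>l\<in>UNIV. v $ l *\<^sub>R axis l 1)"
      by (simp only: flip: expand)
    also have "\<dots> = (\<Sum>l\<in>UNIV. (\<Sum>k\<in>UNIV. u $ k * h (axis k 1) (axis l 1)) * v $ l)"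
      by (simp only: sum_right sum_left scaleR_left scaleR_right)
        (simp add: sum_3 algebra_simps)
    finally show ?thesis .
  qed
  have "(\<chi> i j. h (e i) (e j)) = (?E ** gram h) ** transpose ?E"
    unfolding vec_eq_iff matrix_matrix_mult_def gram_def transpose_def
    by (simp only: vec_lambda_beta) (intro allI hexp)
  then show ?thesis by (simp add: det_mul det_transpose power2_eq_square)
qed

text \<open>A positively oriented orthonormal frame. In its components \<open>vol\<close> is a plain
  determinant, which reduces the vector identities below to polynomial ones.\<close>

lemma orthonormal_frame:
  obtains e :: "3 \<Rightarrow> real ^ 3" where
    "\<And>i j. h (e i) (e j) = (if i = j then 1 else 0)"
    "\<And>u. u = (\<Sum>i\<in>UNIV. h u (e i) *\<^sub>R e i)"
    "sqrt (det (gram h)) * det (\<chi> i. e i) = 1"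
    "\<And>u v w. vol u v w = det (vector [\<chi> i. h u (e i), \<chi> i. h v (e i), \<chi> i. h w (e i)] :: real ^ 3 ^ 3)"
proof -
  obtain e1 where e1: "h e1 e1 = 1" using orthogonal_unit_vector by metis
  obtain e2 where e2: "h e2 e2 = 1" "h e1 e2 = 0" using orthogonal_unit_vector by metis
  obtain e3 where e3: "h e3 e3 = 1" "h e1 e3 = 0" "h e2 e3 = 0" using orthogonal_unit_vector by metis
  define s where "s = sgn (det (vector [e1, e2, e3] :: real ^ 3 ^ 3))"
  define e0 :: "3 \<Rightarrow> real ^ 3" where "e0 i = (vector [e1, e2, e3] :: real ^ 3 ^ 3) $ i" for i
  have on0: "h (e0 i) (e0 j) = (if i = j then 1 else 0)" for i j
    using exhaust_3[of i] exhaust_3[of j] e1 e2 e3 sym[of e2 e1] sym[of e3 e1] sym[of e3 e2]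
    by (auto simp: e0_def)
  have E0: "(\<chi> i. e0 i) = vector [e1, e2, e3]" by (simp add: vec_eq_iff e0_def)
  have mat1: "(\<chi> i j. if i = j then 1 else 0) = (mat 1 :: real ^ 3 ^ 3)" by (simp add: mat_def)
  have "det (gram h) * (det (\<chi> i. e0 i))\<^sup>2 = 1"
    unfolding det_gram_frame on0 mat1 by simp
  then have s: "s * s = 1" by (auto simp: s_def E0 sgn_if)
  \<comment> \<open>Reversing the first vector if necessary makes the determinant of the frame
    nonnegative, so the square in \<open>det_gram_frame\<close> can be removed without a
    sign.\<close>
  define e where "e i = (if i = 1 then s *\<^sub>R e0 i else e0 i)" for i
  have on: "h (e i) (e j) = (if i = j then 1 else 0)" for i j
    using s by (auto simp: e_def bilinear_simps on0)
  have detE: "det (\<chi> i. e i) = s * det (\<chi> i. e0 i)"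
    by (simp add: det_3 e_def algebra_simps)
  have "det (gram h) * (det (\<chi> i. e i))\<^sup>2 = 1"
    unfolding det_gram_frame on mat1 by simp
  moreover have "det (\<chi> i. e i) \<ge> 0"
    unfolding detE by (simp add: s_def E0 sgn_if)
  ultimately have or: "sqrt (det (gram h)) * det (\<chi> i. e i) = 1"
    by (metis real_sqrt_mult real_sqrt_one real_sqrt_abs abs_of_nonneg)
  let ?\<psi> = "\<lambda>c :: real ^ 3. \<Sum>i\<in>UNIV. (c $ i) *\<^sub>R e i"
  have lin: "linear ?\<psi>"
    by (rule linearI) (simp_all add: sum.distrib scaleR_add_left scaleR_sum_right)
  have comp: "h (?\<psi> c) (e i) = c $ i" for c i
    by (simp add: bilinear_simps on if_distrib cong: if_cong)
  have "inj ?\<psi>" by (rule injI) (metis comp vec_eq_iff)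
  then have "surj ?\<psi>" using linear_injective_imp_surjective[OF lin] by blast
  then have rep: "u = (\<Sum>i\<in>UNIV. h u (e i) *\<^sub>R e i)" for u
  proof -
    obtain c where "u = ?\<psi> c" using \<open>surj ?\<psi>\<close> by (rule surjE)
    then show ?thesis by (simp only: comp)
  qed
  have "vol u v w = det (vector [\<chi> i. h u (e i), \<chi> i. h v (e i), \<chi> i. h w (e i)] :: real ^ 3 ^ 3)" for u v w
  proof -
    let ?C = "vector [\<chi> i. h u (e i), \<chi> i. h v (e i), \<chi> i. h w (e i)] :: real ^ 3 ^ 3"
    have 1: "(\<Sum>k\<in>UNIV. h u (e k) * e k $ j) = u $ j" for u j
      by (subst (2) rep[of u]) simp
    have "vector [u, v, w] = ?C ** (\<chi> i. e i)"
      by (simp add: vec_eq_iff matrix_matrix_mult_def forall_3 1)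
    then have "vol u v w = (sqrt (det (gram h)) * det (\<chi> i. e i)) * det ?C"
      by (simp add: vol_def det_mul)
    then show ?thesis by (simp add: or)
  qed
  then show ?thesis by (rule that[OF on rep or])
qed

lemma lin_trace_frame:
  assumes e: "\<And>u. u = (\<Sum>i\<in>UNIV. h u (e i) *\<^sub>R e i)" and L: "linear L"
  shows "lin_trace L = (\<Sum>i\<in>(UNIV :: 3 set). h (L (e i)) (e i))"
proof -
  have "L b \<bullet> b = (\<Sum>i\<in>UNIV. h ((L (e i) \<bullet> b) *\<^sub>R b) (e i))" for b
    by (subst (1) e[of b])
      (simp add: linear_sum[OF L] linear_cmul[OF L] inner_sum_left scaleR_left mult.commute)
  then have "lin_trace L = (\<Sum>i\<in>UNIV. \<Sum>b\<in>Basis. h ((L (e i) \<bullet> b) *\<^sub>R b) (e i))"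
    unfolding lin_trace_def by (subst sum.swap) simp
  then show ?thesis by (simp only: flip: sum_left) (simp add: euclidean_representation)
qed

end

locale inner3_cross = inner3 +
  fixes a :: "real ^ 3" and K :: "real ^ 3 \<Rightarrow> real ^ 3"
  assumes K: "h (K u) z = vol a u z"
begin

lemma K_linear: "linear K"
proof (rule linearI; rule eqI)
  obtain e where vol: "\<And>u v w. vol u v w = det (vector [\<chi> i. h u (e i), \<chi> i. h v (e i), \<chi> i. h w (e i)] :: real ^ 3 ^ 3)"
    by (rule orthonormal_frame) blast
  show "h (K (u + v)) z = h (K u + K v) z" "h (K (c *\<^sub>R u)) z = h (c *\<^sub>R K u) z" for u v z c
    by (simp_all add: K add_left scaleR_left vol det_3 algebra_simps)
qed

text \<open>In an oriented orthonormal frame \<open>K u\<close> has the components of the classical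
  cross product of \<open>a\<close> and \<open>u\<close>; \<open>K_K\<close> is then the formula for
  the double cross product.\<close>

lemma K_identities:
  shows K_antisym: "h u (K v) = - h (K u) v" and K_a: "K a = 0" and a_K: "h a (K u) = 0"
    and K_K: "K (K u) = h a u *\<^sub>R a - h a a *\<^sub>R u" and lin_trace_K: "lin_trace K = 0"
proof -
  obtain e where on: "\<And>i j. h (e i) (e j) = (if i = j then 1 else 0)"
    and rep: "\<And>u. u = (\<Sum>i\<in>UNIV. h u (e i) *\<^sub>R e i)"
    and vol: "\<And>u v w. vol u v w = det (vector [\<chi> i. h u (e i), \<chi> i. h v (e i), \<chi> i. h w (e i)] :: real ^ 3 ^ 3)"
    by (rule orthonormal_frame) blast
  have hc: "h u v = (\<Sum>i\<in>UNIV. h u (e i) * h v (e i))" for u v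
    by (subst rep[of v]) (simp add: bilinear_simps mult.commute)
  have Kc: "h (K u) (e 1) = h a (e 2) * h u (e 3) - h a (e 3) * h u (e 2)"
     "h (K u) (e 2) = h a (e 3) * h u (e 1) - h a (e 1) * h u (e 3)"
     "h (K u) (e 3) = h a (e 1) * h u (e 2) - h a (e 2) * h u (e 1)" for u
    by (simp_all add: K vol det_3 on)
  show asym: "h u (K v) = - h (K u) v" for u v
    by (simp add: hc[of u "K v"] hc[of "K u" v] sum_3 Kc algebra_simps)
  show "K a = 0"
    by (rule eqI) (subst hc, simp add: sum_3 Kc zero_left on)
  show "h a (K u) = 0" by (simp add: hc[of a "K u"] sum_3 Kc algebra_simps)
  show "K (K u) = h a u *\<^sub>R a - h a a *\<^sub>R u"
  proof (rule eqI)
    fix z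
    show "h (K (K u)) z = h (h a u *\<^sub>R a - h a a *\<^sub>R u) z"
      by (simp add: hc[of "K (K u)" z] hc[of a z] hc[of u z] hc[of a u] hc[of a a]
          sum_3 Kc diff_left add_left scaleR_left algebra_simps)
  qed
  show "lin_trace K = 0"
    unfolding lin_trace_frame[OF rep K_linear] by (simp add: sum_3 Kc on)
qed

text \<open>With \<open>B\<close> the covariant derivative of the one-form dual to \<open>a\<close>,
  the assumption \<open>anti\<close> says that the curl of \<open>a\<close> is -2a. The trace of
  \<open>NK\<close> contracts this derivative with the volume form, so only the antisymmetric part
  of \<open>B\<close>, that is the curl, survives.\<close>

lemma lin_trace_cross:
  assumes B: "\<And>u v. h (Na u) v = B u v" and lin: "linear Na" "linear NK"
    and anti: "\<And>u v. B u v - B v u = - 2 * vol a u v" and NK: "\<And>u z. h (NK u) z = vol (Na u) v z"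
  shows "lin_trace NK = - 2 * h a v"
proof -
  obtain e where on: "\<And>i j. h (e i) (e j) = (if i = j then 1 else 0)"
    and rep: "\<And>u. u = (\<Sum>i\<in>UNIV. h u (e i) *\<^sub>R e i)"
    and vol: "\<And>u v w. vol u v w = det (vector [\<chi> i. h u (e i), \<chi> i. h v (e i), \<chi> i. h w (e i)] :: real ^ 3 ^ 3)"
    by (rule orthonormal_frame) blast
  have hc: "h u v = (\<Sum>i\<in>UNIV. h u (e i) * h v (e i))" for u v
    by (subst rep[of v]) (simp add: bilinear_simps mult.commute)
  have "lin_trace NK = (B (e 2) (e 3) - B (e 3) (e 2)) * h v (e 1) + (B (e 3) (e 1) - B (e 1) (e 3)) * h v (e 2)
     + (B (e 1) (e 2) - B (e 2) (e 1)) * h v (e 3)"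
    unfolding lin_trace_frame[OF rep lin(2)] by (simp add: sum_3 NK vol det_3 on B algebra_simps)
  also have "\<dots> = - 2 * h a v"
    unfolding anti by (simp add: vol det_3 on hc[of a v] sum_3 algebra_simps)
  finally show ?thesis .
qed

lemma lin_trace_div:
  assumes lin: "linear L"
    and closed: "\<And>u v w. (vol (L u) v w + \<tau> u * vol a v w) + (vol (L v) w u + \<tau> v * vol a w u)
       + (vol (L w) u v + \<tau> w * vol a u v) = 0" and \<tau>: "linear \<tau>"
  shows "lin_trace L = - \<tau> a"
proof -
  obtain e where on: "\<And>i j. h (e i) (e j) = (if i = j then 1 else 0)"
    and rep: "\<And>u. u = (\<Sum>i\<in>UNIV. h u (e i) *\<^sub>R e i)"
    and vol: "\<And>u v w. vol u v w = det (vector [\<chi> i. h u (e i), \<chi> i. h v (e i), \<chi> i. h w (e i)] :: real ^ 3 ^ 3)"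
    by (rule orthonormal_frame) blast
  have "\<tau> a = (\<Sum>i\<in>UNIV. h a (e i) * \<tau> (e i))"
    by (subst rep[of a]) (simp add: linear_sum[OF \<tau>] linear_cmul[OF \<tau>])
  then show ?thesis
    unfolding lin_trace_frame[OF rep lin] using closed[of "e 1" "e 2" "e 3"]
    by (simp add: vol det_3 on sum_3 algebra_simps)
qed

end

section \<open>The Ricci tensor of a Beltrami metric\<close>

subsection \<open>Algebra at a point\<close>

text \<open>The Levi-Civita connection of \<open>g = \<rho>\<^sup>2 h + (d\<rho> + A/\<rho>)\<^sup>2\<close> differs from that of
  \<open>h + d\<rho>\<^sup>2\<close> by the tensor with components \<open>cc\<close> and \<open>om\<close>. Here \<open>a\<close> is the vector dual to \<open>A\<close>,
  \<open>K\<close> the cross product with \<open>a\<close>, \<open>B\<close> the covariant derivative of \<open>A\<close>, and \<open>p = 1/\<rho>\<close>.\<close>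

locale beltrami_point = inner3_cross h a K
  for h :: "real ^ 3 \<Rightarrow> real ^ 3 \<Rightarrow> real" and a K +
  fixes B :: "real ^ 3 \<Rightarrow> real ^ 3 \<Rightarrow> real" and \<rho> p :: real
  assumes B: "bilinear B" and B_anti: "B u v - B v u = - 2 * h (K u) v"
    and \<rho>p: "\<rho> * p = 1"
begin

text \<open>The one-form d\<rho> + A/\<rho>, whose square is the second summand of
  \<open>g\<close>.\<close>

definition th :: "(real ^ 3) \<times> real \<Rightarrow> real" where
  "th U = snd U + p * h a (fst U)"

definition cc :: "(real ^ 3) \<times> real \<Rightarrow> (real ^ 3) \<times> real \<Rightarrow> real ^ 3" where
  "cc U V = p *\<^sub>R (snd U *\<^sub>R fst V + snd V *\<^sub>R fst U) + (p^2 * h (fst U) (fst V)) *\<^sub>R a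
     - (p^4 * (th U * th V)) *\<^sub>R a - p^3 *\<^sub>R (th V *\<^sub>R K (fst U) + th U *\<^sub>R K (fst V))"

text \<open>The value of \<open>th\<close> on the difference tensor:
  \<open>th (cc U V, om U V) = tau (fst U) (fst V)\<close>. The definition of \<open>om\<close>
  merely solves this equation for the \<rho>-component.\<close>

definition tau :: "(real ^ 3) \<Rightarrow> (real ^ 3) \<Rightarrow> real" where
  "tau u v = - \<rho> * h u v + p * (B u v + h (K u) v) + p^3 * (h a u * h a v)"

definition om :: "(real ^ 3) \<times> real \<Rightarrow> (real ^ 3) \<times> real \<Rightarrow> real" where
  "om U V = tau (fst U) (fst V) - p * h a (cc U V)"

lemma K_simps: "K (u + v) = K u + K v" "K (u - v) = K u - K v" "K (c *\<^sub>R u) = c *\<^sub>R K u" "K 0 = 0" "K (- u) = - K u"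
  using K_linear by (auto simp: linear_add linear_diff linear_cmul linear_0 linear_neg)

lemma B_simps: "B (u + v) w = B u w + B v w" "B u (v + w) = B u v + B u w"
  "B (u - v) w = B u w - B v w" "B u (v - w) = B u v - B u w" "B (c *\<^sub>R u) w = c * B u w" "B u (c *\<^sub>R w) = c * B u w"
  "B 0 w = 0" "B u 0 = 0" "B (- u) w = - B u w" "B u (- w) = - B u w"
  using bilinear_ladd[OF B] bilinear_radd[OF B] bilinear_lsub[OF B] bilinear_rsub[OF B] bilinear_lmul[OF B]
    bilinear_rmul[OF B] bilinear_lzero[OF B] bilinear_rzero[OF B] bilinear_lneg[OF B] bilinear_rneg[OF B] by simp_all

lemmas lin_simps = add_left add_right diff_left diff_right minus_left minus_right
  scaleR_left scaleR_right zero_left zero_right K_simps B_simps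

lemma K_a_left: "h (K u) a = 0"
  using a_K[of u] sym[of a "K u"] by simp

lemma h_KK: "h (K u) (K v) = h a a * h u v - h a u * h a v"
  using K_antisym[of "K u" v] by (simp add: K_K lin_simps)

lemma linear_tau: "linear (\<lambda>b. tau b v)" "linear (tau v)"
  by (rule linearI; simp add: tau_def lin_simps algebra_simps)+

lemma linear_cc: "linear (\<lambda>b. cc (b, 0) V)"
  by (rule linearI) (simp_all add: cc_def th_def lin_simps algebra_simps)

lemma lin_trace_cc_left:
  "lin_trace (\<lambda>b. cc (b, 0) V) = 3 * p * snd V + p^2 * h a (fst V) - p^5 * (h a a * th V)"
proof -
  have "lin_trace (\<lambda>b. cc (b, 0) V) = lin_trace (\<lambda>b. (p * snd V) *\<^sub>R b + (p^2 * h (fst V) b) *\<^sub>R a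
      - ((p^5 * th V) * h a b) *\<^sub>R a - ((p^3 * th V) *\<^sub>R K b + (p^4 * h a b) *\<^sub>R K (fst V)))"
    by (rule arg_cong[where f=lin_trace])
      (auto simp: cc_def th_def fun_eq_iff sym[of _ "fst V"] scaleR_add_right numeral_eq_Suc mult_ac)
  also have "\<dots> = p * snd V * 3 + p^2 * h (fst V) a - (p^5 * th V) * h a a
      - ((p^3 * th V) * 0 + p^4 * h a (K (fst V)))"
    unfolding lin_trace_add lin_trace_diff lin_trace_scaleR lin_trace_id lin_trace_K
    by (subst lin_trace_rank_one, (rule linearI; simp add: lin_simps algebra_simps))+ simp
  finally show ?thesis by (simp add: a_K sym[of "fst V" a] algebra_simps)
qed

text \<open>The full trace of the difference tensor is the logarithmic derivative of the ratio of
  the two volume densities. This ratio is \<rho>^3, since d\<rho> + A/\<rho> and d\<rho> give the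
  same volume when combined with a volume form from N.\<close>

lemma lin_trace_C: "lin_trace (\<lambda>b. cc (b, 0) V) + om (0, 1) V = 3 * p * snd V"
  unfolding lin_trace_cc_left om_def
  by (simp add: cc_def th_def tau_def lin_simps a_K numeral_eq_Suc algebra_simps)

lemma lin_trace_cc_comp:
  assumes z: "linear z" and \<tau>: "linear \<tau>"
  shows "lin_trace (\<lambda>b. cc U (z b, \<tau> b - p * h a (z b))) =
     p * (snd U * lin_trace z + \<tau> (fst U) - p * h a (z (fst U))) + p^2 * h (fst U) (z a)
     - p^4 * (th U * \<tau> a) - p^3 * (\<tau> (K (fst U)) + th U * lin_trace (\<lambda>b. K (z b)))"
proof -
  have "lin_trace (\<lambda>b. cc U (z b, \<tau> b - p * h a (z b))) = lin_trace (\<lambda>b. (p * snd U) *\<^sub>R z b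
      + (p * (\<tau> b - p * h a (z b))) *\<^sub>R fst U + (p^2 * h (fst U) (z b)) *\<^sub>R a
      - (p^4 * (th U * \<tau> b)) *\<^sub>R a - ((p^3 * \<tau> b) *\<^sub>R K (fst U) + (p^3 * th U) *\<^sub>R K (z b)))"
    by (rule arg_cong[where f=lin_trace]) (auto simp: cc_def th_def fun_eq_iff algebra_simps)
  also have "\<dots> = p * snd U * lin_trace z + p * (\<tau> (fst U) - p * h a (z (fst U))) + p^2 * h (fst U) (z a)
      - p^4 * (th U * \<tau> a) - (p^3 * \<tau> (K (fst U)) + p^3 * th U * lin_trace (\<lambda>b. K (z b)))"
    unfolding lin_trace_add lin_trace_diff lin_trace_scaleR
    by (subst lin_trace_rank_one,
        (rule linearI; simp add: lin_simps linear_add[OF z] linear_cmul[OF z] linear_add[OF \<tau>] linear_cmul[OF \<tau>] algebra_simps))+ simp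
  finally show ?thesis by (simp add: algebra_simps)
qed

lemma lin_trace_K_cc: "lin_trace (\<lambda>b. K (cc (b, 0) V)) = 2 * p^3 * (h a a * th V)"
proof -
  have "lin_trace (\<lambda>b. K (cc (b, 0) V)) = lin_trace (\<lambda>b. (p * snd V) *\<^sub>R K b
      - ((p^3 * th V * h a b) *\<^sub>R a - (p^3 * th V * h a a) *\<^sub>R b) - (p^4 * h a b) *\<^sub>R K (K (fst V)))"
    by (rule arg_cong[where f=lin_trace])
      (auto simp: cc_def th_def fun_eq_iff K_simps K_a K_K algebra_simps numeral_eq_Suc)
  also have "\<dots> = p * snd V * 0 - ((p^3 * th V) * h a a - p^3 * th V * h a a * 3) - p^4 * h a (K (K (fst V)))"
    unfolding lin_trace_diff lin_trace_scaleR lin_trace_id lin_trace_K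
    by (subst lin_trace_rank_one, (rule linearI; simp add: lin_simps algebra_simps))+ simp
  finally show ?thesis by (simp add: a_K)
qed

definition om' :: "(real ^ 3) \<times> real \<Rightarrow> (real ^ 3) \<times> real \<Rightarrow> real" where
  "om' U V = - h (fst U) (fst V) - p^2 * (B (fst U) (fst V) + h (K (fst U)) (fst V))
     - 3 * p^4 * (h a (fst U) * h a (fst V))
     + 2 * p^3 * (snd U * h a (fst V) + snd V * h a (fst U)) + 3 * p^4 * (h a a * h (fst U) (fst V))
     - 5 * p^6 * (h a a * (th U * th V)) - p^7 * h a a * (h a (fst U) * th V + th U * h a (fst V))"

text \<open>\<open>om'\<close> is the derivative of \<open>om\<close> with respect to \<open>\<rho>\<close>; the first line below is the
  covariant divergence of \<open>cc\<close>.\<close>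

lemma ricci_identity:
  "- (p^5 * (B a (fst U) * th V + th U * B a (fst V)))
   - p^3 * (p * B (K (fst U)) (fst V) + p * B (K (fst V)) (fst U) - 2 * th V * h a (fst U) - 2 * th U * h a (fst V))
   + om' U V + 3 * p^2 * (snd U * snd V) + 3 * p * om U V
   - (lin_trace (\<lambda>b. cc U (cc (b, 0) V, om (b, 0) V)) + om U (cc (0, 1) V, om (0, 1) V))
   = - 2 * h (fst U) (fst V)"
proof -
  obtain u s v t where UV: "U = (u, s)" "V = (v, t)" by (metis surj_pair)
  have om: "om (b, 0) V = tau b v - p * h a (cc (b, 0) V)" for b by (simp add: om_def UV)
  define z where "z = cc (0, 1) V"
  have z: "z = p *\<^sub>R v - (p^4 * th V) *\<^sub>R a - p^3 *\<^sub>R K v"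
    by (simp add: z_def cc_def th_def UV K_simps zero_right zero_left)
  have om1: "om (0, 1) V = - p * h a z"
    by (simp add: om_def tau_def UV lin_simps z_def[unfolded UV])
  have az: "h a z = p * h a v - p^4 * th V * h a a"
    and uz: "h u z = p * h u v - p^4 * th V * h a u + p^3 * h (K u) v"
    and Kuz: "h (K u) z = p * h (K u) v - p^3 * (h a a * h u v - h a u * h a v)"
    and Buz: "B u z = p * B u v - p^4 * th V * B u a - p^3 * B u (K v)"
    using K_antisym[of u v] by (simp_all add: z lin_simps a_K K_a_left h_KK sym[of u a])
  have acc: "h a (cc U W) = p * (s * h a (fst W) + snd W * h a u) + p^2 * h u (fst W) * h a a
      - p^4 * (th U * th W) * h a a" for W
    by (simp add: cc_def UV lin_simps a_K)
  have th1: "th (z, om (0, 1) V) = 0" by (simp add: th_def om1)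
  have 1: "om U (z, om (0, 1) V) = - \<rho> * h u z + p * (B u z + h (K u) z) + p^3 * (h a u * h a z)
      - p * (p * (s * h a z - p * h a z * h a u) + p^2 * h u z * h a a)"
    unfolding om_def[of U] acc th1 by (simp add: tau_def UV om1[unfolded UV])
  have ca: "h u (cc (a, 0) V) = p * t * h a u + p^2 * h a v * h a u - p^5 * h a a * th V * h a u
      + p^4 * h a a * h (K u) v"
    using K_antisym[of u v] by (simp add: cc_def th_def UV lin_simps K_a sym[of u a] algebra_simps numeral_eq_Suc)
  have cu: "h a (cc (u, 0) V) = p * t * h a u + p^2 * h u v * h a a - p^5 * h a u * th V * h a a"
    by (simp add: cc_def th_def UV lin_simps a_K algebra_simps numeral_eq_Suc)
  have vK: "h (K v) u = - h (K u) v" using K_antisym[of u v] sym[of u "K v"] by simp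
  have taus: "tau u v = - \<rho> * h u v + p * (B u v + h (K u) v) + p^3 * (h a u * h a v)"
    "tau a v = - \<rho> * h a v + p * B a v + p^3 * (h a a * h a v)"
    "tau (K u) v = - \<rho> * h (K u) v + p * (B (K u) v + h a u * h a v - h a a * h u v)"
    by (simp_all add: tau_def K_a lin_simps K_K a_K)
  \<comment> \<open>The Beltrami equation enters through \<open>B_anti\<close>: it exchanges the
    arguments of \<open>B\<close> at the cost of terms in \<open>h\<close> and \<open>a\<close>, so
    that only one arrangement of each pair remains.\<close>
  have Bs: "B u a = B a u" "B u (K v) = B (K v) u - 2 * (h a a * h u v - h a u * h a v)"
    using B_anti[of u a] B_anti[of u "K v"] by (simp_all add: K_a_left h_KK)
  have omUV: "om U V = tau u v - p * (p * (s * h a v + t * h a u) + p^2 * h u v * h a a - p^4 * (th U * th V) * h a a)"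
    unfolding om_def acc by (simp add: UV)
  have thU: "th U = s + p * h a u" and thV: "th V = t + p * h a v" by (simp_all add: th_def UV)
  \<comment> \<open>After the traces have been evaluated the claim concerns scalars only: it is a
    polynomial identity modulo the relation \<open>\<rho> * p = 1\<close>.\<close>
  have goal_eq: "- (p^5 * (B a u * th V + th U * B a v))
   - p^3 * (p * B (K u) v + p * B (K v) u - 2 * th V * h a u - 2 * th U * h a v)
   + om' U V + 3 * p^2 * (s * t) + 3 * p * om U V
   - (p * (s * (3 * p * t + p^2 * h a v - p^5 * (h a a * th V)) + tau u v - p * h a (cc (u, 0) V))
      + p^2 * h u (cc (a, 0) V) - p^4 * (th U * tau a v) - p^3 * (tau (K u) v + th U * (2 * p^3 * (h a a * th V)))
      + om U (z, om (0, 1) V)) = - 2 * h u v"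
    unfolding 1 uz Kuz Buz az ca cu taus Bs omUV om'_def thU thV
    using \<rho>p unfolding UV fst_conv snd_conv
    by algebra
  show ?thesis
    unfolding om lin_trace_cc_comp[OF linear_cc linear_tau(1)] lin_trace_cc_left lin_trace_K_cc z_def[symmetric]
    using goal_eq by (simp add: UV)
qed

end

subsection \<open>Directional derivatives\<close>

lemma has_derivative_dir_deriv: "f differentiable at x \<Longrightarrow> (f has_derivative dir_deriv f x) (at x)"
  unfolding dir_deriv_def[abs_def] by (simp add: frechet_derivative_works)

lemma dir_deriv_eq: "(f has_derivative D) (at x) \<Longrightarrow> dir_deriv f x = D"
  using frechet_derivative_at[of f D x] by (auto simp: dir_deriv_def fun_eq_iff)

lemma linear_dir_deriv: "f differentiable at x \<Longrightarrow> linear (dir_deriv f x)"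
  using has_derivative_dir_deriv has_derivative_linear by blast

lemma has_derivative_cong_open:
  "(f has_derivative D) (at x) \<Longrightarrow> open S \<Longrightarrow> x \<in> S \<Longrightarrow> (\<And>y. y \<in> S \<Longrightarrow> f y = g y) \<Longrightarrow> (g has_derivative D) (at x)"
  by (rule has_derivative_transform_within_open)

lemma differentiable_cong_open:
  "f differentiable at x \<Longrightarrow> open S \<Longrightarrow> x \<in> S \<Longrightarrow> (\<And>y. y \<in> S \<Longrightarrow> f y = g y) \<Longrightarrow> g differentiable at x"
  unfolding differentiable_def using has_derivative_cong_open by blast

lemma dir_deriv_cong_open:
  assumes "f differentiable at x" "open S" "x \<in> S" "\<And>y. y \<in> S \<Longrightarrow> f y = g y"
  shows "dir_deriv g x = dir_deriv f x"
  by (rule dir_deriv_eq[OF has_derivative_cong_open[OF has_derivative_dir_deriv]]) fact+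

lemma differentiable_inner_left: "f differentiable at x \<Longrightarrow> (\<lambda>y. f y \<bullet> b) differentiable at x"
  unfolding differentiable_def by (blast intro: has_derivative_inner_left)

lemma dir_deriv_inner_left: "f differentiable at x \<Longrightarrow> dir_deriv (\<lambda>y. f y \<bullet> b) x u = dir_deriv f x u \<bullet> b"
  by (subst dir_deriv_eq[OF has_derivative_inner_left[OF has_derivative_dir_deriv]]) auto

text \<open>Expansion in a basis leaves finitely many coefficient functions, so the three-factor
  product rule follows from differentiability of each coefficient. The base point \<open>f y\<close>
  may move in another space, which covers pullbacks.\<close>

lemma bilinear_form_has_derivative:
  fixes C :: "'w::euclidean_space \<Rightarrow> 'w \<Rightarrow> 'w \<Rightarrow> 'f::real_normed_vector"
    and f a b :: "'v::real_normed_vector \<Rightarrow> 'w"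
  assumes T: "open T" "f x \<in> T" and bil: "\<And>z. z \<in> T \<Longrightarrow> bilinear (C z)"
    and dif: "\<And>u v. (\<lambda>z. C z u v) differentiable at (f x)"
    and f: "(f has_derivative f') (at x)" and a: "(a has_derivative a') (at x)" and b: "(b has_derivative b') (at x)"
  shows "((\<lambda>y. C (f y) (a y) (b y)) has_derivative
    (\<lambda>h. dir_deriv (\<lambda>z. C z (a x) (b x)) (f x) (f' h) + C (f x) (a' h) (b x) + C (f x) (a x) (b' h))) (at x)"
proof -
  have expand: "C z u v = (\<Sum>i\<in>Basis. \<Sum>j\<in>Basis. ((u \<bullet> i) * (v \<bullet> j)) *\<^sub>R C z i j)" if "z \<in> T" for z u v
  proof -
    have lin: "linear (\<lambda>u. C z u v)" "linear (\<lambda>v. C z u v)" for u v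
      using bil[OF that] by (auto simp: bilinear_def)
    have "C z u v = (\<Sum>i\<in>Basis. (u \<bullet> i) *\<^sub>R C z i v)"
      by (rule linear_eq_sum_Basis[OF lin(1)])
    also have "\<dots> = (\<Sum>i\<in>Basis. \<Sum>j\<in>Basis. ((u \<bullet> i) * (v \<bullet> j)) *\<^sub>R C z i j)"
      by (subst linear_eq_sum_Basis[OF lin(2)]) (simp add: scaleR_sum_right)
    finally show ?thesis .
  qed
  have D: "((\<lambda>z. C z i j) has_derivative dir_deriv (\<lambda>z. C z i j) (f x)) (at (f x))" for i j
    by (rule has_derivative_dir_deriv[OF dif])
  have DC: "dir_deriv (\<lambda>z. C z u v) (f x) w = (\<Sum>i\<in>Basis. \<Sum>j\<in>Basis. ((u \<bullet> i) * (v \<bullet> j)) *\<^sub>R dir_deriv (\<lambda>z. C z i j) (f x) w)" for u v w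
  proof -
    have "((\<lambda>z. \<Sum>i\<in>Basis. \<Sum>j\<in>Basis. ((u \<bullet> i) * (v \<bullet> j)) *\<^sub>R C z i j) has_derivative
      (\<lambda>w. \<Sum>i\<in>Basis. \<Sum>j\<in>Basis. ((u \<bullet> i) * (v \<bullet> j)) *\<^sub>R dir_deriv (\<lambda>z. C z i j) (f x) w)) (at (f x))"
      by (intro has_derivative_sum has_derivative_scaleR_right D)
    then have "((\<lambda>z. C z u v) has_derivative
      (\<lambda>w. \<Sum>i\<in>Basis. \<Sum>j\<in>Basis. ((u \<bullet> i) * (v \<bullet> j)) *\<^sub>R dir_deriv (\<lambda>z. C z i j) (f x) w)) (at (f x))"
      by (rule has_derivative_cong_open[OF _ T]) (rule expand[symmetric])
    from dir_deriv_eq[OF this] show ?thesis by simp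
  qed
  have Df: "((\<lambda>y. C (f y) i j) has_derivative (\<lambda>h. dir_deriv (\<lambda>z. C z i j) (f x) (f' h))) (at x)" for i j
    by (rule has_derivative_compose[OF f D])
  have "((\<lambda>y. \<Sum>i\<in>Basis. \<Sum>j\<in>Basis. ((a y \<bullet> i) * (b y \<bullet> j)) *\<^sub>R C (f y) i j) has_derivative
     (\<lambda>h. \<Sum>i\<in>Basis. \<Sum>j\<in>Basis. ((a x \<bullet> i) * (b x \<bullet> j)) *\<^sub>R dir_deriv (\<lambda>z. C z i j) (f x) (f' h)
        + ((a x \<bullet> i) * (b' h \<bullet> j) + (a' h \<bullet> i) * (b x \<bullet> j)) *\<^sub>R C (f x) i j)) (at x)"
    by (intro has_derivative_sum has_derivative_scaleR has_derivative_mult has_derivative_inner_left a b Df)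
  moreover have "(\<Sum>i\<in>Basis. \<Sum>j\<in>Basis. ((a x \<bullet> i) * (b x \<bullet> j)) *\<^sub>R dir_deriv (\<lambda>z. C z i j) (f x) (f' h)
        + ((a x \<bullet> i) * (b' h \<bullet> j) + (a' h \<bullet> i) * (b x \<bullet> j)) *\<^sub>R C (f x) i j)
      = dir_deriv (\<lambda>z. C z (a x) (b x)) (f x) (f' h) + C (f x) (a' h) (b x) + C (f x) (a x) (b' h)" for h
    unfolding DC[of "a x" "b x"] expand[OF T(2), of "a' h"] expand[OF T(2), of "a x" "b' h"]
    by (simp add: sum.distrib scaleR_add_left algebra_simps)
  ultimately have der: "((\<lambda>y. \<Sum>i\<in>Basis. \<Sum>j\<in>Basis. ((a y \<bullet> i) * (b y \<bullet> j)) *\<^sub>R C (f y) i j) has_derivative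
     (\<lambda>h. dir_deriv (\<lambda>z. C z (a x) (b x)) (f x) (f' h) + C (f x) (a' h) (b x) + C (f x) (a x) (b' h))) (at x)"
    by simp
  have "\<forall>\<^sub>F y in at x. f y \<in> T"
    using has_derivative_continuous[OF f] T by (auto simp: continuous_within topological_tendstoD)
  then have "\<forall>\<^sub>F y in at x. (\<Sum>i\<in>Basis. \<Sum>j\<in>Basis. ((a y \<bullet> i) * (b y \<bullet> j)) *\<^sub>R C (f y) i j) = C (f y) (a y) (b y)"
    by (rule eventually_mono) (rule expand[symmetric])
  then show ?thesis
    by (rule has_derivative_transform_eventually[OF der]) (rule expand[OF T(2), symmetric], simp)
qed

subsection \<open>Real-analytic functions\<close>

definition ra_on :: "('v::euclidean_space \<Rightarrow> real) \<Rightarrow> 'v set \<Rightarrow> bool" where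
  "ra_on f S \<longleftrightarrow> ext_hol (\<lambda>x. complex_of_real (f x)) S"

lemma ra_const: "ra_on (\<lambda>_. c) S"
  by (simp add: ra_on_def ext_hol_const)

lemma ra_add: "open S \<Longrightarrow> ra_on f S \<Longrightarrow> ra_on g S \<Longrightarrow> ra_on (\<lambda>x. f x + g x) S"
  and ra_mult: "open S \<Longrightarrow> ra_on f S \<Longrightarrow> ra_on g S \<Longrightarrow> ra_on (\<lambda>x. f x * g x) S"
  and ra_diff: "open S \<Longrightarrow> ra_on f S \<Longrightarrow> ra_on g S \<Longrightarrow> ra_on (\<lambda>x. f x - g x) S"
  by (simp_all add: ra_on_def ext_hol_add ext_hol_mult ext_hol_diff)

lemma ra_sum: "open S \<Longrightarrow> (\<And>i. i \<in> I \<Longrightarrow> ra_on (f i) S) \<Longrightarrow> ra_on (\<lambda>x. \<Sum>i\<in>I. f i x) S"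
  by (simp add: ra_on_def ext_hol_sum)

lemma ra_inverse: "open S \<Longrightarrow> ra_on f S \<Longrightarrow> (\<And>x. x \<in> S \<Longrightarrow> f x \<noteq> 0) \<Longrightarrow> ra_on (\<lambda>x. inverse (f x)) S"
  by (simp add: ra_on_def ext_hol_inverse)

lemma ra_cong: "ra_on f S \<Longrightarrow> open S \<Longrightarrow> (\<And>x. x \<in> S \<Longrightarrow> f x = g x) \<Longrightarrow> ra_on g S"
  unfolding ra_on_def by (erule ext_hol_cong) auto

lemma ra_real_analytic: "real_analytic_on f S \<Longrightarrow> ra_on f S"
  by (simp add: ra_on_def ext_hol_real_analytic)

lemma ra_has_derivative:
  assumes "open S" "ra_on f S" "x \<in> S"
  shows "(f has_derivative (\<lambda>u. Re (frechet_derivative (\<lambda>x. complex_of_real (f x)) (at x) u))) (at x)"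
proof -
  have "(\<lambda>x. complex_of_real (f x)) differentiable at x"
    using assms unfolding ra_on_def by (rule ext_hol_differentiable)
  then have "((\<lambda>x. complex_of_real (f x)) has_derivative frechet_derivative (\<lambda>x. complex_of_real (f x)) (at x)) (at x)"
    by (simp add: frechet_derivative_works)
  from has_derivative_Re[OF this] show ?thesis by simp
qed

lemma ra_differentiable: "open S \<Longrightarrow> ra_on f S \<Longrightarrow> x \<in> S \<Longrightarrow> f differentiable at x"
  by (rule differentiableI, rule ra_has_derivative)

lemma ra_dir_deriv:
  assumes "open S" "ra_on f S"
  shows "ra_on (\<lambda>x. dir_deriv f x u) S"
  unfolding ra_on_def
proof (rule ext_hol_cong[OF ext_hol_frechet_derivative])
  show "ext_hol (\<lambda>x. complex_of_real (f x)) S" using assms by (simp add: ra_on_def)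
  fix x assume "x \<in> S"
  note ra_differentiable[OF assms this]
  then have "((\<lambda>x. complex_of_real (f x)) has_derivative (\<lambda>u. complex_of_real (dir_deriv f x u))) (at x)"
    by (intro has_derivative_of_real has_derivative_dir_deriv)
  from frechet_derivative_at[OF this]
  show "frechet_derivative (\<lambda>x. complex_of_real (f x)) (at x) u = complex_of_real (dir_deriv f x u)" by metis
qed (use assms in auto)

lemma ra_det:
  fixes m :: "'v::euclidean_space \<Rightarrow> real ^ 3 ^ 3"
  assumes "open S" "\<And>r c. ra_on (\<lambda>y. m y $ r $ c) S"
  shows "ra_on (\<lambda>y. det (m y)) S"
  unfolding det_3 by (intro ra_add ra_diff ra_mult assms)

lemma ra_identity:
  assumes "open S" "ra_on f S" "x \<in> S"
  obtains r where "r > 0" "ball x r \<subseteq> S"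
    "\<And>T y0 y. open T \<Longrightarrow> y0 \<in> T \<Longrightarrow> y0 \<in> ball x r \<Longrightarrow> (\<And>y. y \<in> T \<Longrightarrow> f y = 0) \<Longrightarrow> y \<in> ball x r \<Longrightarrow> f y = 0"
proof -
  obtain r F where r: "r > 0" "cpair.ghol F (ball (x, 0) r)" "\<And>y. y \<in> ball x r \<Longrightarrow> F (y, 0) = complex_of_real (f y)" "ball x r \<subseteq> S"
    using ext_holE[OF assms(2)[unfolded ra_on_def] assms(3,1)] by metis
  show ?thesis
  proof (rule that[OF r(1,4)])
    fix T y0 y assume *: "open T" "y0 \<in> T" "y0 \<in> ball x r" "\<And>y. y \<in> T \<Longrightarrow> f y = 0" "y \<in> ball x r"
    have "complex_of_real (f y) = 0"
      by (rule ext_hol_identity[OF r(2,3) *(1-3) _ *(5)]) (simp_all add: *(4))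
    then show "f y = 0" by simp
  qed
qed

subsection \<open>Analytic metrics on a domain of three-space\<close>

text \<open>The infinitesimal form of the multiplicativity of determinants: \<open>L\<close> acting
  as a derivation on an alternating form of top degree multiplies it by the trace of
  \<open>L\<close>.\<close>

lemma trilinear_trace:
  fixes L :: "real ^ 3 \<Rightarrow> real ^ 3"
  assumes h: "inner3 h" and L: "linear L"
  shows "inner3.vol h (L u) v w + inner3.vol h u (L v) w + inner3.vol h u v (L w) = lin_trace L * inner3.vol h u v w"
proof -
  interpret inner3 h by fact
  obtain e where on: "\<And>i j. h (e i) (e j) = (if i = j then 1 else 0)"
    and rep: "\<And>u. u = (\<Sum>i\<in>UNIV. h u (e i) *\<^sub>R e i)"
    and vol: "\<And>u v w. vol u v w = det (vector [\<chi> i. h u (e i), \<chi> i. h v (e i), \<chi> i. h w (e i)] :: real ^ 3 ^ 3)"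
    by (rule orthonormal_frame) blast
  have "h (L u) (e i) = (\<Sum>j\<in>UNIV. h u (e j) * h (L (e j)) (e i))" for u i
    by (subst rep[of u]) (simp add: linear_sum[OF L] linear_cmul[OF L] sum_left scaleR_left)
  then have Lc: "h (L u) (e i) = h u (e 1) * h (L (e 1)) (e i) + h u (e 2) * h (L (e 2)) (e i) + h u (e 3) * h (L (e 3)) (e i)" for u i
    unfolding sum_3 by blast
  show ?thesis
    unfolding lin_trace_frame[OF rep L] vol det_3 vector_3 vec_lambda_beta sum_3 Lc[of u] Lc[of v] Lc[of w]
    by (simp add: algebra_simps)
qed

locale metric3 =
  fixes S :: "(real ^ 3) set" and H :: "real ^ 3 \<Rightarrow> real ^ 3 \<Rightarrow> real ^ 3 \<Rightarrow> real"
  assumes S: "open S" and H: "\<And>y. y \<in> S \<Longrightarrow> inner3 (H y)" and H_ra: "\<And>u v. ra_on (\<lambda>y. H y u v) S"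
begin

definition ginv :: "real ^ 3 \<Rightarrow> real ^ 3 ^ 3" where
  "ginv y = matrix_inv (gram (H y))"

text \<open>An explicit formula for the dual vector through the inverse Gram matrix. The
  descriptions by \<open>THE\<close> in \<open>sharp\<close> and \<open>christoffel\<close> give no
  access to the dependence on the point; uniqueness identifies them with this formula.\<close>

definition raise :: "real ^ 3 \<Rightarrow> (real ^ 3 \<Rightarrow> real) \<Rightarrow> real ^ 3" where
  "raise y \<alpha> = (\<Sum>k\<in>UNIV. (\<Sum>i\<in>UNIV. ginv y $ k $ i * \<alpha> (axis i 1)) *\<^sub>R axis k 1)"

definition DH :: "real ^ 3 \<Rightarrow> real ^ 3 \<Rightarrow> real ^ 3 \<Rightarrow> real ^ 3 \<Rightarrow> real" where
  "DH x u v w = dir_deriv (\<lambda>y. H y v w) x u"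

definition koszul :: "real ^ 3 \<Rightarrow> real ^ 3 \<Rightarrow> real ^ 3 \<Rightarrow> real ^ 3 \<Rightarrow> real" where
  "koszul x u v z = (DH x u v z + DH x v u z - DH x z u v) / 2"

lemma det_gram_nonzero: "y \<in> S \<Longrightarrow> det (gram (H y)) \<noteq> 0"
  using inner3.orthonormal_frame[OF H[of y]] by (metis mult_zero_left real_sqrt_zero zero_neq_one)

lemma gram_mult_ginv: "y \<in> S \<Longrightarrow> gram (H y) ** ginv y = mat 1"
proof -
  assume "y \<in> S"
  then have "invertible (gram (H y))" using det_gram_nonzero invertible_det_nz by blast
  then have "gram (H y) ** matrix_inv (gram (H y)) = mat 1 \<and> matrix_inv (gram (H y)) ** gram (H y) = mat 1"
    unfolding matrix_inv_def invertible_def by (rule someI_ex)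
  then show ?thesis by (simp add: ginv_def)
qed

text \<open>By Cramer's rule the entries are quotients of determinants in the metric coefficients,
  with a denominator that has no zero.\<close>

lemma ginv_ra: "ra_on (\<lambda>y. ginv y $ k $ i) S"
proof (rule ra_cong[OF _ S])
  have g: "ra_on (\<lambda>y. gram (H y) $ r $ c) S" for r c
    by (simp add: gram_def H_ra)
  have m: "ra_on (\<lambda>y. (if c = k then axis i 1 $ r else gram (H y) $ r $ c)) S" for r c :: 3
    by (cases "c = k") (simp_all add: ra_const g)
  show "ra_on (\<lambda>y. det (\<chi> r c. if c = k then axis i 1 $ r else gram (H y) $ r $ c) * inverse (det (gram (H y)))) S"
    by (intro ra_mult ra_inverse ra_det S det_gram_nonzero) (simp_all add: g m)
  fix y assume y: "y \<in> S"
  have "gram (H y) *v (ginv y *v axis i 1) = axis i 1"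
    by (simp add: matrix_vector_mul_assoc gram_mult_ginv[OF y])
  then have "ginv y *v axis i 1 = (\<chi> k. det (\<chi> r c. if c = k then axis i 1 $ r else gram (H y) $ r $ c) / det (gram (H y)))"
    using cramer[OF det_gram_nonzero[OF y]] by blast
  moreover have "(ginv y *v axis i 1) $ k = ginv y $ k $ i"
    by (simp add: matrix_vector_mult_basis column_def)
  ultimately show "det (\<chi> r c. if c = k then axis i 1 $ r else gram (H y) $ r $ c) * inverse (det (gram (H y))) = ginv y $ k $ i"
    by (metis (no_types, lifting) divide_inverse vec_lambda_beta)
qed

lemma expand_axis: "u = (\<Sum>k\<in>UNIV. u $ k *\<^sub>R axis k 1)" for u :: "real ^ 3"
  using basis_expansion[of u] by (simp add: scalar_mult_eq_scaleR)

lemma H_raise: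
  assumes y: "y \<in> S" and \<alpha>: "linear \<alpha>"
  shows "H y (raise y \<alpha>) z = \<alpha> z"
proof -
  interpret inner3 "H y" by (rule H[OF y])
  have "H y (axis j 1) (raise y \<alpha>) = \<alpha> (axis j 1)" for j
  proof -
    have "H y (axis j 1) (raise y \<alpha>) = (\<Sum>i\<in>UNIV. (\<Sum>k\<in>UNIV. gram (H y) $ j $ k * ginv y $ k $ i) * \<alpha> (axis i 1))"
      by (simp only: raise_def sum_right scaleR_right) (simp add: gram_def sum_3 algebra_simps)
    also have "\<dots> = (\<Sum>i\<in>UNIV. (gram (H y) ** ginv y) $ j $ i * \<alpha> (axis i 1))"
      by (simp add: matrix_matrix_mult_def)
    also have "\<dots> = \<alpha> (axis j 1)"
      unfolding gram_mult_ginv[OF y] by (simp add: mat_def if_distrib if_distribR cong: if_cong)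
    finally show ?thesis .
  qed
  then have "H y (\<Sum>j\<in>UNIV. z $ j *\<^sub>R axis j 1) (raise y \<alpha>) = \<alpha> (\<Sum>j\<in>UNIV. z $ j *\<^sub>R axis j 1)"
    by (simp add: sum_left scaleR_left linear_sum[OF \<alpha>] linear_cmul[OF \<alpha>])
  then show ?thesis by (simp add: sym[of "raise y \<alpha>"] flip: expand_axis)
qed

lemma raise_unique: "y \<in> S \<Longrightarrow> linear \<alpha> \<Longrightarrow> (\<And>z. H y w z = \<alpha> z) \<Longrightarrow> w = raise y \<alpha>"
  by (rule inner3.eqI[OF H], assumption) (simp only: H_raise)

lemma sharp_eq: "y \<in> S \<Longrightarrow> linear (\<alpha> y) \<Longrightarrow> sharp H \<alpha> y = raise y (\<alpha> y)"
  unfolding sharp_def by (rule the_equality) (auto simp: H_raise intro: raise_unique)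

lemma raise_differentiable:
  assumes "x \<in> S" "\<And>i. (\<lambda>y. \<alpha> y (axis i 1)) differentiable at x"
  shows "(\<lambda>y. raise y (\<alpha> y)) differentiable at x"
  unfolding raise_def
  by (intro differentiable_sum ballI differentiable_scaleR differentiable_mult differentiable_const
      ra_differentiable[OF S ginv_ra] assms) auto

lemma H_differentiable: "x \<in> S \<Longrightarrow> (\<lambda>y. H y u v) differentiable at x"
  by (rule ra_differentiable[OF S H_ra])

lemma DH_linear_dir: "x \<in> S \<Longrightarrow> linear (\<lambda>u. DH x u v w)"
  unfolding DH_def using linear_dir_deriv[OF H_differentiable, of x v w] by (simp add: eta_contract_eq)

lemma DH_sym: "x \<in> S \<Longrightarrow> DH x u v w = DH x u w v"
  unfolding DH_def by (subst dir_deriv_cong_open[OF H_differentiable S]) (auto simp: inner3.sym[OF H])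

lemma DH_linear_right:
  assumes x: "x \<in> S" shows "linear (\<lambda>w. DH x u v w)"
proof (rule linearI)
  have D: "((\<lambda>y. H y v w) has_derivative dir_deriv (\<lambda>y. H y v w) x) (at x)" for w
    by (rule has_derivative_dir_deriv[OF H_differentiable[OF x]])
  fix w1 w2 :: "real ^ 3" and c
  have "((\<lambda>y. H y v (w1 + w2)) has_derivative (\<lambda>u. DH x u v w1 + DH x u v w2)) (at x)"
    unfolding DH_def
    by (rule has_derivative_cong_open[OF has_derivative_add[OF D D] S x]) (simp add: inner3.add_right[OF H])
  then show "DH x u v (w1 + w2) = DH x u v w1 + DH x u v w2"
    unfolding DH_def[of x u v "w1 + w2"] by (simp add: dir_deriv_eq)
  have "((\<lambda>y. H y v (c *\<^sub>R w1)) has_derivative (\<lambda>u. c * DH x u v w1)) (at x)"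
    unfolding DH_def
    by (rule has_derivative_cong_open[OF has_derivative_mult_right[OF D] S x]) (simp add: inner3.scaleR_right[OF H])
  then show "DH x u v (c *\<^sub>R w1) = c *\<^sub>R DH x u v w1"
    unfolding DH_def[of x u v "c *\<^sub>R w1"] by (simp add: dir_deriv_eq)
qed

lemma DH_linear_left: "x \<in> S \<Longrightarrow> linear (\<lambda>v. DH x u v w)"
  using DH_linear_right[of x u w] by (subst DH_sym) auto

lemma koszul_linear: "x \<in> S \<Longrightarrow> linear (koszul x u v)"
  by (intro linearI)
    (simp_all add: koszul_def linear_add[OF DH_linear_right] linear_add[OF DH_linear_dir]
      linear_cmul[OF DH_linear_right] linear_cmul[OF DH_linear_dir] field_simps)

definition chr :: "real ^ 3 \<Rightarrow> real ^ 3 \<Rightarrow> real ^ 3 \<Rightarrow> real ^ 3" where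
  "chr x u v = raise x (koszul x u v)"

lemma christoffel_eq: "x \<in> S \<Longrightarrow> christoffel H x u v = chr x u v"
  unfolding christoffel_def chr_def koszul_def[symmetric, unfolded DH_def]
  by (rule the_equality) (auto simp: H_raise koszul_linear intro: raise_unique)

lemma H_chr: "x \<in> S \<Longrightarrow> H x (chr x u v) z = koszul x u v z"
  unfolding chr_def by (simp add: H_raise koszul_linear)

lemma chr_sym: "x \<in> S \<Longrightarrow> chr x u v = chr x v u"
  by (rule inner3.eqI[OF H]) (auto simp: H_chr koszul_def DH_sym[of x _ u v])

lemma chr_linear: assumes x: "x \<in> S" shows "linear (chr x u)" "linear (\<lambda>u. chr x u v)"
proof -
  interpret inner3 "H x" by (rule H[OF x])
  show 1: "linear (chr x u)" for u
    by (rule linearI; rule eqI)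
      (simp_all add: H_chr x add_left scaleR_left koszul_def linear_add[OF DH_linear_right] linear_add[OF DH_linear_left]
        linear_add[OF DH_linear_dir] linear_cmul[OF DH_linear_right] linear_cmul[OF DH_linear_left]
        linear_cmul[OF DH_linear_dir] field_simps)
  show "linear (\<lambda>u. chr x u v)"
    using 1[of v] by (subst chr_sym[OF x])
qed

lemma chr_ra: "ra_on (\<lambda>y. chr y u v $ k) S"
proof -
  have "chr y u v $ k = (\<Sum>i\<in>UNIV. ginv y $ k $ i * koszul y u v (axis i 1))" for y
    by (simp add: chr_def raise_def axis_def if_distrib sum.delta cong: if_cong)
  moreover have "ra_on (\<lambda>y. koszul y u v z) S" for z
  proof -
    have "ra_on (\<lambda>y. (1/2) * (DH y u v z + DH y v u z - DH y z u v)) S"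
      unfolding DH_def by (intro ra_mult ra_add ra_diff ra_const ra_dir_deriv S H_ra)
    then show ?thesis by (simp add: koszul_def)
  qed
  ultimately show ?thesis by (simp add: ra_sum ra_mult S ginv_ra)
qed

lemma differentiable_chr: "x \<in> S \<Longrightarrow> (\<lambda>y. chr y u v) differentiable at x"
proof -
  assume x: "x \<in> S"
  have "(\<lambda>y. \<Sum>k\<in>UNIV. chr y u v $ k *\<^sub>R axis k 1 :: real ^ 3) differentiable at x"
    by (intro differentiable_sum ballI differentiable_scaleR differentiable_const ra_differentiable[OF S chr_ra x]) auto
  then show ?thesis by (simp only: expand_axis[symmetric])
qed

text \<open>Metric compatibility of the Levi-Civita connection: adding two instances of the Koszul
  expression cancels all but one derivative of the metric.\<close>

lemma DH_chr:
  assumes x: "x \<in> S" shows "DH x u v w = H x (chr x u v) w + H x v (chr x u w)"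
proof -
  have "H x v (chr x u w) = koszul x u w v"
    using inner3.sym[OF H[OF x], of v] H_chr[OF x] by simp
  then show ?thesis
    by (simp add: H_chr x koszul_def DH_sym[OF x, of u w v] DH_sym[OF x, of w v u] field_simps)
qed

lemma curvature_eq:
  assumes x: "x \<in> S"
  shows "curvature H x u v w = dir_deriv (\<lambda>y. chr y v w) x u - dir_deriv (\<lambda>y. chr y u w) x v
     + chr x u (chr x v w) - chr x v (chr x u w)"
proof -
  have "dir_deriv (\<lambda>y. christoffel H y v w) x = dir_deriv (\<lambda>y. chr y v w) x" for v w
    by (rule dir_deriv_cong_open[OF differentiable_chr[OF x] S x]) (simp add: christoffel_eq)
  then show ?thesis by (simp add: curvature_def christoffel_eq x)
qed

lemma chr_ra_inner: "ra_on (\<lambda>y. chr y u v \<bullet> b) S"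
proof -
  have "ra_on (\<lambda>y. \<Sum>k\<in>UNIV. chr y u v $ k * b $ k) S"
    by (intro ra_sum ra_mult S chr_ra ra_const)
  then show ?thesis by (simp add: inner_vec_def)
qed

lemma ricci_ra: "ra_on (\<lambda>y. ricci H y v w) S"
proof (rule ra_cong[OF _ S])
  let ?d = "\<lambda>u v w b y. dir_deriv (\<lambda>y. chr y v w \<bullet> b) y u"
  let ?q = "\<lambda>u v w b y. \<Sum>k\<in>UNIV. chr y v w $ k * (chr y u (axis k 1) \<bullet> b)"
  show "ra_on (\<lambda>y. \<Sum>b\<in>Basis. ?d b v w b y - ?d v b w b y + ?q b v w b y - ?q v b w b y) S"
    by (intro ra_sum ra_add ra_diff ra_mult ra_dir_deriv S chr_ra chr_ra_inner)
  fix y assume y: "y \<in> S"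
  have "?q u v w b y = chr y u (chr y v w) \<bullet> b" for u v w b
    by (subst (2) expand_axis[of "chr y v w"])
      (simp add: linear_sum[OF chr_linear(1)[OF y]] linear_cmul[OF chr_linear(1)[OF y]] inner_sum_left)
  then show "(\<Sum>b\<in>Basis. ?d b v w b y - ?d v b w b y + ?q b v w b y - ?q v b w b y) = ricci H y v w"
    by (simp add: ricci_def curvature_eq[OF y] dir_deriv_inner_left[OF differentiable_chr[OF y]] inner_simps)
qed

lemma H_field_has_derivative:
  assumes x: "x \<in> S" and f: "f differentiable at x" and g: "g differentiable at x"
  shows "((\<lambda>y. H y (f y) (g y)) has_derivative (\<lambda>u. DH x u (f x) (g x) + H x (dir_deriv f x u) (g x)
     + H x (f x) (dir_deriv g x u))) (at x)"
  unfolding DH_def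
  by (rule bilinear_form_has_derivative[OF S, where f="\<lambda>y. y" and C=H])
    (auto simp: x H_differentiable has_derivative_dir_deriv f g inner3.bilinear[OF H])

text \<open>The volume form is parallel, hence the logarithmic derivative of its density is the
  trace of the Christoffel symbols.\<close>

lemma sqrt_det_has_derivative:
  assumes x: "x \<in> S"
  shows "((\<lambda>y. sqrt (det (gram (H y)))) has_derivative
    (\<lambda>u. lin_trace (chr x u) * sqrt (det (gram (H x))))) (at x)"
proof -
  interpret inner3 "H x" by (rule H[OF x])
  obtain e where on: "\<And>i j. H x (e i) (e j) = (if i = j then 1 else 0)"
    and rep: "\<And>u. u = (\<Sum>i\<in>UNIV. H x u (e i) *\<^sub>R e i)"
    and or: "sqrt (det (gram (H x))) * det (\<chi> i. e i) = 1"
    by (rule orthonormal_frame) blast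
  define d where "d = det (\<chi> i. e i)"
  have d: "d \<noteq> 0" using or by (auto simp: d_def)
  have D: "((\<lambda>y. H y u v) has_derivative (\<lambda>w. DH x w u v)) (at x)" for u v
    unfolding DH_def using has_derivative_dir_deriv[OF H_differentiable[OF x]] by (simp add: eta_contract_eq)
  \<comment> \<open>The frame is orthonormal at \<open>x\<close> and is kept constant near
    \<open>x\<close>. At \<open>x\<close> its Gram matrix is the identity, so the derivative of the
    determinant reduces to that of the trace; the constant factor \<open>d\<close> relates it to the
    Gram determinant of the standard basis.\<close>
  define \<delta> where "\<delta> y = det (\<chi> i j. H y (e i) (e j))" for y
  have \<delta>x: "\<delta> x = 1"
    by (simp add: \<delta>_def det_3 on)
  have D\<delta>: "(\<delta> has_derivative (\<lambda>u. 2 * lin_trace (chr x u))) (at x)"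
    unfolding \<delta>_def det_3 vec_lambda_beta lin_trace_frame[OF rep chr_linear(1)[OF x]]
    apply (rule has_derivative_eq_rhs)
     apply (rule derivative_intros D)+
    apply (simp add: on fun_eq_iff sum_3 DH_chr[OF x] sym[of "e _" "chr x _ _"])
    done
  have eq: "sqrt (\<delta> y) / \<bar>d\<bar> = sqrt (det (gram (H y)))" if "y \<in> S" for y
    unfolding \<delta>_def using inner3.det_gram_frame[OF H[OF that], of e, symmetric] d
    by (simp add: d_def real_sqrt_mult)
  have "(sqrt has_derivative (\<lambda>t. t / 2)) (at (\<delta> x))"
    by (rule has_derivative_eq_rhs[OF DERIV_real_sqrt[of "\<delta> x", unfolded has_field_derivative_def]])
      (auto simp: \<delta>x fun_eq_iff)
  from has_derivative_mult_left[OF has_derivative_compose[OF D\<delta> this], of "1 / \<bar>d\<bar>"]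
  have "((\<lambda>y. sqrt (\<delta> y) / \<bar>d\<bar>) has_derivative (\<lambda>u. lin_trace (chr x u) / \<bar>d\<bar>)) (at x)"
    by simp
  moreover have "sqrt (det (gram (H x))) = 1 / \<bar>d\<bar>" using eq[OF x] \<delta>x by simp
  ultimately show ?thesis
    by (intro has_derivative_cong_open[OF _ S x eq]) simp_all
qed

end

subsection \<open>The Ricci tensor\<close>

locale beltrami3 = metric3 +
  fixes A :: "real ^ 3 \<Rightarrow> real ^ 3 \<Rightarrow> real"
  assumes A_linear: "\<And>y. y \<in> S \<Longrightarrow> linear (A y)" and A_smooth: "\<And>v. smooth_on (\<lambda>y. A y v) S"
    and A_beltrami: "\<And>x u v. x \<in> S \<Longrightarrow> exterior_deriv A x u v + 2 * hodge_star H A x u v = 0"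
begin

definition DA :: "real ^ 3 \<Rightarrow> real ^ 3 \<Rightarrow> real ^ 3 \<Rightarrow> real" where
  "DA x u v = dir_deriv (\<lambda>y. A y v) x u"

definition av :: "real ^ 3 \<Rightarrow> real ^ 3" where
  "av y = raise y (A y)"

text \<open>The endomorphism dual to -dA/2. This version is visibly differentiable; the Beltrami
  equation turns it into the cross product with \<open>av\<close> in
  \<open>H_Kv_vol\<close>.\<close>

definition Kv :: "real ^ 3 \<Rightarrow> real ^ 3 \<Rightarrow> real ^ 3" where
  "Kv y u = raise y (\<lambda>z. - (1/2) * (DA y u z - DA y z u))"

definition Bv :: "real ^ 3 \<Rightarrow> real ^ 3 \<Rightarrow> real ^ 3 \<Rightarrow> real" where
  "Bv y u v = DA y u v - A y (chr y u v)"

lemma A_differentiable: "x \<in> S \<Longrightarrow> (\<lambda>y. A y v) differentiable at x"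
  using A_smooth[of v] unfolding smooth_on_def by (metis Ck_on.simps(2))

lemma A_C2: "Ck_on (Suc (Suc 0)) (\<lambda>y. A y v) S"
  using A_smooth[of v] unfolding smooth_on_def by blast

lemma DA_differentiable: "x \<in> S \<Longrightarrow> (\<lambda>y. DA y u v) differentiable at x"
  using A_C2[of v] unfolding DA_def dir_deriv_def by simp

lemma D2A_sym: "x \<in> S \<Longrightarrow> dir_deriv (\<lambda>y. DA y u v) x w = dir_deriv (\<lambda>y. DA y w v) x u"
  unfolding DA_def dir_deriv_def
  by (rule second_dir_deriv_symmetric[OF S]) (use A_C2[of v] in auto)

lemma DA_linear: assumes x: "x \<in> S" shows "linear (\<lambda>u. DA x u v)" "linear (\<lambda>v. DA x u v)"
proof -
  show "linear (\<lambda>u. DA x u v)"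
    unfolding DA_def using linear_dir_deriv[OF A_differentiable[OF x], of v] by (simp add: eta_contract_eq)
  have D: "((\<lambda>y. A y w) has_derivative dir_deriv (\<lambda>y. A y w) x) (at x)" for w
    by (rule has_derivative_dir_deriv[OF A_differentiable[OF x]])
  show "linear (\<lambda>v. DA x u v)"
  proof (rule linearI)
    fix w1 w2 :: "real ^ 3" and c
    have "((\<lambda>y. A y (w1 + w2)) has_derivative (\<lambda>u. DA x u w1 + DA x u w2)) (at x)"
      unfolding DA_def
      by (rule has_derivative_cong_open[OF has_derivative_add[OF D D] S x]) (simp add: linear_add[OF A_linear])
    then show "DA x u (w1 + w2) = DA x u w1 + DA x u w2"
      unfolding DA_def[of x u "w1 + w2"] by (simp add: dir_deriv_eq)
    have "((\<lambda>y. A y (c *\<^sub>R w1)) has_derivative (\<lambda>u. c * DA x u w1)) (at x)"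
      unfolding DA_def
      by (rule has_derivative_cong_open[OF has_derivative_mult_right[OF D] S x]) (simp add: linear_cmul[OF A_linear])
    then show "DA x u (c *\<^sub>R w1) = c *\<^sub>R DA x u w1"
      unfolding DA_def[of x u "c *\<^sub>R w1"] by (simp add: dir_deriv_eq)
  qed
qed

lemma A_simps: assumes "x \<in> S"
  shows "A x (u + v) = A x u + A x v" "A x (u - v) = A x u - A x v" "A x (c *\<^sub>R u) = c * A x u" "A x 0 = 0"
  using A_linear[OF assms] by (simp_all add: linear_add linear_diff linear_cmul linear_0)

lemma H_av: "x \<in> S \<Longrightarrow> H x (av x) z = A x z"
  unfolding av_def by (simp add: H_raise A_linear)

lemma H_Kv: assumes x: "x \<in> S" shows "H x (Kv x u) z = - (1/2) * (DA x u z - DA x z u)"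
  unfolding Kv_def
  by (rule H_raise[OF x], rule linearI)
    (simp_all add: linear_add[OF DA_linear(1)[OF x]] linear_add[OF DA_linear(2)[OF x]]
      linear_cmul[OF DA_linear(1)[OF x]] linear_cmul[OF DA_linear(2)[OF x]] field_simps)

lemma H_Kv_vol: assumes x: "x \<in> S" shows "H x (Kv x u) z = inner3.vol (H x) (av x) u z"
proof -
  have "sharp H A x = av x" by (simp add: av_def sharp_eq A_linear x)
  then have "DA x u z - DA x z u + 2 * inner3.vol (H x) (av x) u z = 0"
    using A_beltrami[OF x, of u z]
    by (simp add: exterior_deriv_def hodge_star_def volume_form_def inner3.vol_def[OF H[OF x]] DA_def)
  then show ?thesis unfolding H_Kv[OF x] by (auto simp: field_simps)
qed

lemma Bv_bilinear: assumes x: "x \<in> S" shows "bilinear (Bv x)"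
  unfolding bilinear_def Bv_def
  by (intro conjI allI linearI)
    (simp_all add: linear_add[OF DA_linear(1)[OF x]] linear_add[OF DA_linear(2)[OF x]]
      linear_cmul[OF DA_linear(1)[OF x]] linear_cmul[OF DA_linear(2)[OF x]] linear_add[OF chr_linear(1)[OF x]]
      linear_add[OF chr_linear(2)[OF x]] linear_cmul[OF chr_linear(1)[OF x]] linear_cmul[OF chr_linear(2)[OF x]]
      A_simps[OF x] algebra_simps)

lemma point: assumes x: "x \<in> S" and \<rho>: "\<rho> * p = 1"
  shows "beltrami_point (H x) (av x) (Kv x) (Bv x) \<rho> p"
proof -
  interpret inner3 "H x" by (rule H[OF x])
  show ?thesis
  proof
    show "bilinear (Bv x)" by (rule Bv_bilinear[OF x])
    show "Bv x u v - Bv x v u = - 2 * H x (Kv x u) v" for u v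
      unfolding H_Kv[OF x] Bv_def chr_sym[OF x, of v u] by (simp add: field_simps)
  qed (rule H_Kv_vol[OF x], rule \<rho>)
qed

lemma av_differentiable: "x \<in> S \<Longrightarrow> av differentiable at x"
  unfolding av_def by (intro raise_differentiable A_differentiable)

lemma Kv_differentiable: "x \<in> S \<Longrightarrow> (\<lambda>y. Kv y u) differentiable at x"
  unfolding Kv_def
  by (intro raise_differentiable differentiable_mult differentiable_const differentiable_diff DA_differentiable)

text \<open>The covariant derivative of the vector field \<open>av\<close> in direction
  \<open>u\<close>.\<close>

definition Na :: "real ^ 3 \<Rightarrow> real ^ 3 \<Rightarrow> real ^ 3" where
  "Na x u = dir_deriv av x u + chr x u (av x)"

text \<open>The covariant derivative in direction \<open>u\<close> of the endomorphism field
  \<open>Kv\<close>, applied to \<open>v\<close>. The direction is the last argument, so that traces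
  are taken over it.\<close>

definition NK :: "real ^ 3 \<Rightarrow> real ^ 3 \<Rightarrow> real ^ 3 \<Rightarrow> real ^ 3" where
  "NK x v u = dir_deriv (\<lambda>y. Kv y v) x u + chr x u (Kv x v) - Kv x (chr x u v)"

lemma linear_Da: "x \<in> S \<Longrightarrow> linear (dir_deriv av x)"
  by (rule linear_dir_deriv[OF av_differentiable])

lemma linear_Kv: "x \<in> S \<Longrightarrow> linear (Kv x)"
  using inner3_cross.K_linear[OF beltrami_point.axioms(1)[OF point[of x 1 1]]] by simp

lemma linear_Na: "x \<in> S \<Longrightarrow> linear (Na x)"
  unfolding Na_def[abs_def] by (intro linear_compose_add linear_Da chr_linear)

lemma linear_NK: assumes x: "x \<in> S" shows "linear (NK x v)"
  unfolding NK_def[abs_def]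
  using linear_compose[OF chr_linear(2)[OF x, of v] linear_Kv[OF x]]
  by (intro linear_compose_add linear_compose_sub chr_linear x linear_dir_deriv Kv_differentiable) (simp_all add: o_def x)

lemma H_Na: assumes x: "x \<in> S" shows "H x (Na x u) z = Bv x u z"
proof -
  interpret inner3 "H x" by (rule H[OF x])
  have "((\<lambda>y. H y (av y) z) has_derivative (\<lambda>u. DH x u (av x) z + H x (dir_deriv av x u) z
     + H x (av x) (dir_deriv (\<lambda>y. z) x u))) (at x)"
    by (rule H_field_has_derivative[OF x av_differentiable[OF x]]) simp
  moreover have "dir_deriv (\<lambda>y. z) x = (\<lambda>_. 0)" for z :: "real ^ 3" by (rule dir_deriv_eq) simp
  ultimately have "((\<lambda>y. A y z) has_derivative (\<lambda>u. DH x u (av x) z + H x (dir_deriv av x u) z)) (at x)"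
    by (intro has_derivative_cong_open[OF _ S x H_av]) (simp_all add: zero_right)
  from dir_deriv_eq[OF this] have "DA x u z = DH x u (av x) z + H x (dir_deriv av x u) z"
    by (simp add: DA_def)
  then show ?thesis
    by (simp add: Na_def Bv_def DH_chr[OF x] add_left H_av[OF x])
qed

text \<open>With constant \<open>v\<close> and \<open>z\<close> the function is the volume density
  times a determinant in which only \<open>av\<close> varies; the density contributes the trace of
  the Christoffel symbols.\<close>

lemma Kv_derivative:
  assumes x: "x \<in> S"
  shows "((\<lambda>y. H y (Kv y v) z) has_derivative
    (\<lambda>u. inner3.vol (H x) (dir_deriv av x u) v z + lin_trace (chr x u) * inner3.vol (H x) (av x) v z)) (at x)"
proof -
  interpret inner3 "H x" by (rule H[OF x])
  have Dav: "(av has_derivative dir_deriv av x) (at x)"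
    by (rule has_derivative_dir_deriv[OF av_differentiable[OF x]])
  have comp: "((\<lambda>y. av y $ k) has_derivative (\<lambda>u. dir_deriv av x u $ k)) (at x)" for k
    by (rule bounded_linear.has_derivative[OF bounded_linear_vec_nth Dav])
  have "((\<lambda>y. det (vector [av y, v, z] :: real ^ 3 ^ 3)) has_derivative
     (\<lambda>u. det (vector [dir_deriv av x u, v, z] :: real ^ 3 ^ 3))) (at x)"
    unfolding det_3 vector_3
    by (rule has_derivative_eq_rhs, (rule derivative_intros comp)+) (simp add: fun_eq_iff algebra_simps)
  from has_derivative_mult[OF sqrt_det_has_derivative[OF x] this]
  have "((\<lambda>y. sqrt (det (gram (H y))) * det (vector [av y, v, z] :: real ^ 3 ^ 3)) has_derivative
    (\<lambda>u. vol (dir_deriv av x u) v z + lin_trace (chr x u) * vol (av x) v z)) (at x)"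
    by (rule has_derivative_eq_rhs) (simp add: vol_def fun_eq_iff algebra_simps)
  then show ?thesis
    by (rule has_derivative_cong_open[OF _ S x]) (simp add: H_Kv_vol inner3.vol_def[OF H])
qed

text \<open>Two computations of the derivative of h(Kv, z) are compared, one through metric
  compatibility and one through the volume form. \<open>trilinear_trace\<close> absorbs the
  Christoffel terms, which expresses that the volume form is parallel.\<close>

lemma H_NK: assumes x: "x \<in> S" shows "H x (NK x v u) z = inner3.vol (H x) (Na x u) v z"
proof -
  interpret inner3 "H x" by (rule H[OF x])
  have "((\<lambda>y. H y (Kv y v) z) has_derivative (\<lambda>u. DH x u (Kv x v) z + H x (dir_deriv (\<lambda>y. Kv y v) x u) z
     + H x (Kv x v) (dir_deriv (\<lambda>y. z) x u))) (at x)"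
    by (rule H_field_has_derivative[OF x Kv_differentiable[OF x]]) simp
  moreover have "dir_deriv (\<lambda>y. z) x = (\<lambda>_. 0)" for z :: "real ^ 3" by (rule dir_deriv_eq) simp
  ultimately have "((\<lambda>y. H y (Kv y v) z) has_derivative (\<lambda>u. DH x u (Kv x v) z + H x (dir_deriv (\<lambda>y. Kv y v) x u) z)) (at x)"
    by (simp add: zero_right)
  from has_derivative_unique[OF this Kv_derivative[OF x]]
  have "DH x u (Kv x v) z + H x (dir_deriv (\<lambda>y. Kv y v) x u) z
     = vol (dir_deriv av x u) v z + lin_trace (chr x u) * vol (av x) v z" by (rule fun_cong)
  moreover have "vol (p + q) v z = vol p v z + vol q v z" for p q
    by (simp add: vol_def det_3 algebra_simps)
  ultimately show ?thesis
    unfolding trilinear_trace[OF H[OF x] chr_linear(1)[OF x], of u "av x" v z, symmetric]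
    by (simp add: NK_def Na_def DH_chr[OF x] add_left diff_left H_Kv_vol[OF x])
qed

lemma lin_trace_Na: assumes x: "x \<in> S" shows "lin_trace (Na x) = 0"
proof -
  interpret inner3_cross "H x" "av x" "Kv x"
    by (rule beltrami_point.axioms(1)[OF point[OF x, of 1 1]]) simp
  let ?\<tau> = "\<lambda>u. lin_trace (chr x u)"
  have \<tau>: "linear ?\<tau>"
    by (rule linearI) (simp_all add: lin_trace_def linear_add[OF chr_linear(2)[OF x]] linear_cmul[OF chr_linear(2)[OF x]]
        inner_simps sum.distrib sum_distrib_left)
  have DF: "vol (dir_deriv av x u) v w + ?\<tau> u * vol (av x) v w
      = - (1/2) * (dir_deriv (\<lambda>y. DA y v w) x u - dir_deriv (\<lambda>y. DA y w v) x u)" for u v w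
  proof -
    have D: "((\<lambda>y. DA y v w) has_derivative dir_deriv (\<lambda>y. DA y v w) x) (at x)" for v w
      by (rule has_derivative_dir_deriv[OF DA_differentiable[OF x]])
    have "((\<lambda>y. H y (Kv y v) w) has_derivative (\<lambda>u. - (1/2) * (dir_deriv (\<lambda>y. DA y v w) x u - dir_deriv (\<lambda>y. DA y w v) x u))) (at x)"
      by (rule has_derivative_cong_open[OF has_derivative_mult_right[OF has_derivative_diff[OF D D]] S x]) (simp add: H_Kv)
    from has_derivative_unique[OF Kv_derivative[OF x] this] show ?thesis by (rule fun_cong)
  qed
  have "lin_trace (dir_deriv av x) = - ?\<tau> (av x)"
    by (rule lin_trace_div[OF linear_Da[OF x] _ \<tau>])
      (unfold DF, use D2A_sym[OF x] in \<open>simp add: algebra_simps\<close>)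
  then show ?thesis
    by (simp add: Na_def[abs_def] lin_trace_add chr_sym[OF x, of _ "av x"])
qed

text \<open>The divergence of \<open>Kv\<close> is the curl of \<open>av\<close> up to
  identification, and the Beltrami equation makes this curl a multiple of \<open>av\<close>.\<close>

lemma lin_trace_NK: assumes x: "x \<in> S" shows "lin_trace (NK x v) = - 2 * A x v"
proof -
  interpret inner3_cross "H x" "av x" "Kv x"
    by (rule beltrami_point.axioms(1)[OF point[OF x, of 1 1]]) simp
  have "lin_trace (NK x v) = - 2 * H x (av x) v"
  proof (rule lin_trace_cross[OF _ linear_Na[OF x] linear_NK[OF x]])
    show "Bv x u v - Bv x v u = - 2 * vol (av x) u v" for u v
      using beltrami_point.B_anti[OF point[OF x, of 1 1], of u v] by (simp add: H_Kv_vol[OF x])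
  qed (simp_all add: H_Na H_NK x)
  then show ?thesis by (simp add: H_av[OF x])
qed

end

section \<open>Connection and Ricci tensor of the metric on the product with the half-line\<close>

lemma dir_deriv_fst:
  assumes "f differentiable at (x, r)"
  shows "dir_deriv f (x, r) (u, 0) = dir_deriv (\<lambda>y. f (y, r)) x u"
proof -
  have "((\<lambda>y. f (y, r)) has_derivative (\<lambda>u. dir_deriv f (x, r) (u, 0))) (at x)"
    by (rule has_derivative_compose[where f="\<lambda>y. (y, r)" and g=f])
      (auto intro!: derivative_eq_intros has_derivative_dir_deriv assms)
  then show ?thesis by (simp add: dir_deriv_eq)
qed

lemma dir_deriv_snd:
  assumes "f differentiable at (x, r)"
  shows "dir_deriv f (x, r) (0, s) = dir_deriv (\<lambda>t. f (x, t)) r s"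
proof -
  have "((\<lambda>t. f (x, t)) has_derivative (\<lambda>s. dir_deriv f (x, r) (0, s))) (at r)"
    by (rule has_derivative_compose[where f="\<lambda>t. (x, t)" and g=f])
      (auto intro!: derivative_eq_intros has_derivative_dir_deriv assms)
  then show ?thesis by (simp add: dir_deriv_eq)
qed

lemma differentiable_fst_compose: "f differentiable at (fst X) \<Longrightarrow> (\<lambda>X. f (fst X)) differentiable at X"
  unfolding differentiable_def
  using has_derivative_compose[OF has_derivative_fst[OF has_derivative_ident]] by blast

lemma sum_Basis_prod_real:
  "(\<Sum>b\<in>(Basis :: ('a::euclidean_space \<times> real) set). f b) = (\<Sum>b\<in>Basis. f (b, 0)) + f (0, 1)"
proof -
  have "(\<Sum>b\<in>(\<lambda>u. (u, 0)) ` Basis. f b) = (\<Sum>b\<in>Basis. f (b, 0))"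
    by (subst sum.reindex) (auto simp: inj_on_def)
  then show ?thesis
    unfolding Basis_prod_def by (subst sum.union_disjoint) auto
qed

context beltrami3
begin

definition cg :: "(real ^ 3) \<times> real \<Rightarrow> (real ^ 3) \<times> real \<Rightarrow> (real ^ 3) \<times> real \<Rightarrow> real ^ 3" where
  "cg X U V = beltrami_point.cc (H (fst X)) (av (fst X)) (Kv (fst X)) (inverse (snd X)) U V"

definition og :: "(real ^ 3) \<times> real \<Rightarrow> (real ^ 3) \<times> real \<Rightarrow> (real ^ 3) \<times> real \<Rightarrow> real" where
  "og X U V = beltrami_point.om (H (fst X)) (av (fst X)) (Kv (fst X)) (Bv (fst X)) (snd X) (inverse (snd X)) U V"

definition gm :: "(real ^ 3) \<times> real \<Rightarrow> (real ^ 3) \<times> real \<Rightarrow> (real ^ 3) \<times> real \<Rightarrow> real" where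
  "gm X U V = (snd X)\<^sup>2 * H (fst X) (fst U) (fst V) + inverse ((snd X)\<^sup>2) *
     ((snd X * snd U + A (fst X) (fst U)) * (snd X * snd V + A (fst X) (fst V)))"

lemma cg_eq: assumes "y \<in> S" "r \<noteq> 0"
  shows "cg (y, r) U V = inverse r *\<^sub>R (snd U *\<^sub>R fst V + snd V *\<^sub>R fst U)
     + ((inverse r)^2 * H y (fst U) (fst V)) *\<^sub>R av y
     - ((inverse r)^4 * ((snd U + inverse r * A y (fst U)) * (snd V + inverse r * A y (fst V)))) *\<^sub>R av y
     - (inverse r)^3 *\<^sub>R ((snd V + inverse r * A y (fst V)) *\<^sub>R Kv y (fst U) + (snd U + inverse r * A y (fst U)) *\<^sub>R Kv y (fst V))"
proof -
  interpret beltrami_point "H y" "av y" "Kv y" "Bv y" r "inverse r"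
    by (rule point) (use assms in auto)
  show ?thesis by (simp add: cg_def cc_def th_def H_av[OF assms(1)])
qed

text \<open>In the sum of \<open>Bv\<close> and \<open>h(K u, v)\<close> the antisymmetric part of
  the derivative of \<open>A\<close> cancels. Only its symmetrisation remains, which is the form
  that the Koszul formula produces.\<close>

lemma og_eq: assumes "y \<in> S" "r \<noteq> 0"
  shows "og (y, r) U V = - r * H y (fst U) (fst V) + inverse r * (1/2 * (DA y (fst U) (fst V) + DA y (fst V) (fst U))
     - A y (chr y (fst U) (fst V))) + (inverse r)^3 * (A y (fst U) * A y (fst V))
     - inverse r * A y (cg (y, r) U V)"
proof -
  interpret beltrami_point "H y" "av y" "Kv y" "Bv y" r "inverse r"
    by (rule point) (use assms in auto)
  show ?thesis
    by (simp add: og_def cg_def om_def tau_def H_av[OF assms(1)] Bv_def H_Kv[OF assms(1)] algebra_simps add_divide_distrib diff_divide_distrib)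
qed

lemma H_cg: assumes y: "y \<in> S" and r: "r \<noteq> 0"
  shows "H y (cg (y, r) U V) z = inverse r * (snd U * H y (fst V) z + snd V * H y (fst U) z)
     + (inverse r)^2 * H y (fst U) (fst V) * A y z
     - (inverse r)^4 * ((snd U + inverse r * A y (fst U)) * (snd V + inverse r * A y (fst V))) * A y z
     - (inverse r)^3 * ((snd V + inverse r * A y (fst V)) * (- (1/2) * (DA y (fst U) z - DA y z (fst U)))
         + (snd U + inverse r * A y (fst U)) * (- (1/2) * (DA y (fst V) z - DA y z (fst V))))"
proof -
  interpret inner3 "H y" by (rule H[OF y])
  show ?thesis
    unfolding cg_eq[OF y r] add_left diff_left scaleR_left H_av[OF y] H_Kv[OF y] by simp
qed

lemma gm_has_derivative:
  assumes x: "x \<in> S" and r: "r \<noteq> 0"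
  shows "((\<lambda>Y. gm Y V Z) has_derivative (\<lambda>U.
     2 * r * snd U * H x (fst V) (fst Z) + r\<^sup>2 * DH x (fst U) (fst V) (fst Z)
     - 2 * (inverse r)^3 * snd U * ((r * snd V + A x (fst V)) * (r * snd Z + A x (fst Z)))
     + (inverse r)\<^sup>2 * ((snd U * snd V + DA x (fst U) (fst V)) * (r * snd Z + A x (fst Z))
        + (r * snd V + A x (fst V)) * (snd U * snd Z + DA x (fst U) (fst Z))))) (at (x, r))"
proof -
  have DHf: "((\<lambda>Y. H (fst Y) v z) has_derivative (\<lambda>U. DH x (fst U) v z)) (at (x, r))" for v z
    by (rule has_derivative_compose[where f=fst and g="\<lambda>y. H y v z"])
      (auto intro!: derivative_eq_intros simp: DH_def has_derivative_dir_deriv H_differentiable x)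
  have DAf: "((\<lambda>Y. A (fst Y) v) has_derivative (\<lambda>U. DA x (fst U) v)) (at (x, r))" for v
    by (rule has_derivative_compose[where f=fst and g="\<lambda>y. A y v"])
      (auto intro!: derivative_eq_intros simp: DA_def has_derivative_dir_deriv A_differentiable x)
  have Dr: "((\<lambda>Y. snd Y) has_derivative (\<lambda>U. snd U)) (at (x, r))"
    by (rule has_derivative_snd[OF has_derivative_ident])
  have Di: "((\<lambda>Y. inverse ((snd Y)\<^sup>2)) has_derivative (\<lambda>U. - 2 * (inverse r)^3 * snd U)) (at (x, r))"
  proof -
    have "((\<lambda>t. inverse (t\<^sup>2)) has_real_derivative - 2 * (inverse r)^3) (at r)"
      by (rule derivative_eq_intros refl)+ (use r in \<open>auto simp: power2_eq_square power3_eq_cube\<close>)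
    then have "((\<lambda>t. inverse (t\<^sup>2)) has_derivative (*) (- 2 * (inverse r)^3)) (at (snd (x, r)))"
      by (simp add: has_field_derivative_def)
    from has_derivative_compose[OF Dr this] show ?thesis by simp
  qed
  show ?thesis
    unfolding gm_def
    by (rule has_derivative_eq_rhs, (rule derivative_intros DHf DAf Dr Di)+)
      (simp add: fun_eq_iff algebra_simps power2_eq_square)
qed

text \<open>The Koszul formula for \<open>gm\<close> with all values of the metric, of
  \<open>A\<close> and of their derivatives replaced by free variables. \<open>Ac\<close> stands for
  \<open>A\<close> of the Christoffel vector, \<open>Ag\<close> for \<open>A\<close> of
  \<open>cg\<close>; both cancel.\<close>

lemma gm_koszul_algebra:
  fixes r p s t z1 :: real
  assumes "r * p = 1"
  shows "r^2 * ((Duvz + Dvuz - Dzuv) / 2 + (p * (s * Hvz + t * Huz) + p^2 * Huv * Az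
     - p^4 * ((s + p * Au) * (t + p * Av)) * Az
     - p^3 * ((t + p * Av) * (- (1/2) * (DAuz - DAzu)) + (s + p * Au) * (- (1/2) * (DAvz - DAzv)))))
   + p^2 * ((r * (- r * Huv + p * (1/2 * (DAuv + DAvu) - Ac) + p^3 * (Au * Av) - p * Ag) + (Ac + Ag)) * (r * z1 + Az))
   = ((2 * r * s * Hvz + r^2 * Duvz - 2 * p^3 * s * ((r * t + Av) * (r * z1 + Az))
        + p^2 * ((s * t + DAuv) * (r * z1 + Az) + (r * t + Av) * (s * z1 + DAuz)))
     + (2 * r * t * Huz + r^2 * Dvuz - 2 * p^3 * t * ((r * s + Au) * (r * z1 + Az))
        + p^2 * ((t * s + DAvu) * (r * z1 + Az) + (r * s + Au) * (t * z1 + DAvz)))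
     - (2 * r * z1 * Huv + r^2 * Dzuv - 2 * p^3 * z1 * ((r * s + Au) * (r * t + Av))
        + p^2 * ((z1 * s + DAzu) * (r * t + Av) + (r * s + Au) * (z1 * t + DAzv)))) / 2"
proof -
  \<comment> \<open>Halves become a variable with the polynomial relation 2k = 1, so that the whole
    identity can be treated as one of polynomials.\<close>
  define k :: real where "k = 1/2"
  have k: "2 * k = 1" "y / 2 = k * y" for y by (simp_all add: k_def)
  show ?thesis unfolding k(2) using assms k(1) by algebra
qed

lemma gm_posdef:
  assumes x: "x \<in> S" and r: "r \<noteq> 0" and W: "W \<noteq> 0"
  shows "gm (x, r) W W > 0"
proof -
  interpret inner3 "H x" by (rule H[OF x])
  have "gm (x, r) W W = r\<^sup>2 * H x (fst W) (fst W) + inverse (r\<^sup>2) * (r * snd W + A x (fst W))\<^sup>2"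
    by (simp add: gm_def power2_eq_square)
  also have "\<dots> > 0"
  proof (cases "fst W = 0")
    case True
    then have "snd W \<noteq> 0" using W by (auto simp: prod_eq_iff)
    then show ?thesis using True r by (simp add: zero_left A_simps[OF x])
  next
    case False
    then show ?thesis using posdef[OF False] r by (intro add_pos_nonneg) auto
  qed
  finally show ?thesis .
qed

text \<open>The connection is verified rather than derived: the stated vector satisfies the Koszul
  formula, and positive definiteness of \<open>gm\<close> makes the solution unique.\<close>

lemma christoffel_gm:
  assumes x: "x \<in> S" and r: "r \<noteq> 0"
  shows "christoffel gm (x, r) U V = (chr x (fst U) (fst V) + cg (x, r) U V, og (x, r) U V)"
proof -
  interpret inner3 "H x" by (rule H[OF x])
  let ?W = "(chr x (fst U) (fst V) + cg (x, r) U V, og (x, r) U V)"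
  let ?R = "\<lambda>Z. (dir_deriv (\<lambda>Y. gm Y V Z) (x, r) U + dir_deriv (\<lambda>Y. gm Y U Z) (x, r) V
      - dir_deriv (\<lambda>Y. gm Y U V) (x, r) Z) / 2"
  have W: "gm (x, r) ?W Z = ?R Z" for Z
    unfolding dir_deriv_eq[OF gm_has_derivative[OF x r]]
    unfolding gm_def og_eq[OF x r] fst_conv snd_conv add_left H_chr[OF x] koszul_def H_cg[OF x r] A_simps(1)[OF x] power_inverse[symmetric]
    by (rule gm_koszul_algebra) (use r in simp)
  have "W' = ?W" if "\<forall>Z. gm (x, r) W' Z = ?R Z" for W'
  proof (rule ccontr)
    assume "W' \<noteq> ?W"
    then have "gm (x, r) (W' - ?W) (W' - ?W) > 0" by (intro gm_posdef x r) simp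
    moreover have "gm (x, r) (W' - Q) Z = gm (x, r) W' Z - gm (x, r) Q Z" for Q Z
      by (simp add: gm_def diff_left A_simps[OF x] algebra_simps)
    ultimately show False using that W by simp
  qed
  then show ?thesis
    unfolding christoffel_def using W by (intro the_equality) auto
qed

lemma cg_linear:
  assumes x: "x \<in> S" and r: "r \<noteq> 0"
  shows "cg (x, r) U (V + W) = cg (x, r) U V + cg (x, r) U W" "cg (x, r) (U + V) W = cg (x, r) U W + cg (x, r) V W"
    "cg (x, r) U (c *\<^sub>R V) = c *\<^sub>R cg (x, r) U V" "cg (x, r) (c *\<^sub>R U) V = c *\<^sub>R cg (x, r) U V"
proof -
  interpret beltrami_point "H x" "av x" "Kv x" "Bv x" r "inverse r"
    by (rule point[OF x]) (use r in auto)
  show "cg (x, r) U (V + W) = cg (x, r) U V + cg (x, r) U W" "cg (x, r) (U + V) W = cg (x, r) U W + cg (x, r) V W"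
    "cg (x, r) U (c *\<^sub>R V) = c *\<^sub>R cg (x, r) U V" "cg (x, r) (c *\<^sub>R U) V = c *\<^sub>R cg (x, r) U V"
    by (simp_all add: cg_def cc_def th_def lin_simps algebra_simps)
qed

lemma cg_has_derivative:
  assumes x: "x \<in> S" and r: "r \<noteq> 0"
  shows "((\<lambda>y. cg (y, r) U V) has_derivative (\<lambda>b.
     ((inverse r)^2 * DH x b (fst U) (fst V)) *\<^sub>R av x + ((inverse r)^2 * H x (fst U) (fst V)) *\<^sub>R dir_deriv av x b
     - ((inverse r)^4 * ((inverse r * DA x b (fst U)) * (snd V + inverse r * A x (fst V))
          + (snd U + inverse r * A x (fst U)) * (inverse r * DA x b (fst V)))) *\<^sub>R av x
     - ((inverse r)^4 * ((snd U + inverse r * A x (fst U)) * (snd V + inverse r * A x (fst V)))) *\<^sub>R dir_deriv av x b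
     - (inverse r)^3 *\<^sub>R ((inverse r * DA x b (fst V)) *\<^sub>R Kv x (fst U)
        + (snd V + inverse r * A x (fst V)) *\<^sub>R dir_deriv (\<lambda>y. Kv y (fst U)) x b
        + (inverse r * DA x b (fst U)) *\<^sub>R Kv x (fst V)
        + (snd U + inverse r * A x (fst U)) *\<^sub>R dir_deriv (\<lambda>y. Kv y (fst V)) x b))) (at x)"
proof -
  have D: "((\<lambda>y. H y u v) has_derivative (\<lambda>b. DH x b u v)) (at x)"
    "((\<lambda>y. A y u) has_derivative (\<lambda>b. DA x b u)) (at x)"
    "(av has_derivative dir_deriv av x) (at x)"
    "((\<lambda>y. Kv y u) has_derivative dir_deriv (\<lambda>y. Kv y u) x) (at x)" for u v
    using has_derivative_dir_deriv[OF H_differentiable[OF x]] has_derivative_dir_deriv[OF A_differentiable[OF x]]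
      has_derivative_dir_deriv[OF av_differentiable[OF x]] has_derivative_dir_deriv[OF Kv_differentiable[OF x]]
    by (simp_all add: DH_def DA_def eta_contract_eq)
  show ?thesis
    by (rule has_derivative_cong_open[OF _ S x cg_eq[OF _ r, symmetric]],
        rule has_derivative_eq_rhs, (rule derivative_intros D)+)
      (simp_all add: fun_eq_iff algebra_simps)
qed

lemma og_has_derivative:
  assumes x: "x \<in> S" and r: "r \<noteq> 0"
  shows "((\<lambda>r. og (x, r) U V) has_derivative
    (*) (beltrami_point.om' (H x) (av x) (Kv x) (Bv x) (inverse r) U V)) (at r)"
proof -
  interpret inner3 "H x" by (rule H[OF x])
  interpret p: beltrami_point "H x" "av x" "Kv x" "Bv x" r "inverse r"
    by (rule point[OF x]) (use r in auto)
  let ?k = "Bv x (fst U) (fst V) + H x (Kv x (fst U)) (fst V)"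
  let ?u = "A x (fst U)" and ?v = "A x (fst V)" and ?N = "A x (av x)" and ?h = "H x (fst U) (fst V)"
  have og': "og (x, t) U V = - t * ?h + inverse t * ?k + (inverse t)^3 * (?u * ?v)
     - inverse t * (inverse t * (snd U * ?v + snd V * ?u) + (inverse t)^2 * ?h * ?N
       - (inverse t)^4 * ((snd U + inverse t * ?u) * (snd V + inverse t * ?v)) * ?N)" if "t \<noteq> 0" for t
  proof -
    interpret q: beltrami_point "H x" "av x" "Kv x" "Bv x" t "inverse t"
      by (rule point[OF x]) (use that in auto)
    have "A x (Kv x u) = 0" for u using p.a_K[of u] by (simp add: H_av[OF x])
    then have "A x (q.cc U V) = inverse t * (snd U * ?v + snd V * ?u) + (inverse t)^2 * ?h * ?N
       - (inverse t)^4 * ((snd U + inverse t * ?u) * (snd V + inverse t * ?v)) * ?N"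
      by (simp add: q.cc_def q.th_def A_simps[OF x] H_av[OF x])
    then show ?thesis by (simp add: og_def q.om_def q.tau_def H_av[OF x])
  qed
  have "((\<lambda>t. - t * ?h + inverse t * ?k + (inverse t)^3 * (?u * ?v)
     - inverse t * (inverse t * (snd U * ?v + snd V * ?u) + (inverse t)^2 * ?h * ?N
       - (inverse t)^4 * ((snd U + inverse t * ?u) * (snd V + inverse t * ?v)) * ?N))
     has_real_derivative p.om' U V) (at r)"
    by (rule derivative_eq_intros refl r)+
      (simp add: p.om'_def p.th_def H_av[OF x] numeral_eq_Suc algebra_simps)
  then have "((\<lambda>t. - t * ?h + inverse t * ?k + (inverse t)^3 * (?u * ?v)
     - inverse t * (inverse t * (snd U * ?v + snd V * ?u) + (inverse t)^2 * ?h * ?N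
       - (inverse t)^4 * ((snd U + inverse t * ?u) * (snd V + inverse t * ?v)) * ?N))
     has_derivative (*) (p.om' U V)) (at r)"
    by (simp add: has_field_derivative_def)
  then show ?thesis
    by (rule has_derivative_cong_open[of _ _ _ "- {0}"]) (use r og' in auto)
qed

lemma connection_differentiable:
  assumes x: "x \<in> S" and r: "r \<noteq> 0"
  shows "(\<lambda>X. (chr (fst X) (fst U) (fst V) + cg X U V, og X U V)) differentiable at (x, r)"
proof -
  have f: "(\<lambda>X. H (fst X) u v) differentiable at (x, r)" "(\<lambda>X. A (fst X) u) differentiable at (x, r)"
    "(\<lambda>X. av (fst X)) differentiable at (x, r)" "(\<lambda>X. Kv (fst X) u) differentiable at (x, r)"
    "(\<lambda>X. DA (fst X) u v) differentiable at (x, r)" "(\<lambda>X. chr (fst X) u v) differentiable at (x, r)" for u v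
    by (rule differentiable_fst_compose, simp add: x H_differentiable A_differentiable av_differentiable
        Kv_differentiable DA_differentiable differentiable_chr)+
  have s: "(\<lambda>X. snd X) differentiable at (x, r)" for x :: "real ^ 3"
    by (rule differentiableI[OF has_derivative_snd[OF has_derivative_ident]])
  have i: "(\<lambda>X. inverse (snd X)) differentiable at (x, r)" for x :: "real ^ 3"
    by (rule differentiable_inverse[OF s]) (use r in simp)
  have o: "open (S \<times> - {0 :: real})" "(x, r) \<in> S \<times> - {0}" using S x r by (auto intro: open_Times)
  have A_exp: "(\<lambda>X. A (fst X) (F X)) differentiable at (x, r)" if "F differentiable at (x, r)" for F
  proof -
    have eq: "(\<Sum>b\<in>Basis. (F X \<bullet> b) * A (fst X) b) = A (fst X) (F X)" if "X \<in> S \<times> - {0 :: real}" for X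
      using that linear_eq_sum_Basis[OF A_linear, of "fst X" "F X"] by auto
    have "(\<lambda>X. \<Sum>b\<in>Basis. (F X \<bullet> b) * A (fst X) b) differentiable at (x, r)"
      by (intro differentiable_sum ballI differentiable_mult differentiable_inner_left that f) auto
    then show ?thesis by (rule differentiable_cong_open[OF _ o eq])
  qed
  have cgd: "(\<lambda>X. cg X U V) differentiable at (x, r)"
  proof (rule differentiable_cong_open[OF _ o])
    show "(\<lambda>X. inverse (snd X) *\<^sub>R (snd U *\<^sub>R fst V + snd V *\<^sub>R fst U)
     + ((inverse (snd X))^2 * H (fst X) (fst U) (fst V)) *\<^sub>R av (fst X)
     - ((inverse (snd X))^4 * ((snd U + inverse (snd X) * A (fst X) (fst U)) * (snd V + inverse (snd X) * A (fst X) (fst V)))) *\<^sub>R av (fst X)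
     - (inverse (snd X))^3 *\<^sub>R ((snd V + inverse (snd X) * A (fst X) (fst V)) *\<^sub>R Kv (fst X) (fst U)
       + (snd U + inverse (snd X) * A (fst X) (fst U)) *\<^sub>R Kv (fst X) (fst V))) differentiable at (x, r)"
      by (intro differentiable_add differentiable_diff differentiable_scaleR differentiable_mult differentiable_power
          differentiable_const f i)
  qed (rule cg_eq[of "fst X" "snd X" U V for X, unfolded prod.collapse, symmetric], auto)
  have ogd: "(\<lambda>X. og X U V) differentiable at (x, r)"
  proof (rule differentiable_cong_open[OF _ o])
    show "(\<lambda>X. - snd X * H (fst X) (fst U) (fst V) + inverse (snd X) * (1/2 * (DA (fst X) (fst U) (fst V) + DA (fst X) (fst V) (fst U))
     - A (fst X) (chr (fst X) (fst U) (fst V))) + (inverse (snd X))^3 * (A (fst X) (fst U) * A (fst X) (fst V))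
     - inverse (snd X) * A (fst X) (cg X U V)) differentiable at (x, r)"
      by (intro differentiable_add differentiable_diff differentiable_scaleR differentiable_mult differentiable_power
          differentiable_minus differentiable_const f i s A_exp cgd)
  qed (rule og_eq[of "fst X" "snd X" U V for X, unfolded prod.collapse, symmetric], auto)
  obtain D1 where D1: "((\<lambda>X. chr (fst X) (fst U) (fst V) + cg X U V) has_derivative D1) (at (x, r))"
    using differentiable_add[OF f(6) cgd] unfolding differentiable_def by blast
  obtain D2 where "((\<lambda>X. og X U V) has_derivative D2) (at (x, r))"
    using ogd unfolding differentiable_def by blast
  from has_derivative_Pair[OF D1 this] show ?thesis by (rule differentiableI)
qed

text \<open>The covariant divergence over N of the tensor \<open>cg\<close>. By the product rule it
  involves the covariant derivatives of \<open>A\<close>, \<open>av\<close> and \<open>Kv\<close>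
  only; \<open>lin_trace_Na\<close> removes the terms with the divergence of \<open>av\<close>, and
  \<open>lin_trace_NK\<close> evaluates those with the divergence of \<open>Kv\<close>.\<close>

lemma lin_trace_div_cg:
  assumes x: "x \<in> S" and r: "r \<noteq> 0"
  shows "lin_trace (dir_deriv (\<lambda>y. cg (y, r) U V) x) + lin_trace (\<lambda>b. chr x b (cg (x, r) U V))
     - lin_trace (\<lambda>b. chr x (fst U) (cg (x, r) (b, 0) V)) - lin_trace (\<lambda>b. cg (x, r) U (chr x b (fst V), 0))
   = - ((inverse r)^5 * (Bv x (av x) (fst U) * (snd V + inverse r * A x (fst V)) + (snd U + inverse r * A x (fst U)) * Bv x (av x) (fst V)))
   - (inverse r)^3 * (inverse r * Bv x (Kv x (fst U)) (fst V) + inverse r * Bv x (Kv x (fst V)) (fst U)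
      - 2 * (snd V + inverse r * A x (fst V)) * A x (fst U) - 2 * (snd U + inverse r * A x (fst U)) * A x (fst V))"
proof -
  interpret beltrami_point "H x" "av x" "Kv x" "Bv x" r "inverse r"
    by (rule point[OF x]) (use r in auto)
  let ?p = "inverse r"
  let ?U = "snd U + ?p * A x (fst U)" and ?V = "snd V + ?p * A x (fst V)"
  note chr_simps = linear_add[OF chr_linear(1)[OF x]] linear_diff[OF chr_linear(1)[OF x]] linear_cmul[OF chr_linear(1)[OF x]]
    linear_add[OF chr_linear(2)[OF x]] linear_diff[OF chr_linear(2)[OF x]] linear_cmul[OF chr_linear(2)[OF x]]
  have lin_cg: "linear (\<lambda>b. cg (x, r) (b, 0) V)"
    using cg_linear(2,4)[OF x r] by (intro linearI) (metis add_Pair add.right_neutral, metis scaleR_Pair scaleR_zero_right)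
  \<comment> \<open>Cyclicity of the trace and symmetry of the Christoffel symbols bring this term
    into the shape required for a covariant derivative in direction \<open>b\<close>.\<close>
  have comm: "lin_trace (\<lambda>b. chr x (fst U) (cg (x, r) (b, 0) V)) = lin_trace (\<lambda>b. cg (x, r) (chr x b (fst U), 0) V)"
    unfolding chr_sym[OF x, of _ "fst U"] by (rule lin_trace_commute[OF chr_linear(1)[OF x] lin_cg])
  \<comment> \<open>All Christoffel symbols are absorbed into covariant derivatives, as must happen
    for a tensor.\<close>
  have nabla: "dir_deriv (\<lambda>y. cg (y, r) U V) x b + chr x b (cg (x, r) U V)
     - cg (x, r) (chr x b (fst U), 0) V - cg (x, r) U (chr x b (fst V), 0)
    = (?p^2 * H x (fst U) (fst V)) *\<^sub>R Na x b - (?p^4 * (?U * ?V)) *\<^sub>R Na x b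
     - (?p^5 * (Bv x b (fst U) * ?V + ?U * Bv x b (fst V))) *\<^sub>R av x
     - ((?p^4 * Bv x b (fst V)) *\<^sub>R Kv x (fst U) + (?p^3 * ?V) *\<^sub>R NK x (fst U) b
        + (?p^4 * Bv x b (fst U)) *\<^sub>R Kv x (fst V) + (?p^3 * ?U) *\<^sub>R NK x (fst V) b)" for b
  proof -
    have Da: "dir_deriv av x b = Na x b - chr x b (av x)" by (simp add: Na_def)
    have DK: "dir_deriv (\<lambda>y. Kv y v) x b = NK x v b - chr x b (Kv x v) + Kv x (chr x b v)" for v by (simp add: NK_def)
    have D: "DA x b v = Bv x b v + A x (chr x b v)" for v by (simp add: Bv_def)
    show ?thesis
      unfolding dir_deriv_eq[OF cg_has_derivative[OF x r]] cg_eq[OF x r] Da DK D DH_chr[OF x] fst_conv snd_conv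
      by (simp add: chr_simps algebra_simps numeral_eq_Suc)
  qed
  have lB: "linear (\<lambda>b. Bv x b v)" for v using B by (simp add: bilinear_def)
  have "lin_trace (dir_deriv (\<lambda>y. cg (y, r) U V) x) + lin_trace (\<lambda>b. chr x b (cg (x, r) U V))
     - lin_trace (\<lambda>b. cg (x, r) (chr x b (fst U), 0) V) - lin_trace (\<lambda>b. cg (x, r) U (chr x b (fst V), 0))
    = lin_trace (\<lambda>b. dir_deriv (\<lambda>y. cg (y, r) U V) x b + chr x b (cg (x, r) U V)
     - cg (x, r) (chr x b (fst U), 0) V - cg (x, r) U (chr x b (fst V), 0))"
    by (simp add: lin_trace_add lin_trace_diff eta_contract_eq)
  also have "\<dots> = - (?p^5 * (Bv x (av x) (fst U) * ?V + ?U * Bv x (av x) (fst V)))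
     - (?p^4 * Bv x (Kv x (fst U)) (fst V) + (?p^3 * ?V) * (- 2 * A x (fst U))
        + ?p^4 * Bv x (Kv x (fst V)) (fst U) + (?p^3 * ?U) * (- 2 * A x (fst V)))"
  proof -
    have 1: "lin_trace (\<lambda>b. (?p^5 * (Bv x b (fst U) * ?V + ?U * Bv x b (fst V))) *\<^sub>R av x)
        = ?p^5 * (Bv x (av x) (fst U) * ?V + ?U * Bv x (av x) (fst V))"
      by (rule lin_trace_rank_one, rule linearI) (simp_all add: B_simps algebra_simps)
    have 2: "lin_trace (\<lambda>b. (?p^4 * Bv x b v) *\<^sub>R w) = ?p^4 * Bv x w v" for v w
      by (rule lin_trace_rank_one, rule linearI) (simp_all add: B_simps algebra_simps)
    have 3: "lin_trace (\<lambda>b. Na x b) = 0" "lin_trace (\<lambda>b. NK x v b) = - 2 * A x v" for v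
      using lin_trace_Na[OF x] lin_trace_NK[OF x, of v] by (simp_all add: eta_contract_eq)
    show ?thesis
      unfolding nabla lin_trace_add lin_trace_diff 1 2 lin_trace_scaleR 3 by simp
  qed
  finally show ?thesis unfolding comm by (simp add: algebra_simps numeral_eq_Suc)
qed

text \<open>If two torsion-free connections differ by a tensor C, their Ricci tensors differ by div
  C - d(tr C) + tr(C) C - tr(C C). Here the reference is the connection of h + d\<rho>^2, whose
  Ricci tensor is that of h. \<open>T1\<close> to \<open>T4\<close> are the traces of the four
  curvature terms; \<open>lin_trace_div_cg\<close> and \<open>ricci_identity\<close> reduce the
  difference to -2h.\<close>

theorem ricci_gm:
  assumes x: "x \<in> S" and r: "r > 0"
  shows "ricci gm (x, r) V W = ricci H x (fst V) (fst W) - 2 * H x (fst V) (fst W)"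
proof -
  have r0: "r \<noteq> 0" using r by simp
  interpret beltrami_point "H x" "av x" "Kv x" "Bv x" r "inverse r"
    by (rule point[OF x]) (use r in auto)
  let ?G = "\<lambda>X U V. (chr (fst X) (fst U) (fst V) + cg X U V, og X U V)"
  have o: "open (S \<times> {0 :: real<..})" "(x, r) \<in> S \<times> {0<..}" using S x r by (auto intro: open_Times)
  have Geq: "?G X U V = christoffel gm X U V" if "X \<in> S \<times> {0<..}" for X U V
    using that christoffel_gm[of "fst X" "snd X" U V] by auto
  have Gd: "(\<lambda>X. ?G X U V) differentiable at (x, r)" for U V
    by (rule connection_differentiable[OF x r0])
  have curv: "curvature gm (x, r) U V W = dir_deriv (\<lambda>X. ?G X V W) (x, r) U - dir_deriv (\<lambda>X. ?G X U W) (x, r) V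
     + ?G (x, r) U (?G (x, r) V W) - ?G (x, r) V (?G (x, r) U W)" for U V W
  proof -
    have "dir_deriv (\<lambda>X. christoffel gm X U V) (x, r) = dir_deriv (\<lambda>X. ?G X U V) (x, r)" for U V
      by (rule dir_deriv_cong_open[OF Gd o Geq])
    then show ?thesis unfolding curvature_def by (simp only: Geq[OF o(2)])
  qed
  define \<phi> where "\<phi> y = lin_trace (\<lambda>b. chr y b (fst W))" for y
  \<comment> \<open>The contracted connection needs no details of \<open>cg\<close> and
    \<open>og\<close>: by \<open>lin_trace_C\<close> only the derivative of the volume factor
    \<rho>^3 is added to that of h.\<close>
  have tr: "(\<Sum>b\<in>Basis. ?G (y, t) b Z \<bullet> b) = lin_trace (\<lambda>b. chr y b (fst Z)) + 3 * inverse t * snd Z"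
    if "y \<in> S" "t \<noteq> 0" for y t Z
  proof -
    interpret q: beltrami_point "H y" "av y" "Kv y" "Bv y" t "inverse t"
      by (rule point) (use that in auto)
    have "(\<Sum>b\<in>Basis. ?G (y, t) b Z \<bullet> b) = lin_trace (\<lambda>b. chr y b (fst Z)) + (lin_trace (\<lambda>b. q.cc (b, 0) Z) + q.om (0, 1) Z)"
      by (simp add: sum_Basis_prod_real lin_trace_def inner_simps sum.distrib cg_def og_def)
    then show ?thesis by (simp only: q.lin_trace_C)
  qed
  have T1: "(\<Sum>b\<in>Basis. dir_deriv (\<lambda>X. ?G X V W) (x, r) b \<bullet> b)
     = lin_trace (dir_deriv (\<lambda>y. chr y (fst V) (fst W)) x) + lin_trace (dir_deriv (\<lambda>y. cg (y, r) V W) x) + om' V W"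
  proof -
    have "dir_deriv (\<lambda>y. ?G (y, r) V W) x = (\<lambda>b. (dir_deriv (\<lambda>y. chr y (fst V) (fst W)) x b + dir_deriv (\<lambda>y. cg (y, r) V W) x b,
       dir_deriv (\<lambda>y. og (y, r) V W) x b))"
    proof (rule dir_deriv_eq, rule has_derivative_Pair)
      have 1: "(\<lambda>X. og X V W) differentiable at (x, r)"
        using has_derivative_snd[OF has_derivative_dir_deriv[OF Gd[of V W]]] by (auto intro: differentiableI)
      have "((\<lambda>y. og (y, r) V W) has_derivative (\<lambda>b. dir_deriv (\<lambda>X. og X V W) (x, r) (b, 0))) (at x)"
        by (rule has_derivative_compose[where f="\<lambda>y. (y, r)" and g="\<lambda>X. og X V W"])
          (auto intro!: derivative_eq_intros has_derivative_dir_deriv 1)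
      then show "((\<lambda>y. og (y, r) V W) has_derivative dir_deriv (\<lambda>y. og (y, r) V W) x) (at x)"
        by (intro has_derivative_dir_deriv differentiableI)
      show "((\<lambda>y. chr (fst (y, r)) (fst V) (fst W) + cg (y, r) V W) has_derivative
          (\<lambda>b. dir_deriv (\<lambda>y. chr y (fst V) (fst W)) x b + dir_deriv (\<lambda>y. cg (y, r) V W) x b)) (at x)"
        using has_derivative_add[OF has_derivative_dir_deriv[OF differentiable_chr[OF x]]
            has_derivative_dir_deriv[OF differentiableI[OF cg_has_derivative[OF x r0]]]] by simp
    qed
    moreover have "dir_deriv (\<lambda>t. ?G (x, t) V W) r 1 \<bullet> (0, 1) = om' V W"
    proof -
      have "((\<lambda>t. ?G (x, t) V W) has_derivative (\<lambda>s. dir_deriv (\<lambda>X. ?G X V W) (x, r) (0, s))) (at r)"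
        by (rule has_derivative_compose[where f="\<lambda>t. (x, t)" and g="\<lambda>X. ?G X V W"])
          (auto intro!: derivative_eq_intros has_derivative_dir_deriv Gd)
      then have "((\<lambda>t. ?G (x, t) V W) has_derivative dir_deriv (\<lambda>t. ?G (x, t) V W) r) (at r)"
        by (intro has_derivative_dir_deriv differentiableI)
      from has_derivative_snd[OF this]
      have "((\<lambda>t. og (x, t) V W) has_derivative (\<lambda>s. snd (dir_deriv (\<lambda>t. ?G (x, t) V W) r s))) (at r)" by simp
      from has_derivative_unique[OF this og_has_derivative[OF x r0]]
      have "snd (dir_deriv (\<lambda>t. ?G (x, t) V W) r 1) = om' V W" by (auto dest: fun_cong[where x=1])
      then show ?thesis by (simp add: inner_prod_def)
    qed
    ultimately show ?thesis
      by (simp add: sum_Basis_prod_real dir_deriv_fst[OF Gd] dir_deriv_snd[OF Gd] lin_trace_def inner_simps sum.distrib)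
  qed
  have T2: "(\<Sum>b\<in>Basis. dir_deriv (\<lambda>X. ?G X b W) (x, r) V \<bullet> b)
     = (\<Sum>b\<in>Basis. dir_deriv (\<lambda>y. chr y b (fst W)) x (fst V) \<bullet> b) - 3 * (inverse r)^2 * (snd V * snd W)"
  proof -
    have D: "((\<lambda>y. \<Sum>b\<in>Basis. chr y b (fst W) \<bullet> b) has_derivative
       (\<lambda>u. \<Sum>b\<in>Basis. dir_deriv (\<lambda>y. chr y b (fst W)) x u \<bullet> b)) (at x)"
      by (intro has_derivative_sum has_derivative_inner_left has_derivative_dir_deriv differentiable_chr x)
    have "((\<lambda>X. \<Sum>b\<in>Basis. chr (fst X) b (fst W) \<bullet> b) has_derivative
       (\<lambda>U. \<Sum>b\<in>Basis. dir_deriv (\<lambda>y. chr y b (fst W)) x (fst U) \<bullet> b)) (at (x, r))"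
      by (rule has_derivative_compose[where f=fst and g="\<lambda>y. \<Sum>b\<in>Basis. chr y b (fst W) \<bullet> b"])
        (auto intro!: derivative_eq_intros D)
    moreover have "((\<lambda>X. 3 * inverse (snd X) * snd W) has_derivative (\<lambda>U. - 3 * (inverse r)^2 * (snd U * snd W))) (at (x, r))"
    proof -
      have "((\<lambda>t. 3 * inverse t * snd W) has_real_derivative - 3 * (inverse r)^2 * snd W) (at r)"
        by (rule derivative_eq_intros refl r0)+ (simp add: power2_eq_square)
      then have "((\<lambda>t. 3 * inverse t * snd W) has_derivative (*) (- 3 * (inverse r)^2 * snd W)) (at (snd (x, r)))"
        by (simp add: has_field_derivative_def)
      from has_derivative_compose[OF has_derivative_snd[OF has_derivative_ident] this] show ?thesis
        by (simp add: mult_ac)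
    qed
    ultimately have R: "((\<lambda>X. (\<Sum>b\<in>Basis. chr (fst X) b (fst W) \<bullet> b) + 3 * inverse (snd X) * snd W) has_derivative
       (\<lambda>U. (\<Sum>b\<in>Basis. dir_deriv (\<lambda>y. chr y b (fst W)) x (fst U) \<bullet> b) + - 3 * (inverse r)^2 * (snd U * snd W))) (at (x, r))"
      by (rule has_derivative_add)
    have L: "((\<lambda>X. \<Sum>b\<in>Basis. ?G X b W \<bullet> b) has_derivative
       (\<lambda>U. \<Sum>b\<in>Basis. dir_deriv (\<lambda>X. ?G X b W) (x, r) U \<bullet> b)) (at (x, r))"
      by (intro has_derivative_sum has_derivative_inner_left has_derivative_dir_deriv Gd)
    have "((\<lambda>X. (\<Sum>b\<in>Basis. chr (fst X) b (fst W) \<bullet> b) + 3 * inverse (snd X) * snd W) has_derivative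
       (\<lambda>U. \<Sum>b\<in>Basis. dir_deriv (\<lambda>X. ?G X b W) (x, r) U \<bullet> b)) (at (x, r))"
    proof (rule has_derivative_cong_open[OF L o])
      fix X assume "X \<in> S \<times> {0 :: real<..}"
      then show "(\<Sum>b\<in>Basis. ?G X b W \<bullet> b) = (\<Sum>b\<in>Basis. chr (fst X) b (fst W) \<bullet> b) + 3 * inverse (snd X) * snd W"
        using tr[of "fst X" "snd X" W] by (auto simp: lin_trace_def)
    qed
    from has_derivative_unique[OF this R] show ?thesis by (auto dest: fun_cong[where x=V])
  qed
  have T3: "(\<Sum>b\<in>Basis. ?G (x, r) b (?G (x, r) V W) \<bullet> b)
     = lin_trace (\<lambda>b. chr x b (chr x (fst V) (fst W))) + lin_trace (\<lambda>b. chr x b (cg (x, r) V W)) + 3 * inverse r * om V W"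
    unfolding tr[OF x r0] by (simp add: linear_add[OF chr_linear(1)[OF x]] lin_trace_add og_def)
  have T4: "(\<Sum>b\<in>Basis. ?G (x, r) V (?G (x, r) b W) \<bullet> b)
     = lin_trace (\<lambda>b. chr x (fst V) (chr x b (fst W))) + lin_trace (\<lambda>b. chr x (fst V) (cg (x, r) (b, 0) W))
       + lin_trace (\<lambda>b. cg (x, r) V (chr x b (fst W), 0))
       + (lin_trace (\<lambda>b. cc V (cc (b, 0) W, om (b, 0) W)) + om V (cc (0, 1) W, om (0, 1) W))"
  proof -
    have "cg (x, r) V (chr x b (fst W) + cg (x, r) (b, 0) W, og (x, r) (b, 0) W)
       = cg (x, r) V (chr x b (fst W), 0) + cc V (cc (b, 0) W, om (b, 0) W)" for b
      using cg_linear(1)[OF x r0, of V "(chr x b (fst W), 0)" "(cg (x, r) (b, 0) W, og (x, r) (b, 0) W)"]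
      by (simp add: cg_def og_def)
    then show ?thesis
      by (simp add: sum_Basis_prod_real lin_trace_def inner_simps sum.distrib linear_add[OF chr_linear(1)[OF x]]
          linear_0[OF chr_linear(2)[OF x]] cg_def og_def)
  qed
  have "ricci gm (x, r) V W = (\<Sum>b\<in>Basis. dir_deriv (\<lambda>X. ?G X V W) (x, r) b \<bullet> b) - (\<Sum>b\<in>Basis. dir_deriv (\<lambda>X. ?G X b W) (x, r) V \<bullet> b)
     + (\<Sum>b\<in>Basis. ?G (x, r) b (?G (x, r) V W) \<bullet> b) - (\<Sum>b\<in>Basis. ?G (x, r) V (?G (x, r) b W) \<bullet> b)"
    unfolding ricci_def curv inner_add_left inner_diff_left sum.distrib sum_subtractf ..
  moreover have "ricci H x (fst V) (fst W) = lin_trace (dir_deriv (\<lambda>y. chr y (fst V) (fst W)) x)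
     - (\<Sum>b\<in>Basis. dir_deriv (\<lambda>y. chr y b (fst W)) x (fst V) \<bullet> b)
     + lin_trace (\<lambda>b. chr x b (chr x (fst V) (fst W))) - lin_trace (\<lambda>b. chr x (fst V) (chr x b (fst W)))"
    unfolding ricci_def curvature_eq[OF x] inner_add_left inner_diff_left sum.distrib sum_subtractf lin_trace_def ..
  moreover note lin_trace_div_cg[OF x r0, of V W] ricci_identity[of V W, unfolded th_def H_av[OF x]]
  ultimately show ?thesis unfolding T1 T2 T3 T4 by linarith
qed

end

subsection \<open>The soliton equation\<close>

context beltrami3
begin

definition slice_lie :: "((real ^ 3) \<times> real \<Rightarrow> (real ^ 3) \<times> real) \<Rightarrow> (real ^ 3) \<times> real \<Rightarrow> real ^ 3 \<Rightarrow> real ^ 3 \<Rightarrow> real" where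
  "slice_lie E X u v = lie_derivative E (\<lambda>X U V. H (fst X) (fst U) (fst V)) X (u, 0) (v, 0)"

lemma slice_lie_eq:
  assumes x: "x \<in> S"
  shows "slice_lie E (x, r) u v = DH x (fst (E (x, r))) u v
    + H x (fst (dir_deriv E (x, r) (u, 0))) v + H x u (fst (dir_deriv E (x, r) (v, 0)))"
proof -
  have "((\<lambda>Y. H (fst Y) u v) has_derivative (\<lambda>U. DH x (fst U) u v)) (at (x, r))"
    by (rule has_derivative_compose[where f=fst and g="\<lambda>y. H y u v"])
      (auto intro!: derivative_eq_intros simp: DH_def has_derivative_dir_deriv H_differentiable x)
  then show ?thesis by (simp add: slice_lie_def lie_derivative_def dir_deriv_eq)
qed

text \<open>The soliton equation is tested on two vertical, one slice and one vertical, and two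
  slice vectors. The first test is \<open>soliton_R\<close>. The mixed one determines the
  combination of slice derivatives of \<open>E\<close> and of \<open>DA\<close> that also occurs in
  the third, and eliminating it there yields \<open>soliton_S\<close>.\<close>

lemma soliton_components:
  assumes x: "x \<in> S" and r: "r > 0"
    and sol: "\<And>U V. ricci gm (x, r) U V + a * gm (x, r) U V + 1/2 * lie_derivative E gm (x, r) U V = 0"
  defines "X' \<equiv> fst (dir_deriv E (x, r) (0, 1))" and "f' \<equiv> snd (dir_deriv E (x, r) (0, 1))"
  shows soliton_R: "r * f' + A x X' + a * r = 0"
    and soliton_S: "ricci H x u v - 2 * H x u v + a * r\<^sup>2 * H x u v + 1/2 * r\<^sup>2 * slice_lie E (x, r) u v
      + r * snd (E (x, r)) * H x u v - 1/2 * r * (A x u * H x v X' + A x v * H x u X') = 0"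
proof -
  have r0: "r \<noteq> 0" using r by simp
  interpret inner3 "H x" by (rule H[OF x])
  let ?p = "inverse r" and ?f = "snd (E (x, r))" and ?X = "fst (E (x, r))"
  let ?D = "\<lambda>u. dir_deriv E (x, r) (u, 0)"
  have lie: "lie_derivative E gm (x, r) U V =
     2 * r * ?f * H x (fst U) (fst V) + r\<^sup>2 * DH x ?X (fst U) (fst V)
     - 2 * ?p^3 * ?f * ((r * snd U + A x (fst U)) * (r * snd V + A x (fst V)))
     + ?p\<^sup>2 * ((?f * snd U + DA x ?X (fst U)) * (r * snd V + A x (fst V))
        + (r * snd U + A x (fst U)) * (?f * snd V + DA x ?X (fst V)))
     + gm (x, r) (dir_deriv E (x, r) U) V + gm (x, r) U (dir_deriv E (x, r) V)" for U V
    unfolding lie_derivative_def dir_deriv_eq[OF gm_has_derivative[OF x r0]] ..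
  have rp: "r * ?p = 1" using r0 by simp
  note g = gm_def fst_conv snd_conv power_inverse[symmetric]
  \<comment> \<open>By \<open>ricci_gm\<close> the Ricci tensor sees slice components only; this
    makes it disappear from \<open>E1\<close> and \<open>E2\<close>.\<close>
  have ric0: "ricci H x v 0 = 0" for v
  proof -
    have 0: "chr y v 0 = 0" if "y \<in> S" for y v by (rule linear_0[OF chr_linear(1)[OF that]])
    have D0: "((\<lambda>y. chr y v 0) has_derivative (\<lambda>_. 0)) (at x)" for v
      by (rule has_derivative_cong_open[OF has_derivative_const S x]) (simp add: 0)
    then show ?thesis by (simp add: ricci_def curvature_eq[OF x] dir_deriv_eq[OF D0] 0 x)
  qed
  have lie': "lie_derivative E gm (x, r) U V = - 2 * (ricci H x (fst U) (fst V) - 2 * H x (fst U) (fst V) + a * gm (x, r) U V)" for U V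
    using sol[of U V] unfolding ricci_gm[OF x r] by (simp add: field_simps)
  have zeros: "DA x w 0 = 0" "DH x w u 0 = 0" for w u
    by (rule linear_0[OF DA_linear(2)[OF x]], rule linear_0[OF DH_linear_right[OF x]])
  let ?AE = "r * f' + A x X'"
  let ?DE = "\<lambda>u. r * snd (?D u) + A x (fst (?D u))"
  have E1: "- 2 * ?p^3 * ?f * (r * r) + ?p^2 * (?f * r + r * ?f) + ?p^2 * (?AE * r + r * ?AE) = - 2 * (a * (?p^2 * (r * r)))"
    using lie'[of "(0, 1)" "(0, 1)"] unfolding lie X'_def f'_def g
    by (simp add: zero_left zero_right A_simps[OF x] zeros ric0 algebra_simps)
  have E2: "- 2 * ?p^3 * ?f * (A x u * r) + ?p^2 * (DA x ?X u * r + A x u * ?f) + ?p^2 * (?DE u * r)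
      + (r^2 * H x u X' + ?p^2 * (A x u * ?AE)) = - 2 * (a * (?p^2 * (A x u * r)))" for u
    using lie'[of "(u, 0)" "(0, 1)"] unfolding lie X'_def f'_def g
    by (simp add: zero_left zero_right A_simps[OF x] zeros ric0 algebra_simps)
  have E3: "2 * r * ?f * H x u v + r^2 * DH x ?X u v - 2 * ?p^3 * ?f * (A x u * A x v)
      + ?p^2 * (DA x ?X u * A x v + A x u * DA x ?X v) + (r^2 * H x (fst (?D u)) v + ?p^2 * (?DE u * A x v))
      + (r^2 * H x u (fst (?D v)) + ?p^2 * (A x u * ?DE v))
      = - 2 * (ricci H x u v - 2 * H x u v + a * (r^2 * H x u v + ?p^2 * (A x u * A x v)))"
    using lie'[of "(u, 0)" "(v, 0)"] unfolding lie g by simp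
  show R: "r * f' + A x X' + a * r = 0"
    using E1 rp by algebra
  \<comment> \<open>\<open>E3\<close> minus the multiples of \<open>E2\<close> by
    \<open>A x v\<close> and \<open>A x u\<close>: the derivatives of \<open>f\<close> along the
    slice cancel, and \<open>R\<close> replaces the remaining \<rho>-derivative of
    \<open>f\<close>.\<close>
  have "2 * (ricci H x u v - 2 * H x u v) + 2 * a * r\<^sup>2 * H x u v + r\<^sup>2 * slice_lie E (x, r) u v
      + 2 * r * ?f * H x u v - r * (A x u * H x v X' + A x v * H x u X') = 0"
    unfolding slice_lie_eq[OF x] using E3 E2[of u] E2[of v] R rp by algebra
  then show "ricci H x u v - 2 * H x u v + a * r\<^sup>2 * H x u v + 1/2 * r\<^sup>2 * slice_lie E (x, r) u v
      + r * snd (E (x, r)) * H x u v - 1/2 * r * (A x u * H x v X' + A x v * H x u X') = 0"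
    by (simp add: field_simps)
qed

end

section \<open>Naturality of the Lie derivative under related vector fields\<close>

lemma lie_derivative_related:
  fixes J :: "'v::euclidean_space \<Rightarrow> 'w::euclidean_space" and B' :: "'w \<Rightarrow> 'w \<Rightarrow> 'w \<Rightarrow> 'f::real_normed_vector"
  assumes S: "open S" "x \<in> S" and J: "\<And>y. y \<in> S \<Longrightarrow> J differentiable at y"
    and PD: "\<And>u. (\<lambda>y. dir_deriv J y u) differentiable at x"
    and sym: "\<And>u w. dir_deriv (\<lambda>y. dir_deriv J y u) x w = dir_deriv (\<lambda>y. dir_deriv J y w) x u"
    and V: "V differentiable at x" and V': "V' differentiable at (J x)"
    and rel: "\<And>y. y \<in> S \<Longrightarrow> V' (J y) = dir_deriv J y (V y)"
    and T: "open T" "J x \<in> T" and bil: "\<And>z. z \<in> T \<Longrightarrow> bilinear (B' z)"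
    and dif: "\<And>u v. (\<lambda>z. B' z u v) differentiable at (J x)"
    and pull: "\<And>y u v. y \<in> S \<Longrightarrow> B y u v = B' (J y) (dir_deriv J y u) (dir_deriv J y v)"
  shows "dir_deriv (\<lambda>y. B y u v) x (V x) + B x (dir_deriv V x u) v + B x u (dir_deriv V x v) =
    dir_deriv (\<lambda>z. B' z (dir_deriv J x u) (dir_deriv J x v)) (J x) (V' (J x))
    + B' (J x) (dir_deriv V' (J x) (dir_deriv J x u)) (dir_deriv J x v)
    + B' (J x) (dir_deriv J x u) (dir_deriv V' (J x) (dir_deriv J x v))"
proof -
  let ?P = "\<lambda>y u. dir_deriv J y u"
  have P: "linear (?P y)" if "y \<in> S" for y by (rule linear_dir_deriv[OF J[OF that]])
  have PDd: "((\<lambda>y. ?P y u) has_derivative dir_deriv (\<lambda>y. ?P y u) x) (at x)" for u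
    by (rule has_derivative_dir_deriv[OF PD])
  \<comment> \<open>Differentiating the relation between \<open>V\<close> and \<open>V'\<close>
    produces a second derivative of \<open>J\<close>. By the symmetry assumption it is the
    derivative of \<open>dJ(u)\<close> along \<open>V\<close>, which is exactly what differentiating
    the pullback along \<open>V\<close> produces as well.\<close>
  have V1: "dir_deriv V' (J x) (?P x u) = ?P x (dir_deriv V x u) + dir_deriv (\<lambda>y. ?P y u) x (V x)" for u
  proof -
    have D1: "((\<lambda>y. V' (J y)) has_derivative (\<lambda>u. dir_deriv V' (J x) (?P x u))) (at x)"
      by (rule has_derivative_compose[OF has_derivative_dir_deriv[OF J[OF S(2)]] has_derivative_dir_deriv[OF V']])
    have "((\<lambda>y. \<Sum>b\<in>Basis. (V y \<bullet> b) *\<^sub>R ?P y b) has_derivative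
       (\<lambda>u. \<Sum>b\<in>Basis. (V x \<bullet> b) *\<^sub>R dir_deriv (\<lambda>y. ?P y b) x u + (dir_deriv V x u \<bullet> b) *\<^sub>R ?P x b)) (at x)"
      by (intro has_derivative_sum has_derivative_scaleR has_derivative_inner_left has_derivative_dir_deriv[OF V] PDd)
    then have "((\<lambda>y. V' (J y)) has_derivative
       (\<lambda>u. \<Sum>b\<in>Basis. (V x \<bullet> b) *\<^sub>R dir_deriv (\<lambda>y. ?P y b) x u + (dir_deriv V x u \<bullet> b) *\<^sub>R ?P x b)) (at x)"
    proof (rule has_derivative_cong_open[OF _ S])
      show "(\<Sum>b\<in>Basis. (V y \<bullet> b) *\<^sub>R ?P y b) = V' (J y)" if "y \<in> S" for y
        unfolding rel[OF that] by (rule linear_eq_sum_Basis[OF P[OF that], symmetric])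
    qed
    from has_derivative_unique[OF D1 this]
    have "dir_deriv V' (J x) (?P x u) = (\<Sum>b\<in>Basis. (V x \<bullet> b) *\<^sub>R dir_deriv (\<lambda>y. ?P y b) x u + (dir_deriv V x u \<bullet> b) *\<^sub>R ?P x b)"
      by (rule fun_cong)
    also have "\<dots> = (\<Sum>b\<in>Basis. (V x \<bullet> b) *\<^sub>R dir_deriv (\<lambda>y. ?P y u) x b) + ?P x (dir_deriv V x u)"
      by (simp add: sum.distrib sym[of _ u] linear_eq_sum_Basis[OF P[OF S(2)], of "dir_deriv V x u"])
    also have "(\<Sum>b\<in>Basis. (V x \<bullet> b) *\<^sub>R dir_deriv (\<lambda>y. ?P y u) x b) = dir_deriv (\<lambda>y. ?P y u) x (V x)"
      by (rule linear_eq_sum_Basis[OF linear_dir_deriv[OF PD], symmetric])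
    finally show ?thesis by simp
  qed
  have "((\<lambda>y. B' (J y) (?P y u) (?P y v)) has_derivative
    (\<lambda>h. dir_deriv (\<lambda>z. B' z (?P x u) (?P x v)) (J x) (?P x h) + B' (J x) (dir_deriv (\<lambda>y. ?P y u) x h) (?P x v)
       + B' (J x) (?P x u) (dir_deriv (\<lambda>y. ?P y v) x h))) (at x)"
    by (rule bilinear_form_has_derivative[OF T bil dif has_derivative_dir_deriv[OF J[OF S(2)]] PDd PDd])
  then have "((\<lambda>y. B y u v) has_derivative
    (\<lambda>h. dir_deriv (\<lambda>z. B' z (?P x u) (?P x v)) (J x) (?P x h) + B' (J x) (dir_deriv (\<lambda>y. ?P y u) x h) (?P x v)
       + B' (J x) (?P x u) (dir_deriv (\<lambda>y. ?P y v) x h))) (at x)"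
    by (rule has_derivative_cong_open[OF _ S]) (simp add: pull)
  then show ?thesis
    unfolding V1 bilinear_radd[OF bil[OF T(2)]] bilinear_ladd[OF bil[OF T(2)]]
    by (simp add: dir_deriv_eq pull[OF S(2)] rel[OF S(2)])
qed

text \<open>Symmetry of the second derivatives is recorded in place of their continuity, because it
  is the consequence that \<open>lie_derivative_related\<close> consumes.\<close>

definition C2_on :: "('v::real_normed_vector \<Rightarrow> 'w::real_normed_vector) \<Rightarrow> 'v set \<Rightarrow> bool" where
  "C2_on J S \<longleftrightarrow> (\<forall>y\<in>S. J differentiable at y) \<and> (\<forall>u. \<forall>y\<in>S. (\<lambda>y. dir_deriv J y u) differentiable at y) \<and>
    (\<forall>u w. \<forall>y\<in>S. dir_deriv (\<lambda>y. dir_deriv J y u) y w = dir_deriv (\<lambda>y. dir_deriv J y w) y u)"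

lemma C2_on_componentwise:
  fixes J :: "'v::real_normed_vector \<Rightarrow> 'w::euclidean_space"
  assumes S: "open S" and c: "\<And>b. b \<in> Basis \<Longrightarrow> C2_on (\<lambda>y. J y \<bullet> b) S"
  shows "C2_on J S"
proof -
  have J: "J differentiable at y" if "y \<in> S" for y
    using c that unfolding C2_on_def by (subst differentiable_componentwise_within) blast
  have Jb: "dir_deriv (\<lambda>y. J y \<bullet> b) y u = dir_deriv J y u \<bullet> b" if "y \<in> S" for y u b
    by (rule dir_deriv_inner_left[OF J[OF that]])
  have DJb: "(\<lambda>y. dir_deriv J y u \<bullet> b) differentiable at y" if "y \<in> S" "b \<in> Basis" for y u b
  proof (rule differentiable_cong_open[OF _ S that(1) Jb])
    show "(\<lambda>y. dir_deriv (\<lambda>y. J y \<bullet> b) y u) differentiable at y" using c[OF that(2)] that(1) by (auto simp: C2_on_def)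
  qed
  have DJ: "(\<lambda>y. dir_deriv J y u) differentiable at y" if "y \<in> S" for y u
    using DJb[OF that] by (subst differentiable_componentwise_within) blast
  have "dir_deriv (\<lambda>y. dir_deriv J y u) y w = dir_deriv (\<lambda>y. dir_deriv J y w) y u" if y: "y \<in> S" for y u w
  proof (rule euclidean_eqI)
    fix b :: 'w assume b: "b \<in> Basis"
    have "dir_deriv (\<lambda>y. dir_deriv J y u) y w \<bullet> b = dir_deriv (\<lambda>y. dir_deriv (\<lambda>y. J y \<bullet> b) y u) y w" for u w
    proof -
      have "dir_deriv (\<lambda>y. dir_deriv J y u \<bullet> b) y = dir_deriv (\<lambda>y. dir_deriv (\<lambda>y. J y \<bullet> b) y u) y"
        by (rule dir_deriv_cong_open[OF _ S y Jb]) (use c[OF b] y in \<open>auto simp: C2_on_def\<close>)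
      then show ?thesis by (simp add: dir_deriv_inner_left[OF DJ[OF y], symmetric])
    qed
    then show "dir_deriv (\<lambda>y. dir_deriv J y u) y w \<bullet> b = dir_deriv (\<lambda>y. dir_deriv J y w) y u \<bullet> b"
      using c[OF b] y by (auto simp: C2_on_def)
  qed
  then show ?thesis using J DJ by (auto simp: C2_on_def)
qed

text \<open>The symmetry lemma is stated for real-valued functions; real and imaginary parts, and
  inner products with basis vectors, are all instances of \<open>L\<close>.\<close>

lemma C2_on_real_linear_ext_hol:
  fixes f :: "'v::euclidean_space \<Rightarrow> complex"
  assumes S: "open S" and f: "ext_hol f S" and L: "bounded_linear (L :: complex \<Rightarrow> real)"
  shows "C2_on (\<lambda>y. L (f y)) S"
proof -
  let ?D = "\<lambda>u y. frechet_derivative f (at y) u"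
  have D1: "((\<lambda>y. L (g y)) has_derivative (\<lambda>u. L (frechet_derivative g (at y) u))) (at y)" if "ext_hol g S" "y \<in> S" for g y
    by (rule bounded_linear.has_derivative[OF L]) (use ext_hol_differentiable[OF S that] in \<open>simp add: frechet_derivative_works\<close>)
  have eq1: "frechet_derivative (\<lambda>y. L (g y)) (at y) u = L (frechet_derivative g (at y) u)" if "ext_hol g S" "y \<in> S" for g y u
    using frechet_derivative_at[OF D1[OF that]] by metis
  note eD = ext_hol_frechet_derivative[OF S f]
  have D2: "((\<lambda>y. frechet_derivative (\<lambda>y. L (f y)) (at y) u) has_derivative (\<lambda>w. L (frechet_derivative (?D u) (at y) w))) (at y)"
    if "y \<in> S" for y u
    by (rule has_derivative_cong_open[OF D1[OF eD that] S that]) (simp add: eq1[OF f])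
  have eq2: "frechet_derivative (\<lambda>y. frechet_derivative (\<lambda>y. L (f y)) (at y) u) (at y) w = L (frechet_derivative (?D u) (at y) w)"
    if "y \<in> S" for y u w
    using frechet_derivative_at[OF D2[OF that]] by metis
  have cont: "continuous_on S (\<lambda>y. frechet_derivative (\<lambda>y. frechet_derivative (\<lambda>y. L (f y)) (at y) u) (at y) w)" for u w
  proof (subst continuous_on_cong[OF refl eq2])
    have "ext_hol (\<lambda>y. frechet_derivative (?D u) (at y) w) S" by (rule ext_hol_frechet_derivative[OF S eD])
    then have "continuous_on S (\<lambda>y. frechet_derivative (?D u) (at y) w)"
      by (intro continuous_at_imp_continuous_on ballI differentiable_imp_continuous_within ext_hol_differentiable[OF S])
    then show "continuous_on S (\<lambda>y. L (frechet_derivative (?D u) (at y) w))"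
      by (rule bounded_linear.continuous_on[OF L])
  qed
  show ?thesis
    unfolding C2_on_def dir_deriv_def
    using second_dir_deriv_symmetric[OF S _ differentiableI[OF D1[OF f]] differentiableI[OF D2] cont]
      differentiableI[OF D1[OF f]] differentiableI[OF D2] by blast
qed

lemma C2_on_complex_vec:
  fixes J :: "'v::euclidean_space \<Rightarrow> complex ^ 'n"
  assumes S: "open S" and f: "\<And>k. ext_hol (\<lambda>y. J y $ k) S"
  shows "C2_on J S"
proof (rule C2_on_componentwise[OF S])
  fix b :: "complex ^ 'n" assume "b \<in> Basis"
  then obtain k c where "b = axis k c" by (auto simp: Basis_vec_def)
  then have "J y \<bullet> b = J y $ k \<bullet> c" for y by (simp add: inner_axis)
  then show "C2_on (\<lambda>y. J y \<bullet> b) S"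
    using C2_on_real_linear_ext_hol[OF S f bounded_linear_inner_left] by simp
qed

lemma C2_on_real_vec:
  fixes J :: "'v::euclidean_space \<Rightarrow> real ^ 'n"
  assumes S: "open S" and f: "\<And>k. ra_on (\<lambda>y. J y $ k) S"
  shows "C2_on J S"
proof (rule C2_on_componentwise[OF S])
  fix b :: "real ^ 'n" assume "b \<in> Basis"
  then obtain k where "b = axis k 1" by (auto simp: Basis_vec_def)
  then have "J y \<bullet> b = Re (complex_of_real (J y $ k))" for y by (simp add: inner_axis)
  then show "C2_on (\<lambda>y. J y \<bullet> b) S"
    using C2_on_real_linear_ext_hol[OF S f[unfolded ra_on_def] bounded_linear_Re] by simp
qed

subsection \<open>Moments on a circle\<close>

definition annulus :: "real \<Rightarrow> real \<Rightarrow> complex set" where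
  "annulus r \<delta> = {\<zeta>. r - \<delta> < cmod \<zeta> \<and> cmod \<zeta> < r + \<delta>}"

lemma open_annulus: "open (annulus r \<delta>)"
  unfolding annulus_def by (intro open_Collect_conj open_Collect_less continuous_intros)

lemma connected_annulus_complex: "connected (annulus r \<delta>)"
  using connected_annulus(1)[of "r - \<delta>" "0 :: complex" "r + \<delta>"] by (simp add: annulus_def)

lemma sphere_subset_annulus: "\<delta> > 0 \<Longrightarrow> sphere 0 r \<subseteq> annulus r \<delta>"
  by (auto simp: annulus_def)

lemma of_real_in_annulus: "\<delta> < r \<Longrightarrow> \<bar>t - r\<bar> < \<delta> \<Longrightarrow> complex_of_real t \<in> annulus r \<delta>"
  by (auto simp: annulus_def)

lemma annulus_in_open:
  assumes "open T" "sphere 0 r \<subseteq> T" "r > 0"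
  obtains \<delta> where "0 < \<delta>" "\<delta> < r" "annulus r \<delta> \<subseteq> T"
proof -
  have "compact (sphere (0::complex) r)" by simp
  then obtain e where e: "e > 0" "(\<Union>x\<in>sphere 0 r. ball x e) \<subseteq> T"
    using compact_subset_open_imp_ball_epsilon_subset[of "sphere 0 r" T] assms by blast
  have "annulus r (min e (r/2)) \<subseteq> T"
  proof
    fix \<zeta> assume \<zeta>: "\<zeta> \<in> annulus r (min e (r/2))"
    then have "\<zeta> \<noteq> 0" using assms(3) by (auto simp: annulus_def)
    \<comment> \<open>The radial projection of \<open>\<zeta>\<close> to the circle; its distance
      from \<open>\<zeta>\<close> is the difference of the moduli.\<close>
    define w where "w = of_real (r / cmod \<zeta>) * \<zeta>"
    have w: "w \<in> sphere 0 r" using assms(3) \<open>\<zeta> \<noteq> 0\<close> by (simp add: w_def norm_mult norm_divide)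
    have "dist w \<zeta> = cmod (of_real (r / cmod \<zeta> - 1) * \<zeta>)" by (simp add: w_def dist_norm algebra_simps)
    also have "\<dots> = \<bar>r / cmod \<zeta> - 1\<bar> * cmod \<zeta>" by (simp only: norm_mult norm_of_real)
    also have "\<dots> = \<bar>(r / cmod \<zeta> - 1) * cmod \<zeta>\<bar>" by (simp add: abs_mult)
    also have "\<dots> = \<bar>r - cmod \<zeta>\<bar>" using \<open>\<zeta> \<noteq> 0\<close> by (simp add: left_diff_distrib)
    also have "\<dots> < e" using \<zeta> by (auto simp: annulus_def)
    finally have "\<zeta> \<in> ball w e" by simp
    then show "\<zeta> \<in> T" using e(2) w by blast
  qed
  then show ?thesis using e assms(3) by (intro that[of "min e (r/2)"]) auto
qed

text \<open>The equations are known for real \<rho> near \<open>r\<close> only. This segment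
  accumulates at \<open>r\<close> and the annulus is connected, so the identity theorem carries them
  around the circle.\<close>

lemma annulus_identity:
  assumes \<delta>: "0 < \<delta>" "\<delta> < r" and hol: "F holomorphic_on annulus r \<delta>"
    and real: "\<And>t. \<bar>t - r\<bar> < \<delta> \<Longrightarrow> F (of_real t) = 0" and \<zeta>: "\<zeta> \<in> annulus r \<delta>"
  shows "F \<zeta> = 0"
proof (rule analytic_continuation[OF hol open_annulus connected_annulus_complex])
  show "complex_of_real ` {r - \<delta><..<r + \<delta>} \<subseteq> annulus r \<delta>"
    using \<delta> by (auto intro!: of_real_in_annulus)
  show "complex_of_real r \<in> annulus r \<delta>" using \<delta> by (intro of_real_in_annulus) auto
  show "complex_of_real r islimpt complex_of_real ` {r - \<delta><..<r + \<delta>}"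
    unfolding islimpt_approachable
  proof (intro allI impI)
    fix \<epsilon> :: real assume \<epsilon>: "\<epsilon> > 0"
    define t where "t = r + min \<epsilon> \<delta> / 2"
    have "t \<noteq> r" "\<bar>t - r\<bar> < \<epsilon>" "\<bar>t - r\<bar> < \<delta>" using \<epsilon> \<delta> by (auto simp: t_def)
    moreover from this have "t \<in> {r - \<delta><..<r + \<delta>}" by auto
    ultimately show "\<exists>x'\<in>complex_of_real ` {r - \<delta><..<r + \<delta>}. x' \<noteq> complex_of_real r \<and> dist x' (complex_of_real r) < \<epsilon>"
      by (intro bexI[of _ "of_real t"] imageI) (simp_all add: dist_of_real dist_real_def)
  qed
  show "F z = 0" if "z \<in> complex_of_real ` {r - \<delta><..<r + \<delta>}" for z
    using that real by (auto simp: abs_less_iff)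
qed (rule \<zeta>)

lemma deriv_of_real:
  assumes F: "F holomorphic_on T" "open T" "complex_of_real t \<in> T"
    and eq: "\<And>s. \<bar>s - t\<bar> < \<epsilon> \<Longrightarrow> F (of_real s) = of_real (g s)" and \<epsilon>: "\<epsilon> > 0" and g: "(g has_real_derivative g') (at t)"
  shows "deriv F (of_real t) = of_real g'"
proof -
  have "(F has_field_derivative deriv F (of_real t)) (at (of_real t))"
    by (rule holomorphic_derivI[OF F])
  then have "((\<lambda>s. F (of_real s)) has_vector_derivative deriv F (of_real t)) (at t)"
    by (rule has_vector_derivative_real_field)
  moreover have "((\<lambda>s. F (of_real s)) has_vector_derivative of_real g') (at t)"
  proof (rule has_vector_derivative_transform_within_open[where S="ball t \<epsilon>"])
    show "((\<lambda>s. complex_of_real (g s)) has_vector_derivative of_real g') (at t)"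
      using g by (intro has_vector_derivative_of_real) (simp add: has_real_derivative_iff_has_vector_derivative)
  qed (use \<epsilon> eq in \<open>auto simp: dist_real_def abs_minus_commute\<close>)
  ultimately show ?thesis by (rule vector_derivative_unique_at)
qed

lemma circle_integral_power:
  assumes "r > 0"
  shows "contour_integral (circlepath 0 r) (\<lambda>\<zeta>. \<zeta> ^ n) = 0"
proof (rule contour_integral_unique, rule Cauchy_theorem_convex_simple)
  show "(\<lambda>\<zeta>. \<zeta> ^ n) holomorphic_on UNIV" by (intro holomorphic_intros)
qed simp_all

lemma circle_integral_inverse:
  assumes "r > 0"
  shows "contour_integral (circlepath 0 r) (\<lambda>\<zeta>. 1 / \<zeta>) = 2 * pi * \<i>"
  using contour_integral_unique[OF Cauchy_integral_circlepath_simple[OF holomorphic_on_const, of 0 0 r 1]] assms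
  by simp

text \<open>\<zeta>^n F is single-valued near the circle, so its derivative integrates to zero. For
  \<open>n = 0\<close> the truncated exponent \<open>n - 1\<close> is harmless, since its
  coefficient is zero; that case states that derivatives have vanishing integral.\<close>

lemma circle_integral_by_parts:
  assumes F: "F holomorphic_on T" "open T" "sphere 0 r \<subseteq> T" and r: "r > 0"
  shows "contour_integral (circlepath 0 r) (\<lambda>\<zeta>. \<zeta> ^ n * deriv F \<zeta>)
    = - of_nat n * contour_integral (circlepath 0 r) (\<lambda>\<zeta>. \<zeta> ^ (n - 1) * F \<zeta>)"
proof -
  have img: "path_image (circlepath 0 r) \<subseteq> T" using assms by simp
  have int: "g contour_integrable_on circlepath 0 r" if "g holomorphic_on T" for g
    using that assms(3) r
    by (intro contour_integrable_on_circlepath holomorphic_on_imp_continuous_on) (auto intro: holomorphic_on_subset)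
  have hol: "(\<lambda>\<zeta>. \<zeta> ^ n * deriv F \<zeta>) holomorphic_on T" "(\<lambda>\<zeta>. of_nat n * (\<zeta> ^ (n - 1) * F \<zeta>)) holomorphic_on T"
    "(\<lambda>\<zeta>. \<zeta> ^ (n - 1) * F \<zeta>) holomorphic_on T"
    by (intro holomorphic_on_mult holomorphic_on_power holomorphic_on_ident holomorphic_on_const
        holomorphic_deriv[OF F(1,2)] F(1))+
  have der: "((\<lambda>\<zeta>. \<zeta> ^ n * F \<zeta>) has_field_derivative \<zeta> ^ n * deriv F \<zeta> + of_nat n * (\<zeta> ^ (n - 1) * F \<zeta>)) (at \<zeta> within T)"
    if "\<zeta> \<in> T" for \<zeta>
  proof -
    have "(F has_field_derivative deriv F \<zeta>) (at \<zeta> within T)"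
      by (rule has_field_derivative_at_within[OF holomorphic_derivI[OF F(1,2) that]])
    moreover have "((\<lambda>\<zeta>. \<zeta> ^ n) has_field_derivative of_nat n * \<zeta> ^ (n - 1)) (at \<zeta> within T)"
      using DERIV_power[OF DERIV_ident, where n=n] by simp
    ultimately have "((\<lambda>\<zeta>. \<zeta> ^ n * F \<zeta>) has_field_derivative of_nat n * \<zeta> ^ (n - 1) * F \<zeta> + deriv F \<zeta> * \<zeta> ^ n) (at \<zeta> within T)"
      by (rule DERIV_mult[rotated])
    then show ?thesis by (simp only: ac_simps)
  qed
  have "((\<lambda>\<zeta>. \<zeta> ^ n * deriv F \<zeta> + of_nat n * (\<zeta> ^ (n - 1) * F \<zeta>)) has_contour_integral 0) (circlepath 0 r)"
    by (rule Cauchy_theorem_primitive[OF der _ img]) simp_all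
  from contour_integral_unique[OF this]
  have "contour_integral (circlepath 0 r) (\<lambda>\<zeta>. \<zeta> ^ n * deriv F \<zeta>)
     + of_nat n * contour_integral (circlepath 0 r) (\<lambda>\<zeta>. \<zeta> ^ (n - 1) * F \<zeta>) = 0"
    unfolding contour_integral_add[OF int[OF hol(1)] int[OF hol(2)]] contour_integral_lmul[OF int[OF hol(3)]] .
  then show ?thesis by (simp add: eq_neg_iff_add_eq_0)
qed

lemma contour_integral_sum5:
  assumes "g0 contour_integrable_on \<gamma>" "g1 contour_integrable_on \<gamma>" "g2 contour_integrable_on \<gamma>"
    "g3 contour_integrable_on \<gamma>" "g4 contour_integrable_on \<gamma>"
  shows "contour_integral \<gamma> (\<lambda>\<zeta>. c0 * g0 \<zeta> + (c1 * g1 \<zeta> + (c2 * g2 \<zeta> + (c3 * g3 \<zeta> + c4 * g4 \<zeta>))))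
    = c0 * contour_integral \<gamma> g0 + (c1 * contour_integral \<gamma> g1 + (c2 * contour_integral \<gamma> g2
       + (c3 * contour_integral \<gamma> g3 + c4 * contour_integral \<gamma> g4)))"
  using assms by (simp add: contour_integral_add contour_integral_lmul contour_integrable_add contour_integrable_lmul)

text \<open>\<open>Fu\<close>, \<open>Fv\<close> and \<open>FA\<close> stand for h(u,X), h(v,X) and
  A(X), and \<open>S\<close> is the second soliton equation doubled. Divided by \<zeta>, its only
  pole among the integrated coefficients is 2q/\<zeta>, which gives 2q times 2 \<pi> i. Multiplied
  by \<zeta>^(2n-1) it has no such pole, so \<open>q\<close> disappears and integration by parts
  produces the factor 2n.\<close>

lemma soliton_moments:
  fixes L f Fu Fv FA :: "complex \<Rightarrow> complex" and q h Au Av a :: complex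
  assumes \<delta>: "0 < \<delta>" "\<delta> < r"
    and hol: "L holomorphic_on annulus r \<delta>" "f holomorphic_on annulus r \<delta>" "Fu holomorphic_on annulus r \<delta>"
      "Fv holomorphic_on annulus r \<delta>" "FA holomorphic_on annulus r \<delta>"
    and S: "\<And>t. \<bar>t - r\<bar> < \<delta> \<Longrightarrow> 2 * q + 2 * a * of_real t ^ 2 * h + of_real t ^ 2 * L (of_real t) + 2 * of_real t * f (of_real t) * h
       - of_real t * (Au * deriv Fv (of_real t) + Av * deriv Fu (of_real t)) = 0"
    and R: "\<And>t. \<bar>t - r\<bar> < \<delta> \<Longrightarrow> of_real t * deriv f (of_real t) + deriv FA (of_real t) + a * of_real t = 0"
  shows "contour_integral (circlepath 0 r) (\<lambda>\<zeta>. \<zeta> * L \<zeta>) = - 4 * pi * \<i> * q"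
    and "n > 0 \<Longrightarrow> contour_integral (circlepath 0 r) (\<lambda>\<zeta>. \<zeta> ^ (2 * n + 1) * L \<zeta>) =
      - 2 * h * contour_integral (circlepath 0 r) (\<lambda>\<zeta>. \<zeta> ^ (2 * n) * f \<zeta>)
      - 2 * of_nat n * (Au * contour_integral (circlepath 0 r) (\<lambda>\<zeta>. \<zeta> ^ (2 * n - 1) * Fv \<zeta>)
         + Av * contour_integral (circlepath 0 r) (\<lambda>\<zeta>. \<zeta> ^ (2 * n - 1) * Fu \<zeta>))"
proof -
  let ?A = "annulus r \<delta>" and ?I = "contour_integral (circlepath 0 r)"
  have r: "r > 0" using \<delta> by simp
  have sub: "sphere 0 r \<subseteq> ?A" by (rule sphere_subset_annulus[OF \<delta>(1)])
  have nz: "\<zeta> \<noteq> 0" if "\<zeta> \<in> sphere 0 r" for \<zeta> :: complex using that r by auto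
  note dhol = holomorphic_deriv[OF _ open_annulus]
  have S': "2 * q + 2 * a * \<zeta> ^ 2 * h + \<zeta> ^ 2 * L \<zeta> + 2 * \<zeta> * f \<zeta> * h - \<zeta> * (Au * deriv Fv \<zeta> + Av * deriv Fu \<zeta>) = 0"
    if "\<zeta> \<in> ?A" for \<zeta>
    by (rule annulus_identity[OF \<delta> _ _ that]) (use S in \<open>auto intro!: holomorphic_intros hol dhol\<close>)
  have R': "\<zeta> * deriv f \<zeta> + deriv FA \<zeta> + a * \<zeta> = 0" if "\<zeta> \<in> ?A" for \<zeta>
    by (rule annulus_identity[OF \<delta> _ _ that]) (use R in \<open>auto intro!: holomorphic_intros hol dhol\<close>)
  have int: "g contour_integrable_on circlepath 0 r" if "g holomorphic_on ?A" for g
    using that sub r by (intro contour_integrable_on_circlepath holomorphic_on_imp_continuous_on) (auto intro: holomorphic_on_subset)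
  have inti: "(\<lambda>\<zeta>. c / \<zeta>) contour_integrable_on circlepath 0 r" for c
    using r by (intro contour_integrable_on_circlepath continuous_intros) auto
  have parts: "?I (\<lambda>\<zeta>. \<zeta> ^ n * deriv g \<zeta>) = - of_nat n * ?I (\<lambda>\<zeta>. \<zeta> ^ (n - 1) * g \<zeta>)" if "g holomorphic_on ?A" for g n
    by (rule circle_integral_by_parts[OF that open_annulus sub r])
  note pw = circle_integral_power[OF r]
  \<comment> \<open>Integration by parts replaces \<open>f\<close> by \<zeta> f' up to sign, and
    \<open>R\<close> expresses \<zeta> f' through a derivative and a linear term, both without
    contribution on the circle.\<close>
  have If: "?I f = 0"
  proof -
    have "?I (\<lambda>\<zeta>. \<zeta> ^ 1 * deriv f \<zeta>) = - ?I (\<lambda>\<zeta>. f \<zeta>)" using parts[OF hol(2), of 1] by simp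
    moreover have "?I (\<lambda>\<zeta>. \<zeta> ^ 1 * deriv f \<zeta>) = ?I (\<lambda>\<zeta>. (- 1) * (\<zeta> ^ 0 * deriv FA \<zeta>) + (- a) * \<zeta> ^ 1)"
    proof (rule contour_integral_cong[OF refl])
      fix \<zeta> assume "\<zeta> \<in> path_image (circlepath 0 r)"
      then have "\<zeta> \<in> ?A" using sub r by auto
      from R'[OF this] show "\<zeta> ^ 1 * deriv f \<zeta> = (- 1) * (\<zeta> ^ 0 * deriv FA \<zeta>) + (- a) * \<zeta> ^ 1"
        by (simp add: eq_neg_iff_add_eq_0 algebra_simps)
    qed
    moreover have "\<dots> = (- 1) * ?I (\<lambda>\<zeta>. \<zeta> ^ 0 * deriv FA \<zeta>) + ?I (\<lambda>\<zeta>. (- a) * \<zeta> ^ 1)"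
      by (subst contour_integral_add, (intro int holomorphic_intros dhol hol)+)
        (subst contour_integral_lmul, (intro int holomorphic_intros dhol hol)+, rule refl)
    moreover have "?I (\<lambda>\<zeta>. (- a) * \<zeta> ^ 1) = 0"
      by (subst contour_integral_lmul, (intro int holomorphic_intros)[1]) (simp only: pw mult_zero_right)
    moreover have "?I (\<lambda>\<zeta>. \<zeta> ^ 0 * deriv FA \<zeta>) = 0" unfolding parts[OF hol(5)] by simp
    ultimately show ?thesis by simp
  qed
  show "?I (\<lambda>\<zeta>. \<zeta> * L \<zeta>) = - 4 * pi * \<i> * q"
  proof -
    have "?I (\<lambda>\<zeta>. \<zeta> * L \<zeta>) = ?I (\<lambda>\<zeta>. (- 2 * q) * (1 / \<zeta>) + ((- 2 * a * h) * \<zeta> ^ 1 + ((- 2 * h) * f \<zeta> + (Au * (\<zeta> ^ 0 * deriv Fv \<zeta>) + Av * (\<zeta> ^ 0 * deriv Fu \<zeta>)))))"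
    proof (rule contour_integral_cong[OF refl])
      fix \<zeta> assume "\<zeta> \<in> path_image (circlepath 0 r)"
      then have "\<zeta> \<in> ?A" "\<zeta> \<noteq> 0" using sub r nz by auto
      with S'[OF this(1)] show "\<zeta> * L \<zeta> = (- 2 * q) * (1 / \<zeta>) + ((- 2 * a * h) * \<zeta> ^ 1 + ((- 2 * h) * f \<zeta> + (Au * (\<zeta> ^ 0 * deriv Fv \<zeta>) + Av * (\<zeta> ^ 0 * deriv Fu \<zeta>))))"
        by (simp add: field_simps power2_eq_square)
    qed
    also have "\<dots> = (- 2 * q) * ?I (\<lambda>\<zeta>. 1 / \<zeta>) + ((- 2 * a * h) * ?I (\<lambda>\<zeta>. \<zeta> ^ 1) + ((- 2 * h) * ?I (\<lambda>\<zeta>. f \<zeta>)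
        + (Au * ?I (\<lambda>\<zeta>. \<zeta> ^ 0 * deriv Fv \<zeta>) + Av * ?I (\<lambda>\<zeta>. \<zeta> ^ 0 * deriv Fu \<zeta>))))"
      by (rule contour_integral_sum5; intro inti int holomorphic_intros dhol hol)
    also have "\<dots> = - 4 * pi * \<i> * q"
      unfolding parts[OF hol(4)] parts[OF hol(3)] pw circle_integral_inverse[OF r] If by simp
    finally show ?thesis .
  qed
  show "?I (\<lambda>\<zeta>. \<zeta> ^ (2 * n + 1) * L \<zeta>) =
      - 2 * h * ?I (\<lambda>\<zeta>. \<zeta> ^ (2 * n) * f \<zeta>)
      - 2 * of_nat n * (Au * ?I (\<lambda>\<zeta>. \<zeta> ^ (2 * n - 1) * Fv \<zeta>) + Av * ?I (\<lambda>\<zeta>. \<zeta> ^ (2 * n - 1) * Fu \<zeta>))" if n: "n > 0"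
  proof -
    \<comment> \<open>The exponent 2n - 1 is written as 2m + 1 to avoid truncated subtraction in the
      multiplier.\<close>
    obtain m where m: "n = Suc m" using n gr0_conv_Suc by blast
    have "?I (\<lambda>\<zeta>. \<zeta> ^ (2 * n + 1) * L \<zeta>) = ?I (\<lambda>\<zeta>. (- 2 * q) * \<zeta> ^ (2 * m + 1) + ((- 2 * a * h) * \<zeta> ^ (2 * n + 1) + ((- 2 * h) * (\<zeta> ^ (2 * n) * f \<zeta>)
        + (Au * (\<zeta> ^ (2 * n) * deriv Fv \<zeta>) + Av * (\<zeta> ^ (2 * n) * deriv Fu \<zeta>)))))"
    proof (rule contour_integral_cong[OF refl])
      fix \<zeta> assume "\<zeta> \<in> path_image (circlepath 0 r)"
      then have "\<zeta> \<in> ?A" using sub r by auto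
      note eq = S'[OF this]
      define w where "w = \<zeta> ^ (2 * m)"
      have pows: "\<zeta> ^ (2 * n + 1) = \<zeta> ^ 3 * w" "\<zeta> ^ (2 * n) = \<zeta> ^ 2 * w" "\<zeta> ^ (2 * m + 1) = \<zeta> * w"
        by (simp_all add: m w_def power2_eq_square power3_eq_cube)
      show "\<zeta> ^ (2 * n + 1) * L \<zeta> = (- 2 * q) * \<zeta> ^ (2 * m + 1) + ((- 2 * a * h) * \<zeta> ^ (2 * n + 1) + ((- 2 * h) * (\<zeta> ^ (2 * n) * f \<zeta>)
        + (Au * (\<zeta> ^ (2 * n) * deriv Fv \<zeta>) + Av * (\<zeta> ^ (2 * n) * deriv Fu \<zeta>))))"
        unfolding pows using eq by algebra
    qed
    also have "\<dots> = (- 2 * q) * ?I (\<lambda>\<zeta>. \<zeta> ^ (2 * m + 1)) + ((- 2 * a * h) * ?I (\<lambda>\<zeta>. \<zeta> ^ (2 * n + 1)) + ((- 2 * h) * ?I (\<lambda>\<zeta>. \<zeta> ^ (2 * n) * f \<zeta>)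
        + (Au * ?I (\<lambda>\<zeta>. \<zeta> ^ (2 * n) * deriv Fv \<zeta>) + Av * ?I (\<lambda>\<zeta>. \<zeta> ^ (2 * n) * deriv Fu \<zeta>))))"
      by (rule contour_integral_sum5; intro inti int holomorphic_intros dhol hol)
    also have "\<dots> = - 2 * h * ?I (\<lambda>\<zeta>. \<zeta> ^ (2 * n) * f \<zeta>)
      - 2 * of_nat n * (Au * ?I (\<lambda>\<zeta>. \<zeta> ^ (2 * n - 1) * Fv \<zeta>) + Av * ?I (\<lambda>\<zeta>. \<zeta> ^ (2 * n - 1) * Fu \<zeta>))"
      unfolding parts[OF hol(4)] parts[OF hol(3)] pw by (simp add: algebra_simps)
    finally show ?thesis .
  qed
qed

section \<open>Charts\<close>

lemma is_chartD:
  assumes "is_chart c"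
  shows is_chart_open_dom: "open (chart_dom c)" and is_chart_open_image: "open (chart_image c)"
    and chart_inv_map: "\<And>q. q \<in> chart_dom c \<Longrightarrow> chart_inv c (chart_map c q) = q"
    and chart_map_inv: "\<And>x. x \<in> chart_image c \<Longrightarrow> chart_map c (chart_inv c x) = x"
    and chart_inv_dom: "\<And>x. x \<in> chart_image c \<Longrightarrow> chart_inv c x \<in> chart_dom c"
    and chart_map_image: "\<And>q. q \<in> chart_dom c \<Longrightarrow> chart_map c q \<in> chart_image c"
    and continuous_chart_map: "continuous_on (chart_dom c) (chart_map c)"
    and continuous_chart_inv: "continuous_on (chart_image c) (chart_inv c)"
  using assms by (auto simp: is_chart_def homeomorphism_def chart_image_def)

lemma open_chart_preimage: "is_chart c \<Longrightarrow> open T \<Longrightarrow> open {x \<in> chart_image c. chart_inv c x \<in> T}"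
  using continuous_open_preimage[OF continuous_chart_inv is_chart_open_image, of c T]
  by (simp add: vimage_def Int_def)

lemma overlap_iff: "is_chart c \<Longrightarrow> x \<in> overlap c d \<longleftrightarrow> x \<in> chart_image c \<and> chart_inv c x \<in> chart_dom d"
  unfolding overlap_def by (force simp: chart_inv_map chart_map_inv chart_inv_dom chart_map_image)

lemma open_overlap: "is_chart c \<Longrightarrow> is_chart d \<Longrightarrow> open (overlap c d)"
  using open_chart_preimage[of c "chart_dom d"] by (simp add: is_chart_open_dom overlap_iff[of c _ d, symmetric])

lemma local_rep_id: "local_rep id c d x = chart_map d (chart_inv c x)"
  by (simp add: local_rep_def)

lemma local_rep_id_inverse:
  assumes "is_chart c" "is_chart d" "x \<in> overlap c d"
  shows "local_rep id c d x \<in> overlap d c" "local_rep id d c (local_rep id c d x) = x"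
  using assms by (auto simp: overlap_iff local_rep_id chart_inv_map chart_map_image chart_inv_dom chart_map_inv)

lemma chart_inv_product:
  assumes "is_chart (\<A> i)" "x \<in> chart_image (\<A> i)" "s \<in> T"
  shows "chart_inv (product_atlas T \<A> i) (x, s) = (chart_inv (\<A> i) x, s)"
proof -
  have inj: "inj_on (\<lambda>(p, s). (chart_map (\<A> i) p, s)) (chart_dom (\<A> i) \<times> T)"
    using chart_inv_map[OF assms(1)] by (intro inj_onI) (auto, metis)
  have "(x, s) = (\<lambda>(p, s). (chart_map (\<A> i) p, s)) (chart_inv (\<A> i) x, s)"
    by (simp add: chart_map_inv assms)
  then show ?thesis
    unfolding product_atlas_def chart_inv_def[of "Chart _ _"] chart.sel
    using inv_into_f_f[OF inj, of "(chart_inv (\<A> i) x, s)"] assms by (auto simp: chart_inv_dom)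
qed

lemma chart_image_product: "chart_image (product_atlas T \<A> i) = chart_image (\<A> i) \<times> T"
  by (force simp: chart_image_def product_atlas_def)

subsection \<open>Real-analytic and holomorphic transition maps\<close>

lemma real_analytic_on_inner:
  fixes f :: "'v::euclidean_space \<Rightarrow> 'w::euclidean_space"
  assumes "real_analytic_on f S"
  shows "real_analytic_on (\<lambda>x. f x \<bullet> b) S"
  unfolding real_analytic_on_def
proof
  fix x assume "x \<in> S"
  then obtain r a where r: "r > 0"
    and a: "\<And>y. y \<in> ball x r \<Longrightarrow> ((\<lambda>\<alpha>. (\<Prod>b\<in>Basis. ((y - x) \<bullet> b) ^ \<alpha> b) *\<^sub>R a \<alpha>) has_sum f y) (Basis \<rightarrow>\<^sub>E UNIV)"
    using assms unfolding real_analytic_on_def by blast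
  have "((\<lambda>\<alpha>. (\<Prod>b\<in>Basis. ((y - x) \<bullet> b) ^ \<alpha> b) *\<^sub>R (a \<alpha> \<bullet> b)) has_sum f y \<bullet> b) (Basis \<rightarrow>\<^sub>E UNIV)" if "y \<in> ball x r" for y
    using has_sum_bounded_linear[OF bounded_linear_inner_left a[OF that], of b] by (simp add: o_def)
  then show "\<exists>r>0. \<exists>a. \<forall>y\<in>ball x r. ((\<lambda>\<alpha>. (\<Prod>b\<in>Basis. ((y - x) \<bullet> b) ^ \<alpha> b) *\<^sub>R a \<alpha>) has_sum f y \<bullet> b) (Basis \<rightarrow>\<^sub>E UNIV)"
    using r by (intro exI[of _ r] conjI exI[of _ "\<lambda>\<alpha>. a \<alpha> \<bullet> b"]) auto
qed

lemma ra_component: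
  fixes f :: "'v::euclidean_space \<Rightarrow> real ^ 'n"
  assumes "real_analytic_on f S"
  shows "ra_on (\<lambda>x. f x $ k) S"
  using ra_real_analytic[OF real_analytic_on_inner[OF assms, of "axis k 1"]] by (simp add: inner_axis)

lemma real_analytic_on_differentiable:
  fixes f :: "'v::euclidean_space \<Rightarrow> 'w::euclidean_space"
  assumes "real_analytic_on f S" "open S" "x \<in> S"
  shows "f differentiable at x"
  by (subst differentiable_componentwise_within)
    (use ra_differentiable[OF assms(2) ra_real_analytic[OF real_analytic_on_inner[OF assms(1)]] assms(3)] in blast)

lemma holomorphic_map_linear:
  assumes f: "holomorphic_map_on f S" and g: "bounded_linear g" "\<And>c v. g (c *\<^sub>C v) = c *\<^sub>C g v"
  shows "holomorphic_map_on (\<lambda>z. g (f z)) S"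
  unfolding holomorphic_map_on_def
proof
  fix z assume "z \<in> S"
  then obtain D where D: "(f has_derivative D) (at z)" "complex_linear D"
    using f unfolding holomorphic_map_on_def by blast
  have *: "((\<lambda>z. g (f z)) has_derivative (\<lambda>h. g (D h))) (at z)"
    by (rule bounded_linear.has_derivative[OF g(1) D(1)])
  moreover from has_derivative_linear[OF this] have "complex_linear (\<lambda>h. g (D h))"
    using D(2) by (simp add: complex_linear_def g(2))
  ultimately show "\<exists>D. ((\<lambda>z. g (f z)) has_derivative D) (at z) \<and> complex_linear D" by blast
qed

lemma holomorphic_map_component:
  fixes f :: "'z::complex_space \<Rightarrow> complex ^ 'n"
  shows "holomorphic_map_on f S \<Longrightarrow> holomorphic_map_on (\<lambda>z. f z $ k) S"
  by (rule holomorphic_map_linear[OF _ bounded_linear_vec_nth]) (simp_all add: scaleC_vec_def)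

lemma complex_linear_frechet:
  assumes "holomorphic_map_on f S" "z \<in> S"
  shows "(f has_derivative frechet_derivative f (at z)) (at z)" "complex_linear (frechet_derivative f (at z))"
proof -
  obtain D where D: "(f has_derivative D) (at z)" "complex_linear D"
    using assms unfolding holomorphic_map_on_def by blast
  then show "(f has_derivative frechet_derivative f (at z)) (at z)" "complex_linear (frechet_derivative f (at z))"
    using frechet_derivative_at[OF D(1)] by auto
qed

text \<open>The components of \<open>\<tau>\<close> extend to a common ball because they are
  finitely many. There the extension has a derivative that is complex linear for
  \<open>pair_scale\<close>, and the chain rule with \<open>\<sigma>\<close> preserves this.\<close>

lemma ext_hol_compose:
  fixes \<tau> :: "'v::euclidean_space \<Rightarrow> complex ^ 'n" and \<sigma> :: "complex ^ 'n \<Rightarrow> complex"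
  assumes S: "open S" and \<tau>: "\<And>k. ext_hol (\<lambda>x. \<tau> x $ k) S" and T: "open T" and \<sigma>: "holomorphic_map_on \<sigma> T"
    and ST: "\<And>x. x \<in> S \<Longrightarrow> \<tau> x \<in> T"
  shows "ext_hol (\<lambda>x. \<sigma> (\<tau> x)) S"
proof (rule ext_holI)
  fix x assume x: "x \<in> S"
  have "\<forall>k. \<exists>r F. r > 0 \<and> cpair.ghol F (ball (x, 0) r) \<and> (\<forall>y\<in>ball x r. F (y, 0) = \<tau> y $ k)"
    using ext_holE[OF \<tau> x S] by metis
  then obtain r F where r: "\<And>k. r k > 0" and F: "\<And>k. cpair.ghol (F k) (ball (x, 0) (r k))"
    and eq: "\<And>k y. y \<in> ball x (r k) \<Longrightarrow> F k (y, 0) = \<tau> y $ k" by metis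
  define r0 where "r0 = Min (range r)"
  have r0: "r0 > 0" "\<And>k. r0 \<le> r k" using r by (auto simp: r0_def)
  define G where "G z = (\<chi> k. F k z)" for z
  have F0: "cpair.ghol (F k) (ball (x, 0) r0)" for k
    by (rule cpair.ghol_subset[OF F]) (use r0(2)[of k] in auto)
  have Fd: "(F k has_derivative (\<lambda>v. cpair.cderiv v (F k) z)) (at z)" if "z \<in> ball (x, 0) r0" for k z
    by (rule cpair.ghol_has_derivative[OF _ F0 that]) simp
  have "continuous_on (ball (x, 0) r0) G"
    unfolding G_def by (intro continuous_on_vec_lambda) (use F0 in \<open>auto simp: cpair.ghol_def\<close>)
  then have "open (ball (x, 0) r0 \<inter> G -` T)" by (intro continuous_open_preimage T) auto
  moreover have "(x, 0) \<in> ball (x, 0) r0 \<inter> G -` T"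
  proof -
    have "G (x, 0) = \<tau> x" using eq[of x] r by (simp add: G_def vec_eq_iff)
    then show ?thesis using ST[OF x] r0 by simp
  qed
  ultimately obtain e where e: "e > 0" "ball (x, 0) e \<subseteq> ball (x, 0) r0 \<inter> G -` T"
    using open_contains_ball by blast
  have "cpair.ghol (\<lambda>z. \<sigma> (G z)) (ball (x, 0) e)"
  proof (rule cpair.ghol_if_has_derivative)
    fix z assume "z \<in> ball (x, 0 :: 'v) e"
    then have z: "z \<in> ball (x, 0) r0" "G z \<in> T" using e by auto
    obtain D where D: "(\<sigma> has_derivative D) (at (G z))" "complex_linear D"
      using \<sigma> z(2) unfolding holomorphic_map_on_def by blast
    have "(G has_derivative (\<lambda>v. \<chi> k. cpair.cderiv v (F k) z)) (at z)"
    proof (subst has_derivative_componentwise_within, intro ballI)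
      fix b :: "complex ^ 'n" assume "b \<in> Basis"
      then obtain k c where b: "b = axis k c" by (auto simp: Basis_vec_def)
      then show "((\<lambda>x. G x \<bullet> b) has_derivative (\<lambda>v. (\<chi> k. cpair.cderiv v (F k) z) \<bullet> b)) (at z)"
        using has_derivative_inner_left[OF Fd[OF z(1)], of k c] by (simp add: inner_axis G_def)
    qed
    from has_derivative_compose[OF this D(1)]
    have "((\<lambda>z. \<sigma> (G z)) has_derivative (\<lambda>v. D (\<chi> k. cpair.cderiv v (F k) z))) (at z)" .
    moreover have "D (\<chi> k. cpair.cderiv (pair_scale c v) (F k) z) = c * D (\<chi> k. cpair.cderiv v (F k) z)" for c v
    proof -
      have "(\<chi> k. cpair.cderiv (pair_scale c v) (F k) z) = c *\<^sub>C (\<chi> k. cpair.cderiv v (F k) z)"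
        by (simp add: vec_eq_iff scaleC_vec_def scaleC_complex_def cpair.cderiv_scale[OF _ F0 z(1)])
      then show ?thesis using D(2) by (simp add: complex_linear_def scaleC_complex_def)
    qed
    ultimately show "\<exists>D. ((\<lambda>z. \<sigma> (G z)) has_derivative D) (at z) \<and> (\<forall>c v. D (pair_scale c v) = c * D v)" by blast
  qed simp
  moreover have "\<sigma> (G (y, 0)) = \<sigma> (\<tau> y)" if "y \<in> ball x (min e r0)" for y
  proof -
    have "F k (y, 0) = \<tau> y $ k" for k using that r0(2)[of k] by (intro eq) auto
    then show ?thesis by (simp add: G_def vec_eq_iff flip: vec_nth_inject)
  qed
  ultimately show "\<exists>r>0. \<exists>F. cpair.ghol F (ball (x, 0) r) \<and> (\<forall>y\<in>ball x r. F (y, 0) = \<sigma> (\<tau> y))"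
  proof (intro exI[of _ "min e r0"] conjI exI[of _ "\<lambda>z. \<sigma> (G z)"] ballI)
    show "cpair.ghol (\<lambda>z. \<sigma> (G z)) (ball (x, 0) (min e r0))" if "cpair.ghol (\<lambda>z. \<sigma> (G z)) (ball (x, 0) e)"
      by (rule cpair.ghol_subset[OF that]) (rule subset_ball, simp)
  qed (use e(1) r0(1) in simp_all)
qed

subsection \<open>The embedding in charts\<close>

lemma frechet_derivative_inverse:
  assumes f: "f differentiable at x" and g: "g differentiable at (f x)" and o: "open O1" "x \<in> O1"
    and inv: "\<And>y. y \<in> O1 \<Longrightarrow> g (f y) = y"
  shows "frechet_derivative g (at (f x)) (frechet_derivative f (at x) u) = u"
proof -
  have "((\<lambda>y. g (f y)) has_derivative (\<lambda>u. frechet_derivative g (at (f x)) (frechet_derivative f (at x) u))) (at x)"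
    by (rule has_derivative_compose[OF has_frechet_derivative[OF f] has_frechet_derivative[OF g]])
  moreover have "((\<lambda>y. g (f y)) has_derivative (\<lambda>u. u)) (at x)"
    by (rule has_derivative_cong_open[OF has_derivative_ident o]) (simp add: inv)
  ultimately have "(\<lambda>u. frechet_derivative g (at (f x)) (frechet_derivative f (at x) u)) = (\<lambda>u. u)"
    by (rule has_derivative_unique)
  from fun_cong[OF this] show ?thesis .
qed

lemma complexify_vec_linear: "complexify_vec (u + v) = complexify_vec u + complexify_vec v"
  "complexify_vec (c *\<^sub>R u) = of_real c *\<^sub>C complexify_vec u"
  by (simp_all add: complexify_vec_def vec_eq_iff scaleC_vec_def scaleC_complex_def)

lemma norm_complexify_vec: "norm (complexify_vec u) = norm u"
  by (simp add: norm_vec_def complexify_vec_def)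

lemma bounded_linear_complexify_vec: "bounded_linear complexify_vec"
  by (rule bounded_linear_intro[where K=1])
    (simp_all add: complexify_vec_linear norm_complexify_vec scaleC_of_real)

text \<open>In the adapted charts the embedding is the inclusion of real coordinate space; arbitrary
  charts differ from them by invertible transition maps, analytic on one side and holomorphic on the
  other. Hence \<open>J\<close> is real-analytic, and the images of the real basis vectors under its
  derivative form a complex basis with a dual coframe.\<close>

lemma complexification_chart:
  fixes \<N> :: "'i \<Rightarrow> ('n::topological_space, real ^ 'm) chart"
    and \<X> :: "'k \<Rightarrow> ('x::topological_space, complex ^ 'm) chart"
    and J :: "real ^ 'm \<Rightarrow> complex ^ 'm"
  assumes X: "complexification \<N> \<X> \<iota>" and N: "real_analytic_atlas UNIV \<N>"
    and i: "p \<in> chart_dom (\<N> i)" and k: "\<iota> p \<in> chart_dom (\<X> k)"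
  defines "J \<equiv> local_rep \<iota> (\<N> i) (\<X> k)" and "x \<equiv> chart_map (\<N> i) p"
  obtains O1 :: "(real ^ 'm) set" where "open O1" "x \<in> O1" "O1 \<subseteq> chart_image (\<N> i)"
    "\<And>y. y \<in> O1 \<Longrightarrow> \<iota> (chart_inv (\<N> i) y) \<in> chart_dom (\<X> k)"
    "\<And>l. ext_hol (\<lambda>y. J y $ l) O1"
    "\<exists>\<phi> :: 'm \<Rightarrow> complex ^ 'm \<Rightarrow> complex. (\<forall>m. complex_linear (\<phi> m)) \<and> (\<forall>m u. \<phi> m (dir_deriv J x u) = of_real ((u :: real ^ 'm) $ m)) \<and>
       (\<forall>w. w = (\<Sum>m\<in>UNIV. \<phi> m w *\<^sub>C dir_deriv J x (axis m 1)))"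
proof -
  obtain c d where c: "is_chart c" "analytically_compatible c (\<N> i)" and d: "is_chart d" "holomorphically_compatible d (\<X> k)"
    and p: "p \<in> chart_dom c" and img: "\<iota> ` chart_dom c = chart_dom d \<inter> range \<iota>"
    and \<iota>: "\<And>q. q \<in> chart_dom c \<Longrightarrow> chart_map d (\<iota> q) = complexify_vec (chart_map c q)"
    using X unfolding complexification_def by metis
  have Ni: "is_chart (\<N> i)" and Xk: "is_chart (\<X> k)"
    using N X by (auto simp: real_analytic_atlas_def complexification_def holomorphic_atlas_def)
  define \<tau> where "\<tau> = local_rep id (\<N> i) c"
  define \<tau>' where "\<tau>' = local_rep id c (\<N> i)"
  define \<sigma> where "\<sigma> = local_rep id d (\<X> k)"
  define \<sigma>' where "\<sigma>' = local_rep id (\<X> k) d"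
  have ra: "real_analytic_on \<tau> (overlap (\<N> i) c)" "real_analytic_on \<tau>' (overlap c (\<N> i))"
    using c by (auto simp: analytically_compatible_def \<tau>_def \<tau>'_def)
  have ho: "holomorphic_map_on \<sigma> (overlap d (\<X> k))" "holomorphic_map_on \<sigma>' (overlap (\<X> k) d)"
    using d by (auto simp: holomorphically_compatible_def \<sigma>_def \<sigma>'_def)
  note op = open_overlap[OF Ni c(1)] open_overlap[OF c(1) Ni] open_overlap[OF d(1) Xk] open_overlap[OF Xk d(1)]
  define O1 where "O1 = overlap (\<N> i) c \<inter> (\<lambda>y. complexify_vec (\<tau> y)) -` overlap d (\<X> k)"
  have cont_\<tau>: "continuous_on (overlap (\<N> i) c) \<tau>"
    by (intro continuous_at_imp_continuous_on ballI differentiable_imp_continuous_within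
        real_analytic_on_differentiable[OF ra(1) op(1)])
  have oO: "open O1" unfolding O1_def
    by (intro continuous_open_preimage op bounded_linear.continuous_on[OF bounded_linear_complexify_vec] cont_\<tau>)
  have \<iota>c: "\<iota> q \<in> chart_dom d" if "q \<in> chart_dom c" for q using img that by blast
  have invc: "chart_inv d (complexify_vec (chart_map c q)) = \<iota> q" if "q \<in> chart_dom c" for q
    using \<iota>[OF that] \<iota>c[OF that] chart_inv_map[OF d(1)] by metis
  have xo: "x \<in> overlap (\<N> i) c"
    using i p by (auto simp: x_def overlap_iff[OF Ni] chart_map_image[OF Ni] chart_inv_map[OF Ni])
  have \<tau>x: "\<tau> x = chart_map c p" by (simp add: \<tau>_def local_rep_id x_def chart_inv_map[OF Ni i])
  have cx: "complexify_vec (\<tau> x) = chart_map d (\<iota> p)" using \<iota>[OF p] by (simp add: \<tau>x)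
  have cxo: "complexify_vec (\<tau> x) \<in> overlap d (\<X> k)"
    unfolding cx overlap_iff[OF d(1)] using \<iota>c[OF p] k by (simp add: chart_map_image[OF d(1)] chart_inv_map[OF d(1)])
  have xO: "x \<in> O1" using xo cxo by (simp add: O1_def)
  have J: "J y = \<sigma> (complexify_vec (\<tau> y))" if "y \<in> O1" for y
  proof -
    have y: "y \<in> overlap (\<N> i) c" using that by (simp add: O1_def)
    then have "chart_inv (\<N> i) y \<in> chart_dom c" by (simp add: overlap_iff[OF Ni])
    then show ?thesis
      by (simp add: J_def local_rep_def \<sigma>_def \<tau>_def invc)
  qed
  have dom: "\<iota> (chart_inv (\<N> i) y) \<in> chart_dom (\<X> k)" if "y \<in> O1" for y
  proof -
    have y: "y \<in> overlap (\<N> i) c" "complexify_vec (\<tau> y) \<in> overlap d (\<X> k)" using that by (auto simp: O1_def)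
    then have "chart_inv (\<N> i) y \<in> chart_dom c" by (simp add: overlap_iff[OF Ni])
    then show ?thesis using y(2) by (simp add: overlap_iff[OF d(1)] \<tau>_def local_rep_id invc)
  qed
  have sub: "O1 \<subseteq> chart_image (\<N> i)" using overlap_iff[OF Ni] by (auto simp: O1_def)
  have ext: "ext_hol (\<lambda>y. J y $ l) O1" for l
  proof (rule ext_hol_cong[OF _ oO])
    show "ext_hol (\<lambda>y. \<sigma> (complexify_vec (\<tau> y)) $ l) O1"
    proof (rule ext_hol_compose[OF oO _ op(3) holomorphic_map_component[OF ho(1)]])
      show "ext_hol (\<lambda>x. complexify_vec (\<tau> x) $ k) O1" for k
        using ra_component[OF ra(1), of k] unfolding ra_on_def
        by (simp add: complexify_vec_def) (rule ext_hol_subset, assumption, simp add: O1_def)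
    qed (simp add: O1_def)
  qed (simp add: J)
  have d\<tau>: "\<tau> differentiable at x" by (rule real_analytic_on_differentiable[OF ra(1) op(1) xo])
  have \<tau>xo: "\<tau> x \<in> overlap c (\<N> i)" unfolding \<tau>_def by (rule local_rep_id_inverse(1)[OF Ni c(1) xo])
  have d\<tau>': "\<tau>' differentiable at (\<tau> x)"
    by (rule real_analytic_on_differentiable[OF ra(2) op(2) \<tau>xo])
  note d\<sigma> = complex_linear_frechet[OF ho(1) cxo]
  let ?s = "\<sigma> (complexify_vec (\<tau> x))"
  have so: "?s \<in> overlap (\<X> k) d" unfolding \<sigma>_def by (rule local_rep_id_inverse(1)[OF d(1) Xk cxo])
  note d\<sigma>' = complex_linear_frechet[OF ho(2) so]
  let ?T = "frechet_derivative \<tau> (at x)" and ?T' = "frechet_derivative \<tau>' (at (\<tau> x))"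
    and ?S = "frechet_derivative \<sigma> (at (complexify_vec (\<tau> x)))" and ?S' = "frechet_derivative \<sigma>' (at ?s)"
  have inv\<tau>: "\<tau>' (\<tau> y) = y" if "y \<in> overlap (\<N> i) c" for y
    unfolding \<tau>_def \<tau>'_def by (rule local_rep_id_inverse(2)[OF Ni c(1) that])
  have inv\<tau>': "\<tau> (\<tau>' y) = y" if "y \<in> overlap c (\<N> i)" for y
    unfolding \<tau>_def \<tau>'_def by (rule local_rep_id_inverse(2)[OF c(1) Ni that])
  have inv\<sigma>: "\<sigma>' (\<sigma> y) = y" if "y \<in> overlap d (\<X> k)" for y
    unfolding \<sigma>_def \<sigma>'_def by (rule local_rep_id_inverse(2)[OF d(1) Xk that])
  have inv\<sigma>': "\<sigma> (\<sigma>' y) = y" if "y \<in> overlap (\<X> k) d" for y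
    unfolding \<sigma>_def \<sigma>'_def by (rule local_rep_id_inverse(2)[OF Xk d(1) that])
  have T'T: "?T' (?T u) = u" for u
    by (rule frechet_derivative_inverse[OF d\<tau> d\<tau>' op(1) xo inv\<tau>])
  have TT': "?T (?T' u) = u" for u
    using frechet_derivative_inverse[OF d\<tau>' _ op(2) \<tau>xo inv\<tau>', unfolded inv\<tau>[OF xo], OF d\<tau>] .
  have S'S: "?S' (?S u) = u" for u
    by (rule frechet_derivative_inverse[OF differentiableI[OF d\<sigma>(1)] differentiableI[OF d\<sigma>'(1)] op(3) cxo inv\<sigma>])
  have SS': "?S (?S' u) = u" for u
    using frechet_derivative_inverse[OF differentiableI[OF d\<sigma>'(1)] _ op(4) so inv\<sigma>', unfolded inv\<sigma>[OF cxo], OF differentiableI[OF d\<sigma>(1)]] .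
  have DJ: "dir_deriv J x u = ?S (complexify_vec (?T u))" for u
  proof -
    have "((\<lambda>y. complexify_vec (\<tau> y)) has_derivative (\<lambda>u. complexify_vec (?T u))) (at x)"
      using d\<tau> by (intro bounded_linear.has_derivative[OF bounded_linear_complexify_vec]) (simp add: frechet_derivative_works)
    from has_derivative_compose[OF this d\<sigma>(1)]
    have "((\<lambda>y. \<sigma> (complexify_vec (\<tau> y))) has_derivative (\<lambda>u. ?S (complexify_vec (?T u)))) (at x)" .
    then have "(J has_derivative (\<lambda>u. ?S (complexify_vec (?T u)))) (at x)"
      by (rule has_derivative_cong_open[OF _ oO xO]) (simp add: J)
    then show ?thesis by (simp add: dir_deriv_eq)
  qed
  \<comment> \<open>The inverse of the complexified derivative of \<open>J\<close>: first undo the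
    holomorphic transition by \<open>?S'\<close>, then apply the real inverse \<open>?T'\<close>
    extended complex linearly.\<close>
  define \<phi> where "\<phi> m w = (\<Sum>n\<in>UNIV. of_real (?T' (axis n 1) $ m) * ?S' w $ n)" for m w
  have linT': "linear ?T'" and linT: "linear ?T" by (rule linear_frechet_derivative[OF d\<tau>'], rule linear_frechet_derivative[OF d\<tau>])
  have ax: "u = (\<Sum>k\<in>UNIV. u $ k *\<^sub>R axis k 1)" for u :: "real ^ 'b"
    using basis_expansion[of u] by (simp add: scalar_mult_eq_scaleR)
  have T'ex: "?T' u $ m = (\<Sum>n\<in>UNIV. ?T' (axis n 1) $ m * u $ n)" for u m
    by (subst (1) ax[of u]) (simp add: linear_sum[OF linT'] linear_cmul[OF linT'] mult.commute)
  have "complex_linear (\<phi> m)" for m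
    unfolding complex_linear_def
  proof
    note S'l = d\<sigma>'(2)[unfolded complex_linear_def]
    show "linear (\<phi> m)"
      using S'l by (intro linearI) (simp_all add: \<phi>_def linear_add linear_cmul sum.distrib algebra_simps scaleR_sum_right)
    show "\<forall>c v. \<phi> m (c *\<^sub>C v) = c *\<^sub>C \<phi> m v"
      using S'l by (simp add: \<phi>_def scaleC_vec_def scaleC_complex_def sum_distrib_left mult_ac)
  qed
  moreover have "\<phi> m (dir_deriv J x u) = of_real (u $ m)" for m u
  proof -
    have "\<phi> m (dir_deriv J x u) = of_real (\<Sum>n\<in>UNIV. ?T' (axis n 1) $ m * ?T u $ n)"
      unfolding \<phi>_def DJ S'S by (simp add: complexify_vec_def)
    then show ?thesis unfolding T'ex[symmetric] T'T .
  qed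
  moreover have "w = (\<Sum>m\<in>UNIV. \<phi> m w *\<^sub>C dir_deriv J x (axis m 1))" for w
  proof -
    have Sl: "linear ?S" "\<And>c v. ?S (c *\<^sub>C v) = c *\<^sub>C ?S v" using d\<sigma>(2) by (auto simp: complex_linear_def)
    have Tex: "?T u $ j = (\<Sum>m\<in>UNIV. u $ m * ?T (axis m 1) $ j)" for u j
      by (subst (1) ax[of u]) (simp add: linear_sum[OF linT] linear_cmul[OF linT])
    have "(\<Sum>m\<in>UNIV. \<phi> m w *\<^sub>C complexify_vec (?T (axis m 1))) = ?S' w"
    proof (subst vec_eq_iff, intro allI)
      fix j
      have "(\<Sum>m\<in>UNIV. (\<phi> m w *\<^sub>C complexify_vec (?T (axis m 1))) $ j)
          = (\<Sum>m\<in>UNIV. \<Sum>n\<in>UNIV. of_real (?T' (axis n 1) $ m * ?T (axis m 1) $ j) * ?S' w $ n)"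
        by (simp add: scaleC_vec_def scaleC_complex_def complexify_vec_def \<phi>_def sum_distrib_left sum_distrib_right mult_ac)
      also have "\<dots> = (\<Sum>n\<in>UNIV. of_real (?T (?T' (axis n 1)) $ j) * ?S' w $ n)"
        unfolding Tex[of "?T' _"] of_real_sum sum_distrib_right by (rule sum.swap)
      also have "\<dots> = ?S' w $ j"
      proof -
        have "of_real (axis n 1 $ j) * z = (if n = j then z else 0)" for n and z :: complex by (simp add: axis_def)
        then show ?thesis unfolding TT' by (simp only: sum.delta finite if_True UNIV_I)
      qed
      finally show "(\<Sum>m\<in>UNIV. \<phi> m w *\<^sub>C complexify_vec (?T (axis m 1))) $ j = ?S' w $ j" by simp
    qed
    then have "w = ?S (\<Sum>m\<in>UNIV. \<phi> m w *\<^sub>C complexify_vec (?T (axis m 1)))" by (simp add: SS')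
    then show ?thesis by (simp add: DJ linear_sum[OF Sl(1)] Sl(2))
  qed
  ultimately have "\<exists>\<phi> :: 'm \<Rightarrow> complex ^ 'm \<Rightarrow> complex. (\<forall>m. complex_linear (\<phi> m)) \<and> (\<forall>m u. \<phi> m (dir_deriv J x u) = of_real (u $ m)) \<and>
       (\<forall>w. w = (\<Sum>m\<in>UNIV. \<phi> m w *\<^sub>C dir_deriv J x (axis m 1)))"
    by (intro exI[of _ \<phi>] conjI allI)
  from that[OF oO xO sub dom ext this] show ?thesis .
qed

section \<open>The soliton on the Beltrami manifold\<close>

lemma local_rep_product:
  assumes "is_chart (\<N> i)" "x \<in> chart_image (\<N> i)" "s \<in> T"
  shows "local_rep (\<lambda>(p, s). (J p, g s)) (product_atlas T \<N> i) (product_atlas T' \<X> k) (x, s)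
    = (local_rep J (\<N> i) (\<X> k) x, g s)"
  using chart_inv_product[where \<A>=\<N> and i=i, OF assms] by (simp add: local_rep_def) (simp add: product_atlas_def)

lemma ra_subset: "ra_on f S \<Longrightarrow> T \<subseteq> S \<Longrightarrow> ra_on f T"
  unfolding ra_on_def by (rule ext_hol_subset)

text \<open>The interior of the zero set is open, and by the identity theorem on balls also closed
  in \<open>S\<close>.\<close>

lemma ra_identity_connected:
  assumes S: "open S" "connected S" and f: "ra_on f S" and T: "open T" "y \<in> T" "y \<in> S"
    and f0: "\<And>y. y \<in> T \<Longrightarrow> f y = 0" and x: "x \<in> S"
  shows "f x = 0"
proof -
  define G where "G = interior {x \<in> S. f x = 0}"
  have GS: "G \<subseteq> S" and G0: "\<And>x. x \<in> G \<Longrightarrow> f x = 0" using interior_subset[of "{x \<in> S. f x = 0}"] by (auto simp: G_def)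
  have y: "y \<in> G" unfolding G_def using S T f0 by (intro interiorI[of "T \<inter> S"]) auto
  have "p \<in> G" if p: "p \<in> closure G" "p \<in> S" for p
  proof -
    obtain r where r: "r > 0" "ball p r \<subseteq> S"
      "\<And>T y0 y. open T \<Longrightarrow> y0 \<in> T \<Longrightarrow> y0 \<in> ball p r \<Longrightarrow> (\<And>y. y \<in> T \<Longrightarrow> f y = 0) \<Longrightarrow> y \<in> ball p r \<Longrightarrow> f y = 0"
    proof (rule ra_identity[OF S(1) f p(2)])
      fix r assume "r > 0" "ball p r \<subseteq> S"
        "\<And>T y0 y. open T \<Longrightarrow> y0 \<in> T \<Longrightarrow> y0 \<in> ball p r \<Longrightarrow> (\<And>y. y \<in> T \<Longrightarrow> f y = 0) \<Longrightarrow> y \<in> ball p r \<Longrightarrow> f y = 0"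
      then show thesis by (rule that)
    qed
    have "ball p r \<inter> G \<noteq> {}" using p r(1) open_Int_closure_eq_empty[OF open_ball, of p r G] by (metis IntI centre_in_ball empty_iff)
    then obtain q where q: "q \<in> G" "q \<in> ball p r" by blast
    have "f z = 0" if "z \<in> ball p r" for z
      by (rule r(3)[OF _ q G0 that]) (auto simp: G_def)
    then show ?thesis unfolding G_def using r by (intro interiorI[of "ball p r"]) auto
  qed
  then have "closure G \<inter> S = G" using GS closure_subset by blast
  then have "closedin (top_of_set S) G"
    using closedin_closed_Int[of "closure G" S] by (simp add: Int_commute)
  moreover have "openin (top_of_set S) G" using GS by (intro open_openin_trans S) (simp add: G_def)
  ultimately have "G = S" using S(2) y unfolding connected_clopen by blast
  then show ?thesis using G0 x by blast
qed

text \<open>One statement for two situations: coordinate changes on N, with \<open>g\<close> the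
  identity, and the embedding into the complexification, with \<open>g\<close> the inclusion of the
  reals.\<close>

lemma related_product:
  fixes g :: "real \<Rightarrow> 's::real_normed_vector" and \<N> :: "'i \<Rightarrow> ('n::topological_space, 'v::euclidean_space) chart"
    and \<X> :: "'k \<Rightarrow> ('x::topological_space, 'w::euclidean_space) chart"
  assumes rel: "related_vector_fields (product_atlas T \<N>) (product_atlas T' \<X>) (\<lambda>(p, s). (J p, g s)) S E EC"
    and g: "bounded_linear g" and N: "is_chart (\<N> i)" and T: "open T"
    and x: "x \<in> chart_image (\<N> i)" "s \<in> T" "(chart_inv (\<N> i) x, s) \<in> S" and g': "g s \<in> T'"
    and k: "J (chart_inv (\<N> i) x) \<in> chart_dom (\<X> k)" and J: "local_rep J (\<N> i) (\<X> k) differentiable at x"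
  shows "EC k (local_rep J (\<N> i) (\<X> k) x, g s) =
    (dir_deriv (local_rep J (\<N> i) (\<X> k)) x (fst (E i (x, s))), g (snd (E i (x, s))))"
proof -
  let ?J = "local_rep J (\<N> i) (\<X> k)" and ?F = "local_rep (\<lambda>(p, s). (J p, g s)) (product_atlas T \<N> i) (product_atlas T' \<X> k)"
  have op: "open (chart_image (\<N> i) \<times> T)" "(x, s) \<in> chart_image (\<N> i) \<times> T"
    using is_chart_open_image[OF N] T x by (auto intro: open_Times)
  have "((\<lambda>X. (?J (fst X), g (snd X))) has_derivative (\<lambda>X. (dir_deriv ?J x (fst X), g (snd X)))) (at (x, s))"
  proof (intro has_derivative_Pair bounded_linear.has_derivative[OF g] has_derivative_snd has_derivative_ident)
    show "((\<lambda>X. ?J (fst X)) has_derivative (\<lambda>X. dir_deriv ?J x (fst X))) (at (x, s))"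
      by (rule has_derivative_compose[OF has_derivative_fst[OF has_derivative_ident]])
        (simp add: has_derivative_dir_deriv[OF J])
  qed
  then have "(?F has_derivative (\<lambda>X. (dir_deriv ?J x (fst X), g (snd X)))) (at (x, s))"
    by (rule has_derivative_cong_open[OF _ op]) (auto simp: local_rep_product[where \<N>=\<N> and i=i, OF N])
  then have D: "frechet_derivative ?F (at (x, s)) = (\<lambda>X. (dir_deriv ?J x (fst X), g (snd X)))"
    by (rule frechet_derivative_at[symmetric])
  have p: "(chart_inv (\<N> i) x, s) \<in> S \<inter> chart_dom (product_atlas T \<N> i)"
    using x chart_inv_dom[OF N] by (simp add: product_atlas_def)
  have q: "(\<lambda>(p, s). (J p, g s)) (chart_inv (\<N> i) x, s) \<in> chart_dom (product_atlas T' \<X> k)"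
    using k g' by (simp add: product_atlas_def)
  have m: "chart_map (product_atlas T \<N> i) (chart_inv (\<N> i) x, s) = (x, s)"
    by (simp add: product_atlas_def chart_map_inv[OF N x(1)])
  show ?thesis
    using rel[unfolded related_vector_fields_def Let_def, rule_format, OF p q]
    unfolding m D local_rep_product[where \<N>=\<N> and i=i and T=T, OF N x(1,2)] by simp
qed

lemma slice_derivative:
  assumes "E differentiable at (x, s)"
  shows "((\<lambda>y. fst (E (y, s))) has_derivative (\<lambda>u. fst (dir_deriv E (x, s) (u, 0)))) (at x)"
    and "((\<lambda>y. snd (E (y, s))) has_derivative (\<lambda>u. snd (dir_deriv E (x, s) (u, 0)))) (at x)"
proof -
  have "((\<lambda>y. E (y, s)) has_derivative (\<lambda>u. dir_deriv E (x, s) (u, 0))) (at x)"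
    by (rule has_derivative_compose[where f="\<lambda>y. (y, s)"])
      (auto intro!: derivative_eq_intros has_derivative_dir_deriv assms)
  then show "((\<lambda>y. fst (E (y, s))) has_derivative (\<lambda>u. fst (dir_deriv E (x, s) (u, 0)))) (at x)"
    "((\<lambda>y. snd (E (y, s))) has_derivative (\<lambda>u. snd (dir_deriv E (x, s) (u, 0)))) (at x)"
    by (rule has_derivative_fst, rule has_derivative_snd)
qed

lemma parameter_derivative:
  fixes E :: "'v::real_normed_vector \<times> real \<Rightarrow> 'w::real_normed_vector \<times> real"
  assumes "E differentiable at (x, s)"
  shows "((\<lambda>s. fst (E (x, s))) has_vector_derivative fst (dir_deriv E (x, s) (0, 1))) (at s)"
    and "((\<lambda>s. snd (E (x, s))) has_real_derivative snd (dir_deriv E (x, s) (0, 1))) (at s)"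
proof -
  have "((\<lambda>s. E (x, s)) has_derivative (\<lambda>t. dir_deriv E (x, s) (0, t))) (at s)"
    by (rule has_derivative_compose[where f="\<lambda>s. (x, s)"])
      (auto intro!: derivative_eq_intros has_derivative_dir_deriv assms)
  moreover have "(\<lambda>t. dir_deriv E (x, s) (0, t)) = (\<lambda>t. t *\<^sub>R dir_deriv E (x, s) (0, 1))"
  proof
    show "dir_deriv E (x, s) (0, t) = t *\<^sub>R dir_deriv E (x, s) (0, 1)" for t
      using linear_cmul[OF linear_dir_deriv[OF assms], of t "(0, 1)"] by (simp add: scaleR_prod_def)
  qed
  ultimately have *: "((\<lambda>s. E (x, s)) has_derivative (\<lambda>t. t *\<^sub>R dir_deriv E (x, s) (0, 1))) (at s)"
    by (rule has_derivative_eq_rhs)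
  show "((\<lambda>s. fst (E (x, s))) has_vector_derivative fst (dir_deriv E (x, s) (0, 1))) (at s)"
    using has_derivative_fst[OF *] by (simp add: has_vector_derivative_def)
  show "((\<lambda>s. snd (E (x, s))) has_real_derivative snd (dir_deriv E (x, s) (0, 1))) (at s)"
    using has_derivative_snd[OF *] by (simp add: has_field_derivative_def mult.commute[of _ "snd _"])
qed

locale beltrami_soliton =
  fixes \<N> :: "'i \<Rightarrow> ('n::topological_space, real ^ 3) chart"
    and h :: "'i \<Rightarrow> real ^ 3 \<Rightarrow> real ^ 3 \<Rightarrow> real ^ 3 \<Rightarrow> real"
    and A :: "'i \<Rightarrow> real ^ 3 \<Rightarrow> real ^ 3 \<Rightarrow> real"
    and E :: "'i \<Rightarrow> (real ^ 3) \<times> real \<Rightarrow> (real ^ 3) \<times> real"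
    and a :: real
  assumes N_analytic: "real_analytic_atlas UNIV \<N>"
    and h_metric: "real_analytic_metric \<N> h"
    and A_form: "smooth_one_form \<N> A"
    and beltrami: "beltrami_equation \<N> h A"
    and dA_nonzero: "exterior_deriv_nowhere_zero \<N> A"
    and E_analytic: "real_analytic_vector_field (beltrami_manifold \<N>) E"
    and soliton: "\<And>i x u v. x \<in> chart_image (beltrami_manifold \<N> i) \<Longrightarrow>
      ricci (beltrami_metric h A i) x u v + a * beltrami_metric h A i x u v
      + 1/2 * lie_derivative (E i) (beltrami_metric h A i) x u v = 0"
begin

abbreviation C :: "'i \<Rightarrow> (real ^ 3) set" where "C i \<equiv> chart_image (\<N> i)"

lemma N: "is_chart (\<N> i)" and N_compatible: "analytically_compatible (\<N> i) (\<N> j)"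
  and N_cover: "\<exists>i. p \<in> chart_dom (\<N> i)"
  using N_analytic by (auto simp: real_analytic_atlas_def)

lemma open_C: "open (C i)" by (rule is_chart_open_image[OF N])

sublocale B: beltrami3 "C i" "h i" "A i" for i
proof -
  have m: "bilinear (h i y) \<and> (\<forall>u v. h i y u v = h i y v u) \<and> (\<forall>v. v \<noteq> 0 \<longrightarrow> h i y v v > 0)" if "y \<in> C i" for y
    using h_metric that by (simp add: real_analytic_metric_def)
  have r: "ra_on (\<lambda>y. h i y u v) (C i)" for u v
    using h_metric by (intro ra_real_analytic) (simp add: real_analytic_metric_def)
  show "beltrami3 (C i) (h i) (A i)"
    unfolding beltrami3_def beltrami3_axioms_def metric3_def inner3_def
    using A_form beltrami by (auto simp: open_C m r smooth_one_form_def beltrami_equation_def)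
qed

definition Q :: "'i \<Rightarrow> real ^ 3 \<Rightarrow> real ^ 3 \<Rightarrow> real ^ 3 \<Rightarrow> real" where
  "Q i x u v = ricci (h i) x u v - 2 * h i x u v"

abbreviation L :: "'i \<Rightarrow> real ^ 3 \<Rightarrow> real \<Rightarrow> real ^ 3 \<Rightarrow> real ^ 3 \<Rightarrow> real" where
  "L i x s u v \<equiv> slice_lie_derivative E h s i x u v"

abbreviation X :: "'i \<Rightarrow> real ^ 3 \<Rightarrow> real \<Rightarrow> real ^ 3" where "X i x s \<equiv> fst (E i (x, s))"
abbreviation f :: "'i \<Rightarrow> real ^ 3 \<Rightarrow> real \<Rightarrow> real" where "f i x s \<equiv> snd (E i (x, s))"
abbreviation X' :: "'i \<Rightarrow> real ^ 3 \<Rightarrow> real \<Rightarrow> real ^ 3" where "X' i x s \<equiv> fst (dir_deriv (E i) (x, s) (0, 1))"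
abbreviation f' :: "'i \<Rightarrow> real ^ 3 \<Rightarrow> real \<Rightarrow> real" where "f' i x s \<equiv> snd (dir_deriv (E i) (x, s) (0, 1))"

lemma beltrami_metric_eq: "beltrami_metric h A i = beltrami3.gm (h i) (A i)"
  by (auto simp: fun_eq_iff beltrami_metric_def B.gm_def)

lemma slice_lie_derivative_eq: "L i x s u v = beltrami3.slice_lie (h i) (E i) (x, s) u v"
  by (simp add: slice_lie_derivative_def B.slice_lie_def pullback_projection_def case_prod_unfold)

lemma image_beltrami_manifold: "chart_image (beltrami_manifold \<N> i) = C i \<times> {0<..}"
  by (simp add: beltrami_manifold_def chart_image_product)

lemma ricci_beltrami:
  "x \<in> C i \<Longrightarrow> s > 0 \<Longrightarrow> ricci (beltrami_metric h A i) (x, s) V W = Q i x (fst V) (fst W)"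
  unfolding beltrami_metric_eq Q_def by (rule B.ricci_gm)

lemma einstein_iff: "einstein (beltrami_manifold \<N>) (beltrami_metric h A) \<longleftrightarrow> (\<forall>i. \<forall>x\<in>C i. \<forall>u v. Q i x u v = 0)"
proof
  assume "einstein (beltrami_manifold \<N>) (beltrami_metric h A)"
  then obtain b where b: "\<And>i x u v. x \<in> C i \<times> {0<..} \<Longrightarrow> ricci (beltrami_metric h A i) x u v = b * beltrami_metric h A i x u v"
    unfolding einstein_def image_beltrami_manifold by blast
  show "\<forall>i. \<forall>x\<in>C i. \<forall>u v. Q i x u v = 0"
  proof (intro allI ballI)
    fix i x u v assume x: "x \<in> C i"
    have Q: "Q i x (fst U) (fst V) = b * beltrami_metric h A i (x, 1) U V" for U V
      using b[of "(x, 1)" i U V] x by (simp add: ricci_beltrami)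
    interpret inner3 "h i x" by (rule B.H[OF x])
    \<comment> \<open>On the vertical unit vector at \<rho> = 1 the metric is 1, while the Ricci
      tensor, depending on slice components only, is 0. So the Einstein constant is zero.\<close>
    have "b = b * beltrami_metric h A i (x, 1) (0, 1) (0, 1)"
      by (simp add: beltrami_metric_def B.A_simps[OF x] zero_left)
    also have "\<dots> = Q i x 0 0" by (simp add: Q[of "(0, 1)" "(0, 1)", symmetric])
    also have "\<dots> = 0" using Q[of 0 0] by (simp add: beltrami_metric_def B.A_simps[OF x] zero_left zero_prod_def)
    finally show "Q i x u v = 0" using Q[of "(u, 0)" "(v, 0)"] by simp
  qed
next
  assume Q: "\<forall>i. \<forall>x\<in>C i. \<forall>u v. Q i x u v = 0"
  show "einstein (beltrami_manifold \<N>) (beltrami_metric h A)"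
    unfolding einstein_def image_beltrami_manifold
    by (rule exI[of _ 0]) (use Q in \<open>auto simp: ricci_beltrami\<close>)
qed

lemma soliton_equations:
  assumes x: "x \<in> C i" and s: "s > 0"
  shows soliton_R: "s * f' i x s + A i x (X' i x s) + a * s = 0"
    and soliton_S: "Q i x u v + a * s\<^sup>2 * h i x u v + 1/2 * s\<^sup>2 * L i x s u v
      + s * f i x s * h i x u v - 1/2 * s * (A i x u * h i x v (X' i x s) + A i x v * h i x u (X' i x s)) = 0"
proof -
  have sol: "ricci (beltrami3.gm (h i) (A i)) (x, s) U V + a * beltrami3.gm (h i) (A i) (x, s) U V
      + 1/2 * lie_derivative (E i) (beltrami3.gm (h i) (A i)) (x, s) U V = 0" for U V
    using soliton[of "(x, s)" i U V] x s unfolding beltrami_metric_eq image_beltrami_manifold by simp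
  show "s * f' i x s + A i x (X' i x s) + a * s = 0" by (rule B.soliton_R[OF x s sol])
  show "Q i x u v + a * s\<^sup>2 * h i x u v + 1/2 * s\<^sup>2 * L i x s u v
      + s * f i x s * h i x u v - 1/2 * s * (A i x u * h i x v (X' i x s) + A i x v * h i x u (X' i x s)) = 0"
    unfolding Q_def slice_lie_derivative_eq by (rule B.soliton_S[OF x s sol])
qed

lemma E_differentiable: "x \<in> C i \<Longrightarrow> s > 0 \<Longrightarrow> E i differentiable at (x, s)"
proof (rule real_analytic_on_differentiable)
  show "real_analytic_on (E i) (C i \<times> {0<..})"
    using E_analytic unfolding real_analytic_vector_field_def image_beltrami_manifold by blast
qed (auto intro: open_Times open_C)

lemma L_eq:
  assumes x: "x \<in> C i" and s: "s > 0"
  shows "L i x s u v = dir_deriv (\<lambda>y. h i y u v) x (X i x s) + h i x (dir_deriv (\<lambda>y. X i y s) x u) v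
     + h i x u (dir_deriv (\<lambda>y. X i y s) x v)"
  unfolding slice_lie_derivative_eq B.slice_lie_eq[OF x] B.DH_def
    dir_deriv_eq[OF slice_derivative(1)[OF E_differentiable[OF x s]]] ..

text \<open>At a zero of \<open>A\<close> the Hodge star of \<open>A\<close> is zero, and the
  Beltrami equation would make dA vanish there.\<close>

lemma A_nonzero: assumes x: "x \<in> C i" shows "\<exists>u. A i x u \<noteq> 0"
proof (rule ccontr)
  assume "\<not> ?thesis"
  then have A0: "A i x = (\<lambda>_. 0)" by auto
  obtain u v where "exterior_deriv (A i) x u v \<noteq> 0"
    using dA_nonzero x unfolding exterior_deriv_nowhere_zero_def by blast
  moreover have "hodge_star (h i) (A i) x u v = 0"
  proof -
    interpret inner3 "h i x" by (rule B.H[OF x])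
    have "0 = metric3.raise (h i) x (A i x)"
      by (rule B.raise_unique[OF x B.A_linear[OF x]]) (simp add: A0 zero_left)
    then have "sharp (h i) (A i) x = 0" using B.sharp_eq[OF x, of "A i"] B.A_linear[OF x] by simp
    then show ?thesis by (simp add: hodge_star_def volume_form_def det_3)
  qed
  ultimately show False using B.A_beltrami[OF x, of u v] by simp
qed

subsection \<open>Naturality of the trace-adjusted Ricci tensor\<close>

abbreviation \<tau> :: "'i \<Rightarrow> 'i \<Rightarrow> real ^ 3 \<Rightarrow> real ^ 3" where "\<tau> i j \<equiv> local_rep id (\<N> i) (\<N> j)"

lemma C2_\<tau>: "C2_on (\<tau> i j) (overlap (\<N> i) (\<N> j))"
  using N_compatible[of i j] unfolding analytically_compatible_def
  by (intro C2_on_real_vec open_overlap N ra_component) blast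

lemma E_\<tau>:
  assumes x: "x \<in> overlap (\<N> i) (\<N> j)" and s: "s > 0"
  shows "E j (\<tau> i j x, s) = (dir_deriv (\<tau> i j) x (X i x s), f i x s)"
proof (rule related_product[where g="\<lambda>s. s" and T="{0<..}" and T'="{0<..}" and S=UNIV and \<N>=\<N> and i=i and \<X>=\<N> and k=j and J=id])
  have "id = (\<lambda>(p :: 'n, s :: real). (id p, s))" by auto
  then show "related_vector_fields (product_atlas {0<..} \<N>) (product_atlas {0<..} \<N>) (\<lambda>(p, s). (id p, s)) UNIV E E"
    using E_analytic unfolding real_analytic_vector_field_def beltrami_manifold_def by metis
  show "\<tau> i j differentiable at x" using C2_\<tau> x unfolding C2_on_def by blast
qed (use x s in \<open>auto simp: N overlap_iff[OF N] bounded_linear_ident\<close>)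

lemma X'_\<tau>:
  assumes x: "x \<in> overlap (\<N> i) (\<N> j)" and s: "s > 0"
  shows "X' j (\<tau> i j x) s = dir_deriv (\<tau> i j) x (X' i x s)"
proof -
  have xi: "x \<in> C i" "\<tau> i j x \<in> C j"
    using x local_rep_id_inverse(1)[OF N N x] by (auto simp: overlap_iff[OF N])
  have lin: "linear (dir_deriv (\<tau> i j) x)" using C2_\<tau> x unfolding C2_on_def by (intro linear_dir_deriv) blast
  have "((\<lambda>s. dir_deriv (\<tau> i j) x (X i x s)) has_vector_derivative dir_deriv (\<tau> i j) x (X' i x s)) (at s)"
    by (rule bounded_linear.has_vector_derivative[OF linear_conv_bounded_linear[THEN iffD1, OF lin] parameter_derivative(1)[OF E_differentiable[OF xi(1) s]]])
  then have "((\<lambda>s. X j (\<tau> i j x) s) has_vector_derivative dir_deriv (\<tau> i j) x (X' i x s)) (at s)"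
    by (rule has_vector_derivative_transform_within_open[where S="{0<..}"]) (use s E_\<tau>[OF x] in auto)
  with parameter_derivative(1)[OF E_differentiable[OF xi(2) s]] show ?thesis
    by (rule vector_derivative_unique_at)
qed

lemma h_\<tau>: "x \<in> overlap (\<N> i) (\<N> j) \<Longrightarrow> h i x u v = h j (\<tau> i j x) (dir_deriv (\<tau> i j) x u) (dir_deriv (\<tau> i j) x v)"
proof -
  assume x: "x \<in> overlap (\<N> i) (\<N> j)"
  have p: "chart_inv (\<N> i) x \<in> UNIV \<inter> chart_dom (\<N> i)" "id (chart_inv (\<N> i) x) \<in> chart_dom (\<N> j)" "x \<in> C i"
    using x by (auto simp: overlap_iff[OF N] chart_inv_dom[OF N])
  have "pullback_bilinear_forms \<N> \<N> id UNIV h h" using h_metric by (simp add: real_analytic_metric_def)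
  from this[unfolded pullback_bilinear_forms_def Let_def, rule_format, OF p(1,2), of u v]
  show ?thesis by (simp add: chart_map_inv[OF N p(3)] dir_deriv_def)
qed

lemma A_\<tau>: "x \<in> overlap (\<N> i) (\<N> j) \<Longrightarrow> A i x u = A j (\<tau> i j x) (dir_deriv (\<tau> i j) x u)"
  using A_form unfolding smooth_one_form_def dir_deriv_def by blast

lemma L_\<tau>:
  assumes x: "x \<in> overlap (\<N> i) (\<N> j)" and s: "s > 0"
  shows "L i x s u v = L j (\<tau> i j x) s (dir_deriv (\<tau> i j) x u) (dir_deriv (\<tau> i j) x v)"
proof -
  have xi: "x \<in> C i" "\<tau> i j x \<in> C j"
    using x local_rep_id_inverse(1)[OF N N x] by (auto simp: overlap_iff[OF N])
  note C2 = C2_\<tau>[of i j, unfolded C2_on_def]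
  have dX: "(\<lambda>y. X k y s) differentiable at y" if "y \<in> C k" for k y
    by (rule differentiableI[OF slice_derivative(1)[OF E_differentiable[OF that s]]])
  have "dir_deriv (\<lambda>y. h i y u v) x (X i x s) + h i x (dir_deriv (\<lambda>y. X i y s) x u) v + h i x u (dir_deriv (\<lambda>y. X i y s) x v)
    = dir_deriv (\<lambda>z. h j z (dir_deriv (\<tau> i j) x u) (dir_deriv (\<tau> i j) x v)) (\<tau> i j x) (X j (\<tau> i j x) s)
      + h j (\<tau> i j x) (dir_deriv (\<lambda>y. X j y s) (\<tau> i j x) (dir_deriv (\<tau> i j) x u)) (dir_deriv (\<tau> i j) x v)
      + h j (\<tau> i j x) (dir_deriv (\<tau> i j) x u) (dir_deriv (\<lambda>y. X j y s) (\<tau> i j x) (dir_deriv (\<tau> i j) x v))"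
    by (rule lie_derivative_related[where J="\<tau> i j" and S="overlap (\<N> i) (\<N> j)" and T="C j"])
      (use C2 x xi dX in \<open>auto simp: open_overlap[OF N N] E_\<tau>[OF _ s] open_C inner3.bilinear[OF B.H] B.H_differentiable h_\<tau>\<close>)
  then show ?thesis unfolding L_eq[OF xi(1) s] L_eq[OF xi(2) s] .
qed

text \<open>The soliton equation at \<rho> = 1 expresses Q through h, \<open>A\<close>,
  \<open>f\<close>, X' and the slice Lie derivative. Each of these is already known to transform
  correctly, so Q does too, with no computation of curvature in new coordinates.\<close>

lemma Q_\<tau>:
  assumes x: "x \<in> overlap (\<N> i) (\<N> j)"
  shows "Q i x u v = Q j (\<tau> i j x) (dir_deriv (\<tau> i j) x u) (dir_deriv (\<tau> i j) x v)"
proof -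
  have xi: "x \<in> C i" "\<tau> i j x \<in> C j"
    using x local_rep_id_inverse(1)[OF N N x] by (auto simp: overlap_iff[OF N])
  have "f j (\<tau> i j x) 1 = f i x 1" by (simp add: E_\<tau>[OF x])
  then show ?thesis
    using soliton_S[OF xi(1), of 1 u v] soliton_S[OF xi(2), of 1 "dir_deriv (\<tau> i j) x u" "dir_deriv (\<tau> i j) x v"]
    by (simp add: L_\<tau>[OF x] h_\<tau>[OF x] A_\<tau>[OF x] X'_\<tau>[OF x])
qed

lemma Q_ra: "ra_on (\<lambda>x. Q i x u v) (C i)"
  unfolding Q_def by (intro ra_diff ra_mult ra_const open_C B.ricci_ra B.H_ra)

lemma Q_zero_transfer:
  assumes p: "p \<in> chart_dom (\<N> i)" "p \<in> chart_dom (\<N> j)" and Q: "\<And>u v. Q j (chart_map (\<N> j) p) u v = 0"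
  shows "Q i (chart_map (\<N> i) p) u v = 0"
proof -
  have "chart_map (\<N> i) p \<in> overlap (\<N> i) (\<N> j)" using p by (auto simp: overlap_def)
  from Q_\<tau>[OF this, of u v] show ?thesis
    by (simp add: local_rep_id chart_inv_map[OF N p(1)] Q)
qed

text \<open>Let \<open>G\<close> be the interior of the zero set of Q. Around a point of its closure
  take a coordinate ball: Q vanishes on an open part of the ball, by analyticity on all of it, and
  \<open>Q_zero_transfer\<close> carries this to the other charts. So \<open>G\<close> is closed as
  well as open.\<close>

lemma Q_zero_unique_continuation:
  assumes conn: "connected (UNIV :: 'n set)" and U: "open U" "U \<noteq> {}"
    and Q0: "\<And>i p u v. p \<in> U \<Longrightarrow> p \<in> chart_dom (\<N> i) \<Longrightarrow> Q i (chart_map (\<N> i) p) u v = 0"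
  shows "\<forall>i. \<forall>x\<in>C i. \<forall>u v. Q i x u v = 0"
proof -
  define Z where "Z = {p. \<forall>i u v. p \<in> chart_dom (\<N> i) \<longrightarrow> Q i (chart_map (\<N> i) p) u v = 0}"
  define G where "G = interior Z"
  have UG: "U \<subseteq> G" unfolding G_def using U(1) Q0 by (intro interior_maximal) (auto simp: Z_def)
  have "p \<in> G" if p: "p \<in> closure G" for p
  proof -
    obtain i where i: "p \<in> chart_dom (\<N> i)" using N_cover by blast
    let ?x = "chart_map (\<N> i) p"
    have "?x \<in> C i" by (rule chart_map_image[OF N i])
    then obtain r where r: "r > 0" "ball ?x r \<subseteq> C i" using open_C open_contains_ball by metis
    define O1 where "O1 = chart_dom (\<N> i) \<inter> chart_map (\<N> i) -` ball ?x r"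
    have O1: "open O1" "p \<in> O1"
      using i r unfolding O1_def by (auto intro: continuous_open_preimage continuous_chart_map is_chart_open_dom N)
    have "O1 \<inter> G \<noteq> {}" using p O1 open_Int_closure_eq_empty[OF O1(1), of G] by blast
    then obtain q where q: "q \<in> O1" "q \<in> G" by blast
    let ?T = "{x \<in> C i. chart_inv (\<N> i) x \<in> G}"
    have T: "open ?T" by (rule open_chart_preimage[OF N]) (simp add: G_def)
    have q': "chart_map (\<N> i) q \<in> ?T" "chart_map (\<N> i) q \<in> ball ?x r"
      using q by (auto simp: O1_def chart_inv_map[OF N] chart_map_image[OF N])
    have Z0: "Q i y u v = 0" if "y \<in> ?T" for y u v
    proof -
      have "chart_inv (\<N> i) y \<in> Z" "y \<in> C i" using that interior_subset[of Z] by (auto simp: G_def)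
      then show ?thesis using chart_inv_dom[OF N] chart_map_inv[OF N] unfolding Z_def by force
    qed
    have ball: "Q i y u v = 0" if "y \<in> ball ?x r" for y u v
      by (rule ra_identity_connected[OF open_ball _ ra_subset[OF Q_ra r(2)] T q' Z0 that]) auto
    have "O1 \<subseteq> Z"
    proof
      fix p' assume "p' \<in> O1"
      then have p': "p' \<in> chart_dom (\<N> i)" "chart_map (\<N> i) p' \<in> ball ?x r" by (auto simp: O1_def)
      show "p' \<in> Z" unfolding Z_def using Q_zero_transfer[OF _ p'(1) ball[OF p'(2)]] by blast
    qed
    then show ?thesis unfolding G_def using O1 by (rule interiorI[rotated 2])
  qed
  then have "closed G" by (metis closure_subset closure_eq subsetI subset_antisym)
  then have "G = UNIV"
    using conn U UG unfolding connected_clopen by (auto simp: G_def)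
  then have Z: "p \<in> Z" for p using interior_subset[of Z] by (auto simp: G_def)
  show ?thesis
  proof (intro allI ballI)
    fix i x u v assume x: "x \<in> C i"
    show "Q i x u v = 0"
      using Z[of "chart_inv (\<N> i) x"] chart_inv_dom[OF N x] chart_map_inv[OF N x] unfolding Z_def by force
  qed
qed

end

section \<open>The complexified soliton equation in a chart\<close>

text \<open>Compactness of the circle, in the form of the tube lemma, makes the thickness of the
  annulus uniform for coordinates near \<open>z\<close>.\<close>

lemma annulus_tube:
  fixes T :: "('z::topological_space \<times> complex) set"
  assumes T: "open T" "{z} \<times> sphere 0 r \<subseteq> T" and r: "r > 0"
  obtains \<Omega> \<delta> where "open \<Omega>" "z \<in> \<Omega>" "0 < \<delta>" "\<delta> < r" "\<Omega> \<times> annulus r \<delta> \<subseteq> T"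
proof -
  have "\<exists>U V. openin euclidean U \<and> openin euclidean V \<and> z \<in> U \<and> sphere 0 r \<subseteq> V \<and> U \<times> V \<subseteq> T"
    by (rule tube_lemma_right) (use T in \<open>auto simp: euclidean_product_topology\<close>)
  then obtain U V where UV: "open U" "open V" "z \<in> U" "sphere 0 r \<subseteq> V" "U \<times> V \<subseteq> T" by auto
  obtain \<delta> where "0 < \<delta>" "\<delta> < r" "annulus r \<delta> \<subseteq> V" by (rule annulus_in_open[OF UV(2,4) r])
  then show ?thesis using UV by (intro that[of U \<delta>]) auto
qed

lemma ghol_slices:
  fixes F :: "'z::{complex_space, euclidean_space} \<times> complex \<Rightarrow> complex"
  assumes F: "cspace.ghol F (\<Omega> \<times> T)"
  shows "z \<in> \<Omega> \<Longrightarrow> (\<lambda>\<zeta>. F (z, \<zeta>)) holomorphic_on T" "\<zeta> \<in> T \<Longrightarrow> cspace.ghol (\<lambda>z. F (z, \<zeta>)) \<Omega>"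
    "cspace.cderiv v (\<lambda>z. F (z, \<zeta>)) z = cspace.cderiv (v, 0) F (z, \<zeta>)"
proof -
  have l: "(z, \<zeta>) + \<eta> *\<^sub>C (v, 0) = (z + \<eta> *\<^sub>C v, \<zeta>)" for z v :: 'z and \<zeta> \<eta> :: complex
    by (simp add: scaleC_prod_def scaleC_complex_def)
  show "cspace.cderiv v (\<lambda>z. F (z, \<zeta>)) z = cspace.cderiv (v, 0) F (z, \<zeta>)"
    by (simp add: cspace.cderiv_def l)
  have l0: "(z, 0) + \<eta> *\<^sub>C (0, 1) = (z, \<eta>)" for z :: 'z and \<eta> :: complex
    by (simp add: scaleC_prod_def scaleC_complex_def linear_0[OF cspace.linear_sc])
  show "(\<lambda>\<zeta>. F (z, \<zeta>)) holomorphic_on T" if "z \<in> \<Omega>"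
  proof (rule holomorphic_on_subset)
    show "(\<lambda>\<zeta>. F (z, \<zeta>)) holomorphic_on {\<zeta>. (z, \<zeta>) \<in> \<Omega> \<times> T}"
      using cspace.ghol_line[OF F, of "(z, 0)" "(0, 1)"] unfolding l0 .
  qed (use that in auto)
  show "cspace.ghol (\<lambda>z. F (z, \<zeta>)) \<Omega>" if \<zeta>: "\<zeta> \<in> T"
    unfolding cspace.ghol_def
  proof (intro conjI allI)
    have "continuous_on (\<Omega> \<times> T) F" using F by (simp add: cspace.ghol_def)
    then show "continuous_on \<Omega> (\<lambda>z. F (z, \<zeta>))"
      by (rule continuous_on_compose2) (use \<zeta> in \<open>auto intro!: continuous_intros\<close>)
    show "(\<lambda>\<eta>. F (z + \<eta> *\<^sub>C v, \<zeta>)) holomorphic_on {\<eta>. z + \<eta> *\<^sub>C v \<in> \<Omega>}" for z v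
      using cspace.ghol_line[OF F, of "(z, \<zeta>)" "(v, 0)"] \<zeta> by (simp add: l)
  qed
qed

lemma complex_linear_sum:
  fixes \<phi> :: "'z::complex_space \<Rightarrow> complex"
  assumes "complex_linear \<phi>"
  shows "\<phi> (\<Sum>m\<in>I. c m *\<^sub>C w m) = (\<Sum>m\<in>I. c m * \<phi> (w m))"
  using assms by (simp add: complex_linear_def linear_sum scaleC_complex_def)

lemma complex_vec_expand: "w = (\<Sum>l\<in>UNIV. w $ l *\<^sub>C axis l 1)" for w :: "complex ^ 'n"
proof -
  have "w $ l *\<^sub>C axis l 1 = w $ l *s axis l 1" for l
    by (simp add: vec_eq_iff scaleC_vec_def scaleC_complex_def axis_def)
  then show ?thesis by (simp add: basis_expansion)
qed

lemma complex_linear_expand: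
  fixes \<phi> :: "complex ^ 'n \<Rightarrow> complex"
  assumes "complex_linear \<phi>"
  shows "\<phi> w = (\<Sum>l\<in>UNIV. w $ l * \<phi> (axis l 1))"
  by (subst complex_vec_expand) (rule complex_linear_sum[OF assms])

lemma has_derivative_complex_vec:
  fixes f :: "'z::real_normed_vector \<Rightarrow> complex ^ 'n"
  assumes "\<And>l. ((\<lambda>z. f z $ l) has_derivative (\<lambda>v. f' v $ l)) (at x)"
  shows "(f has_derivative f') (at x)"
proof (subst has_derivative_componentwise_within, intro ballI)
  fix b :: "complex ^ 'n" assume "b \<in> Basis"
  then obtain k c where b: "b = axis k c" by (auto simp: Basis_vec_def)
  show "((\<lambda>z. f z \<bullet> b) has_derivative (\<lambda>v. f' v \<bullet> b)) (at x)"
    using has_derivative_inner_left[OF assms, of k c] by (simp add: b inner_axis)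
qed

text \<open>All data seen in one chart of N and one of its complexification, with \<open>J\<close>
  the embedding in these coordinates. The complex objects live on \<open>\<Omega>\<close> times an
  annulus; their relation to the real ones is recorded only at the points \<open>J y\<close> and,
  where \<rho> occurs, for real \<rho> near \<open>r\<close>.\<close>

locale complex_chart = beltrami_soliton \<N> h A E a
  for \<N> :: "'i \<Rightarrow> ('n::topological_space, real ^ 3) chart" and h A E a +
  fixes i :: 'i and J :: "real ^ 3 \<Rightarrow> complex ^ 3" and O1 :: "(real ^ 3) set" and \<Omega> :: "(complex ^ 3) set" and r \<delta> :: real
    and EC :: "(complex ^ 3) \<times> complex \<Rightarrow> (complex ^ 3) \<times> complex"
    and HC :: "complex ^ 3 \<Rightarrow> complex ^ 3 \<Rightarrow> complex ^ 3 \<Rightarrow> complex"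
    and LC :: "complex \<Rightarrow> complex ^ 3 \<Rightarrow> complex ^ 3 \<Rightarrow> complex ^ 3 \<Rightarrow> complex"
  assumes O1: "open O1" "O1 \<subseteq> C i" and \<Omega>: "open \<Omega>" and \<delta>: "0 < \<delta>" "\<delta> < r"
    and J_in: "\<And>y. y \<in> O1 \<Longrightarrow> J y \<in> \<Omega>" and J_ext: "\<And>l. ext_hol (\<lambda>y. J y $ l) O1"
    and EC_hol: "\<And>l. cspace.ghol (\<lambda>Z. fst (EC Z) $ l) (\<Omega> \<times> annulus r \<delta>)"
      "cspace.ghol (\<lambda>Z. snd (EC Z)) (\<Omega> \<times> annulus r \<delta>)"
    and EC_real: "\<And>y t. y \<in> O1 \<Longrightarrow> \<bar>t - r\<bar> < \<delta> \<Longrightarrow>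
      EC (J y, of_real t) = (dir_deriv J y (X i y t), of_real (f i y t))"
    and HC_linear: "\<And>z u. z \<in> \<Omega> \<Longrightarrow> complex_linear (HC z u)" "\<And>z v. z \<in> \<Omega> \<Longrightarrow> complex_linear (\<lambda>u. HC z u v)"
    and HC_hol: "\<And>u v. cspace.ghol (\<lambda>z. HC z u v) \<Omega>"
    and HC_real: "\<And>y u v. y \<in> O1 \<Longrightarrow> HC (J y) (dir_deriv J y u) (dir_deriv J y v) = of_real (h i y u v)"
    and LC_linear: "\<And>\<zeta> z u. z \<in> \<Omega> \<Longrightarrow> \<zeta> \<in> annulus r \<delta> \<Longrightarrow> complex_linear (LC \<zeta> z u)"
      "\<And>\<zeta> z v. z \<in> \<Omega> \<Longrightarrow> \<zeta> \<in> annulus r \<delta> \<Longrightarrow> complex_linear (\<lambda>u. LC \<zeta> z u v)"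
    and LC_hol: "\<And>u v. cspace.ghol (\<lambda>(z, \<zeta>). LC \<zeta> z u v) (\<Omega> \<times> annulus r \<delta>)"
    and LC_real: "\<And>y t u v. y \<in> O1 \<Longrightarrow> \<bar>t - r\<bar> < \<delta> \<Longrightarrow>
      LC (of_real t) (J y) (dir_deriv J y u) (dir_deriv J y v) = of_real (L i y t u v)"
begin

lemma r: "r > 0" using \<delta> by simp

abbreviation P :: "real ^ 3 \<Rightarrow> real ^ 3 \<Rightarrow> complex ^ 3" where "P \<equiv> dir_deriv J"

text \<open>Component \<open>l\<close> of the complexified field \<integral> \<rho>^m X d\<rho>; for
  m = 2n - 1 this is the field Y of the overview.\<close>

definition G :: "nat \<Rightarrow> 3 \<Rightarrow> complex ^ 3 \<Rightarrow> complex" where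
  "G m l z = contour_integral (circlepath 0 r) (\<lambda>\<zeta>. \<zeta> ^ m * fst (EC (z, \<zeta>)) $ l)"

text \<open>The coframe dual to the images of the real basis vectors. It depends on \<open>J\<close>
  and \<open>x\<close> alone, so one obtained with a different choice of domains remains
  usable.\<close>

definition coframe :: "real ^ 3 \<Rightarrow> (3 \<Rightarrow> complex ^ 3 \<Rightarrow> complex) \<Rightarrow> bool" where
  "coframe x \<phi> \<longleftrightarrow> (\<forall>m. complex_linear (\<phi> m)) \<and> (\<forall>m u. \<phi> m (P x u) = of_real (u $ m)) \<and>
     (\<forall>w. w = (\<Sum>m\<in>UNIV. \<phi> m w *\<^sub>C P x (axis m 1)))"

lemma J_differentiable: "y \<in> O1 \<Longrightarrow> J differentiable at y"
  using C2_on_complex_vec[OF O1(1) J_ext] unfolding C2_on_def by blast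

lemma in_C: "y \<in> O1 \<Longrightarrow> y \<in> C i" using O1(2) by blast

lemma t_pos: "\<bar>t - r\<bar> < \<delta> \<Longrightarrow> t > 0" using \<delta> by linarith

lemma integrable: "g holomorphic_on annulus r \<delta> \<Longrightarrow> g contour_integrable_on circlepath 0 r"
  using holomorphic_on_subset[OF _ sphere_subset_annulus[OF \<delta>(1)]] r
  by (intro contour_integrable_on_circlepath holomorphic_on_imp_continuous_on) auto

lemma EC_holomorphic: "z \<in> \<Omega> \<Longrightarrow> (\<lambda>\<zeta>. fst (EC (z, \<zeta>)) $ l) holomorphic_on annulus r \<delta>"
  "z \<in> \<Omega> \<Longrightarrow> (\<lambda>\<zeta>. snd (EC (z, \<zeta>))) holomorphic_on annulus r \<delta>"
  by (rule ghol_slices(1)[OF EC_hol(1)], assumption) (rule ghol_slices(1)[OF EC_hol(2)])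

lemma LC_holomorphic: "z \<in> \<Omega> \<Longrightarrow> (\<lambda>\<zeta>. LC \<zeta> z u v) holomorphic_on annulus r \<delta>"
  using ghol_slices(1)[OF LC_hol, of z u v] by simp

subsection \<open>Moments of the Lie derivative\<close>

lemma functional_holomorphic:
  assumes "complex_linear \<phi>" "z \<in> \<Omega>"
  shows "(\<lambda>\<zeta>. \<phi> (fst (EC (z, \<zeta>)))) holomorphic_on annulus r \<delta>"
proof (rule holomorphic_transform)
  show "(\<lambda>\<zeta>. \<Sum>l\<in>UNIV. fst (EC (z, \<zeta>)) $ l * \<phi> (axis l 1)) holomorphic_on annulus r \<delta>"
    by (intro holomorphic_intros EC_holomorphic assms)
qed (rule complex_linear_expand[OF assms(1), symmetric])

text \<open>\<open>\<Phi>\<close> is the holomorphic extension in \<rho> of \<alpha>(X), formed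
  through the coframe because \<open>\<alpha>\<close> acts on real vectors only.\<close>

lemma coframe_functional:
  assumes x: "x \<in> O1" and \<phi>: "coframe x \<phi>" and \<alpha>: "linear \<alpha>"
  defines "\<Phi> \<equiv> \<lambda>\<zeta>. \<Sum>m\<in>UNIV. complex_of_real (\<alpha> (axis m 1)) * \<phi> m (fst (EC (J x, \<zeta>)))"
  shows "\<Phi> holomorphic_on annulus r \<delta>"
    and "\<bar>t - r\<bar> < \<delta> \<Longrightarrow> deriv \<Phi> (of_real t) = of_real (\<alpha> (X' i x t))"
proof -
  have \<phi>l: "complex_linear (\<phi> m)" and \<phi>P: "\<phi> m (P x u) = of_real (u $ m)" for m u
    using \<phi> by (auto simp: coframe_def)
  show hol: "\<Phi> holomorphic_on annulus r \<delta>"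
    unfolding \<Phi>_def by (intro holomorphic_intros functional_holomorphic \<phi>l J_in x)
  assume t: "\<bar>t - r\<bar> < \<delta>"
  have val: "\<Phi> (of_real s) = of_real (\<alpha> (X i x s))" if "\<bar>s - r\<bar> < \<delta>" for s
  proof -
    have "\<Phi> (of_real s) = of_real (\<Sum>m\<in>UNIV. \<alpha> (axis m 1) * X i x s $ m)"
      by (simp add: \<Phi>_def EC_real[OF x that] \<phi>P)
    also have "(\<Sum>m\<in>UNIV. \<alpha> (axis m 1) * X i x s $ m) = \<alpha> (\<Sum>m\<in>UNIV. X i x s $ m *\<^sub>R axis m 1)"
      by (simp add: linear_sum[OF \<alpha>] linear_cmul[OF \<alpha>] mult.commute)
    finally show ?thesis unfolding B.expand_axis[symmetric] .
  qed
  show "deriv \<Phi> (of_real t) = of_real (\<alpha> (X' i x t))"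
  proof (rule deriv_of_real[OF hol open_annulus of_real_in_annulus[OF \<delta>(2) t]])
    show "\<Phi> (of_real s) = of_real (\<alpha> (X i x s))" if "\<bar>s - t\<bar> < \<delta> - \<bar>t - r\<bar>" for s
      using that by (intro val) linarith
    show "\<delta> - \<bar>t - r\<bar> > 0" using t by simp
    show "((\<lambda>s. \<alpha> (X i x s)) has_real_derivative \<alpha> (X' i x t)) (at t)"
      unfolding has_real_derivative_iff_has_vector_derivative
      by (rule bounded_linear.has_vector_derivative[OF linear_conv_bounded_linear[THEN iffD1, OF \<alpha>]
            parameter_derivative(1)[OF E_differentiable[OF in_C[OF x] t_pos[OF t]]]])
  qed
qed

text \<open>The functionals h(u,.), h(v,.) and \<open>A\<close> in \<open>coframe_functional\<close>
  supply \<open>Fu\<close>, \<open>Fv\<close> and \<open>FA\<close> of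
  \<open>soliton_moments\<close>. \<open>Y n u\<close> is then the pairing of \<open>u\<close> with
  the field Y of the overview.\<close>

lemma moments:
  assumes x: "x \<in> O1" and \<phi>: "coframe x \<phi>"
  defines "Y \<equiv> \<lambda>n u. contour_integral (circlepath 0 r)
      (\<lambda>\<zeta>. \<zeta> ^ (2 * n - 1) * (\<Sum>m\<in>UNIV. complex_of_real (h i x u (axis m 1)) * \<phi> m (fst (EC (J x, \<zeta>)))))"
  shows moment_1: "contour_integral (circlepath 0 r) (\<lambda>\<zeta>. \<zeta> * LC \<zeta> (J x) (P x u) (P x v)) = - 4 * pi * \<i> * of_real (Q i x u v)"
    and moment_odd: "n > 0 \<Longrightarrow> contour_integral (circlepath 0 r) (\<lambda>\<zeta>. \<zeta> ^ (2 * n + 1) * LC \<zeta> (J x) (P x u) (P x v)) =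
      - 2 * of_real (h i x u v) * contour_integral (circlepath 0 r) (\<lambda>\<zeta>. \<zeta> ^ (2 * n) * snd (EC (J x, \<zeta>)))
      - 2 * of_nat n * (of_real (A i x u) * Y n v + of_real (A i x v) * Y n u)"
proof -
  let ?\<Phi> = "\<lambda>\<alpha> \<zeta>. \<Sum>m\<in>UNIV. complex_of_real (\<alpha> (axis m 1)) * \<phi> m (fst (EC (J x, \<zeta>)))"
  let ?f = "\<lambda>\<zeta>. snd (EC (J x, \<zeta>))"
  note xC = in_C[OF x] and Jx = J_in[OF x]
  have lin: "linear (h i x u)" for u using inner3.bilinear[OF B.H[OF xC]] by (simp add: bilinear_def)
  have linA: "linear (A i x)" by (rule B.A_linear[OF xC])
  note d\<Phi> = coframe_functional[OF x \<phi>]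
  have df: "deriv ?f (of_real t) = of_real (f' i x t)" if t: "\<bar>t - r\<bar> < \<delta>" for t
  proof (rule deriv_of_real[OF EC_holomorphic(2)[OF Jx] open_annulus of_real_in_annulus[OF \<delta>(2) t]])
    show "?f (of_real s) = of_real (f i x s)" if "\<bar>s - t\<bar> < \<delta> - \<bar>t - r\<bar>" for s
      using that EC_real[OF x, of s] by simp
    show "\<delta> - \<bar>t - r\<bar> > 0" using t by simp
    show "((\<lambda>s. f i x s) has_real_derivative f' i x t) (at t)"
      by (rule parameter_derivative(2)[OF E_differentiable[OF xC t_pos[OF t]]])
  qed
  have S: "2 * of_real (Q i x u v) + 2 * of_real a * of_real t ^ 2 * of_real (h i x u v)
       + of_real t ^ 2 * LC (of_real t) (J x) (P x u) (P x v) + 2 * of_real t * ?f (of_real t) * of_real (h i x u v)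
       - of_real t * (of_real (A i x u) * deriv (?\<Phi> (h i x v)) (of_real t) + of_real (A i x v) * deriv (?\<Phi> (h i x u)) (of_real t)) = 0"
    if t: "\<bar>t - r\<bar> < \<delta>" for t
  proof -
    have "2 * Q i x u v + 2 * a * t^2 * h i x u v + t^2 * L i x t u v + 2 * t * f i x t * h i x u v
        - t * (A i x u * h i x v (X' i x t) + A i x v * h i x u (X' i x t)) = 0"
      using soliton_S[OF xC t_pos[OF t], of u v] by (simp add: field_simps)
    then have "complex_of_real (2 * Q i x u v + 2 * a * t^2 * h i x u v + t^2 * L i x t u v + 2 * t * f i x t * h i x u v
        - t * (A i x u * h i x v (X' i x t) + A i x v * h i x u (X' i x t))) = 0" by simp
    then show ?thesis
      unfolding d\<Phi>(2)[OF lin t] LC_real[OF x t] EC_real[OF x t] by simp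
  qed
  have R: "of_real t * deriv ?f (of_real t) + deriv (?\<Phi> (A i x)) (of_real t) + of_real a * of_real t = 0"
    if t: "\<bar>t - r\<bar> < \<delta>" for t
  proof -
    have "complex_of_real (t * f' i x t + A i x (X' i x t) + a * t) = 0"
      using soliton_R[OF xC t_pos[OF t]] by simp
    then show ?thesis unfolding d\<Phi>(2)[OF linA t] df[OF t] by simp
  qed
  note sm = soliton_moments[where L="\<lambda>\<zeta>. LC \<zeta> (J x) (P x u) (P x v)" and f="?f" and Fu="?\<Phi> (h i x u)"
      and Fv="?\<Phi> (h i x v)" and FA="?\<Phi> (A i x)" and q="of_real (Q i x u v)" and h="of_real (h i x u v)"
      and Au="of_real (A i x u)" and Av="of_real (A i x v)" and a="of_real a",
      OF \<delta> LC_holomorphic[OF Jx] EC_holomorphic(2)[OF Jx] d\<Phi>(1)[OF lin] d\<Phi>(1)[OF lin] d\<Phi>(1)[OF linA] S R]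
  show "contour_integral (circlepath 0 r) (\<lambda>\<zeta>. \<zeta> * LC \<zeta> (J x) (P x u) (P x v)) = - 4 * pi * \<i> * of_real (Q i x u v)"
    by (rule sm(1))
  show "contour_integral (circlepath 0 r) (\<lambda>\<zeta>. \<zeta> ^ (2 * n + 1) * LC \<zeta> (J x) (P x u) (P x v)) =
      - 2 * of_real (h i x u v) * contour_integral (circlepath 0 r) (\<lambda>\<zeta>. \<zeta> ^ (2 * n) * snd (EC (J x, \<zeta>)))
      - 2 * of_nat n * (of_real (A i x u) * Y n v + of_real (A i x v) * Y n u)" if "n > 0"
    unfolding Y_def by (rule sm(2)[OF _ _ that])
qed

end

lemma (in complex_scaling) cderiv_cmult:
  assumes "open S" "ghol F S" "z \<in> S"
  shows "cderiv v (\<lambda>z. c * F z) z = c * cderiv v F z"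
proof -
  have "((\<lambda>\<zeta>. c * F (z + sc \<zeta> v)) has_field_derivative c * cderiv v F z) (at 0)"
    using cderiv_line[OF assms(1,2), of z 0 v] assms(3) by (intro DERIV_cmult) simp
  then show ?thesis unfolding cderiv_def by (rule DERIV_imp_deriv)
qed

lemma complex_linear_cderiv:
  assumes "open S" "cspace.ghol F S" "z \<in> S"
  shows "complex_linear (\<lambda>v. cspace.cderiv v F z)"
  using has_derivative_linear[OF cspace.ghol_has_derivative[OF assms]]
  by (simp add: complex_linear_def scaleC_complex_def cspace.cderiv_scale[OF assms])

context complex_chart
begin

lemma contour_integral_expand:
  assumes "\<And>m. m \<in> I \<Longrightarrow> g m holomorphic_on annulus r \<delta>" "finite I"
  shows "contour_integral (circlepath 0 r) (\<lambda>\<zeta>. \<zeta> ^ k * (\<Sum>m\<in>I. c m * g m \<zeta>))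
    = (\<Sum>m\<in>I. c m * contour_integral (circlepath 0 r) (\<lambda>\<zeta>. \<zeta> ^ k * g m \<zeta>))"
proof -
  have int: "(\<lambda>\<zeta>. \<zeta> ^ k * g m \<zeta>) contour_integrable_on circlepath 0 r" if "m \<in> I" for m
    by (intro integrable holomorphic_intros assms that)
  have "contour_integral (circlepath 0 r) (\<lambda>\<zeta>. \<zeta> ^ k * (\<Sum>m\<in>I. c m * g m \<zeta>))
    = contour_integral (circlepath 0 r) (\<lambda>\<zeta>. \<Sum>m\<in>I. c m * (\<zeta> ^ k * g m \<zeta>))"
    by (simp add: sum_distrib_left mult_ac)
  also have "\<dots> = (\<Sum>m\<in>I. contour_integral (circlepath 0 r) (\<lambda>\<zeta>. c m * (\<zeta> ^ k * g m \<zeta>)))"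
    by (rule contour_integral_sum) (use assms(2) int contour_integrable_lmul in auto)
  also have "\<dots> = (\<Sum>m\<in>I. c m * contour_integral (circlepath 0 r) (\<lambda>\<zeta>. \<zeta> ^ k * g m \<zeta>))"
    by (intro sum.cong refl contour_integral_lmul int)
  finally show ?thesis .
qed

text \<open>The soliton equation is available on real vectors only; complex bilinearity and the
  coframe extend its consequences to all complex vectors.\<close>

lemma moment_expand:
  assumes x: "x \<in> O1" and \<phi>: "coframe x \<phi>"
  shows "contour_integral (circlepath 0 r) (\<lambda>\<zeta>. \<zeta> ^ k * LC \<zeta> (J x) u v) =
    (\<Sum>p\<in>UNIV. \<Sum>q\<in>UNIV. \<phi> p u * \<phi> q v *
       contour_integral (circlepath 0 r) (\<lambda>\<zeta>. \<zeta> ^ k * LC \<zeta> (J x) (P x (axis p 1)) (P x (axis q 1))))"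
proof -
  note Jx = J_in[OF x]
  let ?e = "\<lambda>p. P x (axis p 1)"
  have ex: "w = (\<Sum>m\<in>UNIV. \<phi> m w *\<^sub>C ?e m)" for w using \<phi> unfolding coframe_def by blast
  have "LC \<zeta> (J x) u v = (\<Sum>(p, q)\<in>UNIV. (\<phi> p u * \<phi> q v) * LC \<zeta> (J x) (?e p) (?e q))" if \<zeta>: "\<zeta> \<in> annulus r \<delta>" for \<zeta>
  proof -
    have "LC \<zeta> (J x) u v = (\<Sum>p\<in>UNIV. \<phi> p u * LC \<zeta> (J x) (?e p) v)"
      by (subst ex[of u]) (rule complex_linear_sum[OF LC_linear(2)[OF Jx \<zeta>]])
    also have "\<dots> = (\<Sum>p\<in>UNIV. \<phi> p u * (\<Sum>q\<in>UNIV. \<phi> q v * LC \<zeta> (J x) (?e p) (?e q)))"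
      by (subst ex[of v]) (simp only: complex_linear_sum[OF LC_linear(1)[OF Jx \<zeta>]])
    finally show ?thesis by (simp add: sum_distrib_left mult.assoc sum.cartesian_product)
  qed
  then have "contour_integral (circlepath 0 r) (\<lambda>\<zeta>. \<zeta> ^ k * LC \<zeta> (J x) u v) =
    contour_integral (circlepath 0 r) (\<lambda>\<zeta>. \<zeta> ^ k * (\<Sum>(p, q)\<in>UNIV. (\<phi> p u * \<phi> q v) * LC \<zeta> (J x) (?e p) (?e q)))"
    using sphere_subset_annulus[OF \<delta>(1), of r] r by (intro contour_integral_cong) auto
  also have "\<dots> = (\<Sum>m\<in>UNIV. (\<phi> (fst m) u * \<phi> (snd m) v) *
       contour_integral (circlepath 0 r) (\<lambda>\<zeta>. \<zeta> ^ k * LC \<zeta> (J x) (?e (fst m)) (?e (snd m))))"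
    unfolding case_prod_unfold by (rule contour_integral_expand) (auto intro: LC_holomorphic[OF Jx])
  finally show ?thesis by (simp add: sum.cartesian_product case_prod_unfold)
qed

lemma moment_1_vanishes_iff:
  assumes x: "x \<in> O1" and \<phi>: "coframe x \<phi>"
  shows "(\<forall>u v. contour_integral (circlepath 0 r) (\<lambda>\<zeta>. \<zeta> ^ 1 * LC \<zeta> (J x) u v) = 0) \<longleftrightarrow> (\<forall>u v. Q i x u v = 0)"
proof
  assume *: "\<forall>u v. contour_integral (circlepath 0 r) (\<lambda>\<zeta>. \<zeta> ^ 1 * LC \<zeta> (J x) u v) = 0"
  show "\<forall>u v. Q i x u v = 0"
  proof (intro allI)
    fix u v
    have "- 4 * pi * \<i> * of_real (Q i x u v) = 0"
      using *[rule_format, of "P x u" "P x v"] moment_1[OF x \<phi>, of u v] by simp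
    then show "Q i x u v = 0" by simp
  qed
next
  assume "\<forall>u v. Q i x u v = 0"
  then have "contour_integral (circlepath 0 r) (\<lambda>\<zeta>. \<zeta> ^ 1 * LC \<zeta> (J x) (P x u) (P x v)) = 0" for u v
    using moment_1[OF x \<phi>, of u v] by simp
  then show "\<forall>u v. contour_integral (circlepath 0 r) (\<lambda>\<zeta>. \<zeta> ^ 1 * LC \<zeta> (J x) u v) = 0"
    by (subst moment_expand[OF x \<phi>]) (simp del: power_one_right)
qed

lemma functional_kernel:
  fixes \<alpha> :: "real ^ 3 \<Rightarrow> real"
  assumes "linear \<alpha>"
  obtains u where "u \<noteq> 0" "\<alpha> u = 0"
proof -
  let ?e = "\<lambda>k :: 3. axis k 1 :: real ^ 3"
  define w where "w = \<alpha> (?e 2) *\<^sub>R ?e 1 - \<alpha> (?e 1) *\<^sub>R ?e 2"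
  have "\<alpha> w = 0" by (simp add: w_def linear_diff[OF assms] linear_cmul[OF assms])
  moreover have "w $ 1 = \<alpha> (?e 2)" by (simp add: w_def axis_def)
  ultimately have "w \<noteq> 0" if "\<alpha> (?e 2) \<noteq> 0" using that by auto
  moreover have "?e 2 \<noteq> 0" by (simp add: axis_eq_0_iff)
  ultimately show ?thesis using that[of w] that[of "?e 2"] \<open>\<alpha> w = 0\<close> by blast
qed

text \<open>By \<open>moment_odd\<close> the moment is a multiple of \<open>h\<close> plus the symmetric product of \<open>A\<close> with the
  one-form \<open>y\<close>; testing on the kernel of \<open>A\<close> shows that this can be proportional to \<open>h\<close> only if \<open>y = 0\<close>.\<close>

lemma trace_free_moment:
  assumes x: "x \<in> O1" and \<phi>: "coframe x \<phi>" and n: "n > 0"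
    and tf: "\<And>u v. contour_integral (circlepath 0 r) (\<lambda>\<zeta>. \<zeta> ^ (2 * n + 1) * LC \<zeta> (J x) (P x u) (P x v)) = c * of_real (h i x u v)"
  shows "G (2 * n - 1) l (J x) = 0"
proof -
  note xC = in_C[OF x] and Jx = J_in[OF x]
  interpret inner3 "h i x" by (rule B.H[OF xC])
  let ?I = "contour_integral (circlepath 0 r)"
  have \<phi>l: "complex_linear (\<phi> m)" for m using \<phi> by (simp add: coframe_def)
  note hol = functional_holomorphic[OF \<phi>l Jx]
  define Y where "Y m = ?I (\<lambda>\<zeta>. \<zeta> ^ (2 * n - 1) * \<phi> m (fst (EC (J x, \<zeta>))))" for m
  define y where "y u = (\<Sum>m\<in>UNIV. complex_of_real (h i x u (axis m 1)) * Y m)" for u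
  \<comment> \<open>The total coefficient of h: the assumed factor together with the contribution of
    \<open>f\<close> to \<open>moment_odd\<close>. Positivity of h on a kernel vector of
    \<open>A\<close> shows that it is zero.\<close>
  define c' where "c' = c + 2 * ?I (\<lambda>\<zeta>. \<zeta> ^ (2 * n) * snd (EC (J x, \<zeta>)))"
  have eq: "c' * of_real (h i x u v) + 2 * of_nat n * (of_real (A i x u) * y v + of_real (A i x v) * y u) = 0" for u v
  proof -
    have "?I (\<lambda>\<zeta>. \<zeta> ^ (2 * n - 1) * (\<Sum>m\<in>UNIV. complex_of_real (h i x u (axis m 1)) * \<phi> m (fst (EC (J x, \<zeta>))))) = y u" for u
      unfolding y_def Y_def by (rule contour_integral_expand) (auto intro: hol)
    note m = moment_odd[OF x \<phi> n, of u v, unfolded tf this]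
    have "(c1 + 2 * I) * H + 2 * N * z = 0" if "c1 * H = - 2 * H * I - 2 * N * z" for c1 H I N z :: complex
      using that by algebra
    from this[OF m] show ?thesis unfolding c'_def .
  qed
  have linA: "linear (A i x)" by (rule B.A_linear[OF xC])
  obtain u1 where u1: "u1 \<noteq> 0" "A i x u1 = 0" by (rule functional_kernel[OF linA])
  have "c' * of_real (h i x u1 u1) = 0" using eq[of u1 u1] u1 by simp
  then have c': "c' = 0" using posdef[OF u1(1)] by simp
  obtain u0 where u0: "A i x u0 \<noteq> 0" using A_nonzero[OF xC] by blast
  have sym0: "of_real (A i x u) * y v + of_real (A i x v) * y u = 0" for u v using eq[of u v] c' n by simp
  have "y u0 = 0" using sym0[of u0 u0] u0 by (simp flip: distrib_left mult_2)
  then have y0: "y v = 0" for v using sym0[of u0 v] u0 by simp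
  \<comment> \<open>Nondegeneracy of the real form h; it is applied to the real and imaginary parts
    of \<open>Y\<close> separately.\<close>
  have zero: "(\<forall>m. b m = 0)" if b: "\<And>u. (\<Sum>m\<in>UNIV. h i x u (axis m 1) * b m) = 0" for b :: "3 \<Rightarrow> real"
  proof -
    define w where "w = (\<Sum>m\<in>UNIV. b m *\<^sub>R (axis m 1 :: real ^ 3))"
    have "h i x u w = 0" for u
      using b[of u] bilinear by (simp add: w_def bilinear_def linear_sum linear_cmul mult.commute)
    then have "w = 0" using posdef[of w] by force
    moreover have "w $ m = b m" for m by (simp add: w_def axis_def if_distrib cong: if_cong)
    ultimately show ?thesis by (metis zero_index)
  qed
  have "Re (Y m) = 0" "Im (Y m) = 0" for m
    using zero[of "\<lambda>m. Re (Y m)"] zero[of "\<lambda>m. Im (Y m)"] y0[THEN arg_cong, of Re] y0[THEN arg_cong, of Im]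
    by (auto simp: y_def)
  then have Y0: "Y m = 0" for m by (simp add: complex_eq_iff)
  have "fst (EC (J x, \<zeta>)) $ l = (\<Sum>m\<in>UNIV. P x (axis m 1) $ l * \<phi> m (fst (EC (J x, \<zeta>))))" for \<zeta>
  proof -
    have "w = (\<Sum>m\<in>UNIV. \<phi> m w *\<^sub>C P x (axis m 1))" for w using \<phi> unfolding coframe_def by blast
    from this[THEN arg_cong, of "\<lambda>w. w $ l", of "fst (EC (J x, \<zeta>))"] show ?thesis
      by (simp add: scaleC_vec_def scaleC_complex_def mult.commute)
  qed
  then have "G (2 * n - 1) l (J x) = ?I (\<lambda>\<zeta>. \<zeta> ^ (2 * n - 1) * (\<Sum>m\<in>UNIV. P x (axis m 1) $ l * \<phi> m (fst (EC (J x, \<zeta>)))))"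
    by (simp only: G_def)
  also have "\<dots> = (\<Sum>m\<in>UNIV. P x (axis m 1) $ l * Y m)"
    unfolding Y_def by (rule contour_integral_expand) (auto intro: hol)
  finally show ?thesis by (simp add: Y0)
qed

subsection \<open>Descent\<close>

lemma field_has_derivative:
  assumes z: "z \<in> \<Omega>" and \<zeta>: "\<zeta> \<in> annulus r \<delta>"
  shows "((\<lambda>z. fst (EC (z, \<zeta>))) has_derivative (\<lambda>v. \<chi> l. cspace.cderiv v (\<lambda>z. fst (EC (z, \<zeta>)) $ l) z)) (at z)"
  by (rule has_derivative_complex_vec)
    (simp add: cspace.ghol_has_derivative[OF \<Omega> ghol_slices(2)[OF EC_hol(1) \<zeta>] z])

lemma HC_bilinear: "z \<in> \<Omega> \<Longrightarrow> bilinear (HC z)"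
  using HC_linear by (simp add: bilinear_def complex_linear_def)

text \<open>\<open>LC\<close> is specified by its values at real points and real \<rho>. There
  \<open>lie_derivative_related\<close> equates it with the coordinate expression of the Lie
  derivative of \<open>HC\<close> along \<open>EC\<close>; both sides are holomorphic in \<zeta>, so
  they agree on the annulus. The base point stays real throughout.\<close>

lemma lie_formula:
  assumes x: "x \<in> O1" and \<zeta>: "\<zeta> \<in> annulus r \<delta>"
  defines "D \<equiv> \<lambda>\<zeta> l u. cspace.cderiv (P x u) (\<lambda>z. fst (EC (z, \<zeta>)) $ l) (J x)"
  shows "LC \<zeta> (J x) (P x u) (P x v) =
     (\<Sum>l\<in>UNIV. cspace.cderiv (axis l 1) (\<lambda>z. HC z (P x u) (P x v)) (J x) * fst (EC (J x, \<zeta>)) $ l)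
     + (\<Sum>l\<in>UNIV. HC (J x) (axis l 1) (P x v) * D \<zeta> l u) + (\<Sum>l\<in>UNIV. HC (J x) (P x u) (axis l 1) * D \<zeta> l v)"
  (is "_ = ?R \<zeta>")
proof -
  note Jx = J_in[OF x]
  have o: "open (\<Omega> \<times> annulus r \<delta>)" by (intro open_Times \<Omega> open_annulus)
  have Dhol: "(\<lambda>\<zeta>. D \<zeta> l u) holomorphic_on annulus r \<delta>" for l u
    unfolding D_def ghol_slices(3)[OF EC_hol(1)]
    by (rule ghol_slices(1)[OF cspace.ghol_cderiv[OF o EC_hol(1)] Jx])
  have "LC \<zeta> (J x) (P x u) (P x v) - ?R \<zeta> = 0"
  proof (rule annulus_identity[OF \<delta> _ _ \<zeta>])
    show "(\<lambda>\<zeta>. LC \<zeta> (J x) (P x u) (P x v) - ?R \<zeta>) holomorphic_on annulus r \<delta>"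
      by (intro holomorphic_intros LC_holomorphic EC_holomorphic Dhol Jx)
    fix t assume t: "\<bar>t - r\<bar> < \<delta>"
    note ta = of_real_in_annulus[OF \<delta>(2) t] and xC = in_C[OF x]
    note C2 = C2_on_complex_vec[OF O1(1) J_ext, unfolded C2_on_def]
    let ?V' = "\<lambda>z. fst (EC (z, complex_of_real t))"
    note dV' = field_has_derivative[OF Jx ta]
    have dX: "(\<lambda>y. X i y t) differentiable at x"
      by (rule differentiableI[OF slice_derivative(1)[OF E_differentiable[OF xC t_pos[OF t]]]])
    have dHC: "((\<lambda>z. HC z u v) has_derivative (\<lambda>w. cspace.cderiv w (\<lambda>z. HC z u v) (J x))) (at (J x))" for u v
      by (rule cspace.ghol_has_derivative[OF \<Omega> HC_hol Jx])
    have "dir_deriv (\<lambda>y. complex_of_real (h i y u v)) x (X i x t) + of_real (h i x (dir_deriv (\<lambda>y. X i y t) x u) v)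
        + of_real (h i x u (dir_deriv (\<lambda>y. X i y t) x v)) =
      dir_deriv (\<lambda>z. HC z (P x u) (P x v)) (J x) (?V' (J x)) + HC (J x) (dir_deriv ?V' (J x) (P x u)) (P x v)
      + HC (J x) (P x u) (dir_deriv ?V' (J x) (P x v))"
    proof (rule lie_derivative_related[where S=O1 and T=\<Omega> and B="\<lambda>y u v. complex_of_real (h i y u v)"])
      show "open O1" "x \<in> O1" "open \<Omega>" "J x \<in> \<Omega>" by (rule O1 x \<Omega> Jx)+
      show "J differentiable at y" if "y \<in> O1" for y by (rule J_differentiable[OF that])
      show "(\<lambda>y. P y u) differentiable at x" for u using C2 x by blast
      show "dir_deriv (\<lambda>y. P y u) x w = dir_deriv (\<lambda>y. P y w) x u" for u w using C2 x by blast
      show "?V' differentiable at (J x)" by (rule differentiableI[OF dV'])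
      show "?V' (J y) = P y (X i y t)" if "y \<in> O1" for y by (simp add: EC_real[OF that t])
      show "bilinear (HC z)" if "z \<in> \<Omega>" for z by (rule HC_bilinear[OF that])
      show "(\<lambda>z. HC z u v) differentiable at (J x)" for u v by (rule differentiableI[OF dHC])
      show "complex_of_real (h i y u v) = HC (J y) (P y u) (P y v)" if "y \<in> O1" for y u v by (rule HC_real[OF that, symmetric])
    qed (rule dX)
    moreover have "dir_deriv (\<lambda>y. complex_of_real (h i y u v)) x w = of_real (dir_deriv (\<lambda>y. h i y u v) x w)" for w
      by (subst dir_deriv_eq[OF has_derivative_of_real[OF has_derivative_dir_deriv[OF B.H_differentiable[OF xC]]]]) simp
    ultimately have "LC (of_real t) (J x) (P x u) (P x v) =
      dir_deriv (\<lambda>z. HC z (P x u) (P x v)) (J x) (?V' (J x)) + HC (J x) (dir_deriv ?V' (J x) (P x u)) (P x v)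
      + HC (J x) (P x u) (dir_deriv ?V' (J x) (P x v))"
      unfolding LC_real[OF x t] L_eq[OF xC t_pos[OF t]] by simp
    also have "\<dots> = ?R (of_real t)"
    proof -
      have "HC (J x) u (\<chi> l. g l) = (\<Sum>l\<in>UNIV. HC (J x) u (axis l 1) * g l)" for u g
        using complex_linear_expand[OF HC_linear(1)[OF Jx, of u], of "\<chi> l. g l"] by (simp add: mult.commute)
      moreover have "HC (J x) (\<chi> l. g l) v = (\<Sum>l\<in>UNIV. HC (J x) (axis l 1) v * g l)" for v g
        using complex_linear_expand[OF HC_linear(2)[OF Jx, of v], of "\<chi> l. g l"] by (simp add: mult.commute)
      ultimately show ?thesis
        unfolding dir_deriv_eq[OF dV'] dir_deriv_eq[OF dHC]
          complex_linear_expand[OF complex_linear_cderiv[OF \<Omega> HC_hol Jx], of "?V' (J x)"]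
        by (simp only: D_def mult.commute[of "cspace.cderiv (axis _ 1) _ _"])
    qed
    finally show "LC (of_real t) (J x) (P x u) (P x v) - ?R (of_real t) = 0" by simp
  qed
  then show ?thesis by simp
qed

text \<open>Integrating \<open>lie_formula\<close> gives the Lie derivative of h along \<integral>
  \<rho>^m X d\<rho>, whose coefficients are \<open>G m l\<close> and their derivatives in the
  directions \<open>P x u\<close>. These directions are tangent to the real points, so vanishing of
  \<open>G\<close> at real points makes the derivatives vanish too.\<close>

lemma descent:
  assumes x: "x \<in> O1" and \<phi>: "coframe x \<phi>" and G0: "\<And>y l. y \<in> O1 \<Longrightarrow> G m l (J y) = 0"
  shows "contour_integral (circlepath 0 r) (\<lambda>\<zeta>. \<zeta> ^ m * LC \<zeta> (J x) u v) = 0"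
proof -
  note Jx = J_in[OF x]
  let ?I = "contour_integral (circlepath 0 r)"
  let ?D = "\<lambda>\<zeta> l u. cspace.cderiv (P x u) (\<lambda>z. fst (EC (z, \<zeta>)) $ l) (J x)"
  have o: "open (\<Omega> \<times> annulus r \<delta>)" by (intro open_Times \<Omega> open_annulus)
  have Dhol: "(\<lambda>\<zeta>. ?D \<zeta> l u) holomorphic_on annulus r \<delta>" for l u
    unfolding ghol_slices(3)[OF EC_hol(1)]
    by (rule ghol_slices(1)[OF cspace.ghol_cderiv[OF o EC_hol(1)] Jx])
  have sub: "sphere 0 r \<subseteq> annulus r \<delta>" by (rule sphere_subset_annulus[OF \<delta>(1)])
  have cont: "continuous_on (\<Omega> \<times> sphere 0 r) (\<lambda>(z, \<zeta>). \<zeta> ^ m * fst (EC (z, \<zeta>)) $ l)" for l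
  proof -
    have "continuous_on (\<Omega> \<times> sphere 0 r) (\<lambda>Z. fst (EC Z) $ l)"
      using EC_hol(1)[of l] sub unfolding cspace.ghol_def by (blast intro: continuous_on_subset)
    then show ?thesis unfolding case_prod_unfold by (auto intro!: continuous_intros)
  qed
  have gh: "cspace.ghol (\<lambda>z. fst (EC (z, \<zeta>)) $ l) \<Omega>" if "\<zeta> \<in> sphere 0 r" for \<zeta> l
    by (rule ghol_slices(2)[OF EC_hol(1)]) (use that sub in blast)
  have gh': "cspace.ghol (\<lambda>z. \<zeta> ^ m * fst (EC (z, \<zeta>)) $ l) \<Omega>" if "\<zeta> \<in> sphere 0 r" for \<zeta> l
    by (intro cspace.ghol_mult cspace.ghol_const gh that)
  have ID: "?I (\<lambda>\<zeta>. \<zeta> ^ m * ?D \<zeta> l u) = 0" for l u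
  proof -
    have gG: "cspace.ghol (G m l) \<Omega>"
      unfolding G_def by (rule cspace.ghol_contour_integral(1)[OF \<Omega> cont gh']) (use r in auto)
    have "?I (\<lambda>\<zeta>. \<zeta> ^ m * ?D \<zeta> l u) = ?I (\<lambda>\<zeta>. cspace.cderiv (P x u) (\<lambda>z. \<zeta> ^ m * fst (EC (z, \<zeta>)) $ l) (J x))"
      using r by (intro contour_integral_cong) (auto simp: cspace.cderiv_cmult[OF \<Omega> gh Jx])
    also have "\<dots> = cspace.cderiv (P x u) (G m l) (J x)"
      unfolding G_def by (rule cspace.ghol_contour_integral(2)[OF \<Omega> cont gh' _ Jx, symmetric]) (use r in auto)
    also have "\<dots> = 0"
    proof -
      have "((\<lambda>y. G m l (J y)) has_derivative (\<lambda>u. cspace.cderiv (P x u) (G m l) (J x))) (at x)"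
        by (rule has_derivative_compose[OF has_derivative_dir_deriv[OF J_differentiable[OF x]] cspace.ghol_has_derivative[OF \<Omega> gG Jx]])
      moreover have "((\<lambda>y. G m l (J y)) has_derivative (\<lambda>u. 0)) (at x)"
        by (rule has_derivative_cong_open[OF has_derivative_const O1(1) x]) (simp add: G0)
      ultimately show ?thesis using has_derivative_unique by metis
    qed
    finally show ?thesis .
  qed
  have "?I (\<lambda>\<zeta>. \<zeta> ^ m * LC \<zeta> (J x) (P x u) (P x v)) = 0" for u v
  proof -
    let ?a = "\<lambda>l. cspace.cderiv (axis l 1) (\<lambda>z. HC z (P x u) (P x v)) (J x)"
      and ?b = "\<lambda>l. HC (J x) (axis l 1) (P x v)" and ?c = "\<lambda>l. HC (J x) (P x u) (axis l 1)"
    have "?I (\<lambda>\<zeta>. \<zeta> ^ m * LC \<zeta> (J x) (P x u) (P x v)) = ?I (\<lambda>\<zeta>.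
        \<zeta> ^ m * (\<Sum>l\<in>UNIV. ?a l * fst (EC (J x, \<zeta>)) $ l) + \<zeta> ^ m * (\<Sum>l\<in>UNIV. ?b l * ?D \<zeta> l u)
        + \<zeta> ^ m * (\<Sum>l\<in>UNIV. ?c l * ?D \<zeta> l v))"
      using sub r by (intro contour_integral_cong) (auto simp: lie_formula[OF x] distrib_left)
    also have "\<dots> = ?I (\<lambda>\<zeta>. \<zeta> ^ m * (\<Sum>l\<in>UNIV. ?a l * fst (EC (J x, \<zeta>)) $ l)) + ?I (\<lambda>\<zeta>. \<zeta> ^ m * (\<Sum>l\<in>UNIV. ?b l * ?D \<zeta> l u))
        + ?I (\<lambda>\<zeta>. \<zeta> ^ m * (\<Sum>l\<in>UNIV. ?c l * ?D \<zeta> l v))"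
      by (subst contour_integral_add contour_integral_add, (intro integrable holomorphic_intros EC_holomorphic Dhol Jx)+)+ simp
    also have "\<dots> = (\<Sum>l\<in>UNIV. ?a l * G m l (J x)) + (\<Sum>l\<in>UNIV. ?b l * ?I (\<lambda>\<zeta>. \<zeta> ^ m * ?D \<zeta> l u))
        + (\<Sum>l\<in>UNIV. ?c l * ?I (\<lambda>\<zeta>. \<zeta> ^ m * ?D \<zeta> l v))"
      unfolding G_def by (subst (1 2 3) contour_integral_expand) (auto intro: EC_holomorphic Dhol Jx)
    finally show ?thesis by (simp add: ID G0[OF x])
  qed
  then show ?thesis by (subst moment_expand[OF x \<phi>]) simp
qed

end

section \<open>From real points to complex neighbourhoods\<close>

lemma (in complex_chart) moment_ghol:
  "cspace.ghol (\<lambda>z. contour_integral (circlepath 0 r) (\<lambda>\<zeta>. \<zeta> ^ m * LC \<zeta> z u v)) \<Omega>"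
proof (rule cspace.ghol_contour_integral(1)[OF \<Omega>])
  have sub: "sphere 0 r \<subseteq> annulus r \<delta>" by (rule sphere_subset_annulus[OF \<delta>(1)])
  have "continuous_on (\<Omega> \<times> sphere 0 r) (\<lambda>(z, \<zeta>). LC \<zeta> z u v)"
    using LC_hol[of u v] sub unfolding cspace.ghol_def by (blast intro: continuous_on_subset)
  then show "continuous_on (\<Omega> \<times> sphere 0 r) (\<lambda>(z, \<zeta>). \<zeta> ^ m * LC \<zeta> z u v)"
    unfolding case_prod_unfold by (intro continuous_intros)
  show "cspace.ghol (\<lambda>z. \<zeta> ^ m * LC \<zeta> z u v) \<Omega>" if "\<zeta> \<in> sphere 0 r" for \<zeta>
    using ghol_slices(2)[OF LC_hol[of u v], of \<zeta>] that sub
    by (intro cspace.ghol_mult cspace.ghol_const) auto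
qed (use r in simp)

lemma holomorphic_map_compose:
  assumes f: "holomorphic_map_on f S" and g: "holomorphic_map_on g T" and fS: "\<And>z. z \<in> S \<Longrightarrow> f z \<in> T"
  shows "holomorphic_map_on (\<lambda>z. g (f z)) S"
  unfolding holomorphic_map_on_def
proof
  fix z assume z: "z \<in> S"
  obtain D D' where D: "(f has_derivative D) (at z)" "complex_linear D" and D': "(g has_derivative D') (at (f z))" "complex_linear D'"
    using f g z fS[OF z] unfolding holomorphic_map_on_def by blast
  have *: "((\<lambda>z. g (f z)) has_derivative (\<lambda>h. D' (D h))) (at z)"
    by (rule has_derivative_compose[OF D(1) D'(1)])
  moreover from has_derivative_linear[OF this] have "complex_linear (\<lambda>h. D' (D h))"
    using D(2) D'(2) by (simp add: complex_linear_def)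
  ultimately show "\<exists>D. ((\<lambda>z. g (f z)) has_derivative D) (at z) \<and> complex_linear D" by blast
qed

lemma holomorphic_map_subset: "holomorphic_map_on f S \<Longrightarrow> T \<subseteq> S \<Longrightarrow> holomorphic_map_on f T"
  by (auto simp: holomorphic_map_on_def)

lemma holomorphic_map_continuous_on: "holomorphic_map_on f S \<Longrightarrow> continuous_on S f"
  by (intro continuous_at_imp_continuous_on ballI) (auto simp: holomorphic_map_on_def intro: has_derivative_continuous)

text \<open>Join a real point to \<open>w = y\<^sub>0 + a + \<i> b\<close> along the complex line \<open>\<zeta> \<mapsto> y\<^sub>0 + a + \<zeta> b\<close>.\<close>

lemma ghol_zero_on_real:
  fixes F :: "complex ^ 'n \<Rightarrow> complex"
  assumes F: "cspace.ghol F (ball (complexify_vec y0) \<epsilon>)"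
    and F0: "\<And>y. y \<in> ball y0 \<epsilon> \<Longrightarrow> F (complexify_vec y) = 0" and w: "w \<in> ball (complexify_vec y0) \<epsilon>"
  shows "F w = 0"
proof -
  define a where "a = (\<chi> k. Re (w $ k) - y0 $ k)"
  define b where "b = (\<chi> k. Im (w $ k))"
  let ?l = "\<lambda>\<zeta>. complexify_vec (y0 + a) + \<zeta> *\<^sub>C complexify_vec b"
  let ?S = "{\<zeta>. ?l \<zeta> \<in> ball (complexify_vec y0) \<epsilon>}"
  have wl: "?l \<i> = w"
    by (simp add: vec_eq_iff complexify_vec_def scaleC_vec_def scaleC_complex_def a_def b_def complex_eq_iff)
  have real: "?l (of_real t) = complexify_vec (y0 + a + t *\<^sub>R b)" for t
    by (simp add: complexify_vec_linear)
  have dist_real: "dist (complexify_vec y0) (complexify_vec y) = dist y0 y" for y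
  proof -
    have "complexify_vec y0 - complexify_vec y = complexify_vec (y0 - y)"
      by (simp add: vec_eq_iff complexify_vec_def)
    then show ?thesis by (simp add: dist_norm norm_complexify_vec)
  qed
  have "norm a \<le> norm (w - complexify_vec y0)"
    by (rule norm_le_componentwise_cart)
      (use abs_Re_le_cmod in \<open>auto simp: a_def complexify_vec_def\<close>, metis Re_complex_of_real abs_Re_le_cmod minus_complex.simps(1))
  then have a: "y0 + a \<in> ball y0 \<epsilon>" using w by (simp add: dist_norm norm_minus_commute)
  have "((\<lambda>t. y0 + a + t *\<^sub>R b) \<longlongrightarrow> y0 + a + 0 *\<^sub>R b) (at 0)" by (intro tendsto_intros)
  then have "\<forall>\<^sub>F t in at 0. y0 + a + t *\<^sub>R b \<in> ball y0 \<epsilon>"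
    by (rule topological_tendstoD) (use a in auto)
  then obtain d where d: "d > 0" "\<And>t. t \<noteq> 0 \<Longrightarrow> \<bar>t\<bar> < d \<Longrightarrow> y0 + a + t *\<^sub>R b \<in> ball y0 \<epsilon>"
    unfolding eventually_at by (auto simp: dist_real_def)
  have conv: "convex ?S"
  proof -
    have "?S = (\<lambda>\<zeta>. \<zeta> *\<^sub>C complexify_vec b) -` ((\<lambda>z. - complexify_vec (y0 + a) + z) ` ball (complexify_vec y0) \<epsilon>)"
      by (force simp: image_iff algebra_simps)
    moreover have "linear (\<lambda>\<zeta>. \<zeta> *\<^sub>C complexify_vec b)"
      by (intro linearI) (simp_all add: scaleC_add_left scaleR_conv_of_real scaleC_of_real flip: scaleC_scaleC)
    ultimately show ?thesis
      by (simp add: convex_linear_vimage convex_translation)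
  qed
  have "(\<lambda>\<zeta>. F (?l \<zeta>)) \<i> = 0"
  proof (rule analytic_continuation[where f="\<lambda>\<zeta>. F (?l \<zeta>)" and S="?S" and \<xi>=0])
    show "(\<lambda>\<zeta>. F (?l \<zeta>)) holomorphic_on ?S" by (rule cspace.ghol_line[OF F])
    show "open ?S" by (rule cspace.open_line[OF open_ball])
    show "connected ?S" by (rule convex_connected[OF conv])
    show "complex_of_real ` {0<..<d} \<subseteq> ?S"
    proof
      fix z assume "z \<in> complex_of_real ` {0<..<d}"
      then obtain t where t: "z = of_real t" "0 < t" "t < d" by auto
      then have "dist y0 (y0 + a + t *\<^sub>R b) < \<epsilon>" using d(2)[of t] by simp
      then show "z \<in> ?S" unfolding t(1) mem_Collect_eq real mem_ball dist_real .
    qed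
    show "0 \<in> ?S" using a real[of 0] dist_real by simp
    show "0 islimpt complex_of_real ` {0<..<d}"
      unfolding islimpt_approachable
    proof (intro allI impI)
      fix e :: real assume "e > 0"
      then show "\<exists>x'\<in>complex_of_real ` {0<..<d}. x' \<noteq> 0 \<and> dist x' 0 < e"
        using d(1) by (intro bexI[of _ "of_real (min d e / 2)"] imageI) auto
    qed
    show "F (?l z) = 0" if z: "z \<in> complex_of_real ` {0<..<d}" for z
    proof -
      obtain t where t: "z = of_real t" "0 < t" "t < d" using z by auto
      show ?thesis unfolding t(1) real using d(2)[of t] t by (intro F0) auto
    qed
    show "\<i> \<in> ?S" unfolding mem_Collect_eq wl by (rule w)
  qed
  then show ?thesis unfolding wl .
qed

locale complex_soliton = beltrami_soliton \<N> h A E a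
  for \<N> :: "'i \<Rightarrow> ('n::topological_space, real ^ 3) chart" and h A E a +
  fixes \<X> :: "'k \<Rightarrow> ('x::topological_space, complex ^ 3) chart"
    and \<iota> :: "'n \<Rightarrow> 'x" and U :: "'n set" and r :: real and D :: "'x set"
    and HC :: "'k \<Rightarrow> complex ^ 3 \<Rightarrow> complex ^ 3 \<Rightarrow> complex ^ 3 \<Rightarrow> complex"
    and W :: "('x \<times> complex) set"
    and LC :: "complex \<Rightarrow> 'k \<Rightarrow> complex ^ 3 \<Rightarrow> complex ^ 3 \<Rightarrow> complex ^ 3 \<Rightarrow> complex"
    and W' :: "('x \<times> complex) set"
    and EC :: "'k \<Rightarrow> (complex ^ 3) \<times> complex \<Rightarrow> (complex ^ 3) \<times> complex"
  assumes X_complexification: "complexification \<N> \<X> \<iota>" and U: "open U" and r: "r > 0"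
    and EC: "open W'" "W' \<subseteq> UNIV \<times> (- {0})" "\<iota> ` U \<times> sphere 0 r \<subseteq> W'"
      "complexification_vector_field \<N> \<X> \<iota> W' E EC"
    and HC: "open D" "\<iota> ` U \<subseteq> D" "complexification_form \<N> \<X> \<iota> D h HC"
    and LC: "open W" "\<iota> ` U \<times> sphere 0 r \<subseteq> W"
      "complexification_form_family \<N> \<X> \<iota> W (slice_lie_derivative E h) LC"
begin

lemma X: "is_chart (\<X> k)" and X_cover: "\<exists>k. q \<in> chart_dom (\<X> k)"
  using X_complexification by (auto simp: complexification_def holomorphic_atlas_def)

lemma chart_image_mem:
  assumes "q \<in> chart_dom (\<X> k)" "(q, \<zeta>) \<in> S" "\<zeta> \<in> T"
  shows "(chart_map (\<X> k) q, \<zeta>) \<in> chart_map (product_atlas T \<X> k) ` (S \<inter> chart_dom (product_atlas T \<X> k))"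
  using assms by (force simp: product_atlas_def)

text \<open>Near any point of \<open>U\<close> the charts and domains can be shrunk until the
  hypotheses of \<open>complex_chart\<close> hold. The last two conclusions keep the link to
  \<open>U\<close> and \<open>W\<close> that the shrinking provides.\<close>

lemma chart_exists:
  assumes p: "p \<in> U" "p \<in> chart_dom (\<N> i)" "\<iota> p \<in> chart_dom (\<X> k)"
  defines "J \<equiv> local_rep \<iota> (\<N> i) (\<X> k)" and "x \<equiv> chart_map (\<N> i) p"
  obtains O1 \<Omega> \<delta> \<phi> where "complex_chart \<N> h A E a i J O1 \<Omega> r \<delta> (EC k) (HC k) (\<lambda>\<zeta>. LC \<zeta> k)"
    "x \<in> O1" "complex_chart.coframe J x \<phi>"
    "\<forall>y\<in>O1. chart_inv (\<N> i) y \<in> U \<and> \<iota> (chart_inv (\<N> i) y) \<in> chart_dom (\<X> k)"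
    "\<forall>z\<in>\<Omega>. z \<in> chart_image (\<X> k) \<and> {chart_inv (\<X> k) z} \<times> sphere 0 r \<subseteq> W"
proof -
  obtain O2 where O2: "open O2" "x \<in> O2" "O2 \<subseteq> C i"
    "\<And>y. y \<in> O2 \<Longrightarrow> \<iota> (chart_inv (\<N> i) y) \<in> chart_dom (\<X> k)" "\<And>l. ext_hol (\<lambda>y. J y $ l) O2"
    and ex\<phi>: "\<exists>\<phi> :: 3 \<Rightarrow> complex ^ 3 \<Rightarrow> complex. (\<forall>m. complex_linear (\<phi> m)) \<and> (\<forall>m u. \<phi> m (dir_deriv J x u) = of_real ((u :: real ^ 3) $ m)) \<and>
       (\<forall>w. w = (\<Sum>m\<in>UNIV. \<phi> m w *\<^sub>C dir_deriv J x (axis m 1)))"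
    unfolding J_def x_def by (rule complexification_chart[OF X_complexification N_analytic p(2,3)]) blast
  note C2 = C2_on_complex_vec[OF O2(1,5), unfolded C2_on_def]
  have contJ: "continuous_on O2 J"
    using C2 by (intro continuous_at_imp_continuous_on ballI differentiable_imp_continuous_within) auto
  let ?inv = "chart_inv (\<X> k)"
  \<comment> \<open>The common domain, in coordinates, of the extended field (\<open>W'\<close>), of
    \<open>LC\<close> (\<open>W\<close>) and of \<open>HC\<close> (\<open>D\<close>).\<close>
  define T where "T = {Z \<in> chart_image (\<X> k) \<times> UNIV. (?inv (fst Z), snd Z) \<in> W \<inter> W' \<inter> (D \<times> UNIV)}"
  have "continuous_on (chart_image (\<X> k) \<times> UNIV) (\<lambda>Z :: _ \<times> complex. (?inv (fst Z), snd Z))"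
    by (intro continuous_intros continuous_on_compose2[OF continuous_chart_inv[OF X]]) auto
  then have "open ((chart_image (\<X> k) \<times> UNIV) \<inter> (\<lambda>Z. (?inv (fst Z), snd Z)) -` (W \<inter> W' \<inter> (D \<times> UNIV)))"
    by (rule continuous_open_preimage) (intro open_Times is_chart_open_image[OF X] open_UNIV open_Int LC(1) EC(1) HC(1))+
  then have oT: "open T" by (simp add: T_def vimage_def Int_def)
  have Jx: "J x = chart_map (\<X> k) (\<iota> p)" by (simp add: J_def x_def local_rep_def chart_inv_map[OF N p(2)])
  have "{J x} \<times> sphere 0 r \<subseteq> T"
    using p LC(2) EC(3) HC(2) by (auto simp: T_def Jx chart_map_image[OF X] chart_inv_map[OF X])
  then obtain \<Omega> \<delta> where \<Omega>: "open \<Omega>" "J x \<in> \<Omega>" "0 < \<delta>" "\<delta> < r" "\<Omega> \<times> annulus r \<delta> \<subseteq> T"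
    by (rule annulus_tube[OF oT _ r])
  have inT: "z \<in> chart_image (\<X> k)" "(?inv z, \<zeta>) \<in> W" "(?inv z, \<zeta>) \<in> W'" "?inv z \<in> D" "\<zeta> \<noteq> 0"
    if "z \<in> \<Omega>" "\<zeta> \<in> annulus r \<delta>" for z \<zeta>
  proof -
    have "(z, \<zeta>) \<in> T" using that \<Omega>(5) by blast
    then show "z \<in> chart_image (\<X> k)" "(?inv z, \<zeta>) \<in> W" "(?inv z, \<zeta>) \<in> W'" "?inv z \<in> D" "\<zeta> \<noteq> 0"
      using EC(2) by (auto simp: T_def)
  qed
  \<comment> \<open>Any point of the annulus would do: it serves as a witness for those consequences
    of \<open>inT\<close> that concern \<open>z\<close> alone.\<close>
  have r_ann: "of_real r \<in> annulus r \<delta>" using \<Omega>(3,4) by (intro of_real_in_annulus) auto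
  note inD = inT[OF _ r_ann]
  define O1 where "O1 = (O2 \<inter> J -` \<Omega>) \<inter> {y \<in> C i. chart_inv (\<N> i) y \<in> U}"
  have O1: "open O1" unfolding O1_def
    by (intro open_Int continuous_open_preimage contJ O2 \<Omega> open_chart_preimage N U)
  have O1D: "y \<in> O2" "J y \<in> \<Omega>" "y \<in> C i" "chart_inv (\<N> i) y \<in> U" if "y \<in> O1" for y using that by (auto simp: O1_def)
  have Jinv: "?inv (J y) = \<iota> (chart_inv (\<N> i) y)" if "y \<in> O2" for y
    using O2(4)[OF that] by (simp add: J_def local_rep_def chart_inv_map[OF X])
  have x1: "x \<in> O1" using O2(2,3) \<Omega>(2) p by (auto simp: O1_def x_def chart_inv_map[OF N])
  have o: "open (\<Omega> \<times> annulus r \<delta>)" by (intro open_Times \<Omega> open_annulus)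
  have sub: "\<Omega> \<times> annulus r \<delta> \<subseteq> chart_map (product_atlas S \<X> k) ` (R \<inter> chart_dom (product_atlas S \<X> k))"
    if "\<And>z \<zeta>. z \<in> \<Omega> \<Longrightarrow> \<zeta> \<in> annulus r \<delta> \<Longrightarrow> (?inv z, \<zeta>) \<in> R \<and> \<zeta> \<in> S" for R S
  proof safe
    fix z \<zeta> assume z: "z \<in> \<Omega>" "\<zeta> \<in> annulus r \<delta>"
    from chart_image_mem[OF chart_inv_dom[OF X inT(1)[OF z]], of \<zeta> R S] that[OF z]
    show "(z, \<zeta>) \<in> chart_map (product_atlas S \<X> k) ` (R \<inter> chart_dom (product_atlas S \<X> k))"
      by (simp add: chart_map_inv[OF X inT(1)[OF z]])
  qed
  have ECh: "holomorphic_map_on (EC k) (\<Omega> \<times> annulus r \<delta>)"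
  proof (rule holomorphic_map_subset)
    show "holomorphic_map_on (EC k) (chart_map (product_atlas (- {0}) \<X> k) ` (W' \<inter> chart_dom (product_atlas (- {0}) \<X> k)))"
      using EC(4) by (simp add: complexification_vector_field_def holomorphic_vector_field_def)
    show "\<Omega> \<times> annulus r \<delta> \<subseteq> chart_map (product_atlas (- {0}) \<X> k) ` (W' \<inter> chart_dom (product_atlas (- {0}) \<X> k))"
      by (rule sub) (use inT in auto)
  qed
  have LCf: "holomorphic_form_family \<X> W LC" and LCp: "\<And>\<rho>. \<rho> > 0 \<Longrightarrow>
      pullback_bilinear_forms \<N> \<X> \<iota> {p. (\<iota> p, complex_of_real \<rho>) \<in> W}
        (\<lambda>i x u v. complex_of_real (L i x \<rho> u v)) (LC (complex_of_real \<rho>))"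
    using LC(3) by (auto simp: complexification_form_family_def)
  \<comment> \<open>The parameter value 1 is arbitrary, because a single form is treated as a family
    constant in the parameter.\<close>
  have HCf: "holomorphic_form_family \<X> (D \<times> UNIV) (\<lambda>_. HC)" and HCp: "
      pullback_bilinear_forms \<N> \<X> \<iota> {p. (\<iota> p, complex_of_real 1) \<in> D \<times> UNIV}
        (\<lambda>i x u v. complex_of_real (h i x u v)) HC"
    using HC(3) zero_less_one unfolding complexification_form_def complexification_form_family_def by blast+
  have "complex_chart \<N> h A E a i J O1 \<Omega> r \<delta> (EC k) (HC k) (\<lambda>\<zeta>. LC \<zeta> k)"
  proof (intro complex_chart.intro complex_chart_axioms.intro beltrami_soliton_axioms)
    show "open O1" "O1 \<subseteq> C i" "open \<Omega>" "0 < \<delta>" "\<delta> < r" using O1 \<Omega> by (auto simp: O1_def)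
    show "J y \<in> \<Omega>" if "y \<in> O1" for y by (rule O1D(2)[OF that])
    show "ext_hol (\<lambda>y. J y $ l) O1" for l by (rule ext_hol_subset[OF O2(5)]) (auto simp: O1_def)
    show "cspace.ghol (\<lambda>Z. fst (EC k Z) $ l) (\<Omega> \<times> annulus r \<delta>)" for l
      unfolding holomorphic_map_on_iff_ghol[OF o, symmetric]
      by (intro holomorphic_map_component holomorphic_map_linear[where g=fst, OF ECh] bounded_linear_fst) (simp add: scaleC_prod_def)
    show "cspace.ghol (\<lambda>Z. snd (EC k Z)) (\<Omega> \<times> annulus r \<delta>)"
      unfolding holomorphic_map_on_iff_ghol[OF o, symmetric]
      by (intro holomorphic_map_linear[where g=snd, OF ECh] bounded_linear_snd) (simp add: scaleC_prod_def)
    show "EC k (J y, of_real t) = (dir_deriv J y (X i y t), of_real (f i y t))" if y: "y \<in> O1" and t: "\<bar>t - r\<bar> < \<delta>" for y t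
    proof -
      have ta: "of_real t \<in> annulus r \<delta>" and t0: "t > 0" using t \<Omega>(4) by (auto intro: of_real_in_annulus)
      show ?thesis
        unfolding J_def
      proof (rule related_product[where g=complex_of_real and \<N>=\<N> and i=i and \<X>=\<X> and k=k and T="{0<..}" and T'="- {0}"
            and S="{(p, \<rho>). (\<iota> p, complex_of_real \<rho>) \<in> W'}"])
        show "related_vector_fields (product_atlas {0<..} \<N>) (product_atlas (- {0}) \<X>) (\<lambda>(p, s). (\<iota> p, complex_of_real s))
            {(p, \<rho>). (\<iota> p, complex_of_real \<rho>) \<in> W'} E EC"
          using EC(4) by (simp add: complexification_vector_field_def)
        show "(chart_inv (\<N> i) y, t) \<in> {(p, \<rho>). (\<iota> p, complex_of_real \<rho>) \<in> W'}"
          using inT(3)[OF O1D(2)[OF y] ta] Jinv[OF O1D(1)[OF y]] by simp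
        show "local_rep \<iota> (\<N> i) (\<X> k) differentiable at y" using C2 O1D(1)[OF y] unfolding J_def by blast
      qed (use t0 O1D[OF y] O2(4) in \<open>auto simp: N bounded_linear_of_real\<close>)
    qed
    show "complex_linear (HC k z u)" "complex_linear (\<lambda>u. HC k z u v)" if z: "z \<in> \<Omega>" for z u v
      using HCf[unfolded holomorphic_form_family_def Let_def, THEN conjunct1, rule_format, of "(?inv z, 1)" k] inD[OF z]
      by (auto simp: chart_inv_dom[OF X] chart_map_inv[OF X])
    show "cspace.ghol (\<lambda>z. HC k z u v) \<Omega>" for u v
    proof -
      have "holomorphic_map_on (\<lambda>(z, \<zeta> :: complex). HC k z u v) (\<Omega> \<times> annulus r \<delta>)"
      proof (rule holomorphic_map_subset)
        show "holomorphic_map_on (\<lambda>(z, \<zeta> :: complex). HC k z u v) (chart_map (product_atlas UNIV \<X> k) ` (D \<times> UNIV \<inter> chart_dom (product_atlas UNIV \<X> k)))"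
          using HCf unfolding holomorphic_form_family_def by blast
        show "\<Omega> \<times> annulus r \<delta> \<subseteq> chart_map (product_atlas UNIV \<X> k) ` (D \<times> UNIV \<inter> chart_dom (product_atlas UNIV \<X> k))"
          by (rule sub) (use inT in auto)
      qed
      from ghol_slices(2)[OF this[unfolded holomorphic_map_on_iff_ghol[OF o]] r_ann] show ?thesis by simp
    qed
    show "HC k (J y) (dir_deriv J y u) (dir_deriv J y v) = of_real (h i y u v)" if y: "y \<in> O1" for y u v
    proof -
      have q: "chart_inv (\<N> i) y \<in> {p. (\<iota> p, complex_of_real 1) \<in> D \<times> UNIV} \<inter> chart_dom (\<N> i)" "\<iota> (chart_inv (\<N> i) y) \<in> chart_dom (\<X> k)"
        using O1D[OF y] O2(4) HC(2) by (auto simp: chart_inv_dom[OF N])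
      show ?thesis
        using HCp[unfolded pullback_bilinear_forms_def Let_def, rule_format, OF q, of u v]
        by (simp add: chart_map_inv[OF N O1D(3)[OF y]] dir_deriv_def J_def)
    qed
    show "complex_linear (LC \<zeta> k z u)" "complex_linear (\<lambda>u. LC \<zeta> k z u v)" if z: "z \<in> \<Omega>" "\<zeta> \<in> annulus r \<delta>" for z \<zeta> u v
      using LCf[unfolded holomorphic_form_family_def Let_def, THEN conjunct1, rule_format, of "(?inv z, \<zeta>)" k] inT[OF z]
      by (auto simp: chart_inv_dom[OF X] chart_map_inv[OF X])
    show "cspace.ghol (\<lambda>(z, \<zeta>). LC \<zeta> k z u v) (\<Omega> \<times> annulus r \<delta>)" for u v
      unfolding holomorphic_map_on_iff_ghol[OF o, symmetric]
    proof (rule holomorphic_map_subset)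
      show "holomorphic_map_on (\<lambda>(z, \<zeta>). LC \<zeta> k z u v) (chart_map (product_atlas UNIV \<X> k) ` (W \<inter> chart_dom (product_atlas UNIV \<X> k)))"
        using LCf unfolding holomorphic_form_family_def by blast
      show "\<Omega> \<times> annulus r \<delta> \<subseteq> chart_map (product_atlas UNIV \<X> k) ` (W \<inter> chart_dom (product_atlas UNIV \<X> k))"
        by (rule sub) (use inT in auto)
    qed
    show "LC (of_real t) k (J y) (dir_deriv J y u) (dir_deriv J y v) = of_real (L i y t u v)" if y: "y \<in> O1" and t: "\<bar>t - r\<bar> < \<delta>" for y t u v
    proof -
      have ta: "of_real t \<in> annulus r \<delta>" and t0: "t > 0" using t \<Omega>(4) by (auto intro: of_real_in_annulus)
      have q: "chart_inv (\<N> i) y \<in> {p. (\<iota> p, complex_of_real t) \<in> W} \<inter> chart_dom (\<N> i)" "\<iota> (chart_inv (\<N> i) y) \<in> chart_dom (\<X> k)"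
        using O1D[OF y] O2(4) inT(2)[OF O1D(2)[OF y] ta] Jinv[OF O1D(1)[OF y]] by (auto simp: chart_inv_dom[OF N])
      show ?thesis
        using LCp[OF t0, unfolded pullback_bilinear_forms_def Let_def, rule_format, OF q, of u v]
        by (simp add: chart_map_inv[OF N O1D(3)[OF y]] dir_deriv_def J_def)
    qed
  qed
  moreover from this obtain \<phi> where "complex_chart.coframe J x \<phi>"
    using ex\<phi> by (auto simp: complex_chart.coframe_def)
  moreover have "z \<in> chart_image (\<X> k) \<and> {chart_inv (\<X> k) z} \<times> sphere 0 r \<subseteq> W" if "z \<in> \<Omega>" for z
    using inT[OF that] r_ann sphere_subset_annulus[OF \<Omega>(3), of r] by blast
  ultimately show ?thesis
    using that[of O1 \<Omega> \<delta> \<phi>] x1 O1D O2(4) by blast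
qed

end

context complex_soliton
begin

text \<open>Vanishing at the real points of \<open>U\<close> only, which is what the pointwise
  equations deliver; \<open>moment_vanishes_iff\<close> shows that it implies vanishing on a complex
  neighbourhood.\<close>

definition moment_zero :: "nat \<Rightarrow> bool" where
  "moment_zero m \<longleftrightarrow> (\<forall>p\<in>U. \<forall>k u v. \<iota> p \<in> chart_dom (\<X> k) \<longrightarrow> moment_form r m LC k (chart_map (\<X> k) (\<iota> p)) u v = 0)"

text \<open>Vanishing of the trace-free part enters only as proportionality to the complexified
  metric. With the factor 0 a vanishing moment has this property, which drives the induction
  below.\<close>

definition moment_trace_free :: "nat \<Rightarrow> bool" where
  "moment_trace_free m \<longleftrightarrow> (\<forall>p\<in>U. \<forall>k. \<iota> p \<in> chart_dom (\<X> k) \<longrightarrow>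
     (\<exists>c. \<forall>u v. moment_form r m LC k (chart_map (\<X> k) (\<iota> p)) u v = c * HC k (chart_map (\<X> k) (\<iota> p)) u v))"

lemma moment_zero_1_iff: "moment_zero 1 \<longleftrightarrow> (\<forall>i. \<forall>p\<in>U. p \<in> chart_dom (\<N> i) \<longrightarrow> (\<forall>u v. Q i (chart_map (\<N> i) p) u v = 0))"
proof -
  have iff: "(\<forall>u v. moment_form r 1 LC k (chart_map (\<X> k) (\<iota> p)) u v = 0) \<longleftrightarrow> (\<forall>u v. Q i (chart_map (\<N> i) p) u v = 0)"
    if p: "p \<in> U" "p \<in> chart_dom (\<N> i)" "\<iota> p \<in> chart_dom (\<X> k)" for p i k
  proof -
    let ?J = "local_rep \<iota> (\<N> i) (\<X> k)" and ?x = "chart_map (\<N> i) p"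
    obtain O1 \<Omega> \<delta> \<phi> where c: "complex_chart \<N> h A E a i ?J O1 \<Omega> r \<delta> (EC k) (HC k) (\<lambda>\<zeta>. LC \<zeta> k)"
      "?x \<in> O1" "complex_chart.coframe ?J ?x \<phi>"
      by (rule chart_exists[OF p])
    have "?J ?x = chart_map (\<X> k) (\<iota> p)" by (simp add: local_rep_def chart_inv_map[OF N p(2)])
    with complex_chart.moment_1_vanishes_iff[OF c] show ?thesis by (simp only: moment_form_def)
  qed
  show ?thesis
  proof
    assume z: "moment_zero 1"
    show "\<forall>i. \<forall>p\<in>U. p \<in> chart_dom (\<N> i) \<longrightarrow> (\<forall>u v. Q i (chart_map (\<N> i) p) u v = 0)"
    proof (intro allI ballI impI)
      fix i p u v assume p: "p \<in> U" "p \<in> chart_dom (\<N> i)"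
      obtain k where k: "\<iota> p \<in> chart_dom (\<X> k)" using X_cover by blast
      show "Q i (chart_map (\<N> i) p) u v = 0" using z iff[OF p k] p k unfolding moment_zero_def by blast
    qed
  next
    assume Q: "\<forall>i. \<forall>p\<in>U. p \<in> chart_dom (\<N> i) \<longrightarrow> (\<forall>u v. Q i (chart_map (\<N> i) p) u v = 0)"
    show "moment_zero 1" unfolding moment_zero_def
    proof (intro ballI allI impI)
      fix p k u v assume p: "p \<in> U" and k: "\<iota> p \<in> chart_dom (\<X> k)"
      obtain i where i: "p \<in> chart_dom (\<N> i)" using N_cover by blast
      show "moment_form r 1 LC k (chart_map (\<X> k) (\<iota> p)) u v = 0" using Q iff[OF p i k] p i by blast
    qed
  qed
qed

lemma einstein_iff_moment_zero:
  assumes "connected (UNIV :: 'n set)" "U \<noteq> {}"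
  shows "einstein (beltrami_manifold \<N>) (beltrami_metric h A) \<longleftrightarrow> moment_zero 1"
  unfolding einstein_iff moment_zero_1_iff
  using Q_zero_unique_continuation[OF assms(1) U assms(2)] chart_map_image[OF N] by blast

text \<open>\<open>trace_free_moment\<close> makes the field of order 2n - 1 vanish pointwise, but
  \<open>descent\<close> differentiates it and so needs this at all real points of a neighbourhood,
  which the openness of \<open>U\<close> provides.\<close>

lemma moment_zero_descent:
  assumes n: "n > 0" and tf: "moment_trace_free (2 * n + 1)"
  shows "moment_zero (2 * n - 1)"
  unfolding moment_zero_def
proof (intro ballI allI impI)
  fix p k u v assume p: "p \<in> U" and k: "\<iota> p \<in> chart_dom (\<X> k)"
  obtain i where i: "p \<in> chart_dom (\<N> i)" using N_cover by blast
  let ?J = "local_rep \<iota> (\<N> i) (\<X> k)" and ?x = "chart_map (\<N> i) p"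
  obtain O1 \<Omega> \<delta> \<phi> where c: "complex_chart \<N> h A E a i ?J O1 \<Omega> r \<delta> (EC k) (HC k) (\<lambda>\<zeta>. LC \<zeta> k)"
    "?x \<in> O1" "complex_chart.coframe ?J ?x \<phi>"
    and O1: "\<forall>y\<in>O1. chart_inv (\<N> i) y \<in> U \<and> \<iota> (chart_inv (\<N> i) y) \<in> chart_dom (\<X> k)"
    by (rule chart_exists[OF p i k])
  interpret c: complex_chart \<N> h A E a i ?J O1 \<Omega> r \<delta> "EC k" "HC k" "\<lambda>\<zeta>. LC \<zeta> k" by (rule c(1))
  have "c.G (2 * n - 1) l (?J y) = 0" if y: "y \<in> O1" for y l
  proof -
    let ?q = "chart_inv (\<N> i) y"
    have yC: "y \<in> C i" by (rule c.in_C[OF y])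
    have q: "?q \<in> U" "?q \<in> chart_dom (\<N> i)" "\<iota> ?q \<in> chart_dom (\<X> k)" and mq: "chart_map (\<N> i) ?q = y"
      using bspec[OF O1 y] by (auto simp: chart_inv_dom[OF N yC] chart_map_inv[OF N yC])
    \<comment> \<open>Only the coframe at \<open>y\<close> is taken from this second localisation;
      the domains remain those of the first.\<close>
    obtain O2 \<Omega>2 \<delta>2 \<psi> where c2: "complex_chart \<N> h A E a i ?J O2 \<Omega>2 r \<delta>2 (EC k) (HC k) (\<lambda>\<zeta>. LC \<zeta> k)"
      "y \<in> O2" "complex_chart.coframe ?J y \<psi>"
      by (rule chart_exists[OF q, unfolded mq])
    have Jy: "chart_map (\<X> k) (\<iota> ?q) = ?J y" by (simp add: local_rep_def)
    obtain b where b: "\<And>u v. moment_form r (2 * n + 1) LC k (?J y) u v = b * HC k (?J y) u v"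
      using tf q unfolding moment_trace_free_def Jy[symmetric] by blast
    show ?thesis
    proof (rule c.trace_free_moment[OF y c2(3) n])
      show "contour_integral (circlepath 0 r) (\<lambda>\<zeta>. \<zeta> ^ (2 * n + 1) * LC \<zeta> k (?J y) (c.P y u) (c.P y v)) = b * of_real (h i y u v)" for u v
        using b[of "c.P y u" "c.P y v"] unfolding moment_form_def c.HC_real[OF y] .
    qed
  qed
  from c.descent[OF c(2,3) this, of u v]
  show "moment_form r (2 * n - 1) LC k (chart_map (\<X> k) (\<iota> p)) u v = 0"
    by (simp add: moment_form_def local_rep_def chart_inv_map[OF N i])
qed

text \<open>Each descent lowers the order by two, and the vanishing moment so obtained is again
  proportional to h. The orders stay odd, hence the chain ends at 1.\<close>

lemma trace_free_imp_moment_zero_1: "moment_trace_free (2 * n + 1) \<Longrightarrow> n > 0 \<Longrightarrow> moment_zero 1"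
proof (induction n)
  case (Suc n)
  have z: "moment_zero (2 * n + 1)" using moment_zero_descent[of "Suc n"] Suc.prems by simp
  show ?case
  proof (cases "n = 0")
    case False
    have "moment_trace_free (2 * n + 1)"
      unfolding moment_trace_free_def using z unfolding moment_zero_def by (metis mult_zero_left)
    then show ?thesis using Suc.IH False by simp
  qed (use z in simp)
qed simp

lemma moment_vanishes_imp_zero: "moment_vanishes \<X> \<iota> U r W LC m \<Longrightarrow> moment_zero m"
  unfolding moment_vanishes_def form_vanishes_on_def moment_zero_def by blast

lemma trace_free_moment_vanishes_imp: "trace_free_moment_vanishes \<X> \<iota> U r D HC W LC m \<Longrightarrow> moment_trace_free m"
  unfolding moment_trace_free_def
proof (intro ballI allI impI)
  fix p k assume "trace_free_moment_vanishes \<X> \<iota> U r D HC W LC m" and p: "p \<in> U" "\<iota> p \<in> chart_dom (\<X> k)"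
  then obtain V where V: "\<iota> ` U \<subseteq> V" "form_vanishes_on \<X> V (\<lambda>k z. trace_free_part (HC k z) (moment_form r m LC k z))"
    unfolding trace_free_moment_vanishes_def by blast
  let ?z = "chart_map (\<X> k) (\<iota> p)"
  have "\<forall>u v. trace_free_part (HC k ?z) (moment_form r m LC k ?z) u v = 0"
    using V p unfolding form_vanishes_on_def by blast
  then show "\<exists>c. \<forall>u v. moment_form r m LC k ?z u v = c * HC k ?z u v"
    unfolding trace_free_part_def by (intro exI allI) (simp only: right_minus_eq)
qed

text \<open>The moments are holomorphic, and in the charts provided by \<open>complexification\<close> a holomorphic
  function is determined by its values at the real points.\<close>

lemma moment_zero_imp_vanishes_near:
  assumes m: "moment_zero m" and p: "p \<in> U"
  shows "\<exists>V. open V \<and> \<iota> p \<in> V \<and> V \<times> sphere 0 r \<subseteq> W \<and> form_vanishes_on \<X> V (moment_form r m LC)"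
proof -
  obtain i k where i: "p \<in> chart_dom (\<N> i)" and k: "\<iota> p \<in> chart_dom (\<X> k)" using N_cover X_cover by metis
  obtain c d where c: "is_chart c" and d: "is_chart d" "holomorphically_compatible d (\<X> k)"
    and pc: "p \<in> chart_dom c" and img: "\<iota> ` chart_dom c = chart_dom d \<inter> range \<iota>"
    and \<iota>: "\<And>q. q \<in> chart_dom c \<Longrightarrow> chart_map d (\<iota> q) = complexify_vec (chart_map c q)"
    and real: "complexify_vec -` chart_image d = chart_image c"
    using X_complexification unfolding complexification_def by metis
  obtain O1 \<Omega> \<delta> \<phi> where ch: "complex_chart \<N> h A E a i (local_rep \<iota> (\<N> i) (\<X> k)) O1 \<Omega> r \<delta> (EC k) (HC k) (\<lambda>\<zeta>. LC \<zeta> k)"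
    "chart_map (\<N> i) p \<in> O1"
    and \<Omega>W: "\<forall>z\<in>\<Omega>. z \<in> chart_image (\<X> k) \<and> {chart_inv (\<X> k) z} \<times> sphere 0 r \<subseteq> W"
    by (rule chart_exists[OF p i k])
  interpret ch: complex_chart \<N> h A E a i "local_rep \<iota> (\<N> i) (\<X> k)" O1 \<Omega> r \<delta> "EC k" "HC k" "\<lambda>\<zeta>. LC \<zeta> k" by (rule ch(1))
  define \<sigma> where "\<sigma> = local_rep id d (\<X> k)"
  let ?y0 = "chart_map c p"
  have \<sigma>: "holomorphic_map_on \<sigma> (overlap d (\<X> k))"
    using d(2) by (simp add: holomorphically_compatible_def \<sigma>_def)
  have \<iota>d: "\<iota> q \<in> chart_dom d" if "q \<in> chart_dom c" for q using img that by blast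
  have \<sigma>\<iota>: "\<sigma> (complexify_vec (chart_map c q)) = chart_map (\<X> k) (\<iota> q)" if "q \<in> chart_dom c" for q
    by (simp add: \<sigma>_def local_rep_id \<iota>[OF that, symmetric] chart_inv_map[OF d(1) \<iota>d[OF that]])
  have p\<Omega>: "chart_map (\<X> k) (\<iota> p) \<in> \<Omega>"
    using ch.J_in[OF ch(2)] by (simp add: local_rep_def chart_inv_map[OF N i])
  \<comment> \<open>The coordinates of the adapted chart \<open>d\<close> in which the transition to
    the chart \<open>k\<close> is defined and lands where the moment is holomorphic. The adapted
    chart is needed because only there are the real points those with real coordinates.\<close>
  define T where "T = overlap d (\<X> k) \<inter> \<sigma> -` \<Omega>"
  have oT: "open T"
    unfolding T_def by (intro continuous_open_preimage holomorphic_map_continuous_on[OF \<sigma>] open_overlap d X ch.\<Omega>)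
  have w0: "complexify_vec ?y0 \<in> T"
    using p\<Omega> k \<iota>d[OF pc] by (simp add: T_def \<sigma>\<iota>[OF pc]) (simp add: \<iota>[OF pc, symmetric] overlap_iff[OF d(1)] chart_map_image[OF d(1)] chart_inv_map[OF d(1)])
  obtain \<epsilon>1 where \<epsilon>1: "\<epsilon>1 > 0" "ball (complexify_vec ?y0) \<epsilon>1 \<subseteq> T"
    using oT w0 open_contains_ball by metis
  have "open {y \<in> chart_image c. chart_inv c y \<in> U}" by (rule open_chart_preimage[OF c U])
  moreover have "?y0 \<in> {y \<in> chart_image c. chart_inv c y \<in> U}" using p pc by (simp add: chart_map_image[OF c] chart_inv_map[OF c])
  ultimately have "\<exists>e>0. ball ?y0 e \<subseteq> {y \<in> chart_image c. chart_inv c y \<in> U}"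
    by (rule open_contains_ball[THEN iffD1, rule_format])
  then obtain \<epsilon>2 where \<epsilon>2: "\<epsilon>2 > 0" "ball ?y0 \<epsilon>2 \<subseteq> {y \<in> chart_image c. chart_inv c y \<in> U}" by blast
  define \<epsilon> where "\<epsilon> = min \<epsilon>1 \<epsilon>2"
  have \<epsilon>: "\<epsilon> > 0" "ball (complexify_vec ?y0) \<epsilon> \<subseteq> T" "ball ?y0 \<epsilon> \<subseteq> {y \<in> chart_image c. chart_inv c y \<in> U}"
    using \<epsilon>1 \<epsilon>2 by (auto simp: \<epsilon>_def)
  let ?B = "ball (complexify_vec ?y0) \<epsilon>"
  have van: "moment_form r m LC k (\<sigma> w) u v = 0" if w: "w \<in> ?B" for w u v
  proof (rule ghol_zero_on_real[OF _ _ w])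
    have "holomorphic_map_on (\<lambda>z. moment_form r m LC k z u v) \<Omega>"
      unfolding moment_form_def holomorphic_map_on_iff_ghol[OF ch.\<Omega>] by (rule ch.moment_ghol)
    with holomorphic_map_subset[OF \<sigma>, of ?B] have "holomorphic_map_on (\<lambda>w. moment_form r m LC k (\<sigma> w) u v) ?B"
      by (rule holomorphic_map_compose) (use \<epsilon>(2) in \<open>auto simp: T_def\<close>)
    then show "cspace.ghol (\<lambda>w. moment_form r m LC k (\<sigma> w) u v) ?B"
      by (simp add: holomorphic_map_on_iff_ghol)
    fix y assume y: "y \<in> ball ?y0 \<epsilon>"
    then have yc: "y \<in> chart_image c" "chart_inv c y \<in> U" using \<epsilon>(3) by auto
    have "complexify_vec y - complexify_vec ?y0 = complexify_vec (y - ?y0)" by (simp add: vec_eq_iff complexify_vec_def)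
    then have "complexify_vec y \<in> ?B"
      using y by (simp add: dist_norm norm_minus_commute) (simp add: norm_minus_commute norm_complexify_vec)
    then have "complexify_vec y \<in> overlap d (\<X> k)" using \<epsilon>(2) by (auto simp: T_def)
    moreover have "chart_inv d (complexify_vec y) = \<iota> (chart_inv c y)"
      using \<iota>[OF chart_inv_dom[OF c yc(1)]] chart_inv_map[OF d(1) \<iota>d[OF chart_inv_dom[OF c yc(1)]]]
      by (simp add: chart_map_inv[OF c yc(1)])
    ultimately have "\<iota> (chart_inv c y) \<in> chart_dom (\<X> k)" by (simp add: overlap_iff[OF d(1)])
    with m yc show "moment_form r m LC k (\<sigma> (complexify_vec y)) u v = 0"
      using \<sigma>\<iota>[OF chart_inv_dom[OF c yc(1)]] by (simp add: moment_zero_def chart_map_inv[OF c yc(1)])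
  qed
  define V where "V = chart_dom d \<inter> chart_map d -` ?B"
  have "open V" unfolding V_def
    by (intro continuous_open_preimage continuous_chart_map is_chart_open_dom d open_ball)
  moreover have "\<iota> p \<in> V" using \<epsilon>(1) \<iota>d[OF pc] by (simp add: V_def \<iota>[OF pc])
  moreover have V: "q \<in> chart_dom (\<X> k)" "\<sigma> (chart_map d q) = chart_map (\<X> k) q" "{q} \<times> sphere 0 r \<subseteq> W"
      "moment_form r m LC k (chart_map (\<X> k) q) u v = 0" if "q \<in> V" for q u v
  proof -
    have q: "q \<in> chart_dom d" "chart_map d q \<in> ?B" using that by (auto simp: V_def)
    then have "chart_map d q \<in> T" using \<epsilon>(2) by blast
    then have *: "chart_map d q \<in> overlap d (\<X> k)" "\<sigma> (chart_map d q) \<in> \<Omega>" by (auto simp: T_def)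
    show qk: "q \<in> chart_dom (\<X> k)" using * q by (simp add: overlap_iff[OF d(1)] chart_inv_map[OF d(1)])
    show s: "\<sigma> (chart_map d q) = chart_map (\<X> k) q" using q by (simp add: \<sigma>_def local_rep_id chart_inv_map[OF d(1)])
    show "{q} \<times> sphere 0 r \<subseteq> W" using bspec[OF \<Omega>W *(2)] by (simp only: s chart_inv_map[OF X qk])
    show "moment_form r m LC k (chart_map (\<X> k) q) u v = 0" using van[OF q(2), of u v] by (simp only: s)
  qed
  moreover have "form_vanishes_on \<X> V (moment_form r m LC)"
    unfolding form_vanishes_on_def
  proof (intro allI ballI)
    fix l q u v assume q: "q \<in> V \<inter> chart_dom (\<X> l)"
    let ?\<tau> = "local_rep id (\<X> l) (\<X> k)" and ?z = "chart_map (\<X> l) q"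
    let ?D = "frechet_derivative ?\<tau> (at ?z)"
    have \<tau>z: "?\<tau> ?z = chart_map (\<X> k) q" using q by (simp add: local_rep_id chart_inv_map[OF X])
    \<comment> \<open>Vanishing has been shown in the chart \<open>k\<close>; the transformation
      rule at each point of the circle, with a derivative independent of \<zeta>, carries it to
      every other chart.\<close>
    have "LC \<zeta> l ?z u v = LC \<zeta> k (?\<tau> ?z) (?D u) (?D v)" if "\<zeta> \<in> sphere 0 r" for \<zeta>
    proof -
      have "holomorphic_form_family \<X> W LC" using LC(3) by (simp add: complexification_form_family_def)
      then have "pullback_bilinear_forms \<X> \<X> id {p. (p, \<zeta>) \<in> W} (LC \<zeta>) (LC \<zeta>)"
        unfolding holomorphic_form_family_def by blast
      moreover have "q \<in> {p. (p, \<zeta>) \<in> W} \<inter> chart_dom (\<X> l)" "id q \<in> chart_dom (\<X> k)"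
        using q V(1,3)[of q] that by auto
      ultimately show ?thesis unfolding pullback_bilinear_forms_def Let_def by blast
    qed
    then have "moment_form r m LC l ?z u v = moment_form r m LC k (?\<tau> ?z) (?D u) (?D v)"
      unfolding moment_form_def using r by (intro contour_integral_cong) auto
    then show "moment_form r m LC l ?z u v = 0" using V(4) q by (simp add: \<tau>z)
  qed
  ultimately show ?thesis by blast
qed

lemma moment_vanishes_iff: "moment_vanishes \<X> \<iota> U r W LC m \<longleftrightarrow> moment_zero m"
proof
  assume "moment_zero m"
  then have "\<forall>p\<in>U. \<exists>V. open V \<and> \<iota> p \<in> V \<and> V \<times> sphere 0 r \<subseteq> W \<and> form_vanishes_on \<X> V (moment_form r m LC)"
    using moment_zero_imp_vanishes_near by blast
  then obtain V where V: "\<And>p. p \<in> U \<Longrightarrow> open (V p) \<and> \<iota> p \<in> V p \<and> V p \<times> sphere 0 r \<subseteq> W \<and> form_vanishes_on \<X> (V p) (moment_form r m LC)"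
    by metis
  show "moment_vanishes \<X> \<iota> U r W LC m"
    unfolding moment_vanishes_def
    \<comment> \<open>Vanishing of a form is a pointwise condition, so the neighbourhoods of the
      single points can simply be united.\<close>
    by (intro exI[of _ "\<Union>p\<in>U. V p"] conjI open_UN) (use V in \<open>force simp: form_vanishes_on_def\<close>)+
qed (rule moment_vanishes_imp_zero)

end

theorem theorem5p1:
  fixes \<N> :: "'i \<Rightarrow> ('n::{t2_space, second_countable_topology}, real ^ 3) chart"
    and h :: "'i \<Rightarrow> real ^ 3 \<Rightarrow> real ^ 3 \<Rightarrow> real ^ 3 \<Rightarrow> real"
    and A :: "'i \<Rightarrow> real ^ 3 \<Rightarrow> real ^ 3 \<Rightarrow> real"
    and E :: "'i \<Rightarrow> (real ^ 3) \<times> real \<Rightarrow> (real ^ 3) \<times> real"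
    and \<X> :: "'k \<Rightarrow> ('x::{t2_space, second_countable_topology}, complex ^ 3) chart"
    and \<iota> :: "'n \<Rightarrow> 'x"
    and U :: "'n set" and r :: real
    and D :: "'x set"
    and HC :: "'k \<Rightarrow> complex ^ 3 \<Rightarrow> complex ^ 3 \<Rightarrow> complex ^ 3 \<Rightarrow> complex"
    and W :: "('x \<times> complex) set"
    and LC :: "complex \<Rightarrow> 'k \<Rightarrow> complex ^ 3 \<Rightarrow> complex ^ 3 \<Rightarrow> complex ^ 3 \<Rightarrow> complex"
  assumes N_connected: "connected (UNIV :: 'n set)"
    and N_analytic: "real_analytic_atlas UNIV \<N>"
    and N_oriented: "oriented_atlas \<N>"
    and h_metric: "real_analytic_metric \<N> h"
    and A_form: "smooth_one_form \<N> A"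
    and beltrami: "beltrami_equation \<N> h A"
    and dA_nonzero: "exterior_deriv_nowhere_zero \<N> A"
    and E_analytic: "real_analytic_vector_field (beltrami_manifold \<N>) E"
    and E_soliton: "soliton_flow (beltrami_manifold \<N>) (beltrami_metric h A) E"
    and X_complexification: "complexification \<N> \<X> \<iota>"
    and U: "open U" "U \<noteq> {}"
    and r: "r > 0"
    and E_complexification: "admits_complexification_on \<N> \<X> \<iota> E (\<iota> ` U \<times> sphere 0 r)"
    \<comment> \<open>\<open>HC\<close> is the complexification of \<open>h\<close>, defined near \<open>U\<close>\<close>
    and HC: "open D" "\<iota> ` U \<subseteq> D" "complexification_form \<N> \<X> \<iota> D h HC"
    \<comment> \<open>\<open>LC\<close> is the complexification of the Lie derivative of \<open>h\<close> along \<open>E\<close>, defined near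
      \<open>U \<times> \<gamma>\<close>\<close>
    and LC: "open W" "W \<subseteq> UNIV \<times> (- {0})" "\<iota> ` U \<times> sphere 0 r \<subseteq> W"
      "complexification_form_family \<N> \<X> \<iota> W (slice_lie_derivative E h) LC"
  shows "(einstein (beltrami_manifold \<N>) (beltrami_metric h A) \<longleftrightarrow>
           moment_vanishes \<X> \<iota> U r W LC 1) \<and>
         ((\<exists>j\<ge>1. trace_free_moment_vanishes \<X> \<iota> U r D HC W LC (2 * j + 1)) \<longrightarrow>
           einstein (beltrami_manifold \<N>) (beltrami_metric h A) \<and>
           moment_vanishes \<X> \<iota> U r W LC 1)"
proof -
  obtain a where soliton: "\<And>i x u v. x \<in> chart_image (beltrami_manifold \<N> i) \<Longrightarrow>
      ricci (beltrami_metric h A i) x u v + a * beltrami_metric h A i x u v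
      + 1/2 * lie_derivative (E i) (beltrami_metric h A i) x u v = 0"
    using E_soliton unfolding soliton_flow_def by blast
  \<comment> \<open>The domain \<open>W'\<close> of the extended field is not related to
    \<open>W\<close> or \<open>D\<close>; \<open>chart_exists\<close> passes to a common part near
    each point of \<open>U\<close>.\<close>
  obtain W' EC where EC: "open W'" "W' \<subseteq> UNIV \<times> (- {0})" "\<iota> ` U \<times> sphere 0 r \<subseteq> W'"
    "complexification_vector_field \<N> \<X> \<iota> W' E EC"
    using E_complexification unfolding admits_complexification_on_def by blast
  interpret complex_soliton \<N> h A E a \<X> \<iota> U r D HC W LC W' EC
    by unfold_locales
      (fact N_analytic h_metric A_form beltrami dA_nonzero E_analytic soliton X_complexification U(1) r EC HC LC(1,3,4))+
  show ?thesis
    using einstein_iff_moment_zero[OF N_connected \<open>U \<noteq> {}\<close>] moment_vanishes_iff[of 1]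
      trace_free_moment_vanishes_imp trace_free_imp_moment_zero_1 by (metis One_nat_def Suc_le_lessD)
qed

end
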